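(* Let $\varphi:\mathbf{R}^n\times[0,T]\to\mathbf{R}$ be a Lebesgue measurable function belonging to $X_1^0=L^1([0,T]\to L_2(\mathbf{R}^n))$, and let $$V(x,s)=\int_s^T\varphi[y^{x,s}(t),t]\,dt .$$ Then $V(x,s)$ is Lebesgue measurable with respect to $(x,s)$ and, for each $s\in[0,T]$, is uniquely determined as an element of $L_2(\mathbf{R}^n)$, i.e. for almost all $x\in\mathbf{R}^n$. Moreover $V\in\mathscr{C}^0=C([0,T]\to L_2(\mathbf{R}^n))$ and $V=v$ in $\mathscr{C}^0$, where $v=L\varphi\in\mathscr{C}^0$ and $L:X_1^0\to\mathscr{C}^0$ is the extended operator described in the context.
   Context: Fix $T>0$ and $n\ge 1$. The function $f:\mathbf{R}^n\times[0,T]\to\mathbf{R}^n$ and its $x$-derivatives up to second order inclusive (which exist for each $t$) are measurable and bounded. For $x\in\mathbf{R}^n$, $s\in[0,T]$, $y^{x,s}(t)$, $t\in[s,T]$, denotes the solution of $\frac{dy}{dt}(t)=f[y(t),t]$ with $y(s)=x$. Notation: $H^k=W_2^k(\mathbf{R}^n)$ (so $H^0=L_2(\mathbf{R}^n)$), $\mathscr{C}^0=C([0,T]\to H^0)$, $X^k=L^2([0,T]\to H^k)$, $X_1^0=L^1([0,T]\to H^0)$. The operator $L$: for $\varphi\in X^1$, $L\varphi$ is the solution $v\in X^1\cap\mathscr{C}^0$ of the Cauchy problem $$\frac{\partial v}{\partial s}(x,s)+\sum_{i=1}^n f_i(x,s)\frac{\partial v}{\partial x_i}(x,s)=-\varphi(x,s),\qquad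 v(x,T)=0,\quad 0\le s\le T$$ (understood in integrated form in $H^0$). Since $X^1$ is dense in $X_1^0$, $L$ extends by continuity to a continuous linear operator $L:X_1^0\to\mathscr{C}^0$; this extension is meant in the claim. *)

theory Defs
  imports "HOL-Analysis.Analysis"
begin

subsection \<open>The Hilbert space of square-integrable functions\<close>

definition square_integrable :: "('a::euclidean_space \<Rightarrow> real) \<Rightarrow> bool" where
  "square_integrable f \<longleftrightarrow>
     f \<in> borel_measurable lebesgue \<and> integrable lebesgue (\<lambda>x. (f x)\<^sup>2)"

lemma square_integrable_meas: "square_integrable f \<Longrightarrow> f \<in> borel_measurable lebesgue"
  by (simp add: square_integrable_def)

lemma square_integrable_mult:
  assumes "square_integrable f" "square_integrable g"
  shows "integrable lebesgue (\<lambda>x. f x * g x)"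
proof (rule Bochner_Integration.integrable_bound)
  show "integrable lebesgue (\<lambda>x. (f x)\<^sup>2 + (g x)\<^sup>2)"
    using assms by (auto simp: square_integrable_def)
  show "(\<lambda>x. f x * g x) \<in> borel_measurable lebesgue"
    using assms by (auto simp: square_integrable_def)
  have "\<bar>a * b\<bar> \<le> a\<^sup>2 + b\<^sup>2" for a b :: real
  proof -
    have "2 * \<bar>a * b\<bar> \<le> a\<^sup>2 + b\<^sup>2"
      using sum_squares_bound[of "\<bar>a\<bar>" "\<bar>b\<bar>"] by (simp add: abs_mult mult.assoc)
    then show ?thesis by linarith
  qed
  then show "AE x in lebesgue. norm (f x * g x) \<le> norm ((f x)\<^sup>2 + (g x)\<^sup>2)"
    by auto
qed

lemma square_integrable_0: "square_integrable (\<lambda>x. 0)"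
  by (simp add: square_integrable_def)

lemma square_integrable_add:
  assumes "square_integrable f" "square_integrable g"
  shows "square_integrable (\<lambda>x. f x + g x)"
  using assms square_integrable_mult[OF assms]
  by (auto simp: square_integrable_def power2_sum mult.assoc)

lemma square_integrable_scale:
  "square_integrable f \<Longrightarrow> square_integrable (\<lambda>x. c * f x)"
  by (auto simp: square_integrable_def power_mult_distrib)

lemma square_integrable_minus:
  "square_integrable f \<Longrightarrow> square_integrable (\<lambda>x. - f x)"
  by (auto simp: square_integrable_def)

lemma square_integrable_diff:
  assumes "square_integrable f" "square_integrable g"
  shows "square_integrable (\<lambda>x. f x - g x)"
  using square_integrable_add[OF assms(1) square_integrable_minus[OF assms(2)]] by simp

definition l2_rel :: "('a::euclidean_space \<Rightarrow> real) \<Rightarrow> ('a \<Rightarrow> real) \<Rightarrow> bool" where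
  "l2_rel f g \<longleftrightarrow>
     square_integrable f \<and> square_integrable g \<and> (AE x in lebesgue. f x = g x)"

quotient_type (overloaded) 'a l2 = "'a::euclidean_space \<Rightarrow> real" / partial: l2_rel
proof (rule part_equivpI)
  show "\<exists>x::'a \<Rightarrow> real. l2_rel x x"
    by (rule exI[of _ "\<lambda>x. 0"]) (simp add: l2_rel_def square_integrable_0)
  show "symp (l2_rel :: ('a \<Rightarrow> real) \<Rightarrow> _)"
    by (auto simp: symp_def l2_rel_def eq_commute)
  show "transp (l2_rel :: ('a \<Rightarrow> real) \<Rightarrow> _)"
    by (auto simp: transp_def l2_rel_def)
qed

lemma abs_l2_eq_iff:
  assumes "square_integrable f" "square_integrable g"
  shows "abs_l2 f = abs_l2 g \<longleftrightarrow> (AE x in lebesgue. f x = g x)"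
  using assms Quotient3_rel[OF Quotient3_l2, of f g] by (auto simp: l2_rel_def)

lemma l2_rel_rep: "l2_rel (rep_l2 u) (rep_l2 u)"
  by (rule Quotient3_rep_reflp[OF Quotient3_l2])

lemma square_integrable_rep_l2: "square_integrable (rep_l2 u)"
  using l2_rel_rep[of u] by (simp add: l2_rel_def)

lemma abs_rep_l2: "abs_l2 (rep_l2 u) = u"
  by (rule Quotient3_abs_rep[OF Quotient3_l2])

lemma AE_rep_abs_l2:
  "square_integrable f \<Longrightarrow> AE x in lebesgue. rep_l2 (abs_l2 f) x = f x"
  using abs_l2_eq_iff abs_rep_l2 square_integrable_rep_l2 by metis

instantiation l2 :: (euclidean_space) real_vector
begin

lift_definition zero_l2 :: "'a l2" is "\<lambda>x. 0"
  by (simp add: l2_rel_def square_integrable_0)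

lift_definition plus_l2 :: "'a l2 \<Rightarrow> 'a l2 \<Rightarrow> 'a l2" is "\<lambda>f g x. f x + g x"
  by (auto simp: l2_rel_def square_integrable_add)

lift_definition minus_l2 :: "'a l2 \<Rightarrow> 'a l2 \<Rightarrow> 'a l2" is "\<lambda>f g x. f x - g x"
  by (auto simp: l2_rel_def square_integrable_diff)

lift_definition uminus_l2 :: "'a l2 \<Rightarrow> 'a l2" is "\<lambda>f x. - f x"
  by (auto simp: l2_rel_def square_integrable_minus)

lift_definition scaleR_l2 :: "real \<Rightarrow> 'a l2 \<Rightarrow> 'a l2" is "\<lambda>c f x. c * f x"
  by (auto simp: l2_rel_def square_integrable_scale)

instance
  by standard
    (transfer, simp add: l2_rel_def algebra_simps square_integrable_add square_integrable_scale
      square_integrable_0 square_integrable_diff square_integrable_minus)+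

end

instantiation l2 :: (euclidean_space) real_inner
begin

lift_definition inner_l2 :: "'a l2 \<Rightarrow> 'a l2 \<Rightarrow> real"
  is "\<lambda>f g. integral\<^sup>L lebesgue (\<lambda>x. f x * g x)"
  unfolding l2_rel_def
  by (intro Bochner_Integration.integral_cong_AE borel_measurable_times)
    (auto simp: square_integrable_meas)

definition norm_l2 :: "'a l2 \<Rightarrow> real" where "norm_l2 u = sqrt (inner u u)"
definition dist_l2 :: "'a l2 \<Rightarrow> 'a l2 \<Rightarrow> real" where "dist_l2 u v = norm (u - v)"
definition sgn_l2 :: "'a l2 \<Rightarrow> 'a l2" where "sgn_l2 u = inverse (norm u) *\<^sub>R u"
definition uniformity_l2 :: "('a l2 \<times> 'a l2) filter" where
  "uniformity_l2 = (INF e\<in>{0 <..}. principal {(x, y). dist x y < e})"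
definition open_l2 :: "'a l2 set \<Rightarrow> bool" where
  "open_l2 U \<longleftrightarrow> (\<forall>x\<in>U. eventually (\<lambda>(x', y). x' = x \<longrightarrow> y \<in> U) uniformity)"

instance
proof
  fix u v w :: "'a l2" and r :: real and U :: "'a l2 set"
  show "dist u v = norm (u - v)" by (rule dist_l2_def)
  show "sgn u = inverse (norm u) *\<^sub>R u" by (rule sgn_l2_def)
  show "uniformity = (INF e\<in>{0 <..}. principal {(x, y::'a l2). dist x y < e})"
    by (rule uniformity_l2_def)
  show "open U \<longleftrightarrow> (\<forall>x\<in>U. eventually (\<lambda>(x', y). x' = x \<longrightarrow> y \<in> U) uniformity)"
    by (rule open_l2_def)
  show "norm u = sqrt (inner u u)" by (rule norm_l2_def)
  show "inner u v = inner v u"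
    by transfer (simp add: mult.commute)
  show "inner (u + v) w = inner u w + inner v w"
    by transfer
      (simp add: l2_rel_def distrib_right Bochner_Integration.integral_add square_integrable_mult)
  show "inner (r *\<^sub>R u) v = r * inner u v"
    by transfer (simp add: mult.assoc)
  show "0 \<le> inner u u"
    by transfer (simp add: integral_nonneg_AE)
  show "inner u u = 0 \<longleftrightarrow> u = 0"
  proof transfer
    fix f :: "'a \<Rightarrow> real" assume f: "l2_rel f f"
    have "integral\<^sup>L lebesgue (\<lambda>x. f x * f x) = 0 \<longleftrightarrow> (AE x in lebesgue. f x * f x = 0)"
      using f by (intro integral_nonneg_eq_0_iff_AE square_integrable_mult) (auto simp: l2_rel_def)
    then show "integral\<^sup>L lebesgue (\<lambda>x. f x * f x) = 0 \<longleftrightarrow> l2_rel f (\<lambda>x. 0)"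
      using f by (simp add: l2_rel_def square_integrable_0)
  qed
qed

end

lemma inner_abs_l2:
  assumes "square_integrable f" "square_integrable g"
  shows "inner (abs_l2 f) (abs_l2 g) = integral\<^sup>L lebesgue (\<lambda>x. f x * g x)"
  using assms by (intro inner_l2.abs_eq) (auto simp: l2_rel_def)

lemma norm_abs_l2:
  "square_integrable f \<Longrightarrow> norm (abs_l2 f) = sqrt (integral\<^sup>L lebesgue (\<lambda>x. (f x)\<^sup>2))"
  by (simp add: norm_eq_sqrt_inner inner_abs_l2 power2_eq_square)

lemma abs_l2_add:
  assumes "square_integrable f" "square_integrable g"
  shows "abs_l2 (\<lambda>x. f x + g x) = abs_l2 f + abs_l2 g"
  using assms by (subst plus_l2.abs_eq) (auto simp: l2_rel_def)

lemma abs_l2_diff: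
  assumes "square_integrable f" "square_integrable g"
  shows "abs_l2 (\<lambda>x. f x - g x) = abs_l2 f - abs_l2 g"
  using assms by (subst minus_l2.abs_eq) (auto simp: l2_rel_def)

lemma abs_l2_scale:
  "square_integrable f \<Longrightarrow> abs_l2 (\<lambda>x. c * f x) = c *\<^sub>R abs_l2 f"
  by (subst scaleR_l2.abs_eq) (auto simp: l2_rel_def)

subsection \<open>Separability\<close>

lemma square_integrable_sum:
  assumes "\<And>i. i \<in> I \<Longrightarrow> square_integrable (f i)"
  shows "square_integrable (\<lambda>x. \<Sum>i\<in>I. f i x)"
  using assms
  by (induction I rule: infinite_finite_induct)
    (auto simp: square_integrable_0 intro!: square_integrable_add)

lemma abs_l2_sum:
  assumes "finite I" "\<And>i. i \<in> I \<Longrightarrow> square_integrable (f i)"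
  shows "abs_l2 (\<lambda>x. \<Sum>i\<in>I. f i x) = (\<Sum>i\<in>I. abs_l2 (f i))"
  using assms
proof (induction I rule: finite_induct)
  case empty
  then show ?case by (simp add: zero_l2.abs_eq)
next
  case (insert j I)
  then show ?case
    by (simp add: abs_l2_add square_integrable_sum)
qed

lemma square_integrable_indicator:
  assumes "A \<in> sets borel"
  shows "square_integrable (indicator (A \<inter> ball 0 r) :: 'a::euclidean_space \<Rightarrow> real)"
proof -
  have A: "A \<inter> ball 0 r \<in> sets lebesgue" using assms by auto
  have "emeasure lebesgue (A \<inter> ball 0 r) \<le> emeasure lebesgue (ball 0 r :: 'a set)"
    by (intro emeasure_mono) auto
  also have "\<dots> < \<infinity>"
    using emeasure_lborel_ball_finite[of "0::'a" r] by simp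
  finally have "integrable lebesgue (indicator (A \<inter> ball 0 r) :: 'a \<Rightarrow> real)"
    using A by (intro integrable_real_indicator) auto
  moreover have "(indicator (A \<inter> ball 0 r) x :: real)\<^sup>2 = indicator (A \<inter> ball 0 r) x" for x :: 'a
    by (simp add: indicator_def)
  ultimately show ?thesis
    using A by (simp add: square_integrable_def)
qed

lemma abs_l2_dominated_tendsto:
  fixes g :: "'a::euclidean_space \<Rightarrow> real"
  assumes f: "\<And>n. square_integrable (f n)" and g: "square_integrable g"
    and w: "square_integrable w" and bound: "\<And>n x. \<bar>f n x\<bar> \<le> w x"
    and lim: "\<And>x. (\<lambda>n. f n x) \<longlonglongrightarrow> g x"
  shows "(\<lambda>n. abs_l2 (f n)) \<longlonglongrightarrow> abs_l2 g"
proof -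
  have gw: "\<bar>g x\<bar> \<le> w x" for x
    using tendsto_rabs[OF lim[of x]] bound by (intro LIMSEQ_le_const2) auto
  have sq: "square_integrable (\<lambda>x. f n x - g x)" for n
    using f g by (rule square_integrable_diff)
  have "(\<lambda>n. integral\<^sup>L lebesgue (\<lambda>x. (f n x - g x)\<^sup>2)) \<longlonglongrightarrow> integral\<^sup>L lebesgue (\<lambda>x::'a. 0 :: real)"
  proof (rule integral_dominated_convergence[where w="\<lambda>x. (2 * w x)\<^sup>2"])
    show "integrable lebesgue (\<lambda>x. (2 * w x)\<^sup>2)"
      using square_integrable_scale[OF w, of 2] by (simp add: square_integrable_def)
    show "(\<lambda>x. (f n x - g x)\<^sup>2) \<in> borel_measurable lebesgue" for n
      using sq[of n] unfolding square_integrable_def by (intro borel_measurable_integrable) simp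
    show "AE x in lebesgue. norm ((f n x - g x)\<^sup>2) \<le> (2 * w x)\<^sup>2" for n
    proof (rule AE_I2)
      fix x
      have "\<bar>f n x - g x\<bar> \<le> \<bar>2 * w x\<bar>" using bound[of n x] gw[of x] by linarith
      then show "norm ((f n x - g x)\<^sup>2) \<le> (2 * w x)\<^sup>2"
        using power2_le_iff_abs_le[of "\<bar>2 * w x\<bar>" "f n x - g x"] by simp
    qed
    show "AE x in lebesgue. (\<lambda>n. (f n x - g x)\<^sup>2) \<longlonglongrightarrow> 0"
    proof (rule AE_I2)
      fix x
      have "(\<lambda>n. f n x - g x) \<longlonglongrightarrow> 0" using lim[of x] by (simp add: LIM_zero)
      from tendsto_power[OF this, of 2] show "(\<lambda>n. (f n x - g x)\<^sup>2) \<longlonglongrightarrow> 0" by simp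
    qed
  qed simp
  then have "(\<lambda>n. integral\<^sup>L lebesgue (\<lambda>x. (f n x - g x)\<^sup>2)) \<longlonglongrightarrow> 0" by simp
  then have "(\<lambda>n. norm (abs_l2 (f n) - abs_l2 g)) \<longlonglongrightarrow> 0"
    unfolding abs_l2_diff[OF f g, symmetric] norm_abs_l2[OF sq]
    using tendsto_real_sqrt[of "\<lambda>n. integral\<^sup>L lebesgue (\<lambda>x. (f n x - g x)\<^sup>2)" 0] by simp
  then show ?thesis by (simp add: LIM_zero_iff tendsto_norm_zero_iff)
qed

lemma borel_Int_stable_countable_generator:
  obtains G :: "'a::second_countable_topology set set"
  where "countable G" "Int_stable G" "UNIV \<in> G" "sets borel = sigma_sets UNIV G"
proof -
  obtain B :: "'a set set" where B: "countable B" "topological_basis B"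
    using ex_countable_basis by blast
  define G where "G = Inter ` {F. finite F \<and> F \<subseteq> B}"
  have "countable G"
    unfolding G_def using B(1) by (intro countable_image countable_Collect_finite_subset)
  moreover have "Int_stable G"
  proof (rule Int_stableI)
    fix a b assume "a \<in> G" "b \<in> G"
    then obtain F F' where *: "finite F" "F \<subseteq> B" "a = \<Inter>F" "finite F'" "F' \<subseteq> B" "b = \<Inter>F'"
      by (auto simp: G_def)
    then have "a \<inter> b = \<Inter>(F \<union> F')" by auto
    then show "a \<inter> b \<in> G" using * by (auto simp: G_def)
  qed
  moreover have "UNIV \<in> G" by (auto simp: G_def intro!: image_eqI[of _ _ "{}"])
  moreover have "sets borel = sigma_sets UNIV G"
  proof (rule antisym)
    have "B \<subseteq> G"
    proof
      fix b assume "b \<in> B"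
      then show "b \<in> G" by (auto simp: G_def intro!: image_eqI[of _ _ "{b}"])
    qed
    have "sets borel = sigma_sets UNIV B"
      by (subst borel_eq_countable_basis[OF B]) (simp add: sets_measure_of)
    also have "\<dots> \<subseteq> sigma_sets UNIV G" using \<open>B \<subseteq> G\<close> by (rule sigma_sets_mono')
    finally show "sets borel \<subseteq> sigma_sets UNIV G" .
    have "G \<subseteq> sets borel"
    proof
      fix a assume "a \<in> G"
      then obtain F where F: "finite F" "F \<subseteq> B" "a = \<Inter>F" by (auto simp: G_def)
      have "open a"
        using F topological_basis_open[OF B(2)] by (auto intro!: open_Inter)
      then show "a \<in> sets borel" by simp
    qed
    then show "sigma_sets UNIV G \<subseteq> sets borel"
      using sets.sigma_sets_subset[of G borel] by simp
  qed
  ultimately show ?thesis using that by blast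
qed

lemma l2_dense_aux:
  fixes G :: "'a::euclidean_space set set" and E :: "'a l2 set"
  assumes G: "Int_stable G" "UNIV \<in> G" "sets borel = sigma_sets UNIV G"
    and E: "subspace E" "closed E"
    and ind: "\<And>A k. A \<in> G \<Longrightarrow> abs_l2 (indicator (A \<inter> ball 0 (real k))) \<in> E"
  shows "E = UNIV"
proof -
  have *: "abs_l2 (indicator (A \<inter> ball 0 (real k))) \<in> E" if "A \<in> sets borel" for A k
  proof -
    have "G \<subseteq> Pow UNIV" by simp
    from G(1) this that[unfolded G(3)] show ?thesis
    proof (induction rule: sigma_sets_induct_disjoint)
      case (basic A)
      then show ?case by (rule ind)
    next
      case empty
      then show ?case
        using subspace_0[OF E(1)] by (simp add: zero_l2.abs_eq indicator_def)
    next
      case (compl A)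
      have A: "A \<in> sets borel" using compl.hyps(1) unfolding G(3) .
      have "abs_l2 (indicator ((UNIV - A) \<inter> ball 0 (real k))) =
          abs_l2 (\<lambda>x. indicator (UNIV \<inter> ball 0 (real k)) x - indicator (A \<inter> ball 0 (real k)) x)"
        by (intro arg_cong[of _ _ abs_l2]) (auto simp: indicator_def fun_eq_iff)
      also have "\<dots> = abs_l2 (indicator (UNIV \<inter> ball 0 (real k))) - abs_l2 (indicator (A \<inter> ball 0 (real k)))"
        using A by (intro abs_l2_diff square_integrable_indicator) auto
      finally show ?case
        using subspace_diff[OF E(1) ind[OF G(2), of k] compl.IH] by simp
    next
      case (union A)
      have A: "A i \<in> sets borel" for i using union.hyps(2) unfolding G(3) by blast
      let ?U = "\<lambda>n. (\<Union>i<n. A i) \<inter> ball 0 (real k)"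
      have "abs_l2 (indicator (?U n)) \<in> E" for n
      proof -
        have "indicator (?U n) x = (\<Sum>i<n. indicator (A i \<inter> ball 0 (real k)) x :: real)" for x
        proof (induction n)
          case (Suc n)
          have "A n \<inter> A i = {}" if "i < n" for i
            using disjoint_family_onD[OF union.hyps(1), of n i] that by simp
          then have "x \<notin> A n \<or> x \<notin> (\<Union>i<n. A i)" by blast
          then have "indicator (?U (Suc n)) x = (indicator (?U n) x + indicator (A n \<inter> ball 0 (real k)) x :: real)"
            unfolding indicator_def lessThan_Suc by (simp split: if_splits)
          also have "\<dots> = (\<Sum>i<Suc n. indicator (A i \<inter> ball 0 (real k)) x)"
            unfolding Suc.IH by simp
          finally show ?case .
        qed simp
        then have "indicator (?U n) = (\<lambda>x. \<Sum>i<n. indicator (A i \<inter> ball 0 (real k)) x :: real)"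
          by (rule ext)
        then have "abs_l2 (indicator (?U n)) =
            abs_l2 (\<lambda>x. \<Sum>i<n. indicator (A i \<inter> ball 0 (real k)) x)"
          by (rule arg_cong)
        also have "\<dots> = (\<Sum>i<n. abs_l2 (indicator (A i \<inter> ball 0 (real k))))"
          by (rule abs_l2_sum) (simp_all add: A square_integrable_indicator)
        also have "\<dots> \<in> E"
          by (rule subspace_sum[OF E(1)]) (rule union.IH)
        finally show ?thesis .
      qed
      moreover have "(\<lambda>n. abs_l2 (indicator (?U n))) \<longlonglongrightarrow> abs_l2 (indicator ((\<Union>i. A i) \<inter> ball 0 (real k)))"
      proof (rule abs_l2_dominated_tendsto[where w="indicator (UNIV \<inter> ball 0 (real k))"])
        show "square_integrable (indicator (UNIV \<inter> ball 0 (real k)) :: 'a \<Rightarrow> real)"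
          by (rule square_integrable_indicator) simp
        show "square_integrable (indicator (?U n) :: 'a \<Rightarrow> real)" for n
          using A by (intro square_integrable_indicator) auto
        show "square_integrable (indicator ((\<Union>i. A i) \<inter> ball 0 (real k)) :: 'a \<Rightarrow> real)"
          using A by (intro square_integrable_indicator) auto
        show "\<bar>indicator (?U n) x :: real\<bar> \<le> indicator (UNIV \<inter> ball 0 (real k)) x" for n x
          by (auto simp: indicator_def)
        show "(\<lambda>n. indicator (?U n) x :: real) \<longlonglongrightarrow> indicator ((\<Union>i. A i) \<inter> ball 0 (real k)) x" for x
        proof (cases "x \<in> (\<Union>i. A i) \<inter> ball 0 (real k)")
          case True
          then obtain m where m: "x \<in> A m" by blast
          show ?thesis
            using m True
            by (intro tendsto_eventually eventually_sequentiallyI[of "Suc m"])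
              (auto simp: indicator_def Suc_le_eq)
        next
          case False
          then have "indicator (?U n) x = (0::real)" for n by (auto simp: indicator_def)
          with False show ?thesis by simp
        qed
      qed
      ultimately show ?case by (rule closed_sequentially[OF E(2)])
    qed
  qed
  have "u \<in> E" for u :: "'a l2"
  proof -
    have "rep_l2 u \<in> borel_measurable (completion lborel)"
      using square_integrable_meas[OF square_integrable_rep_l2] .
    from completion_ex_borel_measurable_real[OF this]
    obtain g where g: "g \<in> borel_measurable lborel" "AE x in lborel. rep_l2 u x = g x" by blast
    have AE: "AE x in lebesgue. rep_l2 u x = g x" using g(2) by (rule AE_completion)
    have g_meas: "g \<in> borel_measurable lebesgue" using g(1) by (rule measurable_completion)
    have g_sq: "square_integrable g"
    proof -
      have "integrable lebesgue (\<lambda>x. (rep_l2 u x)\<^sup>2) \<longleftrightarrow> integrable lebesgue (\<lambda>x. (g x)\<^sup>2)"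
        using AE g_meas square_integrable_meas[OF square_integrable_rep_l2, of u]
        by (intro integrable_cong_AE) auto
      then show ?thesis
        using g_meas square_integrable_rep_l2[of u] by (simp add: square_integrable_def)
    qed
    have u: "abs_l2 g = u"
      using AE abs_l2_eq_iff[OF square_integrable_rep_l2[of u] g_sq] abs_rep_l2[of u] by simp
    from borel_measurable_implies_sequence_metric[OF g(1), of 0]
    obtain s where s: "\<And>i. simple_function lborel (s i)"
      "\<And>x. (\<lambda>i. s i x) \<longlonglongrightarrow> g x" "\<And>i x. \<bar>s i x\<bar> \<le> 2 * \<bar>g x\<bar>"
      by auto
    let ?S = "\<lambda>i y. s i -` {y} \<inter> ball 0 (real i)"
    define t where "t i x = (\<Sum>y\<in>range (s i). y * indicator (?S i y) x)" for i x
    have fin: "finite (range (s i))" for i using s(1)[of i] by (simp add: simple_function_def)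
    have S: "s i -` {y} \<in> sets borel" for i y
      using s(1)[of i, THEN borel_measurable_simple_function] measurable_sets[of "s i" lborel borel "{y}"]
      by simp
    have t_eq: "t i x = s i x * indicator (ball 0 (real i)) x" for i x
    proof -
      have "t i x = (\<Sum>y\<in>{s i x}. y * indicator (?S i y) x)"
        unfolding t_def using fin by (intro sum.mono_neutral_right) (auto simp: indicator_def)
      then show ?thesis by (simp add: indicator_def)
    qed
    have sq_term: "square_integrable (\<lambda>x. y * indicator (?S i y) x)" for i y
      using S by (intro square_integrable_scale square_integrable_indicator)
    have t_sq: "square_integrable (t i)" for i
      unfolding t_def using sq_term by (intro square_integrable_sum)
    have t_E: "abs_l2 (t i) \<in> E" for i
    proof -
      have "abs_l2 (t i) = (\<Sum>y\<in>range (s i). y *\<^sub>R abs_l2 (indicator (?S i y)))"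
        unfolding t_def using S
        by (subst abs_l2_sum[OF fin sq_term]) (simp add: abs_l2_scale square_integrable_indicator)
      also have "\<dots> \<in> E"
        using S by (intro subspace_sum[OF E(1)] subspace_scale[OF E(1)] *)
      finally show ?thesis .
    qed
    have "(\<lambda>i. abs_l2 (t i)) \<longlonglongrightarrow> abs_l2 g"
    proof (rule abs_l2_dominated_tendsto[OF t_sq g_sq])
      have "square_integrable (\<lambda>x. \<bar>g x\<bar>)"
        using g_sq unfolding square_integrable_def by (auto intro: borel_measurable_abs)
      then show "square_integrable (\<lambda>x. 2 * \<bar>g x\<bar>)" by (rule square_integrable_scale)
      show "\<bar>t i x\<bar> \<le> 2 * \<bar>g x\<bar>" for i x
        using s(3)[of i x] by (simp add: t_eq indicator_def)
      show "(\<lambda>i. t i x) \<longlonglongrightarrow> g x" for x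
      proof -
        obtain N :: nat where N: "norm x < real N" using reals_Archimedean2 by blast
        have "eventually (\<lambda>i. s i x = t i x) sequentially"
          using N by (intro eventually_sequentiallyI[of N]) (auto simp: t_eq indicator_def)
        then show ?thesis using s(2) by (rule Lim_transform_eventually[rotated])
      qed
    qed
    with t_E have "abs_l2 g \<in> E" by (rule closed_sequentially[OF E(2)])
    then show ?thesis by (simp add: u)
  qed
  then show ?thesis by blast
qed

lemma separable_imp_countable_subbasis:
  fixes D :: "'a::metric_space set"
  assumes "countable D" "closure D = UNIV"
  shows "\<exists>B::'a set set. countable B \<and> open = generate_topology B"
proof -
  define B where "B = (\<lambda>(d, n). ball d (1 / Suc n)) ` (D \<times> (UNIV :: nat set))"
  have "countable B" unfolding B_def using assms(1) by (intro countable_image countable_SIGMA) auto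
  moreover have "open U \<longleftrightarrow> generate_topology B U" for U
  proof
    assume "generate_topology B U"
    then show "open U" by induction (auto simp: B_def)
  next
    assume U: "open U"
    have "\<exists>b\<in>B. x \<in> b \<and> b \<subseteq> U" if "x \<in> U" for x
    proof -
      obtain e where e: "e > 0" "ball x e \<subseteq> U" using U \<open>x \<in> U\<close> openE by blast
      obtain n where n: "1 / Suc n < e / 2" using e(1) nat_approx_posE[of "e / 2"] by auto
      have "x \<in> closure D" using assms(2) by simp
      then obtain d where d: "d \<in> D" "dist d x < 1 / Suc n"
        unfolding closure_approachable by (metis of_nat_0_less_iff zero_less_Suc zero_less_divide_1_iff)
      have "ball d (1 / Suc n) \<subseteq> ball x e"
      proof
        fix z assume "z \<in> ball d (1 / Suc n)"
        then show "z \<in> ball x e"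
          using d(2) n dist_triangle[of x z d] by (simp add: dist_commute)
      qed
      then show ?thesis
        using d e(2) by (intro bexI[of _ "ball d (1 / Suc n)"]) (auto simp: B_def)
    qed
    then have "U = \<Union>{b \<in> B. b \<subseteq> U}" by blast
    moreover have "generate_topology B (\<Union>{b \<in> B. b \<subseteq> U})"
      by (intro generate_topology.UN) (auto intro: generate_topology.Basis)
    ultimately show "generate_topology B U" by simp
  qed
  ultimately show ?thesis by (intro exI[of _ B]) (auto simp: fun_eq_iff)
qed

lemma subspace_closure_rational_span:
  fixes D :: "'a::real_normed_vector set"
  assumes 0: "0 \<in> D" and add: "\<And>x y. x \<in> D \<Longrightarrow> y \<in> D \<Longrightarrow> x + y \<in> D"
    and scale: "\<And>q x. x \<in> D \<Longrightarrow> real_of_rat q *\<^sub>R x \<in> D"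
  shows "subspace (closure D)"
proof (rule subspaceI)
  show "0 \<in> closure D" using 0 closure_subset by blast
next
  fix x y assume "x \<in> closure D" "y \<in> closure D"
  then obtain X Y where "\<And>n. X n \<in> D" "X \<longlonglongrightarrow> x" "\<And>n. Y n \<in> D" "Y \<longlonglongrightarrow> y"
    unfolding closure_sequential by blast
  then show "x + y \<in> closure D"
    unfolding closure_sequential using add by (intro exI[of _ "\<lambda>n. X n + Y n"]) (auto intro: tendsto_add)
next
  fix c x assume "x \<in> closure D"
  then obtain X where X: "\<And>n. X n \<in> D" "X \<longlonglongrightarrow> x"
    unfolding closure_sequential by blast
  have "\<exists>q. \<bar>real_of_rat q - c\<bar> < 1 / Suc n" for n
  proof -
    obtain q where "c < real_of_rat q" "real_of_rat q < c + 1 / Suc n"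
      using of_rat_dense[of c "c + 1 / Suc n"] by auto
    then show ?thesis by (intro exI[of _ q]) auto
  qed
  then obtain q where q: "\<And>n. \<bar>real_of_rat (q n) - c\<bar> < 1 / Suc n" by metis
  have "(\<lambda>n. real_of_rat (q n) - c) \<longlonglongrightarrow> 0"
  proof (rule Lim_null_comparison)
    show "\<forall>\<^sub>F n in sequentially. norm (real_of_rat (q n) - c) \<le> 1 / Suc n"
      using q by (auto intro!: always_eventually less_imp_le)
    show "(\<lambda>n. 1 / real (Suc n)) \<longlonglongrightarrow> 0" using LIMSEQ_inverse_real_of_nat by (simp add: inverse_eq_divide)
  qed
  then have "(\<lambda>n. real_of_rat (q n)) \<longlonglongrightarrow> c" by (simp add: LIM_zero_iff)
  then have "(\<lambda>n. real_of_rat (q n) *\<^sub>R X n) \<longlonglongrightarrow> c *\<^sub>R x" using X(2) by (rule tendsto_scaleR)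
  then show "c *\<^sub>R x \<in> closure D"
    unfolding closure_sequential using X(1) scale by (intro exI[of _ "\<lambda>n. real_of_rat (q n) *\<^sub>R X n"]) auto
qed

instance l2 :: (euclidean_space) second_countable_topology
proof
  obtain G :: "'a set set" where G: "countable G" "Int_stable G" "UNIV \<in> G" "sets borel = sigma_sets UNIV G"
    using borel_Int_stable_countable_generator by blast
  define S where "S = (\<lambda>(A, k). abs_l2 (indicator (A \<inter> ball 0 (real k)) :: 'a \<Rightarrow> real)) ` (G \<times> UNIV)"
  define c :: "(rat \<times> 'a l2) list \<Rightarrow> 'a l2"
    where "c l = (\<Sum>(q, s)\<leftarrow>l. real_of_rat q *\<^sub>R s)" for l
  define D where "D = c ` lists (UNIV \<times> S)"
  have "countable S" unfolding S_def using G(1) by (intro countable_image countable_SIGMA) auto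
  then have "countable D" unfolding D_def by (intro countable_image countable_lists countable_SIGMA) auto
  moreover have "closure D = UNIV"
  proof (rule l2_dense_aux[OF G(2-4)])
    show "subspace (closure D)"
    proof (rule subspace_closure_rational_span)
      show "0 \<in> D" unfolding D_def by (intro image_eqI[of _ _ "[]"]) (auto simp: c_def)
      show "x + y \<in> D" if x: "x \<in> D" and y: "y \<in> D" for x y
      proof -
        obtain l where l: "l \<in> lists (UNIV \<times> S)" "x = c l"
          using x unfolding D_def by (elim imageE)
        obtain l' where l': "l' \<in> lists (UNIV \<times> S)" "y = c l'"
          using y unfolding D_def by (elim imageE)
        have "x + y = c (l @ l')" using l(2) l'(2) by (simp add: c_def)
        moreover have "l @ l' \<in> lists (UNIV \<times> S)" using l(1) l'(1) by simp
        ultimately show ?thesis unfolding D_def by (rule image_eqI)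
      qed
      show "real_of_rat q *\<^sub>R x \<in> D" if x: "x \<in> D" for q x
      proof -
        obtain l where l: "l \<in> lists (UNIV \<times> S)" "x = c l" using x unfolding D_def by (elim imageE)
        have "real_of_rat q *\<^sub>R c l = c (map (\<lambda>(p, s). (q * p, s)) l)"
          by (induction l) (auto simp: c_def scaleR_add_right of_rat_mult)
        moreover have "map (\<lambda>(p, s). (q * p, s)) l \<in> lists (UNIV \<times> S)" using l(1) by auto
        ultimately show ?thesis unfolding D_def l(2) by (rule image_eqI)
      qed
    qed
    show "closed (closure D)" by simp
    show "abs_l2 (indicator (A \<inter> ball 0 (real k))) \<in> closure D" if "A \<in> G" for A k
    proof -
      have "abs_l2 (indicator (A \<inter> ball 0 (real k))) \<in> S" using that by (auto simp: S_def)
      then have "abs_l2 (indicator (A \<inter> ball 0 (real k))) \<in> D"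
        unfolding D_def
        by (intro image_eqI[of _ _ "[(1, abs_l2 (indicator (A \<inter> ball 0 (real k))))]"]) (auto simp: c_def)
      then show ?thesis using closure_subset by blast
    qed
  qed
  ultimately show "\<exists>B::'a l2 set set. countable B \<and> open = generate_topology B"
    by (rule separable_imp_countable_subbasis)
qed

subsection \<open>Partial derivatives and the Sobolev space of order one\<close>

definition has_partial_deriv ::
    "'n::finite \<Rightarrow> (real^'n \<Rightarrow> 'b::real_normed_vector) \<Rightarrow> real^'n \<Rightarrow> bool" where
  "has_partial_deriv i g x \<longleftrightarrow> (\<lambda>h. g (x + h *\<^sub>R axis i 1)) differentiable (at 0)"

definition partial_deriv ::
    "'n::finite \<Rightarrow> (real^'n \<Rightarrow> 'b::real_normed_vector) \<Rightarrow> real^'n \<Rightarrow> 'b" where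
  "partial_deriv i g x = vector_derivative (\<lambda>h. g (x + h *\<^sub>R axis i 1)) (at 0)"

primrec C_k :: "nat \<Rightarrow> (real^'n::finite \<Rightarrow> real) \<Rightarrow> bool" where
  "C_k 0 g \<longleftrightarrow> continuous_on UNIV g"
| "C_k (Suc k) g \<longleftrightarrow>
     continuous_on UNIV g \<and> (\<forall>i. (\<forall>x. has_partial_deriv i g x) \<and> C_k k (partial_deriv i g))"

definition test_function :: "(real^'n::finite \<Rightarrow> real) \<Rightarrow> bool" where
  "test_function \<psi> \<longleftrightarrow> (\<forall>k. C_k k \<psi>) \<and> compact (closure {x. \<psi> x \<noteq> 0})"

definition is_weak_deriv :: "'n::finite \<Rightarrow> (real^'n) l2 \<Rightarrow> (real^'n) l2 \<Rightarrow> bool" where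
  "is_weak_deriv i u w \<longleftrightarrow>
     (\<forall>\<psi>. test_function \<psi> \<longrightarrow>
        (LINT x|lebesgue. rep_l2 u x * partial_deriv i \<psi> x) = - (LINT x|lebesgue. rep_l2 w x * \<psi> x))"

definition weak_deriv :: "'n::finite \<Rightarrow> (real^'n) l2 \<Rightarrow> (real^'n) l2" where
  "weak_deriv i u = (THE w. is_weak_deriv i u w)"

definition H1 :: "(real^'n::finite) l2 set" where
  "H1 = {u. \<forall>i. \<exists>w. is_weak_deriv i u w}"

definition norm_H1 :: "(real^'n::finite) l2 \<Rightarrow> real" where
  "norm_H1 u = sqrt ((norm u)\<^sup>2 + (\<Sum>i\<in>UNIV. (norm (weak_deriv i u))\<^sup>2))"

subsection \<open>Function spaces on the time interval\<close>

text \<open>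
  Elements are functions of time with values in classes of functions of space; only their values
  for times in \<open>[0,T]\<close> matter, and for \<open>X1\<close> and \<open>X10\<close> only up to null sets of times.
\<close>

definition C0 :: "real \<Rightarrow> (real \<Rightarrow> (real^'n::finite) l2) set" where
  "C0 T = {v. continuous_on {0..T} v}"

definition X10 :: "real \<Rightarrow> (real \<Rightarrow> (real^'n::finite) l2) set" where
  "X10 T = {v. integrable (lebesgue_on {0..T}) v}"

text \<open>
  The map \<open>u \<mapsto> (u, \<partial>\<^sub>1 u, \<dots>, \<partial>\<^sub>n u)\<close> is an isometry of \<open>H1\<close>, normed by \<open>norm_H1\<close>, into a finite power
  of the separable space \<open>l2\<close>; hence (strong) measurability of an \<open>H1\<close>-valued function is
  measurability of these components.
\<close>

definition X1 :: "real \<Rightarrow> (real \<Rightarrow> (real^'n::finite) l2) set" where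
  "X1 T = {v. (AE t in lebesgue_on {0..T}. v t \<in> H1) \<and>
      v \<in> borel_measurable (lebesgue_on {0..T}) \<and>
      (\<forall>i. (\<lambda>t. weak_deriv i (v t)) \<in> borel_measurable (lebesgue_on {0..T})) \<and>
      integrable (lebesgue_on {0..T}) (\<lambda>t. (norm_H1 (v t))\<^sup>2)}"

subsection \<open>The velocity field and its characteristics\<close>

definition bounded_measurable ::
    "real \<Rightarrow> (real^'n::finite \<Rightarrow> real \<Rightarrow> 'b::real_normed_vector) \<Rightarrow> bool" where
  "bounded_measurable T g \<longleftrightarrow>
     (\<lambda>(x, t). g x t) \<in> borel_measurable (lebesgue_on (UNIV \<times> {0..T})) \<and>
     (\<exists>K. \<forall>x. \<forall>t\<in>{0..T}. norm (g x t) \<le> K)"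

definition velocity_field :: "real \<Rightarrow> (real^'n::finite \<Rightarrow> real \<Rightarrow> real^'n) \<Rightarrow> bool" where
  "velocity_field T f \<longleftrightarrow>
     bounded_measurable T f \<and>
     (\<forall>i. (\<forall>x. \<forall>t\<in>{0..T}. has_partial_deriv i (\<lambda>x. f x t) x) \<and>
          bounded_measurable T (\<lambda>x t. partial_deriv i (\<lambda>x. f x t) x)) \<and>
     (\<forall>i j. (\<forall>x. \<forall>t\<in>{0..T}. has_partial_deriv j (partial_deriv i (\<lambda>x. f x t)) x) \<and>
          bounded_measurable T (\<lambda>x t. partial_deriv j (partial_deriv i (\<lambda>x. f x t)) x))"

text \<open>
  As \<open>f\<close> is only measurable in time, solutions of the differential equation are taken in the
  sense of Caratheodory: \<open>y t = x + \<integral>\<^sub>s\<^sup>t f (y r) r dr\<close>.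
\<close>

definition is_characteristic ::
    "real \<Rightarrow> (real^'n::finite \<Rightarrow> real \<Rightarrow> real^'n) \<Rightarrow> real^'n \<Rightarrow> real \<Rightarrow> (real \<Rightarrow> real^'n) \<Rightarrow> bool" where
  "is_characteristic T f x s y \<longleftrightarrow>
     (\<forall>t\<in>{s..T}. has_bochner_integral (lebesgue_on {s..t}) (\<lambda>r. f (y r) r) (y t - x))"

definition characteristic ::
    "real \<Rightarrow> (real^'n::finite \<Rightarrow> real \<Rightarrow> real^'n) \<Rightarrow> real^'n \<Rightarrow> real \<Rightarrow> real \<Rightarrow> real^'n" where
  "characteristic T f x s t = (THE z. \<exists>y. is_characteristic T f x s y \<and> y t = z)"

definition char_integral ::
    "real \<Rightarrow> (real^'n::finite \<Rightarrow> real \<Rightarrow> real^'n) \<Rightarrow> (real^'n \<Rightarrow> real \<Rightarrow> real) \<Rightarrow> real^'n \<Rightarrow> real \<Rightarrow> real" where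
  "char_integral T f \<phi> x s = (LINT t|lebesgue_on {s..T}. \<phi> (characteristic T f x s t) t)"

subsection \<open>The solution operator of the transport equation\<close>

definition transport_term ::
    "(real^'n::finite \<Rightarrow> real \<Rightarrow> real^'n) \<Rightarrow> real \<Rightarrow> (real^'n) l2 \<Rightarrow> (real^'n) l2" where
  "transport_term f t u = abs_l2 (\<lambda>x. \<Sum>i\<in>UNIV. f x t $ i * rep_l2 (weak_deriv i u) x)"

text \<open>
  Integrating the equation from \<open>s\<close> to \<open>T\<close> and using \<open>v T = 0\<close> gives
  \<open>v s = \<integral>\<^sub>s\<^sup>T (\<phi> t + \<Sum>\<^sub>i f\<^sub>i \<partial>\<^sub>i v t) dt\<close>, a Bochner integral in \<open>l2\<close>.
\<close>

definition cauchy_solution ::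
    "real \<Rightarrow> (real^'n::finite \<Rightarrow> real \<Rightarrow> real^'n) \<Rightarrow>
      (real \<Rightarrow> (real^'n) l2) \<Rightarrow> (real \<Rightarrow> (real^'n) l2) \<Rightarrow> bool" where
  "cauchy_solution T f \<phi> v \<longleftrightarrow>
     v \<in> X1 T \<inter> C0 T \<and>
     (\<forall>s\<in>{0..T}. has_bochner_integral (lebesgue_on {s..T})
        (\<lambda>t. \<phi> t + transport_term f t (v t)) (v s))"

definition is_solution_operator ::
    "real \<Rightarrow> (real^'n::finite \<Rightarrow> real \<Rightarrow> real^'n) \<Rightarrow>
      ((real \<Rightarrow> (real^'n) l2) \<Rightarrow> (real \<Rightarrow> (real^'n) l2)) \<Rightarrow> bool" where
  "is_solution_operator T f L \<longleftrightarrow>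
     L ` X10 T \<subseteq> C0 T \<and>
     (\<forall>\<phi>\<in>X10 T. \<forall>\<psi>\<in>X10 T. \<forall>s\<in>{0..T}. L (\<lambda>t. \<phi> t + \<psi> t) s = L \<phi> s + L \<psi> s) \<and>
     (\<forall>c. \<forall>\<phi>\<in>X10 T. \<forall>s\<in>{0..T}. L (\<lambda>t. c *\<^sub>R \<phi> t) s = c *\<^sub>R L \<phi> s) \<and>
     (\<exists>K. \<forall>\<phi>\<in>X10 T. \<forall>s\<in>{0..T}.
        norm (L \<phi> s) \<le> K * (LINT t|lebesgue_on {0..T}. norm (\<phi> t))) \<and>
     (\<forall>\<phi>\<in>X1 T. cauchy_solution T f \<phi> (L \<phi>))"

text \<open>
  A choice is needed only because the values outside \<open>X10 T\<close> and outside \<open>[0,T]\<close> are irrelevant: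
  uniqueness for the Cauchy problem and density of \<open>X1 T\<close> determine everything else.
\<close>

definition solution_operator ::
    "real \<Rightarrow> (real^'n::finite \<Rightarrow> real \<Rightarrow> real^'n) \<Rightarrow>
      (real \<Rightarrow> (real^'n) l2) \<Rightarrow> (real \<Rightarrow> (real^'n) l2)" where
  "solution_operator T f = (SOME L. is_solution_operator T f L)"

end

theory Submission
  imports Defs
begin

text \<open>
  After a modification of \<open>f\<close> on a null set of times, \<open>f\<close> is Borel, bounded and Lipschitz in \<open>x\<close>,
  and its flow \<open>\<Phi>\<close> is Lipschitz with a Lipschitz inverse. Hence \<open>U s t g = g \<circ> \<Phi> s t\<close> acts boundedly
  on \<open>l2\<close> and, by duality with test functions, on \<open>H1\<close>; membership in \<open>H1\<close> is convergence of
  difference quotients. The Bochner integral \<open>\<integral>\<^sub>s\<^sup>T U s t (\<phi> t) dt\<close> is therefore a bounded operator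
  on \<open>X10\<close>, and first-order expansions of \<open>U\<close>, valid up to errors negligible with respect to an
  absolutely continuous function, show that it solves the Cauchy problem for \<open>\<phi> \<in> X1\<close>. The energy
  estimate, in which the transport term loses its derivatives by antisymmetry, gives uniqueness,
  so this integral is the solution operator. Finally, Tonelli's theorem and Minkowski's
  inequality, applied to a Borel representative of \<open>\<phi>\<close>, identify it with the pointwise integral
  along characteristics: since \<open>\<Phi> s t\<close> pulls null sets back to null sets, the choice of the
  representative is irrelevant.
\<close>

subsection \<open>Completeness of the space of square-integrable functions\<close>

text \<open>The obstacle is regularity in time: \<open>f\<close> is only measurable in t and
  \<open>\<phi>\<close> only integrable, so neither \<open>evol s t u\<close> nor the solution can
  be differentiated at a given time. Identities in time are therefore integrated, and proved by
  comparing left increments of a scalar function p with \<epsilon> times those of an auxiliary M,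
  for every \<epsilon>; then p is constant. M has to dominate the errors: it contains the integral
  of the derivative norms of \<open>\<phi>\<close> in the existence proof, and is the integral of
  the norm of the transport term in the energy identity. The second obstacle is regularity in space:
  the flow is used as a bi-Lipschitz map only. The Jacobian is replaced by the inequality
  \<open>nonsingular\<close> for measures of preimages, and the chain rule in \<open>H1\<close> by a
  bound on a dual pairing, from which a Riesz argument recovers the derivatives. Finally, the null
  set on which \<open>f\<close> is changed must consist of whole time slices: the graph of a single
  characteristic is null in space-time, so a change on an arbitrary null set could alter the
  solutions.\<close>

lemma l2_borel_rep:
  obtains g where "g \<in> borel_measurable borel" "square_integrable g" "abs_l2 g = u"
proof -
  have "rep_l2 u \<in> borel_measurable (completion lborel)"
    using square_integrable_meas[OF square_integrable_rep_l2] .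
  from completion_ex_borel_measurable_real[OF this]
  obtain g where g: "g \<in> borel_measurable lborel" "AE x in lborel. rep_l2 u x = g x" by blast
  have AE: "AE x in lebesgue. rep_l2 u x = g x" using g(2) by (rule AE_completion)
  have g_meas: "g \<in> borel_measurable lebesgue" using g(1) by (rule measurable_completion)
  have "integrable lebesgue (\<lambda>x. (rep_l2 u x)\<^sup>2) \<longleftrightarrow> integrable lebesgue (\<lambda>x. (g x)\<^sup>2)"
    using AE g_meas square_integrable_meas[OF square_integrable_rep_l2, of u]
    by (intro integrable_cong_AE) auto
  then have sq: "square_integrable g"
    using g_meas square_integrable_rep_l2[of u] by (simp add: square_integrable_def)
  have "abs_l2 g = u"
    using AE abs_l2_eq_iff[OF square_integrable_rep_l2[of u] sq] abs_rep_l2[of u] by simp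
  then show ?thesis using that[of g] g(1) sq by simp
qed

lemma norm_l2_sq: "square_integrable f \<Longrightarrow> (norm (abs_l2 f))\<^sup>2 = (LINT x|lebesgue. (f x)\<^sup>2)"
  by (simp add: norm_abs_l2)

lemma nn_integral_l2:
  "square_integrable f \<Longrightarrow> (\<integral>\<^sup>+x. ennreal ((f x)\<^sup>2) \<partial>lebesgue) = ennreal ((norm (abs_l2 f))\<^sup>2)"
  by (subst nn_integral_eq_integral) (auto simp: square_integrable_def norm_abs_l2)

lemma square_integrableI_nn:
  assumes "f \<in> borel_measurable lebesgue" "(\<integral>\<^sup>+x. ennreal ((f x)\<^sup>2) \<partial>lebesgue) < \<infinity>"
  shows "square_integrable f"
  unfolding square_integrable_def using assms by (auto intro!: integrableI_bounded)

lemma norm_l2_leI_nn: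
  assumes "square_integrable f" "(\<integral>\<^sup>+x. ennreal ((f x)\<^sup>2) \<partial>lebesgue) \<le> ennreal (c\<^sup>2)" "0 \<le> c"
  shows "norm (abs_l2 f) \<le> c"
  using assms by (auto simp: nn_integral_l2 intro: power2_le_imp_le)

text \<open>The square root of a strictly positive integrable function, which every sigma-finite
  measure admits. It is the weight in the completeness proof below.\<close>

lemma ex_positive_square_integrable:
  obtains w :: "'a::euclidean_space \<Rightarrow> real" where "square_integrable w" "\<And>x. w x > 0"
proof -
  obtain h :: "'a \<Rightarrow> ennreal" where h: "h \<in> borel_measurable lborel" "integral\<^sup>N lborel h \<noteq> \<infinity>"
    "\<And>x. 0 < h x" "\<And>x. h x < \<infinity>"
    using sigma_finite_measure.Ex_finite_integrable_function[OF sigma_finite_lborel] by auto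
  define w where "w x = sqrt (enn2real (h x))" for x
  have eq: "ennreal ((w x)\<^sup>2) = h x" for x
    using h(4)[of x] by (simp add: w_def)
  show ?thesis
  proof (rule that[of w])
    have "w \<in> borel_measurable lborel" unfolding w_def using h(1) by measurable
    then have "w \<in> borel_measurable lebesgue" by (rule measurable_completion)
    moreover have "(\<integral>\<^sup>+x. ennreal ((w x)\<^sup>2) \<partial>lebesgue) < \<infinity>"
      unfolding eq nn_integral_completion using h(2) by (simp add: less_top)
    ultimately show "square_integrable w" by (rule square_integrableI_nn)
    show "w x > 0" for x
      using h(3,4)[of x] by (simp add: w_def enn2real_positive_iff)
  qed
qed

text \<open>
  Multiplication by a positive square-integrable weight turns a Cauchy sequence in \<open>l2\<close> into one in
  \<open>L\<^sup>1\<close>; this yields an almost everywhere convergent subsequence, and Fatou's lemma does the rest.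
\<close>

instance l2 :: (euclidean_space) banach
proof
  fix X :: "nat \<Rightarrow> 'a l2" assume X: "Cauchy X"
  define f where "f n = rep_l2 (X n)" for n
  have sf: "square_integrable (f n)" for n by (simp add: f_def square_integrable_rep_l2)
  have Xf: "X n = abs_l2 (f n)" for n by (simp add: f_def abs_rep_l2)
  obtain w :: "'a \<Rightarrow> real" where w: "square_integrable w" "\<And>x. w x > 0"
    using ex_positive_square_integrable by blast
  have aw: "\<bar>w x\<bar> = w x" for x using w(2)[of x] by simp
  have nw: "norm (abs_l2 w) \<ge> 0" by simp
  have int: "integrable lebesgue (\<lambda>x. w x * f n x)" for n
    using square_integrable_mult[OF w(1) sf] .
  have "\<exists>N. \<forall>i\<ge>N. \<forall>j\<ge>N. LINT x|lebesgue. norm (w x * f i x - w x * f j x) < e" if "e > 0" for e :: real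
  proof -
    \<comment> \<open>By Cauchy-Schwarz the weighted distance in the mean is at most
      \<open>norm (abs_l2 w)\<close> times the distance in \<open>l2\<close>; the summand 1 avoids a
      division by zero.\<close>
    have "e / (norm (abs_l2 w) + 1) > 0" using that nw by (intro divide_pos_pos) linarith+
    from metric_CauchyD[OF X this]
    obtain N where N: "\<And>i j. i \<ge> N \<Longrightarrow> j \<ge> N \<Longrightarrow> dist (X i) (X j) < e / (norm (abs_l2 w) + 1)" by blast
    have "LINT x|lebesgue. norm (w x * f i x - w x * f j x) < e" if ij: "i \<ge> N" "j \<ge> N" for i j
    proof -
      have sd: "square_integrable (\<lambda>x. \<bar>f i x - f j x\<bar>)"
        using square_integrable_diff[OF sf sf, of i j] unfolding square_integrable_def by auto
      have "(LINT x|lebesgue. norm (w x * f i x - w x * f j x)) = (LINT x|lebesgue. w x * \<bar>f i x - f j x\<bar>)"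
        by (intro Bochner_Integration.integral_cong) (auto simp: abs_mult aw simp flip: right_diff_distrib)
      also have "\<dots> = inner (abs_l2 w) (abs_l2 (\<lambda>x. \<bar>f i x - f j x\<bar>))"
        by (rule inner_abs_l2[OF w(1) sd, symmetric])
      also have "\<dots> \<le> norm (abs_l2 w) * norm (abs_l2 (\<lambda>x. \<bar>f i x - f j x\<bar>))"
        by (rule norm_cauchy_schwarz)
      also have "norm (abs_l2 (\<lambda>x. \<bar>f i x - f j x\<bar>)) = dist (X i) (X j)"
        using sf by (simp add: norm_abs_l2[OF sd] dist_norm Xf norm_abs_l2 square_integrable_diff
          flip: abs_l2_diff)
      also have "norm (abs_l2 w) * dist (X i) (X j) \<le> (norm (abs_l2 w) + 1) * dist (X i) (X j)"
        by (intro mult_right_mono) auto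
      also have "\<dots> < e" using N[OF ij] nw by (simp add: pos_less_divide_eq mult.commute)
      finally show ?thesis .
    qed
    then show ?thesis by blast
  qed
  from cauchy_L1_AE_cauchy_subseq[OF int this]
  obtain r where r: "strict_mono r" "AE x in lebesgue. Cauchy (\<lambda>i. w x * f (r i) x)" by blast
  \<comment> \<open>Where the subsequence diverges the value of \<open>lim\<close> is irrelevant:
    these points form a null set and \<open>g\<close> stays measurable.\<close>
  define g where "g x = lim (\<lambda>i. f (r i) x)" for x
  have fm: "f n \<in> borel_measurable lebesgue" for n using square_integrable_meas[OF sf] .
  have gm: "g \<in> borel_measurable lebesgue"
    unfolding g_def using fm by (intro borel_measurable_lim_metric) auto
  have lim: "AE x in lebesgue. (\<lambda>i. f (r i) x) \<longlonglongrightarrow> g x"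
    using r(2)
  proof eventually_elim
    case (elim x)
    then have "convergent (\<lambda>i. w x * f (r i) x)" by (simp add: Cauchy_convergent_iff)
    then obtain l where "(\<lambda>i. w x * f (r i) x) \<longlonglongrightarrow> l" by (auto simp: convergent_def)
    from tendsto_divide[OF this tendsto_const, of "w x"]
    have "(\<lambda>i. f (r i) x) \<longlonglongrightarrow> l / w x" using w(2)[of x] by simp
    then show ?case unfolding g_def by (simp add: limI)
  qed
  \<comment> \<open>Fatou's lemma along the subsequence. With e = 1 it makes \<open>g\<close> square
    integrable, with small e it gives convergence of the whole sequence.\<close>
  have dist_le: "(\<integral>\<^sup>+x. ennreal ((f n x - g x)\<^sup>2) \<partial>lebesgue) \<le> ennreal (e\<^sup>2)"
    if e: "e > 0" "\<And>i. i \<ge> N \<Longrightarrow> dist (X n) (X i) < e" for e n N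
  proof -
    have "(\<integral>\<^sup>+x. ennreal ((f n x - g x)\<^sup>2) \<partial>lebesgue)
        = (\<integral>\<^sup>+x. liminf (\<lambda>i. ennreal ((f n x - f (r i) x)\<^sup>2)) \<partial>lebesgue)"
    proof (rule nn_integral_cong_AE)
      show "AE x in lebesgue. ennreal ((f n x - g x)\<^sup>2) = liminf (\<lambda>i. ennreal ((f n x - f (r i) x)\<^sup>2))"
        using lim
      proof eventually_elim
        case (elim x)
        then have "(\<lambda>i. ennreal ((f n x - f (r i) x)\<^sup>2)) \<longlonglongrightarrow> ennreal ((f n x - g x)\<^sup>2)"
          by (intro tendsto_ennrealI tendsto_intros)
        then show ?case by (metis lim_imp_Liminf trivial_limit_sequentially)
      qed
    qed
    also have "\<dots> \<le> liminf (\<lambda>i. \<integral>\<^sup>+x. ennreal ((f n x - f (r i) x)\<^sup>2) \<partial>lebesgue)"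
      using fm by (intro nn_integral_liminf) auto
    also have "(\<lambda>i. \<integral>\<^sup>+x. ennreal ((f n x - f (r i) x)\<^sup>2) \<partial>lebesgue) = (\<lambda>i. ennreal ((dist (X n) (X (r i)))\<^sup>2))"
      using sf by (simp add: nn_integral_l2 square_integrable_diff dist_norm Xf abs_l2_diff)
    also have "liminf (\<lambda>i. ennreal ((dist (X n) (X (r i)))\<^sup>2)) \<le> ennreal (e\<^sup>2)"
    proof -
      have "eventually (\<lambda>i. ennreal ((dist (X n) (X (r i)))\<^sup>2) \<le> ennreal (e\<^sup>2)) sequentially"
      proof (rule eventually_sequentiallyI[of N])
        fix i assume "i \<ge> N"
        then have "r i \<ge> N" using seq_suble[OF r(1), of i] by simp
        then have "dist (X n) (X (r i)) \<le> e" using e(2) by (simp add: less_imp_le)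
        then show "ennreal ((dist (X n) (X (r i)))\<^sup>2) \<le> ennreal (e\<^sup>2)"
          by (intro ennreal_leI power_mono) auto
      qed
      then have "liminf (\<lambda>i. ennreal ((dist (X n) (X (r i)))\<^sup>2)) \<le> liminf (\<lambda>i::nat. ennreal (e\<^sup>2))"
        by (rule Liminf_mono)
      then show ?thesis by (simp add: Liminf_const)
    qed
    finally show ?thesis .
  qed
  have sg: "square_integrable g"
  proof -
    from metric_CauchyD[OF X zero_less_one]
    obtain N where N: "\<And>i j. i \<ge> N \<Longrightarrow> j \<ge> N \<Longrightarrow> dist (X i) (X j) < 1" by blast
    have "(\<integral>\<^sup>+x. ennreal ((f N x - g x)\<^sup>2) \<partial>lebesgue) \<le> ennreal (1\<^sup>2)"
      using N by (intro dist_le[of 1 N]) auto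
    then have "(\<integral>\<^sup>+x. ennreal ((f N x - g x)\<^sup>2) \<partial>lebesgue) < \<infinity>"
      by (rule le_less_trans) auto
    then have "square_integrable (\<lambda>x. f N x - g x)"
      using fm gm by (intro square_integrableI_nn) auto
    from square_integrable_diff[OF sf[of N] this] show ?thesis by simp
  qed
  have "X \<longlonglongrightarrow> abs_l2 g"
  proof (rule metric_LIMSEQ_I)
    fix e :: real assume e: "e > 0"
    then have e2: "e / 2 > 0" by simp
    from metric_CauchyD[OF X e2]
    obtain N where N: "\<And>i j. i \<ge> N \<Longrightarrow> j \<ge> N \<Longrightarrow> dist (X i) (X j) < e / 2" by blast
    have "dist (X n) (abs_l2 g) < e" if n: "n \<ge> N" for n
    proof -
      have "norm (abs_l2 (\<lambda>x. f n x - g x)) \<le> e / 2"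
        using n N e2 by (intro norm_l2_leI_nn square_integrable_diff sf sg dist_le[of _ N]) auto
      then show ?thesis using e by (simp add: dist_norm Xf abs_l2_diff sf sg)
    qed
    then show "\<exists>N. \<forall>n\<ge>N. dist (X n) (abs_l2 g) < e" by blast
  qed
  then show "convergent X" by (auto simp: convergent_def)
qed

subsection \<open>Composition with a nonsingular map\<close>

text \<open>A quantitative form of "preimages of null sets are null" that replaces the change of
  variables formula: C stands for a bound on the Jacobian of the inverse, but neither
  differentiability nor surjectivity of \<open>\<Psi>\<close> enters.\<close>

definition nonsingular :: "real \<Rightarrow> ('a::euclidean_space \<Rightarrow> 'a) \<Rightarrow> bool" where
  "nonsingular C \<Psi> \<longleftrightarrow> 0 \<le> C \<and> \<Psi> \<in> borel_measurable borel \<and>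
     (\<forall>A\<in>sets borel. emeasure lborel (\<Psi> -` A) \<le> ennreal C * emeasure lborel A)"

lemma nonsingular_nonneg: "nonsingular C \<Psi> \<Longrightarrow> 0 \<le> C"
  by (simp add: nonsingular_def)

lemma nonsingular_borel: "nonsingular C \<Psi> \<Longrightarrow> \<Psi> \<in> borel_measurable borel"
  by (simp add: nonsingular_def)

text \<open>Under a mere Borel map the preimage of a Lebesgue set can fail to be Lebesgue
  measurable. Here null sets pull back to null sets, so the map is measurable between the
  completions.\<close>

lemma nonsingular_lebesgue:
  fixes \<Psi> :: "'a::euclidean_space \<Rightarrow> 'a"
  assumes "nonsingular C \<Psi>"
  shows "\<Psi> \<in> lebesgue \<rightarrow>\<^sub>M lebesgue"
proof (rule completion.measurable_completion2)
  have b: "\<Psi> \<in> borel_measurable lborel" using nonsingular_borel[OF assms] by simp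
  then show b': "\<Psi> \<in> completion lborel \<rightarrow>\<^sub>M lborel" using measurable_completion[OF b] by simp
  show "null_sets lborel \<subseteq> null_sets (distr lebesgue lborel \<Psi>)"
  proof
    fix A :: "'a set" assume A: "A \<in> null_sets lborel"
    then have "A \<in> sets borel" "emeasure lborel A = 0" by auto
    then have "emeasure lborel (\<Psi> -` A) = 0"
      using assms unfolding nonsingular_def by fastforce
    moreover have "\<Psi> -` A \<in> sets lborel" using measurable_sets[OF b, of A] \<open>A \<in> sets borel\<close> by simp
    ultimately show "A \<in> null_sets (distr lebesgue lborel \<Psi>)"
      using b' \<open>A \<in> sets borel\<close> by (auto intro!: null_setsI simp: emeasure_distr)
  qed
qed

text \<open>The defining inequality says that the image measure lies below C times Lebesgue measure,
  and integrals of nonnegative functions are monotone in the measure.\<close>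

lemma nonsingular_nn_integral:
  fixes \<Psi> :: "'a::euclidean_space \<Rightarrow> 'a" and g :: "'a \<Rightarrow> ennreal"
  assumes "nonsingular C \<Psi>" "g \<in> borel_measurable borel"
  shows "(\<integral>\<^sup>+x. g (\<Psi> x) \<partial>lborel) \<le> ennreal C * (\<integral>\<^sup>+x. g x \<partial>lborel)"
proof -
  have b: "\<Psi> \<in> borel_measurable lborel" using nonsingular_borel[OF assms(1)] by simp
  have "(\<integral>\<^sup>+x. g (\<Psi> x) \<partial>lborel) = (\<integral>\<^sup>+x. g x \<partial>distr lborel borel \<Psi>)"
    using b assms(2) by (subst nn_integral_distr) auto
  also have "\<dots> \<le> (\<integral>\<^sup>+x. g x \<partial>scale_measure (ennreal C) lborel)"
  proof (rule nn_integral_mono_measure)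
    show "distr lborel borel \<Psi> \<le> scale_measure (ennreal C) lborel"
    proof (subst le_measure_iff, simp add: space_scale_measure, rule le_funI)
      fix A :: "'a set"
      show "emeasure (distr lborel borel \<Psi>) A \<le> emeasure (scale_measure (ennreal C) lborel) A"
      proof (cases "A \<in> sets borel")
        case True
        then show ?thesis using b assms(1) by (simp add: emeasure_distr nonsingular_def)
      next
        case False
        then show ?thesis by (simp add: emeasure_notin_sets)
      qed
    qed
  qed simp
  also have "\<dots> = ennreal C * (\<integral>\<^sup>+x. g x \<partial>lborel)"
    using assms(2) by (subst nn_integral_scale_measure) auto
  finally show ?thesis .
qed

lemma nonsingular_AE:
  assumes "nonsingular C \<Psi>" "AE x in lebesgue. P x"
  shows "AE x in lebesgue. P (\<Psi> x)"
proof -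
  have "AE x in lborel. P x" using assms(2) by (simp add: AE_completion_iff)
  then obtain N where N: "{x. \<not> P x} \<subseteq> N" "N \<in> sets borel" "emeasure lborel N = 0"
    by (auto elim!: AE_E)
  have "emeasure lborel (\<Psi> -` N) = 0"
    using assms(1) N unfolding nonsingular_def by fastforce
  moreover have "\<Psi> -` N \<in> sets lborel"
    using measurable_sets[of \<Psi> borel borel N] nonsingular_borel[OF assms(1)] N(2) by simp
  ultimately have "\<Psi> -` N \<in> null_sets lborel" by blast
  then have "AE x in lborel. P (\<Psi> x)"
    using N(1) by (intro AE_I'[of "\<Psi> -` N"]) auto
  then show ?thesis by (rule AE_completion)
qed

lemma nonsingular_square_integrable:
  assumes "nonsingular C \<Psi>" "square_integrable f"
  shows "square_integrable (\<lambda>x. f (\<Psi> x))"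
    and "norm (abs_l2 (\<lambda>x. f (\<Psi> x))) \<le> sqrt C * norm (abs_l2 f)"
proof -
  have C: "0 \<le> C" using assms(1) by (rule nonsingular_nonneg)
  have m: "(\<lambda>x. f (\<Psi> x)) \<in> borel_measurable lebesgue"
    using measurable_compose[OF nonsingular_lebesgue[OF assms(1)] square_integrable_meas[OF assms(2)]] .
  \<comment> \<open>\<open>nonsingular_nn_integral\<close> is about Borel integrands. Replacing
    \<open>f\<close> by a Borel representative is harmless, because equality almost everywhere
    survives composition with \<open>\<Psi>\<close>.\<close>
  obtain g where g: "g \<in> borel_measurable borel" "square_integrable g" "abs_l2 g = abs_l2 f"
    using l2_borel_rep by blast
  have AE: "AE x in lebesgue. g x = f x" using g assms(2) abs_l2_eq_iff by blast
  have "(\<integral>\<^sup>+x. ennreal ((f (\<Psi> x))\<^sup>2) \<partial>lebesgue) = (\<integral>\<^sup>+x. ennreal ((g (\<Psi> x))\<^sup>2) \<partial>lebesgue)"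
    using nonsingular_AE[OF assms(1) AE] by (intro nn_integral_cong_AE) auto
  also have "\<dots> = (\<integral>\<^sup>+x. ennreal ((g (\<Psi> x))\<^sup>2) \<partial>lborel)"
    by (rule nn_integral_completion)
  also have "\<dots> \<le> ennreal C * (\<integral>\<^sup>+x. ennreal ((g x)\<^sup>2) \<partial>lborel)"
    using g(1) by (intro nonsingular_nn_integral[OF assms(1)]) measurable
  also have "(\<integral>\<^sup>+x. ennreal ((g x)\<^sup>2) \<partial>lborel) = ennreal ((norm (abs_l2 f))\<^sup>2)"
    using nn_integral_l2[OF g(2)] g(3) by (simp add: nn_integral_completion)
  also have "ennreal C * \<dots> = ennreal ((sqrt C * norm (abs_l2 f))\<^sup>2)"
    using C by (simp add: power_mult_distrib flip: ennreal_mult)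
  finally have le: "(\<integral>\<^sup>+x. ennreal ((f (\<Psi> x))\<^sup>2) \<partial>lebesgue) \<le> ennreal ((sqrt C * norm (abs_l2 f))\<^sup>2)" .
  then have "(\<integral>\<^sup>+x. ennreal ((f (\<Psi> x))\<^sup>2) \<partial>lebesgue) < \<infinity>" by (rule le_less_trans) auto
  with m show sq: "square_integrable (\<lambda>x. f (\<Psi> x))" by (rule square_integrableI_nn)
  show "norm (abs_l2 (\<lambda>x. f (\<Psi> x))) \<le> sqrt C * norm (abs_l2 f)"
    using C by (intro norm_l2_leI_nn[OF sq le]) auto
qed

definition comp_l2 :: "('a::euclidean_space \<Rightarrow> 'a) \<Rightarrow> 'a l2 \<Rightarrow> 'a l2" where
  "comp_l2 \<Psi> u = abs_l2 (\<lambda>x. rep_l2 u (\<Psi> x))"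

lemma comp_abs_l2:
  assumes "nonsingular C \<Psi>" "square_integrable f"
  shows "comp_l2 \<Psi> (abs_l2 f) = abs_l2 (\<lambda>x. f (\<Psi> x))"
  unfolding comp_l2_def
  using nonsingular_AE[OF assms(1) AE_rep_abs_l2[OF assms(2)]]
  by (subst abs_l2_eq_iff) (auto intro: nonsingular_square_integrable[OF assms(1)]
    square_integrable_rep_l2 assms(2))

lemma norm_comp_l2_le:
  assumes "nonsingular C \<Psi>"
  shows "norm (comp_l2 \<Psi> u) \<le> sqrt C * norm u"
  using nonsingular_square_integrable(2)[OF assms square_integrable_rep_l2[of u]]
  by (simp add: comp_l2_def abs_rep_l2)

lemma bounded_linear_comp_l2:
  assumes "nonsingular C \<Psi>"
  shows "bounded_linear (comp_l2 \<Psi>)"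
proof (rule bounded_linear_intro)
  fix u v :: "'a l2" and c :: real
  note sq = square_integrable_rep_l2
  have "comp_l2 \<Psi> (u + v) = comp_l2 \<Psi> (abs_l2 (\<lambda>x. rep_l2 u x + rep_l2 v x))"
    by (simp add: abs_l2_add sq abs_rep_l2)
  also have "\<dots> = comp_l2 \<Psi> u + comp_l2 \<Psi> v"
    unfolding comp_abs_l2[OF assms square_integrable_add[OF sq sq]]
    by (simp add: abs_l2_add nonsingular_square_integrable(1)[OF assms sq] comp_l2_def)
  finally show "comp_l2 \<Psi> (u + v) = comp_l2 \<Psi> u + comp_l2 \<Psi> v" .
  have "comp_l2 \<Psi> (c *\<^sub>R u) = comp_l2 \<Psi> (abs_l2 (\<lambda>x. c * rep_l2 u x))"
    by (simp add: abs_l2_scale sq abs_rep_l2)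
  also have "\<dots> = c *\<^sub>R comp_l2 \<Psi> u"
    unfolding comp_abs_l2[OF assms square_integrable_scale[OF sq]]
    by (simp add: abs_l2_scale nonsingular_square_integrable(1)[OF assms sq] comp_l2_def)
  finally show "comp_l2 \<Psi> (c *\<^sub>R u) = c *\<^sub>R comp_l2 \<Psi> u" .
  show "norm (comp_l2 \<Psi> u) \<le> norm u * sqrt C"
    using norm_comp_l2_le[OF assms, of u] by (simp add: mult.commute)
qed

lemma comp_l2_compose:
  assumes "nonsingular C \<Psi>" "nonsingular D \<Theta>"
  shows "comp_l2 \<Psi> (comp_l2 \<Theta> u) = comp_l2 (\<lambda>x. \<Theta> (\<Psi> x)) u"
  unfolding comp_l2_def[of \<Theta>]
  by (subst comp_abs_l2[OF assms(1)])
    (auto simp: comp_l2_def nonsingular_square_integrable[OF assms(2)] square_integrable_rep_l2)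

lemma comp_l2_id: "comp_l2 (\<lambda>x. x) u = u"
  by (simp add: comp_l2_def abs_rep_l2)

subsection \<open>Test functions\<close>

lemma partial_derivI:
  assumes "((\<lambda>h. g (x + h *\<^sub>R axis i 1)) has_vector_derivative D) (at 0)"
  shows "has_partial_deriv i g x" "partial_deriv i g x = D"
  using assms
  by (auto simp: has_partial_deriv_def partial_deriv_def vector_derivative_at
      intro: differentiableI_vector)

lemma partial_derivD:
  "has_partial_deriv i g x \<Longrightarrow>
     ((\<lambda>h. g (x + h *\<^sub>R axis i 1)) has_vector_derivative partial_deriv i g x) (at 0)"
  by (simp add: has_partial_deriv_def partial_deriv_def vector_derivative_works)

lemma has_vector_derivative_partial_shift:
  assumes "has_partial_deriv i g (x + t *\<^sub>R axis i 1)"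
  shows "((\<lambda>t. g (x + t *\<^sub>R axis i 1)) has_vector_derivative
    partial_deriv i g (x + t *\<^sub>R axis i 1)) (at t)"
proof -
  have "((\<lambda>h. g (x + t *\<^sub>R axis i 1 + h *\<^sub>R axis i 1)) has_vector_derivative
      partial_deriv i g (x + t *\<^sub>R axis i 1)) (at (t - t))"
    using partial_derivD[OF assms] by simp
  then have "((\<lambda>h. g (x + t *\<^sub>R axis i 1 + h *\<^sub>R axis i 1)) \<circ> (\<lambda>s. s - t) has_vector_derivative
      1 *\<^sub>R partial_deriv i g (x + t *\<^sub>R axis i 1)) (at t)"
    by (intro vector_diff_chain_at) (auto intro!: derivative_eq_intros)
  moreover have "x + t *\<^sub>R axis i 1 + (s - t) *\<^sub>R axis i 1 = x + s *\<^sub>R axis i 1" for s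
    by (simp add: algebra_simps)
  ultimately show ?thesis by (simp add: o_def)
qed

section \<open>Algebra operations and translations in the classes \<open>C_k\<close>\<close>

lemma C_k_continuous: "C_k k g \<Longrightarrow> continuous_on UNIV g"
  by (cases k) auto

lemma C_k_SucD: "C_k (Suc k) g \<Longrightarrow> C_k k g"
proof (induction k arbitrary: g)
  case (Suc k)
  then show ?case using C_k.simps(2)[of "Suc k" g] C_k.simps(2)[of k g] by blast
qed auto

lemma C_k_const: "C_k k (\<lambda>x::real^'n::finite. c)"
proof (induction k arbitrary: c)
  case (Suc k)
  have *: "has_partial_deriv i (\<lambda>x. c) x" "partial_deriv i (\<lambda>x::real^'n. c) x = 0"
    for i :: 'n and x
    by (rule partial_derivI[where D=0]; auto intro!: derivative_eq_intros)+
  then have "partial_deriv i (\<lambda>x::real^'n. c) = (\<lambda>x. 0)" for i by (auto simp: fun_eq_iff)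
  then show ?case using * Suc by simp
qed auto

lemma C_k_add: "C_k k f \<Longrightarrow> C_k k g \<Longrightarrow> C_k k (\<lambda>x. f x + g x)"
proof (induction k arbitrary: f g)
  case (Suc k)
  then have pd: "\<And>i x. has_partial_deriv i f x" "\<And>i x. has_partial_deriv i g x" by auto
  have *: "has_partial_deriv i (\<lambda>x. f x + g x) x"
    "partial_deriv i (\<lambda>x. f x + g x) x = partial_deriv i f x + partial_deriv i g x" for i x
    by (rule partial_derivI; rule derivative_intros; rule partial_derivD[OF pd(1)] partial_derivD[OF pd(2)])+
  then have "partial_deriv i (\<lambda>x. f x + g x) = (\<lambda>x. partial_deriv i f x + partial_deriv i g x)" for i
    by (auto simp: fun_eq_iff)
  then show ?case using * Suc by (auto intro: continuous_on_add)
qed (auto intro: continuous_on_add)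

lemma C_k_mult: "C_k k f \<Longrightarrow> C_k k g \<Longrightarrow> C_k k (\<lambda>x. f x * g x)"
proof (induction k arbitrary: f g)
  case (Suc k)
  then have pd: "\<And>i x. has_partial_deriv i f x" "\<And>i x. has_partial_deriv i g x" by auto
  have *: "has_partial_deriv i (\<lambda>x. f x * g x) x"
    "partial_deriv i (\<lambda>x. f x * g x) x = f x * partial_deriv i g x + partial_deriv i f x * g x" for i x
    using partial_derivI[OF has_vector_derivative_mult[OF partial_derivD[OF pd(1)[of i x]] partial_derivD[OF pd(2)[of i x]]]]
    by auto
  then have eq: "partial_deriv i (\<lambda>x. f x * g x) = (\<lambda>x. f x * partial_deriv i g x + partial_deriv i f x * g x)" for i
    by (auto simp: fun_eq_iff)
  have "C_k k (\<lambda>x. f x * partial_deriv i g x + partial_deriv i f x * g x)" for i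
    using Suc.prems C_k_SucD[OF Suc.prems(1)] C_k_SucD[OF Suc.prems(2)]
    by (intro C_k_add Suc.IH) auto
  then show ?case using * eq Suc.prems by (auto intro: continuous_on_mult)
qed (auto intro: continuous_on_mult)

lemma C_k_prod:
  assumes "\<And>i. i \<in> I \<Longrightarrow> C_k k (f i)" shows "C_k k (\<lambda>x. \<Prod>i\<in>I. f i x)"
  using assms
proof (induction I rule: infinite_finite_induct)
  case (insert j I)
  then have "C_k k (\<lambda>x. f j x * (\<Prod>i\<in>I. f i x))" by (intro C_k_mult) auto
  then show ?case using insert.hyps by simp
qed (simp_all add: C_k_const)

lemma C_k_power:
  assumes "C_k k f" shows "C_k k (\<lambda>x. f x ^ n)"
proof (induction n)
  case (Suc n)
  from C_k_mult[OF assms this] show ?case by simp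
qed (simp add: C_k_const)

lemma C_k_diff:
  assumes "C_k k f" "C_k k g" shows "C_k k (\<lambda>x. f x - g x)"
  using C_k_add[OF assms(1) C_k_mult[OF C_k_const[of k "-1"] assms(2)]] by simp

lemma partial_deriv_shift:
  "partial_deriv i (\<lambda>x. g (x + a)) x = partial_deriv i g (x + a)"
  "has_partial_deriv i (\<lambda>x. g (x + a)) x \<longleftrightarrow> has_partial_deriv i g (x + a)"
  by (simp_all add: partial_deriv_def has_partial_deriv_def add.assoc add.left_commute add.commute)

lemma C_k_shift: "C_k k g \<Longrightarrow> C_k k (\<lambda>x. g (x + a))"
proof (induction k arbitrary: g)
  case (Suc k)
  have c: "continuous_on UNIV g \<Longrightarrow> continuous_on UNIV (\<lambda>x. g (x + a))" for g
    by (rule continuous_on_compose2[of UNIV g]) (auto intro!: continuous_intros)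
  have "partial_deriv i (\<lambda>x. g (x + a)) = (\<lambda>x. partial_deriv i g (x + a))" for i
    by (auto simp: partial_deriv_shift)
  then show ?case using Suc c by (auto simp: partial_deriv_shift)
next
  case 0
  then show ?case
    by (auto intro!: continuous_on_compose2[of UNIV g] continuous_intros)
qed

text \<open>For m = 0 this is the classical flat function exp (-1/y). The powers of 1/y make the
  family closed under differentiation up to linear combinations, so that one induction on k covers
  all m.\<close>

definition hexp :: "nat \<Rightarrow> real \<Rightarrow> real" where
  "hexp m y = (if y > 0 then inverse y ^ m * exp (- inverse y) else 0)"

text \<open>With z = 1/y the right-hand limit is that of z^m / exp z as z tends to infinity.\<close>

lemma hexp_at_0: "(hexp m \<longlongrightarrow> 0) (at 0)"
proof -
  have "((\<lambda>y. inverse y ^ m / exp (inverse y)) \<longlongrightarrow> (0::real)) (at_right 0)"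
    using filterlim_compose[OF tendsto_power_div_exp_0 filterlim_inverse_at_top_right] .
  then have "(hexp m \<longlongrightarrow> 0) (at_right 0)"
    by (rule Lim_transform_eventually)
      (auto simp: hexp_def exp_minus divide_inverse eventually_at_right_less intro: eventually_mono[OF eventually_at_right_less])
  moreover have "(hexp m \<longlongrightarrow> 0) (at_left 0)"
    by (rule Lim_transform_eventually[OF tendsto_const])
      (auto simp: eventually_at_filter hexp_def)
  ultimately show ?thesis by (rule filterlim_split_at[rotated])
qed

lemma hexp_deriv: "(hexp m has_real_derivative hexp (m + 2) y - m * hexp (m + 1) y) (at y)"
proof (cases y "0::real" rule: linorder_cases)
  case less
  have "((\<lambda>y. 0) has_real_derivative hexp (m + 2) y - m * hexp (m + 1) y) (at y)"
    using less by (simp add: hexp_def)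
  moreover have "eventually (\<lambda>y. 0 = hexp m y) (nhds y)"
    using eventually_nhds_in_open[of "{..<0}" y] less
    by (auto simp: hexp_def elim!: eventually_mono)
  ultimately show ?thesis
    by (subst DERIV_cong_ev[OF refl _ refl, of "hexp m" "\<lambda>y. 0" y]) (auto elim: eventually_mono)
next
  case equal
  \<comment> \<open>The difference quotient at 0 is itself a member of the family, the one with
    exponent \<open>Suc m\<close>, so \<open>hexp_at_0\<close> applies again.\<close>
  have "((\<lambda>h. (hexp m (0 + h) - hexp m 0) / h) \<longlongrightarrow> 0) (at 0)"
  proof (rule Lim_transform_eventually[OF hexp_at_0[of "Suc m"]])
    show "eventually (\<lambda>h. hexp (Suc m) h = (hexp m (0 + h) - hexp m 0) / h) (at 0)"
      by (auto simp: eventually_at_filter hexp_def divide_inverse)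
  qed
  then show ?thesis using equal by (simp add: DERIV_def hexp_def)
next
  case greater
  have "((\<lambda>y. inverse y ^ m * exp (- inverse y)) has_real_derivative hexp (m + 2) y - m * hexp (m + 1) y) (at y)"
    using greater
    apply (auto intro!: derivative_eq_intros simp: hexp_def)
    apply (cases m; simp add: field_simps power2_eq_square)
    done
  moreover have "eventually (\<lambda>y. inverse y ^ m * exp (- inverse y) = hexp m y) (nhds y)"
    using eventually_nhds_in_open[of "{0<..}" y] greater
    by (auto simp: hexp_def elim!: eventually_mono)
  ultimately show ?thesis
    by (subst DERIV_cong_ev[OF refl _ refl, of "hexp m" "\<lambda>y. inverse y ^ m * exp (- inverse y)" y])
      (auto elim: eventually_mono)
qed

lemma C_k_hexp: "C_k k (\<lambda>x::real^'n::finite. hexp m (\<sigma> * x $ i + c))"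
proof -
  have cont: "continuous_on UNIV (\<lambda>x::real^'n. hexp m (\<sigma> * x $ i + c))" for m
  proof (rule continuous_on_compose2[of UNIV "hexp m"])
    show "continuous_on UNIV (hexp m)"
      using hexp_deriv by (intro DERIV_continuous_on) (auto intro: has_field_derivative_at_within)
  qed (auto intro!: continuous_intros)
  show ?thesis
  proof (induction k arbitrary: m)
    case (Suc k)
    define D where "D j x = (if j = i then \<sigma> * (hexp (m + 2) (\<sigma> * x $ i + c) - m * hexp (m + 1) (\<sigma> * x $ i + c)) else 0)"
      for j :: 'n and x :: "real^'n"
    have "((\<lambda>h. hexp m (\<sigma> * (x + h *\<^sub>R axis j 1) $ i + c)) has_real_derivative D j x) (at 0)" for j x
    proof (cases "j = i")
      case True
      have "((\<lambda>h. hexp m (\<sigma> * (x $ i + h) + c)) has_real_derivative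
          (hexp (m + 2) (\<sigma> * (x $ i + 0) + c) - m * hexp (m + 1) (\<sigma> * (x $ i + 0) + c)) * \<sigma>) (at 0)"
        by (rule DERIV_chain2[OF hexp_deriv]) (auto intro!: derivative_eq_intros)
      then show ?thesis using True by (simp add: D_def mult.commute)
    qed (auto simp: D_def axis_def)
    then have *: "has_partial_deriv j (\<lambda>x::real^'n. hexp m (\<sigma> * x $ i + c)) x"
      "partial_deriv j (\<lambda>x::real^'n. hexp m (\<sigma> * x $ i + c)) x = D j x" for j x
      by (auto intro!: partial_derivI simp: has_real_derivative_iff_has_vector_derivative)
    then have eq: "partial_deriv j (\<lambda>x::real^'n. hexp m (\<sigma> * x $ i + c)) = D j" for j by auto
    have "C_k k (D j)" for j
      unfolding D_def by (cases "j = i") (auto intro!: C_k_mult C_k_diff C_k_const Suc.IH)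
    with * eq cont show ?case by simp
  qed (use cont in auto)
qed

lemma hexp_0_bounds: "0 \<le> hexp 0 y" "hexp 0 y \<le> 1" "hexp 0 y \<noteq> 0 \<longleftrightarrow> y > 0"
  by (auto simp: hexp_def)

definition box_bump :: "real^'n::finite \<Rightarrow> real^'n \<Rightarrow> real^'n \<Rightarrow> real" where
  "box_bump a b x = (\<Prod>i\<in>UNIV. hexp 0 (x $ i - a $ i) * hexp 0 (b $ i - x $ i))"

lemma box_bump: "0 \<le> box_bump a b x" "box_bump a b x \<le> 1" "box_bump a b x \<noteq> 0 \<longleftrightarrow> x \<in> box a b"
proof -
  have *: "0 \<le> hexp 0 (x $ i - a $ i) * hexp 0 (b $ i - x $ i) \<and>
      hexp 0 (x $ i - a $ i) * hexp 0 (b $ i - x $ i) \<le> 1" for i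
    by (intro conjI mult_nonneg_nonneg mult_le_one hexp_0_bounds(1,2))
  show "0 \<le> box_bump a b x" unfolding box_bump_def using * by (intro prod_nonneg) blast
  show "box_bump a b x \<le> 1" unfolding box_bump_def using * by (intro prod_le_1) blast
  show "box_bump a b x \<noteq> 0 \<longleftrightarrow> x \<in> box a b"
    unfolding box_bump_def mem_box_cart using hexp_0_bounds(3) by simp
qed

lemma C_k_box_bump: "C_k k (box_bump a b)"
proof -
  have "C_k k (\<lambda>x. hexp 0 (x $ i - a $ i))" "C_k k (\<lambda>x. hexp 0 (b $ i - x $ i))" for i
    using C_k_hexp[of k 0 1 i "- a $ i"] C_k_hexp[of k 0 "-1" i "b $ i"] by auto
  then have "C_k k (\<lambda>x. \<Prod>i\<in>UNIV. hexp 0 (x $ i - a $ i) * hexp 0 (b $ i - x $ i))"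
    by (intro C_k_prod C_k_mult)
  then show ?thesis by (simp add: box_bump_def[abs_def])
qed

section \<open>Test functions and their classes in \<open>l2\<close>\<close>

lemma test_function_iff: "test_function \<psi> \<longleftrightarrow> (\<forall>k. C_k k \<psi>) \<and> bounded {x. \<psi> x \<noteq> 0}"
  by (simp add: test_function_def compact_closure)

lemma test_function_add:
  assumes "test_function f" "test_function g" shows "test_function (\<lambda>x. f x + g x)"
proof -
  have "{x. f x + g x \<noteq> 0} \<subseteq> {x. f x \<noteq> 0} \<union> {x. g x \<noteq> 0}" by auto
  then have "bounded {x. f x + g x \<noteq> 0}"
    using assms bounded_subset bounded_Un unfolding test_function_iff by blast
  moreover have "C_k k (\<lambda>x. f x + g x)" for k
    using assms unfolding test_function_iff by (intro C_k_add) blast+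
  ultimately show ?thesis
    unfolding test_function_iff by blast
qed

lemma test_function_scale:
  assumes "test_function f" shows "test_function (\<lambda>x. c * f x)"
proof -
  have "{x. c * f x \<noteq> 0} \<subseteq> {x. f x \<noteq> 0}" by auto
  then have "bounded {x. c * f x \<noteq> 0}"
    using assms bounded_subset unfolding test_function_iff by blast
  moreover have "C_k k (\<lambda>x. c * f x)" for k
    using assms unfolding test_function_iff by (intro C_k_mult[OF C_k_const]) blast
  ultimately show ?thesis
    unfolding test_function_iff by blast
qed

lemma test_function_0: "test_function (\<lambda>x. 0)"
  by (simp add: test_function_iff C_k_const)

lemma test_function_shift:
  assumes "test_function f" shows "test_function (\<lambda>x. f (x + a))"
proof -
  have "{x. f (x + a) \<noteq> 0} = (\<lambda>x. - a + x) ` {x. f x \<noteq> 0}"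
    by (auto intro!: image_eqI[where x="_ + a"])
  then have "bounded {x. f (x + a) \<noteq> 0}"
    using assms bounded_translation[of "{x. f x \<noteq> 0}" "- a"] unfolding test_function_iff by metis
  with assms show ?thesis
    unfolding test_function_iff by (simp add: C_k_shift)
qed

lemma test_function_continuous: "test_function \<psi> \<Longrightarrow> continuous_on UNIV \<psi>"
  using C_k_continuous[of 0 \<psi>] by (simp add: test_function_def)

lemma test_function_partial: "test_function \<psi> \<Longrightarrow> has_partial_deriv i \<psi> x"
  unfolding test_function_def using C_k.simps(2) by blast

lemma test_function_supp:
  assumes "test_function \<psi>"
  obtains r where "r > 0" "\<And>x. \<psi> x \<noteq> 0 \<Longrightarrow> norm x < r"
  using assms unfolding test_function_iff bounded_pos_less by auto

lemma test_function_partial_deriv: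
  assumes "test_function \<psi>" shows "test_function (partial_deriv i \<psi>)"
proof -
  obtain r where r: "r > 0" "\<And>x. \<psi> x \<noteq> 0 \<Longrightarrow> norm x < r" using test_function_supp[OF assms] by blast
  have "norm x \<le> r" if "partial_deriv i \<psi> x \<noteq> 0" for x
  proof (rule ccontr)
    assume "\<not> norm x \<le> r"
    then have x: "x \<in> - cball 0 r" by simp
    have "eventually (\<lambda>h. x + h *\<^sub>R axis i 1 \<in> - cball 0 r) (nhds 0)"
    proof (rule topological_tendstoD)
      show "((\<lambda>h. x + h *\<^sub>R axis i 1) \<longlongrightarrow> x + 0 *\<^sub>R axis i 1) (nhds 0)" by (intro tendsto_intros) (simp add: filterlim_ident)
    qed (use x in auto)
    then have ev: "eventually (\<lambda>h. \<psi> (x + h *\<^sub>R axis i 1) = 0) (nhds 0)"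
      by eventually_elim (use r(2) in force)
    have "eventually (\<lambda>h. h \<in> UNIV \<longrightarrow> \<psi> (x + h *\<^sub>R axis i 1) = 0) (nhds 0)" using ev by simp
    from has_vector_derivative_cong_ev[OF this eventually_nhds_x_imp_x[OF ev], of 0]
    have "((\<lambda>h. \<psi> (x + h *\<^sub>R axis i 1)) has_vector_derivative 0) (at 0)" by simp
    then show False using that partial_derivI(2) by blast
  qed
  then have "bounded {x. partial_deriv i \<psi> x \<noteq> 0}" unfolding bounded_iff by blast
  moreover have "C_k k (partial_deriv i \<psi>)" for k
    using assms C_k.simps(2)[of k \<psi>] unfolding test_function_def by blast
  ultimately show ?thesis by (simp add: test_function_iff)
qed

lemma square_integrable_dominated:
  assumes "f \<in> borel_measurable lebesgue" "square_integrable g" "\<And>x. \<bar>f x\<bar> \<le> \<bar>g x\<bar>"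
  shows "square_integrable f"
proof -
  have "(f x)\<^sup>2 \<le> (g x)\<^sup>2" for x using assms(3)[of x] by (simp add: abs_le_square_iff)
  then have "AE x in lebesgue. norm ((f x)\<^sup>2) \<le> norm ((g x)\<^sup>2)" by simp
  moreover have "(\<lambda>x. (f x)\<^sup>2) \<in> borel_measurable lebesgue" using assms(1) by measurable
  ultimately have "integrable lebesgue (\<lambda>x. (f x)\<^sup>2)"
    using assms(2) unfolding square_integrable_def
    by (metis Bochner_Integration.integrable_bound)
  with assms(1) show ?thesis by (simp add: square_integrable_def)
qed

lemma square_integrable_ball: "square_integrable (\<lambda>x::'a::euclidean_space. c * indicator (ball 0 r) x)"
  using square_integrable_scale[OF square_integrable_indicator[of UNIV r], of c] by simp

lemma borel_measurable_continuous_lebesgue: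
  "continuous_on UNIV f \<Longrightarrow> f \<in> borel_measurable (lebesgue :: 'a::euclidean_space measure)"
  by (intro measurable_completion) (simp add: borel_measurable_continuous_onI)

lemma continuous_bounded_supp:
  fixes f :: "'a::euclidean_space \<Rightarrow> real"
  assumes "continuous_on UNIV f" "bounded {x. f x \<noteq> 0}"
  obtains M r where "M > 0" "r > 0" "\<And>x. f x \<noteq> 0 \<Longrightarrow> norm x < r" "\<And>x. \<bar>f x\<bar> \<le> M"
    "\<And>x. \<bar>f x\<bar> \<le> M * indicator (ball 0 r) x"
proof -
  obtain r where r: "r > 0" "\<And>x. f x \<noteq> 0 \<Longrightarrow> norm x < r"
    using assms(2) unfolding bounded_pos_less by auto
  have "compact (f ` cball 0 r)"
    using assms(1) by (intro compact_continuous_image) (auto intro: continuous_on_subset)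
  from compact_imp_bounded[OF this] obtain M where "M > 0" "\<forall>y\<in>f ` cball 0 r. norm y \<le> M"
    unfolding bounded_pos by blast
  then have M: "M > 0" "\<And>x. norm x \<le> r \<Longrightarrow> \<bar>f x\<bar> \<le> M" by simp_all
  have "\<bar>f x\<bar> \<le> M * indicator (ball 0 r) x" for x
    using r(2)[of x] M(2)[of x] by (cases "f x = 0") (auto simp: indicator_def M(1) less_imp_le)
  moreover have "\<bar>f x\<bar> \<le> M" for x using r(2)[of x] M(2)[of x] M(1) by (cases "f x = 0") auto
  ultimately show ?thesis using that[OF M(1) r] by blast
qed

lemma square_integrable_continuous_supp:
  fixes f :: "'a::euclidean_space \<Rightarrow> real"
  assumes "continuous_on UNIV f" "bounded {x. f x \<noteq> 0}"
  shows "square_integrable f"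
proof -
  obtain M r where M: "M > 0" "r > 0" "\<And>x. \<bar>f x\<bar> \<le> M * indicator (ball 0 r) x"
    using continuous_bounded_supp[OF assms] by metis
  have "\<bar>f x\<bar> \<le> \<bar>M * indicator (ball 0 r) x\<bar>" for x
    using M(3)[of x] by simp
  with borel_measurable_continuous_lebesgue[OF assms(1)] square_integrable_ball[of M r]
  show ?thesis by (rule square_integrable_dominated)
qed

lemma square_integrable_test: "test_function \<psi> \<Longrightarrow> square_integrable \<psi>"
  using test_function_continuous by (auto simp: test_function_iff intro: square_integrable_continuous_supp)

definition test_l2 :: "(real^'n::finite) l2 set" where
  "test_l2 = abs_l2 ` {\<psi>. test_function \<psi>}"

lemma subspace_test_l2: "subspace test_l2"
proof (rule subspaceI)
  show "0 \<in> test_l2"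
    unfolding test_l2_def zero_l2.abs_eq using test_function_0 by (intro imageI) simp
next
  fix x y :: "(real^'n) l2" and c :: real
  assume "x \<in> test_l2"
  then obtain f where f: "test_function f" "x = abs_l2 f" unfolding test_l2_def by blast
  have "c *\<^sub>R x = abs_l2 (\<lambda>z. c * f z)"
    by (simp add: f(2) abs_l2_scale square_integrable_test f(1))
  then show "c *\<^sub>R x \<in> test_l2"
    unfolding test_l2_def using test_function_scale[OF f(1)] by blast
  assume "y \<in> test_l2"
  then obtain g where g: "test_function g" "y = abs_l2 g" unfolding test_l2_def by blast
  have "x + y = abs_l2 (\<lambda>z. f z + g z)"
    by (simp add: f g abs_l2_add square_integrable_test)
  then show "x + y \<in> test_l2"
    unfolding test_l2_def using test_function_add[OF f(1) g(1)] by blast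
qed

text \<open>
  Indicators of bounded open sets are monotone limits of the test functions
  \<open>1 - \<Prod>\<^sub>j (1 - \<beta>\<^sub>j)\<^sup>n\<close>, where the \<open>\<beta>\<^sub>j\<close> are bumps on boxes exhausting the set.
\<close>

lemma indicator_in_closure_test_l2:
  fixes S :: "(real^'n::finite) set"
  assumes "open S" "bounded S"
  shows "abs_l2 (indicator S) \<in> closure test_l2"
proof -
  obtain \<D> where D: "countable \<D>" "\<D> \<subseteq> Pow S" "\<And>X. X \<in> \<D> \<Longrightarrow> \<exists>a b. X = box a b" "\<Union>\<D> = S"
    using open_countable_Union_open_box[OF assms(1)] by blast
  show ?thesis
  proof (cases "\<D> = {}")
    case True
    then have "(indicator S :: real^'n \<Rightarrow> real) = (\<lambda>x. 0)" using D(4) by auto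
    then have "abs_l2 (indicator S) = (0 :: (real^'n) l2)" by (simp add: zero_l2.abs_eq)
    moreover have "(0 :: (real^'n) l2) \<in> closure test_l2"
      using subspace_0[OF subspace_test_l2] closure_subset by blast
    ultimately show ?thesis by simp
  next
    case False
    define X where "X = from_nat_into \<D>"
    have X: "X j \<in> \<D>" for j using False by (simp add: X_def from_nat_into)
    have UX: "(\<Union>j. X j) = S" using D(1,4) False by (auto simp: X_def)
    have "\<forall>j. \<exists>a b. X j = box a b" using D(3)[OF X] by blast
    then obtain a b where ab: "\<And>j. X j = box (a j) (b j)" by metis
    define \<rho> where "\<rho> n x = 1 - (\<Prod>j<n. (1 - box_bump (a j) (b j) x)) ^ n" for n x
    have bb: "0 \<le> 1 - box_bump (a j) (b j) x" "1 - box_bump (a j) (b j) x \<le> 1" for j x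
      using box_bump(1,2)[of "a j" "b j" x] by simp_all
    have prod01: "0 \<le> (\<Prod>j<n. (1 - box_bump (a j) (b j) x))" "(\<Prod>j<n. (1 - box_bump (a j) (b j) x)) \<le> 1" for n x
      by (intro prod_nonneg ballI bb) (intro prod_le_1 conjI bb)
    have \<rho>01: "0 \<le> \<rho> n x" "\<rho> n x \<le> 1" for n x
      using power_le_one[OF prod01[of x n], of n] zero_le_power[OF prod01(1)[of x n], of n]
      by (simp_all add: \<rho>_def)
    have \<rho>0: "\<rho> n x = 0" if "x \<notin> S" for n x
    proof -
      have "box_bump (a j) (b j) x = 0" for j
      proof -
        have "x \<notin> X j" using that UX by blast
        then show ?thesis using ab[of j] box_bump(3)[of "a j" "b j" x] by metis
      qed
      then show ?thesis by (simp add: \<rho>_def)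
    qed
    have test: "test_function (\<rho> n)" for n
    proof -
      have "C_k k (\<lambda>x. 1 - box_bump (a j) (b j) x)" for k j
        by (rule C_k_diff[OF C_k_const C_k_box_bump])
      then have "C_k k (\<lambda>x. \<Prod>j<n. 1 - box_bump (a j) (b j) x)" for k
        by (rule C_k_prod)
      then have "C_k k (\<lambda>x. 1 - (\<Prod>j<n. 1 - box_bump (a j) (b j) x) ^ n)" for k
        by (rule C_k_diff[OF C_k_const C_k_power])
      then have "C_k k (\<rho> n)" for k by (simp add: \<rho>_def[abs_def])
      moreover have "bounded {x. \<rho> n x \<noteq> 0}" using \<rho>0 by (intro bounded_subset[OF assms(2)]) auto
      ultimately show ?thesis by (simp add: test_function_iff)
    qed
    have lim: "(\<lambda>n. \<rho> n x) \<longlonglongrightarrow> indicator S x" for x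
    proof (cases "x \<in> S")
      case True
      then obtain m where m: "x \<in> X m" using UX by blast
      define q where "q = 1 - box_bump (a m) (b m) x"
      have q: "0 \<le> q" "q < 1"
      proof -
        have "box_bump (a m) (b m) x \<noteq> 0" using m ab[of m] box_bump(3)[of "a m" "b m" x] by metis
        then show "0 \<le> q" "q < 1"
          using box_bump(1,2)[of "a m" "b m" x] by (simp_all add: q_def)
      qed
      have "(\<lambda>n. (\<Prod>j<n. (1 - box_bump (a j) (b j) x)) ^ n) \<longlonglongrightarrow> 0"
      proof (rule tendsto_sandwich[OF _ _ tendsto_const LIMSEQ_realpow_zero[OF q]])
        show "\<forall>\<^sub>F n in sequentially. 0 \<le> (\<Prod>j<n. (1 - box_bump (a j) (b j) x)) ^ n"
          using prod01 by auto
        show "\<forall>\<^sub>F n in sequentially. (\<Prod>j<n. (1 - box_bump (a j) (b j) x)) ^ n \<le> q ^ n"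
        \<comment> \<open>From n = m + 1 on the product contains the factor q < 1 that belongs to a
          box around x, and all other factors are at most 1.\<close>
        proof (rule eventually_sequentiallyI[of "Suc m"])
          fix n assume n: "n \<ge> Suc m"
          have "(\<Prod>j<n. (1 - box_bump (a j) (b j) x)) = q * (\<Prod>j\<in>{..<n} - {m}. (1 - box_bump (a j) (b j) x))"
            unfolding q_def using n by (intro prod.remove) auto
          also have "\<dots> \<le> q"
            by (intro mult_left_le prod_le_1 conjI bb q(1))
          finally show "(\<Prod>j<n. (1 - box_bump (a j) (b j) x)) ^ n \<le> q ^ n"
            using prod01 by (intro power_mono) auto
        qed
      qed
      then have "(\<lambda>n. 1 - (\<Prod>j<n. (1 - box_bump (a j) (b j) x)) ^ n) \<longlonglongrightarrow> 1 - 0"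
        by (intro tendsto_intros)
      then show ?thesis using True by (simp add: \<rho>_def)
    qed (use \<rho>0 in simp)
    obtain r where r: "S \<subseteq> ball 0 r" using bounded_subset_ballD[OF assms(2)] by blast
    have "(\<lambda>n. abs_l2 (\<rho> n)) \<longlonglongrightarrow> abs_l2 (indicator S)"
    proof (rule abs_l2_dominated_tendsto[OF square_integrable_test[OF test] _ square_integrable_ball[of 1 r] _ lim])
      show "square_integrable (indicator S :: real^'n \<Rightarrow> real)"
        using assms(1) square_integrable_indicator[of S r] r by (simp add: Int_absorb2)
      show "\<bar>\<rho> n x\<bar> \<le> 1 * indicator (ball 0 r) x" for n x
        using \<rho>01[of n x] \<rho>0[of x n] r by (cases "x \<in> S") auto
    qed
    then show ?thesis
      unfolding closure_sequential using test by (intro exI[of _ "\<lambda>n. abs_l2 (\<rho> n)"]) (auto simp: test_l2_def)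
  qed
qed

text \<open>Open sets form an intersection-stable generator of the Borel sets and the closure of a
  subspace is a subspace, so \<open>l2_dense_aux\<close> asks only for indicators of bounded open
  sets.\<close>

lemma closure_test_l2: "closure test_l2 = (UNIV :: (real^'n::finite) l2 set)"
proof (rule l2_dense_aux)
  show "Int_stable {S :: (real^'n) set. open S}" by (auto simp: Int_stable_def)
  show "sets borel = sigma_sets UNIV {S :: (real^'n) set. open S}"
    by (simp add: borel_def sets_measure_of)
  show "subspace (closure test_l2 :: (real^'n) l2 set)"
    using subspace_test_l2
    by (intro subspace_closure_rational_span) (auto intro: subspace_0 subspace_add subspace_scale)
  show "abs_l2 (indicator (A \<inter> ball 0 (real k))) \<in> closure test_l2" if "A \<in> {S. open S}"
    for A :: "(real^'n) set" and k
    using that by (intro indicator_in_closure_test_l2) (auto intro: bounded_subset[OF bounded_ball])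
qed auto

lemma l2_dense_induct:
  fixes u :: "(real^'n::finite) l2"
  assumes "\<And>\<psi>. test_function \<psi> \<Longrightarrow> P (abs_l2 \<psi>)" "closed {u. P u}"
  shows "P u"
proof -
  have "closure test_l2 \<subseteq> {u. P u}"
    using assms by (intro closure_minimal) (auto simp: test_l2_def)
  then show ?thesis using closure_test_l2 by auto
qed

lemma l2_eqI_test:
  fixes u v :: "(real^'n::finite) l2"
  assumes "\<And>\<psi>. test_function \<psi> \<Longrightarrow> inner u (abs_l2 \<psi>) = inner v (abs_l2 \<psi>)"
  shows "u = v"
proof -
  have "inner (u - v) w = 0" for w
  proof (rule l2_dense_induct[of _ w])
    show "inner (u - v) (abs_l2 \<psi>) = 0" if "test_function \<psi>" for \<psi>
      using assms[OF that] by (simp add: inner_diff_left)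
    show "closed {w. inner (u - v) w = 0}"
      by (intro closed_Collect_eq continuous_intros)
  qed
  from this[of "u - v"] show ?thesis by simp
qed

lemma norm_l2_le_test:
  fixes u :: "(real^'n::finite) l2"
  assumes "\<And>\<psi>. test_function \<psi> \<Longrightarrow> \<bar>inner u (abs_l2 \<psi>)\<bar> \<le> c * norm (abs_l2 \<psi>)"
    and "0 \<le> c"
  shows "norm u \<le> c"
proof -
  have "\<bar>inner u w\<bar> \<le> c * norm w" for w
  proof (rule l2_dense_induct[of _ w])
    show "closed {w. \<bar>inner u w\<bar> \<le> c * norm w}"
      by (intro closed_Collect_le continuous_intros)
  qed (rule assms(1))
  from this[of u] have "norm u * norm u \<le> c * norm u"
    by (simp add: power2_norm_eq_inner[symmetric] power2_eq_square)
  then show ?thesis using assms(2) by (cases "u = 0") auto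
qed

subsection \<open>Translations and weak derivatives\<close>

text \<open>The three-epsilon argument. The Lipschitz constant common to all \<open>A n\<close> is
  what carries convergence from a dense set to the whole space.\<close>

lemma closed_strong_convergence:
  fixes A :: "nat \<Rightarrow> 'a::real_normed_vector \<Rightarrow> 'b::real_normed_vector"
  assumes "\<And>n u v. norm (A n u - A n v) \<le> M * norm (u - v)"
    and "\<And>u v. norm (B u - B v) \<le> M * norm (u - v)"
  shows "closed {u. (\<lambda>n. A n u) \<longlonglongrightarrow> B u}"
  unfolding closed_sequential_limits
proof (intro allI impI, elim conjE)
  fix X u assume X: "\<forall>k. X k \<in> {u. (\<lambda>n. A n u) \<longlonglongrightarrow> B u}" "X \<longlonglongrightarrow> u"
  have "(\<lambda>n. A n u) \<longlonglongrightarrow> B u"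
  proof (rule LIMSEQ_I)
    fix e :: real assume e: "e > 0"
    \<comment> \<open>M is not known to be positive, hence the denominator
      \<open>\<bar>M\<bar> + 1\<close>.\<close>
    have "e / (3 * (\<bar>M\<bar> + 1)) > 0" using e by simp
    from LIMSEQ_D[OF X(2) this] obtain k where k: "norm (X k - u) < e / (3 * (\<bar>M\<bar> + 1))" by blast
    have "M * norm (X k - u) \<le> (\<bar>M\<bar> + 1) * norm (X k - u)" by (intro mult_right_mono) auto
    also have "\<dots> < e / 3" using k by (simp add: field_simps)
    finally have Mk: "M * norm (X k - u) < e / 3" .
    have "(\<lambda>n. A n (X k)) \<longlonglongrightarrow> B (X k)" using X(1) by simp
    from LIMSEQ_D[OF this, of "e / 3"] e
    obtain N where N: "\<And>n. n \<ge> N \<Longrightarrow> norm (A n (X k) - B (X k)) < e / 3" by auto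
    have "norm (A n u - B u) < e" if "n \<ge> N" for n
    proof -
      have "norm (A n u - B u) \<le> norm (A n u - A n (X k)) + norm (A n (X k) - B (X k)) + norm (B (X k) - B u)"
        using norm_triangle_ineq[of "A n u - A n (X k)" "A n (X k) - B u"]
          norm_triangle_ineq[of "A n (X k) - B (X k)" "B (X k) - B u"] by simp
      moreover have "norm (A n u - A n (X k)) < e / 3"
        using assms(1)[of n u "X k"] Mk by (simp add: norm_minus_commute)
      moreover have "norm (B (X k) - B u) < e / 3" using assms(2)[of "X k" u] Mk by simp
      ultimately show ?thesis using N[OF that] by linarith
    qed
    then show "\<exists>N. \<forall>n\<ge>N. norm (A n u - B u) < e" by blast
  qed
  then show "u \<in> {u. (\<lambda>n. A n u) \<longlonglongrightarrow> B u}" by simp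
qed

text \<open>For a test function the bound R on the displacements keeps all compositions supported in
  one ball of radius r + R, so dominated convergence applies; the common constant C then gives all
  of \<open>l2\<close> by density. Both continuity of translations and continuity of the evolution
  operators in time are instances.\<close>

lemma comp_l2_tendsto:
  fixes \<Psi> :: "nat \<Rightarrow> real^'n::finite \<Rightarrow> real^'n"
  assumes ns: "\<And>n. nonsingular C (\<Psi> n)" "nonsingular C \<Theta>"
    and R: "\<And>n x. norm (\<Psi> n x - x) \<le> R"
    and lim: "\<And>x. (\<lambda>n. \<Psi> n x) \<longlonglongrightarrow> \<Theta> x"
  shows "(\<lambda>n. comp_l2 (\<Psi> n) u) \<longlonglongrightarrow> comp_l2 \<Theta> u"
proof (rule l2_dense_induct[of _ u])
  have le: "norm (comp_l2 \<Psi>' u - comp_l2 \<Psi>' v) \<le> sqrt C * norm (u - v)" if "nonsingular C \<Psi>'"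
    for \<Psi>' and u v :: "(real^'n) l2"
    using norm_comp_l2_le[OF that, of "u - v"] bounded_linear.linear[OF bounded_linear_comp_l2[OF that]]
    by (simp add: linear_diff)
  show "closed {u. (\<lambda>n. comp_l2 (\<Psi> n) u) \<longlonglongrightarrow> comp_l2 \<Theta> u}"
    by (rule closed_strong_convergence[OF le[OF ns(1)] le[OF ns(2)]])
next
  fix \<psi> :: "real^'n \<Rightarrow> real" assume \<psi>: "test_function \<psi>"
  have cont: "continuous_on UNIV \<psi>" using test_function_continuous[OF \<psi>] .
  obtain M r where M: "M > 0" "\<And>x. \<bar>\<psi> x\<bar> \<le> M * indicator (ball 0 r) x"
    using continuous_bounded_supp[OF cont] \<psi> unfolding test_function_iff by metis
  have "(\<lambda>n. abs_l2 (\<lambda>x. \<psi> (\<Psi> n x))) \<longlonglongrightarrow> abs_l2 (\<lambda>x. \<psi> (\<Theta> x))"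
  proof (rule abs_l2_dominated_tendsto[where w = "\<lambda>x. M * indicator (ball 0 (r + R)) x"])
    show "square_integrable (\<lambda>x. \<psi> (\<Psi> n x))" for n
      using nonsingular_square_integrable(1)[OF ns(1) square_integrable_test[OF \<psi>]] .
    show "square_integrable (\<lambda>x. \<psi> (\<Theta> x))"
      using nonsingular_square_integrable(1)[OF ns(2) square_integrable_test[OF \<psi>]] .
    show "\<bar>\<psi> (\<Psi> n x)\<bar> \<le> M * indicator (ball 0 (r + R)) x" for n x
    proof (cases "norm x < r + R")
      case True
      have "M * indicator (ball 0 r) (\<Psi> n x) \<le> M" using M(1) by (simp add: indicator_def)
      then show ?thesis using True M(2)[of "\<Psi> n x"] by (simp add: indicator_def)
    next
      case False
      have "norm x \<le> norm (\<Psi> n x) + norm (\<Psi> n x - x)"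
        using norm_triangle_ineq4[of "\<Psi> n x" "\<Psi> n x - x"] by simp
      then have "\<not> norm (\<Psi> n x) < r" using R[of n x] False by linarith
      then show ?thesis using M(2)[of "\<Psi> n x"] False by (simp add: indicator_def)
    qed
    show "(\<lambda>n. \<psi> (\<Psi> n x)) \<longlonglongrightarrow> \<psi> (\<Theta> x)" for x
      using cont lim[of x] by (simp add: continuous_on_tendsto_compose[of UNIV \<psi>])
  qed (rule square_integrable_ball)
  then show "(\<lambda>n. comp_l2 (\<Psi> n) (abs_l2 \<psi>)) \<longlonglongrightarrow> comp_l2 \<Theta> (abs_l2 \<psi>)"
    by (simp add: comp_abs_l2[OF ns(1)] comp_abs_l2[OF ns(2)] square_integrable_test \<psi>)
qed

section \<open>Translations as isometries of \<open>l2\<close>\<close>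

definition shift_l2 :: "'a::euclidean_space \<Rightarrow> 'a l2 \<Rightarrow> 'a l2" where
  "shift_l2 a = comp_l2 (\<lambda>x. x + a)"

lemma nonsingular_translation: "nonsingular 1 (\<lambda>x. x + a)"
proof -
  have "emeasure lborel ((\<lambda>x. x + a) -` A) = emeasure lborel A" if "A \<in> sets borel" for A
  proof -
    have "emeasure lborel A = emeasure (distr lborel borel ((+) a)) A" by (simp add: lborel_distr_plus)
    also have "\<dots> = emeasure lborel ((+) a -` A)" using that by (subst emeasure_distr) auto
    finally show ?thesis by (simp add: add.commute[of _ a])
  qed
  then show ?thesis by (simp add: nonsingular_def)
qed

lemma shift_abs_l2: "square_integrable f \<Longrightarrow> shift_l2 a (abs_l2 f) = abs_l2 (\<lambda>x. f (x + a))"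
  unfolding shift_l2_def by (rule comp_abs_l2[OF nonsingular_translation])

lemma square_integrable_shift: "square_integrable f \<Longrightarrow> square_integrable (\<lambda>x. f (x + a))"
  by (rule nonsingular_square_integrable(1)[OF nonsingular_translation])

lemma bounded_linear_shift_l2: "bounded_linear (shift_l2 a)"
  unfolding shift_l2_def by (rule bounded_linear_comp_l2[OF nonsingular_translation])

lemmas shift_l2_simps = linear_add[OF bounded_linear.linear[OF bounded_linear_shift_l2]]
  linear_diff[OF bounded_linear.linear[OF bounded_linear_shift_l2]]
  linear_cmul[OF bounded_linear.linear[OF bounded_linear_shift_l2]]
  linear_0[OF bounded_linear.linear[OF bounded_linear_shift_l2]]

lemma shift_shift_l2: "shift_l2 a (shift_l2 b u) = shift_l2 (a + b) u"
  unfolding shift_l2_def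
  by (subst comp_l2_compose[OF nonsingular_translation nonsingular_translation]) (simp add: add.assoc)

lemma shift_l2_0 [simp]: "shift_l2 0 u = u"
  by (simp add: shift_l2_def comp_l2_id)

lemma norm_shift_l2 [simp]: "norm (shift_l2 a u) = norm u"
proof -
  have "norm (shift_l2 a u) \<le> norm u" for a and u :: "'a l2"
    using norm_comp_l2_le[OF nonsingular_translation[of a], of u] by (simp add: shift_l2_def)
  from this[of a u] this[of "- a" "shift_l2 a u"] show ?thesis by (simp add: shift_shift_l2)
qed

text \<open>By polarization an isometry preserves inner products, and the inverse of the translation
  by a is the translation by -a.\<close>

lemma inner_shift_l2: "inner (shift_l2 a u) v = inner u (shift_l2 (- a) v)"
proof -
  have "inner (shift_l2 a u) (shift_l2 a w) = inner u w" for w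
    by (simp add: dot_norm shift_l2_simps(1)[symmetric])
  from this[of "shift_l2 (- a) v"] show ?thesis by (simp add: shift_shift_l2)
qed

lemma continuous_shift_l2: "continuous_on UNIV (\<lambda>a::real^'n::finite. shift_l2 a u)"
  unfolding continuous_on_sequentially
proof (intro ballI allI impI, elim conjE)
  fix X :: "nat \<Rightarrow> real^'n" and a assume X: "X \<longlonglongrightarrow> a"
  obtain R where R: "\<And>n. norm (X n) \<le> R"
    using convergent_imp_Bseq[of X] X by (auto simp: convergent_def Bseq_def)
  have "(\<lambda>n. comp_l2 (\<lambda>x. x + X n) u) \<longlonglongrightarrow> comp_l2 (\<lambda>x. x + a) u"
    using X by (intro comp_l2_tendsto[OF nonsingular_translation nonsingular_translation, where R=R])
      (auto simp: R intro!: tendsto_intros)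
  then show "((\<lambda>a. shift_l2 a u) \<circ> X) \<longlonglongrightarrow> shift_l2 a u"
    by (simp add: shift_l2_def o_def)
qed

lemma tendsto_shift_l2:
  fixes a :: "real^'n::finite"
  shows "(g \<longlongrightarrow> a) F \<Longrightarrow> ((\<lambda>x. shift_l2 (g x) u) \<longlongrightarrow> shift_l2 a u) F"
  using continuous_on_tendsto_compose[OF continuous_shift_l2, of g a F] by simp

text \<open>The strong derivative along the translation group. It agrees with the weak derivative
  (\<open>is_weak_deriv_iff\<close>); as a limit of difference quotients in norm it gives product
  rules and measurability in time directly.\<close>

definition l2_deriv :: "'n::finite \<Rightarrow> (real^'n) l2 \<Rightarrow> (real^'n) l2 \<Rightarrow> bool" where
  "l2_deriv i u w \<longleftrightarrow> ((\<lambda>h. shift_l2 (h *\<^sub>R axis i 1) u) has_vector_derivative w) (at 0)"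

lemma has_vector_derivative_at_0_iff:
  fixes F :: "real \<Rightarrow> 'a::real_normed_vector"
  shows "(F has_vector_derivative w) (at 0) \<longleftrightarrow> ((\<lambda>h. (F h - F 0) /\<^sub>R h) \<longlongrightarrow> w) (at 0)"
proof -
  have "norm (F h - F 0 - h *\<^sub>R w) / norm h = norm ((F h - F 0) /\<^sub>R h - w)" if "h \<noteq> 0" for h
  proof -
    have "(F h - F 0) /\<^sub>R h - w = (F h - F 0 - h *\<^sub>R w) /\<^sub>R h"
      using that by (simp add: scaleR_diff_right)
    then show ?thesis by (simp add: divide_inverse mult.commute)
  qed
  then have "((\<lambda>h. norm (F h - F 0 - h *\<^sub>R w) / norm h) \<longlongrightarrow> 0) (at 0) \<longleftrightarrow>
      ((\<lambda>h. norm ((F h - F 0) /\<^sub>R h - w)) \<longlongrightarrow> 0) (at 0)"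
    by (intro filterlim_cong refl) (auto simp: eventually_at_filter)
  then show ?thesis
    unfolding has_vector_derivative_def has_derivative_at
    by (simp add: bounded_linear_scaleR_left tendsto_norm_zero_iff LIM_zero_iff)
qed

lemma l2_deriv_iff:
  "l2_deriv i u w \<longleftrightarrow> ((\<lambda>h. (shift_l2 (h *\<^sub>R axis i 1) u - u) /\<^sub>R h) \<longlongrightarrow> w) (at 0)"
  by (simp add: l2_deriv_def has_vector_derivative_at_0_iff)

lemma l2_deriv_at:
  assumes "l2_deriv i u w"
  shows "((\<lambda>h. shift_l2 (h *\<^sub>R axis i 1) u) has_vector_derivative shift_l2 (t *\<^sub>R axis i 1) w) (at t)"
proof -
  have "((\<lambda>h. shift_l2 (t *\<^sub>R axis i 1) (shift_l2 (h *\<^sub>R axis i 1) u)) has_vector_derivative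
      shift_l2 (t *\<^sub>R axis i 1) w) (at (t - t))"
    using bounded_linear.has_vector_derivative[OF bounded_linear_shift_l2 assms[unfolded l2_deriv_def]] by simp
  then have "((\<lambda>h. shift_l2 (t *\<^sub>R axis i 1) (shift_l2 (h *\<^sub>R axis i 1) u)) \<circ> (\<lambda>s. s - t)
      has_vector_derivative 1 *\<^sub>R shift_l2 (t *\<^sub>R axis i 1) w) (at t)"
    by (intro vector_diff_chain_at) (auto intro!: derivative_eq_intros)
  then show ?thesis by (simp add: o_def shift_shift_l2 flip: scaleR_add_left)
qed

text \<open>The function h \<mapsto> inner (shift u by h) v, equal to inner u (shift v by -h), is
  differentiated at 0 in both forms.\<close>

lemma l2_deriv_by_parts:
  assumes "l2_deriv i u w" "l2_deriv i v z"
  shows "inner w v = - inner u z"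
proof -
  have 1: "((\<lambda>h. inner (shift_l2 (h *\<^sub>R axis i 1) u) v) has_real_derivative inner w v) (at 0)"
    using bounded_linear.has_vector_derivative[OF bounded_linear_inner_left assms(1)[unfolded l2_deriv_def]]
    by (simp add: has_real_derivative_iff_has_vector_derivative)
  have "((\<lambda>h. inner u (shift_l2 (h *\<^sub>R axis i 1) v)) has_real_derivative inner u z) (at (- 0))"
    using bounded_linear.has_vector_derivative[OF bounded_linear_inner_right assms(2)[unfolded l2_deriv_def]]
    by (simp add: has_real_derivative_iff_has_vector_derivative)
  from DERIV_chain2[OF this DERIV_minus[OF DERIV_ident]]
  have 2: "((\<lambda>h. inner (shift_l2 (h *\<^sub>R axis i 1) u) v) has_real_derivative - inner u z) (at 0)"
    by (simp add: inner_shift_l2)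
  show ?thesis using DERIV_unique[OF 1 2] .
qed

text \<open>The Lipschitz bound dominates the difference quotients, and for \<bar>h\<bar> \<le> 1
  they are all supported in the ball of radius r + 1, so pointwise convergence becomes convergence
  in \<open>l2\<close>.\<close>

lemma l2_deriv_pointwise:
  fixes k :: "real^'n::finite \<Rightarrow> real"
  assumes k: "continuous_on UNIV k" "bounded {x. k x \<noteq> 0}"
    and lip: "\<And>x h. \<bar>k (x + h *\<^sub>R axis i 1) - k x\<bar> \<le> L * \<bar>h\<bar>"
    and pd: "\<And>x. has_partial_deriv i k x"
  shows "square_integrable (partial_deriv i k)" "l2_deriv i (abs_l2 k) (abs_l2 (partial_deriv i k))"
proof -
  have sk: "square_integrable k" using k by (rule square_integrable_continuous_supp)
  have L: "L \<ge> 0" using lip[of 0 1] by simp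
  obtain r where r: "r > 0" "\<And>x. k x \<noteq> 0 \<Longrightarrow> norm x < r"
    using k(2) unfolding bounded_pos_less by auto
  define q where "q h x = (k (x + h *\<^sub>R axis i 1) - k x) / h" for h x
  have sq: "square_integrable (q h)" for h
    using square_integrable_scale[OF square_integrable_diff[OF square_integrable_shift[OF sk] sk], of "1 / h" "h *\<^sub>R axis i 1"]
    by (simp add: q_def[abs_def])
  have qb: "\<bar>q h x\<bar> \<le> L * indicator (ball 0 (r + 1)) x" if "\<bar>h\<bar> \<le> 1" for h x
  proof (cases "norm x < r + 1")
    case True
    then show ?thesis using lip[of x h] L
      by (cases "h = 0") (auto simp: q_def abs_divide indicator_def pos_divide_le_eq)
  next
    case False
    have "norm x \<le> norm (x + h *\<^sub>R axis i 1) + norm (h *\<^sub>R axis i (1::real))"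
      using norm_triangle_ineq4[of "x + h *\<^sub>R axis i 1" "h *\<^sub>R axis i (1::real)"] by simp
    also have "norm (h *\<^sub>R axis i (1::real)) \<le> 1" using that by (simp add: norm_axis_1)
    finally have "\<not> norm (x + h *\<^sub>R axis i 1) < r" using False by linarith
    then have "k (x + h *\<^sub>R axis i 1) = 0" "k x = 0" using r(2)[of x] r(2)[of "x + h *\<^sub>R axis i 1"] False by auto
    then show ?thesis using L by (simp add: q_def indicator_def)
  qed
  have ql: "((\<lambda>h. q h x) \<longlongrightarrow> partial_deriv i k x) (at 0)" for x
    using partial_derivD[OF pd[of x]] unfolding has_vector_derivative_at_0_iff
    by (simp add: q_def divide_inverse mult.commute)
  have qs: "(\<lambda>n. q (H n) x) \<longlonglongrightarrow> partial_deriv i k x" if "\<And>n. H n \<noteq> 0" "H \<longlonglongrightarrow> 0" for H :: "nat \<Rightarrow> real" and x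
    using ql[of x] that unfolding tendsto_at_iff_sequentially by (auto simp: o_def)
  have pdm: "partial_deriv i k \<in> borel_measurable lebesgue"
  proof (rule borel_measurable_LIMSEQ_real[of _ "\<lambda>n. q (inverse (real (Suc n)))"])
    show "(\<lambda>n. q (inverse (real (Suc n))) x) \<longlonglongrightarrow> partial_deriv i k x" for x
      using qs[of "\<lambda>n. inverse (real (Suc n))"] LIMSEQ_inverse_real_of_nat by simp
  qed (use sq in \<open>simp add: square_integrable_def\<close>)
  have "\<bar>partial_deriv i k x\<bar> \<le> L * indicator (ball 0 (r + 1)) x" for x
  proof (rule LIMSEQ_le_const2)
    show "(\<lambda>n. \<bar>q (inverse (real (Suc n))) x\<bar>) \<longlonglongrightarrow> \<bar>partial_deriv i k x\<bar>"
      using qs[of "\<lambda>n. inverse (real (Suc n))"] LIMSEQ_inverse_real_of_nat by (intro tendsto_rabs) simp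
    show "\<exists>N. \<forall>n\<ge>N. \<bar>q (inverse (real (Suc n))) x\<bar> \<le> L * indicator (ball 0 (r + 1)) x"
      using qb by (auto simp: field_simps)
  qed
  then show spd: "square_integrable (partial_deriv i k)"
    using L by (intro square_integrable_dominated[OF pdm square_integrable_ball[of L "r + 1"]]) auto
  have "((\<lambda>h. abs_l2 (q h)) \<longlongrightarrow> abs_l2 (partial_deriv i k)) (at 0)"
    unfolding tendsto_at_iff_sequentially
  proof (intro allI impI)
    fix H :: "nat \<Rightarrow> real" assume H: "\<forall>n. H n \<in> UNIV - {0}" "H \<longlonglongrightarrow> 0"
    have "\<forall>\<^sub>F n in sequentially. \<bar>H n\<bar> < 1"
      using order_tendstoD(2)[OF tendsto_rabs[OF H(2)], of 1] by simp
    then obtain N where N: "\<And>n. n \<ge> N \<Longrightarrow> \<bar>H n\<bar> < 1" unfolding eventually_sequentially by blast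
    have "(\<lambda>n. abs_l2 (q (H (n + N)))) \<longlonglongrightarrow> abs_l2 (partial_deriv i k)"
    proof (rule abs_l2_dominated_tendsto[OF sq spd square_integrable_ball[of L "r + 1"]])
      show "\<bar>q (H (n + N)) x\<bar> \<le> L * indicator (ball 0 (r + 1)) x" for n x
        using N[of "n + N"] by (intro qb) simp
      show "(\<lambda>n. q (H (n + N)) x) \<longlonglongrightarrow> partial_deriv i k x" for x
        using H LIMSEQ_ignore_initial_segment[OF H(2), of N] by (intro qs) auto
    qed
    then show "((\<lambda>h. abs_l2 (q h)) \<circ> H) \<longlonglongrightarrow> abs_l2 (partial_deriv i k)"
      unfolding o_def by (rule LIMSEQ_offset)
  qed
  moreover have "abs_l2 (q h) = (shift_l2 (h *\<^sub>R axis i 1) (abs_l2 k) - abs_l2 k) /\<^sub>R h" for h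
    using sk by (simp add: shift_abs_l2 q_def[abs_def] divide_inverse mult.commute[of _ "inverse h"]
      abs_l2_scale square_integrable_diff square_integrable_shift flip: abs_l2_diff)
  ultimately show "l2_deriv i (abs_l2 k) (abs_l2 (partial_deriv i k))"
    by (simp add: l2_deriv_iff)
qed

lemma partial_lipschitz:
  fixes g :: "real^'n::finite \<Rightarrow> 'b::real_normed_vector"
  assumes "\<And>x. has_partial_deriv i g x" "\<And>x. norm (partial_deriv i g x) \<le> L"
  shows "norm (g (x + h *\<^sub>R axis i 1) - g x) \<le> L * \<bar>h\<bar>"
proof -
  have "norm ((\<lambda>t. g (x + t *\<^sub>R axis i 1)) h - (\<lambda>t. g (x + t *\<^sub>R axis i 1)) 0) \<le> L * norm (h - 0)"
  proof (rule differentiable_bound[where S = UNIV and f' = "\<lambda>t d. d *\<^sub>R partial_deriv i g (x + t *\<^sub>R axis i 1)"])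
    show "((\<lambda>t. g (x + t *\<^sub>R axis i 1)) has_derivative (\<lambda>d. d *\<^sub>R partial_deriv i g (x + t *\<^sub>R axis i 1))) (at t within UNIV)" for t
      using has_vector_derivative_partial_shift[OF assms(1)] by (simp add: has_vector_derivative_def)
    show "onorm (\<lambda>d. d *\<^sub>R partial_deriv i g (x + t *\<^sub>R axis i 1)) \<le> L" for t
      using assms(2) by (simp add: onorm_scaleR_left[OF bounded_linear_ident] onorm_id)
  qed auto
  then show ?thesis by simp
qed

lemma test_function_lipschitz:
  fixes \<psi> :: "real^'n::finite \<Rightarrow> real"
  assumes "test_function \<psi>"
  obtains L where "\<And>x h. \<bar>\<psi> (x + h *\<^sub>R axis i 1) - \<psi> x\<bar> \<le> L * \<bar>h\<bar>"
proof -
  have t: "test_function (partial_deriv i \<psi>)" using assms by (rule test_function_partial_deriv)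
  obtain M where "\<And>x. \<bar>partial_deriv i \<psi> x\<bar> \<le> M"
    using continuous_bounded_supp[OF test_function_continuous[OF t]] t unfolding test_function_iff by metis
  then have "\<bar>\<psi> (x + h *\<^sub>R axis i 1) - \<psi> x\<bar> \<le> M * \<bar>h\<bar>" for x h
    using partial_lipschitz[of i \<psi> M x h] test_function_partial[OF assms] by simp
  then show ?thesis by (rule that)
qed

lemma l2_deriv_test:
  assumes "test_function \<psi>"
  shows "l2_deriv i (abs_l2 \<psi>) (abs_l2 (partial_deriv i \<psi>))"
proof -
  obtain L where "\<And>x h. \<bar>\<psi> (x + h *\<^sub>R axis i 1) - \<psi> x\<bar> \<le> L * \<bar>h\<bar>"
    using test_function_lipschitz[OF assms] by blast
  then show ?thesis
    using assms test_function_continuous[OF assms] test_function_partial[OF assms]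
    by (intro l2_deriv_pointwise(2)) (simp_all add: test_function_iff)
qed

lemma is_weak_deriv_iff_inner:
  "is_weak_deriv i u w \<longleftrightarrow>
    (\<forall>\<psi>. test_function \<psi> \<longrightarrow> inner u (abs_l2 (partial_deriv i \<psi>)) = - inner w (abs_l2 \<psi>))"
proof -
  have "(LINT x|lebesgue. rep_l2 v x * \<psi> x) = inner v (abs_l2 \<psi>)" if "test_function \<psi>"
    for v and \<psi> :: "real^'a \<Rightarrow> real"
    using inner_abs_l2[OF square_integrable_rep_l2 square_integrable_test[OF that], of v]
    by (simp add: abs_rep_l2)
  then show ?thesis
    by (auto simp: is_weak_deriv_def test_function_partial_deriv)
qed

text \<open>Weak derivatives are strong. Paired with \<psi>, the first-order remainder of the
  translation of u by t is a scalar function of t whose derivative is the pairing of \<psi> with (w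
  translated by t) - w. The mean value inequality bounds the remainder by \<bar>h\<bar> times the
  oscillation of the translates of w, which tends to 0.\<close>

lemma weak_deriv_l2_deriv:
  assumes "is_weak_deriv i u w"
  shows "l2_deriv i u w"
proof -
  define e :: "real^'a" where "e = axis i 1"
  have weak: "inner u (abs_l2 (partial_deriv i \<psi>)) = - inner w (abs_l2 \<psi>)" if "test_function \<psi>" for \<psi>
    using assms that unfolding is_weak_deriv_iff_inner by blast
  have main: "norm (shift_l2 (h *\<^sub>R e) u - u - h *\<^sub>R w) \<le> B * \<bar>h\<bar>"
    if B: "\<And>t. \<bar>t\<bar> \<le> \<bar>h\<bar> \<Longrightarrow> norm (shift_l2 (t *\<^sub>R e) w - w) \<le> B" for h B
  proof (rule norm_l2_le_test)
    show "0 \<le> B * \<bar>h\<bar>" using B[of 0] by simp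
    fix \<psi> :: "real^'a \<Rightarrow> real" assume \<psi>: "test_function \<psi>"
    define p where "p t = inner (shift_l2 (t *\<^sub>R e) u - u - t *\<^sub>R w) (abs_l2 \<psi>)" for t
    have deriv: "(p has_field_derivative inner (shift_l2 (t *\<^sub>R e) w - w) (abs_l2 \<psi>)) (at t)" for t
    proof -
      \<comment> \<open>The weak identity is used for a translate of \<psi>, again a test function;
        this gives the derivative at every t and not only at 0.\<close>
      define \<psi>' where "\<psi>' x = \<psi> (x + (- t) *\<^sub>R e)" for x
      have \<psi>': "test_function \<psi>'" unfolding \<psi>'_def by (rule test_function_shift[OF \<psi>])
      have sh: "abs_l2 \<psi>' = shift_l2 ((- t) *\<^sub>R e) (abs_l2 \<psi>)"
        by (simp add: shift_abs_l2 square_integrable_test \<psi> \<psi>'_def[abs_def])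
      have "((\<lambda>h. shift_l2 (h *\<^sub>R e) (abs_l2 \<psi>)) has_vector_derivative shift_l2 ((- t) *\<^sub>R e) (abs_l2 (partial_deriv i \<psi>))) (at (- t))"
        using l2_deriv_at[OF l2_deriv_test[OF \<psi>]] unfolding e_def .
      moreover have "shift_l2 ((- t) *\<^sub>R e) (abs_l2 (partial_deriv i \<psi>)) = abs_l2 (partial_deriv i \<psi>')"
      proof -
        have "partial_deriv i \<psi>' = (\<lambda>x. partial_deriv i \<psi> (x + (- t) *\<^sub>R e))"
          unfolding \<psi>'_def[abs_def] by (rule ext) (rule partial_deriv_shift(1))
        then show ?thesis
          by (simp only: shift_abs_l2 square_integrable_test test_function_partial_deriv \<psi>)
      qed
      ultimately have "((\<lambda>h. shift_l2 (h *\<^sub>R e) (abs_l2 \<psi>)) has_vector_derivative abs_l2 (partial_deriv i \<psi>')) (at (- t))" by simp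
      from bounded_linear.has_vector_derivative[OF bounded_linear_inner_right[of u] this]
      have "((\<lambda>h. inner u (shift_l2 (h *\<^sub>R e) (abs_l2 \<psi>))) has_field_derivative - inner w (abs_l2 \<psi>')) (at (- t))"
        by (simp add: weak[OF \<psi>'] has_real_derivative_iff_has_vector_derivative)
      from DERIV_chain2[OF this DERIV_minus[OF DERIV_ident]]
      have "((\<lambda>h. inner (shift_l2 (h *\<^sub>R e) u) (abs_l2 \<psi>)) has_field_derivative inner (shift_l2 (t *\<^sub>R e) w) (abs_l2 \<psi>)) (at t)"
        by (simp add: inner_shift_l2 sh)
      then show ?thesis
        unfolding p_def inner_diff_left inner_scaleR_left
        by (auto intro!: derivative_eq_intros)
    qed
    have "norm (p h - p 0) \<le> (B * norm (abs_l2 \<psi>)) * norm (h - 0)"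
    proof (rule field_differentiable_bound[where S = "{- \<bar>h\<bar>..\<bar>h\<bar>}"])
      show "(p has_field_derivative inner (shift_l2 (t *\<^sub>R e) w - w) (abs_l2 \<psi>)) (at t within {- \<bar>h\<bar>..\<bar>h\<bar>})" for t
        using deriv by (rule has_field_derivative_at_within)
      show "norm (inner (shift_l2 (t *\<^sub>R e) w - w) (abs_l2 \<psi>)) \<le> B * norm (abs_l2 \<psi>)"
        if "t \<in> {- \<bar>h\<bar>..\<bar>h\<bar>}" for t
      proof -
        have "\<bar>t\<bar> \<le> \<bar>h\<bar>" using that by auto
        have "norm (inner (shift_l2 (t *\<^sub>R e) w - w) (abs_l2 \<psi>)) \<le> norm (shift_l2 (t *\<^sub>R e) w - w) * norm (abs_l2 \<psi>)"
          using Cauchy_Schwarz_ineq2 by simp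
        also have "\<dots> \<le> B * norm (abs_l2 \<psi>)" using B[OF \<open>\<bar>t\<bar> \<le> \<bar>h\<bar>\<close>] by (intro mult_right_mono) auto
        finally show ?thesis .
      qed
    qed auto
    then show "\<bar>inner (shift_l2 (h *\<^sub>R e) u - u - h *\<^sub>R w) (abs_l2 \<psi>)\<bar> \<le> B * \<bar>h\<bar> * norm (abs_l2 \<psi>)"
      by (simp add: p_def mult.commute mult.left_commute)
  qed
  show ?thesis
    unfolding l2_deriv_iff
  proof (rule LIM_I)
    fix \<epsilon> :: real assume \<epsilon>: "\<epsilon> > 0"
    have "((\<lambda>t. shift_l2 (t *\<^sub>R e) w) \<longlongrightarrow> shift_l2 (0 *\<^sub>R e) w) (at 0)"
      by (intro tendsto_shift_l2 tendsto_intros)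
    then have "((\<lambda>t. shift_l2 (t *\<^sub>R e) w) \<longlongrightarrow> w) (at 0)" by simp
    from LIM_D[OF this, of "\<epsilon> / 2"] \<epsilon>
    obtain d where d: "d > 0" "\<And>t. t \<noteq> 0 \<Longrightarrow> \<bar>t\<bar> < d \<Longrightarrow> norm (shift_l2 (t *\<^sub>R e) w - w) < \<epsilon> / 2" by auto
    have "norm ((shift_l2 (h *\<^sub>R axis i 1) u - u) /\<^sub>R h - w) < \<epsilon>" if h: "h \<noteq> 0" "\<bar>h\<bar> < d" for h
    proof -
      have "norm (shift_l2 (t *\<^sub>R e) w - w) \<le> \<epsilon> / 2" if "\<bar>t\<bar> \<le> \<bar>h\<bar>" for t
        using d(2)[of t] that h \<epsilon> by (cases "t = 0") auto
      from main[OF this] have m: "norm (shift_l2 (h *\<^sub>R e) u - u - h *\<^sub>R w) \<le> \<epsilon> / 2 * \<bar>h\<bar>" .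
      have "(shift_l2 (h *\<^sub>R axis i 1) u - u) /\<^sub>R h - w = (shift_l2 (h *\<^sub>R e) u - u - h *\<^sub>R w) /\<^sub>R h"
        using h(1) by (simp add: scaleR_diff_right e_def)
      then have "norm ((shift_l2 (h *\<^sub>R axis i 1) u - u) /\<^sub>R h - w) \<le> \<epsilon> / 2"
        using m h(1) by (simp add: divide_inverse[symmetric] pos_divide_le_eq mult.commute[of "inverse _"])
      then show ?thesis using \<epsilon> by simp
    qed
    then show "\<exists>s>0. \<forall>h. h \<noteq> 0 \<and> norm (h - 0) < s \<longrightarrow> norm ((shift_l2 (h *\<^sub>R axis i 1) u - u) /\<^sub>R h - w) < \<epsilon>"
      using d(1) by auto
  qed
qed

lemma is_weak_deriv_iff: "is_weak_deriv i u w \<longleftrightarrow> l2_deriv i u w"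
proof
  assume "l2_deriv i u w"
  then show "is_weak_deriv i u w"
    unfolding is_weak_deriv_iff_inner using l2_deriv_by_parts[OF _ l2_deriv_test] by fastforce
qed (rule weak_deriv_l2_deriv)

lemma l2_deriv_unique: "l2_deriv i u w \<Longrightarrow> l2_deriv i u w' \<Longrightarrow> w = w'"
  unfolding l2_deriv_def using vector_derivative_at by blast

lemma weak_deriv_eqI: "l2_deriv i u w \<Longrightarrow> weak_deriv i u = w"
  unfolding weak_deriv_def is_weak_deriv_iff by (rule the_equality) (auto dest: l2_deriv_unique)

lemma H1_iff: "u \<in> H1 \<longleftrightarrow> (\<forall>i. \<exists>w. l2_deriv i u w)"
  by (simp add: H1_def is_weak_deriv_iff)

lemma H1_l2_deriv: "u \<in> H1 \<Longrightarrow> l2_deriv i u (weak_deriv i u)"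
  unfolding H1_iff using weak_deriv_eqI by metis

lemma l2_deriv_add: "l2_deriv i u w \<Longrightarrow> l2_deriv i v z \<Longrightarrow> l2_deriv i (u + v) (w + z)"
  unfolding l2_deriv_def by (simp add: shift_l2_simps has_vector_derivative_add)

lemma l2_deriv_diff: "l2_deriv i u w \<Longrightarrow> l2_deriv i v z \<Longrightarrow> l2_deriv i (u - v) (w - z)"
  unfolding l2_deriv_def by (simp add: shift_l2_simps has_vector_derivative_diff)

lemma l2_deriv_scaleR: "l2_deriv i u w \<Longrightarrow> l2_deriv i (c *\<^sub>R u) (c *\<^sub>R w)"
  unfolding l2_deriv_def shift_l2_simps
  by (rule bounded_linear.has_vector_derivative[OF bounded_linear_scaleR_right])

lemma test_in_H1: "test_function \<psi> \<Longrightarrow> abs_l2 \<psi> \<in> H1"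
  using l2_deriv_test by (auto simp: H1_iff)

text \<open>Riesz representation by minimizing norm x ^ 2 - 2 F x over D. The parallelogram law
  makes a minimizing sequence Cauchy; its limit w is taken in the whole space, so D may be
  non-closed, and the first variation along D gives inner w y = F y.\<close>

lemma riesz_on_subspace:
  fixes F :: "'a::{real_inner,banach} \<Rightarrow> real"
  assumes D: "subspace D"
    and add: "\<And>x y. x \<in> D \<Longrightarrow> y \<in> D \<Longrightarrow> F (x + y) = F x + F y"
    and scale: "\<And>c x. x \<in> D \<Longrightarrow> F (c *\<^sub>R x) = c * F x"
    and bound: "\<And>x. x \<in> D \<Longrightarrow> \<bar>F x\<bar> \<le> C * norm x" and C: "0 \<le> C"
  obtains w where "norm w \<le> C" "\<And>y. y \<in> D \<Longrightarrow> inner w y = F y"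
proof -
  define J where "J x = (norm x)\<^sup>2 - 2 * F x" for x
  have Jge: "J x \<ge> - (C\<^sup>2)" if "x \<in> D" for x
  proof -
    have "0 \<le> (norm x - C)\<^sup>2" by simp
    then have "2 * (C * norm x) \<le> (norm x)\<^sup>2 + C\<^sup>2" by (simp add: power2_diff mult_ac)
    then show ?thesis using bound[OF that] by (auto simp: J_def)
  qed
  have D0: "0 \<in> D" using D by (rule subspace_0)
  have bdd: "bdd_below (J ` D)" using Jge by (intro bdd_belowI2)
  define m where "m = Inf (J ` D)"
  have m_le: "m \<le> J x" if "x \<in> D" for x
    unfolding m_def using bdd that by (rule cINF_lower)
  have "\<exists>x\<in>D. J x < m + 1 / Suc n" for n
    using cInf_lessD[of "J ` D" "m + 1 / Suc n"] D0 unfolding m_def by auto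
  then obtain X where X: "\<And>n. X n \<in> D" "\<And>n. J (X n) < m + 1 / Suc n" by metis
  \<comment> \<open>The parallelogram law, with the midpoint of x and y as competitor for the
    infimum m.\<close>
  have para: "(norm (x - y))\<^sup>2 \<le> 2 * J x + 2 * J y - 4 * m" if "x \<in> D" "y \<in> D" for x y
  proof -
    have xy: "x + y \<in> D" "(1/2) *\<^sub>R (x + y) \<in> D"
      using that D by (auto intro: subspace_add subspace_scale)
    have "m \<le> (norm ((1/2) *\<^sub>R (x + y)))\<^sup>2 - (F x + F y)"
      using m_le[OF xy(2)] scale[OF xy(1), of "1/2"] add[OF that] unfolding J_def by linarith
    moreover have "(norm ((1/2) *\<^sub>R (x + y)))\<^sup>2 = (norm (x + y))\<^sup>2 / 4" by (simp add: power_divide)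
    moreover have "(norm (x + y))\<^sup>2 + (norm (x - y))\<^sup>2 = 2 * (norm x)\<^sup>2 + 2 * (norm y)\<^sup>2"
      by (simp add: power2_norm_eq_inner inner_add inner_diff inner_commute)
    ultimately show ?thesis by (simp add: J_def)
  qed
  have "Cauchy X"
  proof (rule metric_CauchyI)
    fix e :: real assume e: "e > 0"
    obtain N where N: "1 / Suc N < e\<^sup>2 / 4" using nat_approx_posE[of "e\<^sup>2 / 4"] e by auto
    have "dist (X k) (X l) < e" if "k \<ge> N" "l \<ge> N" for k l
    proof -
      have "1 / Suc k \<le> 1 / Suc N" "1 / Suc l \<le> 1 / Suc N"
        using that by (auto intro!: divide_left_mono)
      moreover have "(norm (X k - X l))\<^sup>2 \<le> 2 * J (X k) + 2 * J (X l) - 4 * m" by (rule para[OF X(1) X(1)])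
      ultimately have "(norm (X k - X l))\<^sup>2 < e\<^sup>2" using N X(2)[of k] X(2)[of l] by linarith
      then show ?thesis using e by (simp add: dist_norm power2_less_imp_less)
    qed
    then show "\<exists>N. \<forall>k\<ge>N. \<forall>l\<ge>N. dist (X k) (X l) < e" by blast
  qed
  then obtain w where w: "X \<longlonglongrightarrow> w" by (auto simp: Cauchy_convergent_iff convergent_def)
  have J_lim: "(\<lambda>n. J (X n)) \<longlonglongrightarrow> m"
  proof (rule tendsto_sandwich[OF _ _ tendsto_const])
    show "\<forall>\<^sub>F n in sequentially. m \<le> J (X n)" using m_le X(1) by simp
    show "\<forall>\<^sub>F n in sequentially. J (X n) \<le> m + inverse (real (Suc n))"
      using X(2) by (auto simp: inverse_eq_divide less_imp_le)
    show "(\<lambda>n. m + inverse (real (Suc n))) \<longlonglongrightarrow> m"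
      using tendsto_add[OF tendsto_const LIMSEQ_inverse_real_of_nat, of m] by simp
  qed
  have eq: "inner w y = F y" if y: "y \<in> D" for y
  proof -
    have ge: "0 \<le> 2 * t * (inner w y - F y) + t\<^sup>2 * (norm y)\<^sup>2" for t
    proof -
      have "m \<le> J (X n) + (2 * t * (inner (X n) y - F y) + t\<^sup>2 * (norm y)\<^sup>2)" for n
      proof -
        have "X n + t *\<^sub>R y \<in> D" using X(1) y D by (auto intro: subspace_add subspace_scale)
        have "(norm (X n + t *\<^sub>R y))\<^sup>2 = (norm (X n))\<^sup>2 + 2 * t * inner (X n) y + t\<^sup>2 * (norm y)\<^sup>2"
          unfolding power2_norm_eq_inner power2_eq_square[of t] by (simp add: inner_add inner_commute algebra_simps)
        with m_le[OF \<open>X n + t *\<^sub>R y \<in> D\<close>] show ?thesis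
          using add[OF X(1), of "t *\<^sub>R y" n] scale[OF y, of t] subspace_scale[OF D y, of t]
          by (simp add: J_def algebra_simps)
      qed
      moreover have "(\<lambda>n. J (X n) + (2 * t * (inner (X n) y - F y) + t\<^sup>2 * (norm y)\<^sup>2))
          \<longlonglongrightarrow> m + (2 * t * (inner w y - F y) + t\<^sup>2 * (norm y)\<^sup>2)"
        by (intro tendsto_intros J_lim w)
      ultimately have "m \<le> m + (2 * t * (inner w y - F y) + t\<^sup>2 * (norm y)\<^sup>2)"
        by (intro LIMSEQ_le_const[where X = "\<lambda>n. J (X n) + (2 * t * (inner (X n) y - F y) + t\<^sup>2 * (norm y)\<^sup>2)"]) auto
      then show ?thesis by simp
    qed
    show ?thesis
    proof (rule ccontr)
      assume ne: "inner w y \<noteq> F y"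
      define d where "d = inner w y - F y"
      \<comment> \<open>Nearly the minimizer of the quadratic 2 t d + t^2 (norm y)^2; the summand 1
        keeps the denominator positive for y = 0. The quadratic becomes negative there unless d =
        0.\<close>
      define t where "t = - d / ((norm y)\<^sup>2 + 1)"
      have dd: "d\<^sup>2 > 0" using ne by (simp add: d_def)
      have "2 * t * d + t\<^sup>2 * (norm y)\<^sup>2 \<le> 2 * t * d + t\<^sup>2 * ((norm y)\<^sup>2 + 1)"
        by (intro add_left_mono mult_left_mono) auto
      also have "t\<^sup>2 * ((norm y)\<^sup>2 + 1) = - (t * d)"
      proof -
        have p: "(norm y)\<^sup>2 + 1 \<noteq> 0" by (smt (verit) zero_le_power2)
        have "t * ((norm y)\<^sup>2 + 1) = - d" using p by (simp add: t_def)
        then show ?thesis by (simp add: power2_eq_square mult.assoc)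
      qed
      also have "2 * t * d + - (t * d) = - (d\<^sup>2 / ((norm y)\<^sup>2 + 1))"
        by (simp add: t_def power2_eq_square)
      also have "\<dots> < 0" using dd by (simp add: add_nonneg_pos)
      finally show False using ge[of t] by (simp add: d_def)
    qed
  qed
  have "norm w \<le> C"
  proof -
    have "inner w (X n) \<le> C * norm (X n)" for n using eq[OF X(1)] bound[OF X(1), of n] by simp
    moreover have "(\<lambda>n. inner w (X n)) \<longlonglongrightarrow> inner w w" "(\<lambda>n. C * norm (X n)) \<longlonglongrightarrow> C * norm w"
      by (intro tendsto_intros w)+
    ultimately have "inner w w \<le> C * norm w" by (intro LIMSEQ_le) auto
    then have "norm w * norm w \<le> C * norm w" by (simp add: power2_norm_eq_inner[symmetric] power2_eq_square)
    then show ?thesis using C by (cases "w = 0") auto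
  qed
  then show ?thesis using eq that by blast
qed

text \<open>Duality criterion for a weak derivative: \<psi> \<mapsto> - inner u (\<partial>\<psi>)
  is bounded in the norm of \<open>l2\<close> on a dense subspace, hence represented by an element
  w. Derivatives of evolved functions are obtained in this way, without a formula for them.\<close>

lemma weak_deriv_exists:
  assumes bound: "\<And>\<psi>. test_function \<psi> \<Longrightarrow> \<bar>inner u (abs_l2 (partial_deriv i \<psi>))\<bar> \<le> C * norm (abs_l2 \<psi>)"
    and C: "0 \<le> C"
  obtains w where "l2_deriv i u w" "norm w \<le> C"
proof -
  \<comment> \<open>F has to be a function of classes, so the classical derivative of \<psi> is
    expressed through \<open>weak_deriv\<close> of its class.\<close>
  define F where "F x = - inner u (weak_deriv i x)" for x
  have D: "l2_deriv i x (weak_deriv i x)" if "x \<in> test_l2" for x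
    using that test_in_H1 H1_l2_deriv by (auto simp: test_l2_def)
  have F: "F (abs_l2 \<psi>) = - inner u (abs_l2 (partial_deriv i \<psi>))" if "test_function \<psi>" for \<psi>
    using weak_deriv_eqI[OF l2_deriv_test[OF that], of i] by (simp add: F_def)
  obtain w where w: "norm w \<le> C" "\<And>y. y \<in> test_l2 \<Longrightarrow> inner w y = F y"
  proof (rule riesz_on_subspace[OF subspace_test_l2, of F C])
    show "F (x + y) = F x + F y" if "x \<in> test_l2" "y \<in> test_l2" for x y
      using weak_deriv_eqI[OF l2_deriv_add[OF D[OF that(1)] D[OF that(2)]]]
      by (simp add: F_def inner_add_right)
    show "F (c *\<^sub>R x) = c * F x" if "x \<in> test_l2" for c x
      using weak_deriv_eqI[OF l2_deriv_scaleR[OF D[OF that], of c]] by (simp add: F_def)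
    show "\<bar>F x\<bar> \<le> C * norm x" if "x \<in> test_l2" for x
      using that F bound by (auto simp: test_l2_def)
  qed (use C in auto)
  have "is_weak_deriv i u w"
    unfolding is_weak_deriv_iff_inner using w(2) F by (force simp: test_l2_def)
  then show ?thesis using w(1) that by (simp add: is_weak_deriv_iff)
qed

subsection \<open>Multiplication operators\<close>

definition mult_l2 :: "('a::euclidean_space \<Rightarrow> real) \<Rightarrow> 'a l2 \<Rightarrow> 'a l2" where
  "mult_l2 a u = abs_l2 (\<lambda>x. a x * rep_l2 u x)"

lemma
  assumes a: "a \<in> borel_measurable lebesgue" "\<And>x. \<bar>a x\<bar> \<le> K" and f: "square_integrable f"
  shows square_integrable_times: "square_integrable (\<lambda>x. a x * f x)"
    and mult_abs_l2: "mult_l2 a (abs_l2 f) = abs_l2 (\<lambda>x. a x * f x)"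
    and norm_abs_l2_times: "norm (abs_l2 (\<lambda>x. a x * f x)) \<le> K * norm (abs_l2 f)"
proof -
  have K: "K \<ge> 0" using a(2)[of undefined] abs_ge_zero order_trans by blast
  have sq: "square_integrable (\<lambda>x. a x * f x)" if f: "square_integrable f" for f
  proof (rule square_integrable_dominated[OF _ square_integrable_scale[OF f, of K]])
    show "(\<lambda>x. a x * f x) \<in> borel_measurable lebesgue"
      using a(1) square_integrable_meas[OF f] by (rule borel_measurable_times)
    show "\<bar>a x * f x\<bar> \<le> \<bar>K * f x\<bar>" for x
      using a(2)[of x] K by (simp add: abs_mult mult_right_mono)
  qed
  show "square_integrable (\<lambda>x. a x * f x)" using f by (rule sq)
  show "mult_l2 a (abs_l2 f) = abs_l2 (\<lambda>x. a x * f x)"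
    unfolding mult_l2_def using AE_rep_abs_l2[OF f]
    by (subst abs_l2_eq_iff[OF sq[OF square_integrable_rep_l2] sq[OF f]]) auto
  have "(norm (abs_l2 (\<lambda>x. a x * f x)))\<^sup>2 \<le> (norm (abs_l2 (\<lambda>x. K * f x)))\<^sup>2"
    unfolding norm_l2_sq[OF sq[OF f]] norm_l2_sq[OF square_integrable_scale[OF f]]
  proof (rule integral_mono)
    show "integrable lebesgue (\<lambda>x. (a x * f x)\<^sup>2)" "integrable lebesgue (\<lambda>x. (K * f x)\<^sup>2)"
      using sq[OF f] square_integrable_scale[OF f, of K] by (auto simp: square_integrable_def)
    show "(a x * f x)\<^sup>2 \<le> (K * f x)\<^sup>2" for x
      using a(2)[of x] K by (subst abs_le_square_iff[symmetric]) (simp add: abs_mult mult_right_mono)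
  qed
  then have "norm (abs_l2 (\<lambda>x. a x * f x)) \<le> norm (abs_l2 (\<lambda>x. K * f x))"
    by (rule power2_le_imp_le) simp
  then show "norm (abs_l2 (\<lambda>x. a x * f x)) \<le> K * norm (abs_l2 f)"
    using K by (simp add: abs_l2_scale f)
qed

lemma norm_mult_l2:
  assumes "a \<in> borel_measurable lebesgue" "\<And>x. \<bar>a x\<bar> \<le> K"
  shows "norm (mult_l2 a u) \<le> K * norm u"
  using norm_abs_l2_times[OF assms square_integrable_rep_l2[of u]] by (simp add: mult_l2_def abs_rep_l2)

lemma bounded_linear_mult_l2:
  assumes "a \<in> borel_measurable lebesgue" "\<And>x. \<bar>a x\<bar> \<le> K"
  shows "bounded_linear (mult_l2 a)"
proof (rule bounded_linear_intro)
  fix u v :: "'a l2" and c :: real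
  note sq = square_integrable_rep_l2 and st = square_integrable_times[OF assms square_integrable_rep_l2]
  have "mult_l2 a (u + v) = mult_l2 a (abs_l2 (\<lambda>x. rep_l2 u x + rep_l2 v x))"
    by (simp add: abs_l2_add sq abs_rep_l2)
  also have "\<dots> = abs_l2 (\<lambda>x. a x * rep_l2 u x + a x * rep_l2 v x)"
    unfolding mult_abs_l2[OF assms square_integrable_add[OF sq sq]] by (simp add: distrib_left)
  also have "\<dots> = mult_l2 a u + mult_l2 a v"
    unfolding mult_l2_def by (rule abs_l2_add[OF st st])
  finally show "mult_l2 a (u + v) = mult_l2 a u + mult_l2 a v" .
  have "mult_l2 a (c *\<^sub>R u) = mult_l2 a (abs_l2 (\<lambda>x. c * rep_l2 u x))"
    by (simp add: abs_l2_scale sq abs_rep_l2)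
  also have "\<dots> = abs_l2 (\<lambda>x. c * (a x * rep_l2 u x))"
    unfolding mult_abs_l2[OF assms square_integrable_scale[OF sq]] by (simp add: mult.left_commute)
  also have "\<dots> = c *\<^sub>R mult_l2 a u"
    unfolding mult_l2_def by (rule abs_l2_scale[OF st])
  finally show "mult_l2 a (c *\<^sub>R u) = c *\<^sub>R mult_l2 a u" .
  show "norm (mult_l2 a u) \<le> norm u * K"
    using norm_mult_l2[OF assms, of u] by (simp add: mult.commute)
qed

lemma inner_mult_l2:
  assumes "a \<in> borel_measurable lebesgue" "\<And>x. \<bar>a x\<bar> \<le> K"
  shows "inner (mult_l2 a u) v = inner u (mult_l2 a v)"
proof -
  note sq = square_integrable_rep_l2 and st = square_integrable_times[OF assms square_integrable_rep_l2]
  have "inner (mult_l2 a u) v = (LINT x|lebesgue. (a x * rep_l2 u x) * rep_l2 v x)"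
    using inner_abs_l2[OF st sq, of u v] by (simp add: mult_l2_def abs_rep_l2)
  also have "\<dots> = (LINT x|lebesgue. rep_l2 u x * (a x * rep_l2 v x))"
    by (simp add: mult_ac)
  also have "\<dots> = inner u (mult_l2 a v)"
    using inner_abs_l2[OF sq st, of u v] by (simp add: mult_l2_def abs_rep_l2)
  finally show ?thesis .
qed

lemma mult_l2_tendsto:
  fixes a :: "nat \<Rightarrow> 'a::euclidean_space \<Rightarrow> real"
  assumes a: "\<And>n. a n \<in> borel_measurable lebesgue" "\<And>n x. \<bar>a n x\<bar> \<le> K"
    and b: "b \<in> borel_measurable lebesgue" "\<And>x. \<bar>b x\<bar> \<le> K"
    and lim: "\<And>x. (\<lambda>n. a n x) \<longlonglongrightarrow> b x"
  shows "(\<lambda>n. mult_l2 (a n) u) \<longlonglongrightarrow> mult_l2 b u"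
  unfolding mult_l2_def
proof (rule abs_l2_dominated_tendsto[where w = "\<lambda>x. K * \<bar>rep_l2 u x\<bar>"])
  show "square_integrable (\<lambda>x. a n x * rep_l2 u x)" for n
    by (rule square_integrable_times[OF a square_integrable_rep_l2])
  show "square_integrable (\<lambda>x. b x * rep_l2 u x)"
    by (rule square_integrable_times[OF b square_integrable_rep_l2])
  have "square_integrable (\<lambda>x. \<bar>rep_l2 u x\<bar>)"
    using square_integrable_rep_l2[of u] by (auto simp: square_integrable_def)
  then show "square_integrable (\<lambda>x. K * \<bar>rep_l2 u x\<bar>)" by (rule square_integrable_scale)
  show "\<bar>a n x * rep_l2 u x\<bar> \<le> K * \<bar>rep_l2 u x\<bar>" for n x
    using a(2)[of n x] by (simp add: abs_mult mult_right_mono)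
  show "(\<lambda>n. a n x * rep_l2 u x) \<longlonglongrightarrow> b x * rep_l2 u x" for x
    by (intro tendsto_mult lim tendsto_const)
qed

text \<open>The quotient of the product splits into the translated multiplier applied to the
  quotient of u plus the quotient of a applied to u. The quotients of a converge only pointwise,
  under the bound K; \<open>mult_l2_tendsto\<close> turns this into strong convergence of the
  multiplication operators.\<close>

lemma l2_deriv_mult:
  fixes a :: "real^'n::finite \<Rightarrow> real"
  assumes cont: "continuous_on UNIV a" and K: "\<And>x. \<bar>a x\<bar> \<le> K"
    and pd: "\<And>x. has_partial_deriv i a x" and K': "\<And>x. \<bar>partial_deriv i a x\<bar> \<le> K"
    and u: "l2_deriv i u w"
  shows "partial_deriv i a \<in> borel_measurable lebesgue"
    and "l2_deriv i (mult_l2 a u) (mult_l2 a w + mult_l2 (partial_deriv i a) u)"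
proof -
  define e :: "real^'n" where "e = axis i 1"
  define q where "q h x = (a (x + h *\<^sub>R e) - a x) / h" for h x
  have K0: "K \<ge> 0" using K[of undefined] abs_ge_zero order_trans by blast
  have am: "(\<lambda>x. a (x + c)) \<in> borel_measurable lebesgue" for c
    by (rule borel_measurable_continuous_lebesgue, rule continuous_on_compose2[OF cont]) (auto intro!: continuous_intros)
  have a_m: "a \<in> borel_measurable lebesgue" using am[of 0] by simp
  have qm: "q h \<in> borel_measurable lebesgue" for h
    unfolding q_def[abs_def] using am[of "h *\<^sub>R e"] a_m by measurable
  have lip: "\<bar>a (x + h *\<^sub>R e) - a x\<bar> \<le> K * \<bar>h\<bar>" for x h
    using partial_lipschitz[of i a K x h] pd K' by (simp add: e_def)
  have qb: "\<bar>q h x\<bar> \<le> K" for h x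
    using lip[of x h] K0 by (cases "h = 0") (auto simp: q_def pos_divide_le_eq abs_divide)
  have ql: "((\<lambda>h. q h x) \<longlongrightarrow> partial_deriv i a x) (at 0)" for x
    using partial_derivD[OF pd[of x]] unfolding has_vector_derivative_at_0_iff
    by (simp add: q_def divide_inverse mult.commute e_def)
  have qs: "(\<lambda>n. q (H n) x) \<longlonglongrightarrow> partial_deriv i a x" if "\<And>n. H n \<noteq> 0" "H \<longlonglongrightarrow> 0" for H :: "nat \<Rightarrow> real" and x
    using ql[of x] that unfolding tendsto_at_iff_sequentially by (auto simp: o_def)
  show pdm: "partial_deriv i a \<in> borel_measurable lebesgue"
  proof (rule borel_measurable_LIMSEQ_real[of _ "\<lambda>n. q (inverse (real (Suc n)))"])
    show "(\<lambda>n. q (inverse (real (Suc n))) x) \<longlonglongrightarrow> partial_deriv i a x" for x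
      using qs[of "\<lambda>n. inverse (real (Suc n))"] LIMSEQ_inverse_real_of_nat by simp
  qed (rule qm)
  have split: "(shift_l2 (h *\<^sub>R e) (mult_l2 a u) - mult_l2 a u) /\<^sub>R h =
      mult_l2 (\<lambda>x. a (x + h *\<^sub>R e)) ((shift_l2 (h *\<^sub>R e) u - u) /\<^sub>R h) + mult_l2 (q h) u" for h
  proof -
    note sq = square_integrable_rep_l2[of u]
    have ss: "square_integrable (\<lambda>x. rep_l2 u (x + h *\<^sub>R e))" by (rule square_integrable_shift[OF sq])
    note t1 = square_integrable_times[OF a_m K] and t2 = square_integrable_times[OF am K]
      and t3 = square_integrable_times[OF qm qb]
    have sd: "(shift_l2 (h *\<^sub>R e) u - u) /\<^sub>R h = abs_l2 (\<lambda>x. inverse h * (rep_l2 u (x + h *\<^sub>R e) - rep_l2 u x))"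
      unfolding abs_l2_scale[OF square_integrable_diff[OF ss sq]] abs_l2_diff[OF ss sq]
      using shift_abs_l2[OF sq] by (simp add: abs_rep_l2)
    have sh: "shift_l2 (h *\<^sub>R e) (mult_l2 a u) = abs_l2 (\<lambda>x. a (x + h *\<^sub>R e) * rep_l2 u (x + h *\<^sub>R e))"
      unfolding mult_l2_def by (rule shift_abs_l2[OF t1[OF sq]])
    have "(shift_l2 (h *\<^sub>R e) (mult_l2 a u) - mult_l2 a u) /\<^sub>R h =
        abs_l2 (\<lambda>x. inverse h * (a (x + h *\<^sub>R e) * rep_l2 u (x + h *\<^sub>R e) - a x * rep_l2 u x))"
      unfolding sh abs_l2_scale[OF square_integrable_diff[OF t2[OF ss] t1[OF sq]]] abs_l2_diff[OF t2[OF ss] t1[OF sq]]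
      by (simp add: mult_l2_def)
    also have "\<dots> = abs_l2 (\<lambda>x. a (x + h *\<^sub>R e) * (inverse h * (rep_l2 u (x + h *\<^sub>R e) - rep_l2 u x)) + q h x * rep_l2 u x)"
      by (intro arg_cong[of _ _ abs_l2] ext) (simp add: q_def divide_inverse algebra_simps)
    also have "\<dots> = abs_l2 (\<lambda>x. a (x + h *\<^sub>R e) * (inverse h * (rep_l2 u (x + h *\<^sub>R e) - rep_l2 u x))) + mult_l2 (q h) u"
      unfolding mult_l2_def by (intro abs_l2_add t2 t3 square_integrable_scale square_integrable_diff ss sq)
    also have "abs_l2 (\<lambda>x. a (x + h *\<^sub>R e) * (inverse h * (rep_l2 u (x + h *\<^sub>R e) - rep_l2 u x))) =
        mult_l2 (\<lambda>x. a (x + h *\<^sub>R e)) ((shift_l2 (h *\<^sub>R e) u - u) /\<^sub>R h)"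
      unfolding sd by (rule mult_abs_l2[OF am K, symmetric]) (intro square_integrable_scale square_integrable_diff ss sq)
    finally show ?thesis .
  qed
  show "l2_deriv i (mult_l2 a u) (mult_l2 a w + mult_l2 (partial_deriv i a) u)"
    unfolding l2_deriv_iff e_def[symmetric] split
    unfolding tendsto_at_iff_sequentially
  proof (intro allI impI)
    fix H :: "nat \<Rightarrow> real" assume H: "\<forall>n. H n \<in> UNIV - {0}" "H \<longlonglongrightarrow> 0"
    have D: "(\<lambda>n. (shift_l2 (H n *\<^sub>R e) u - u) /\<^sub>R H n) \<longlonglongrightarrow> w"
      using u H unfolding l2_deriv_iff tendsto_at_iff_sequentially by (auto simp: o_def e_def)
    \<comment> \<open>Multiplier and argument both vary with n. Replacing the quotient of u by its
      limit w costs at most K times a null sequence; afterwards the argument is fixed.\<close>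
    have "(\<lambda>n. mult_l2 (\<lambda>x. a (x + H n *\<^sub>R e)) ((shift_l2 (H n *\<^sub>R e) u - u) /\<^sub>R H n - w)) \<longlonglongrightarrow> 0"
    proof (rule Lim_null_comparison)
      show "\<forall>\<^sub>F n in sequentially. norm (mult_l2 (\<lambda>x. a (x + H n *\<^sub>R e)) ((shift_l2 (H n *\<^sub>R e) u - u) /\<^sub>R H n - w))
          \<le> K * norm ((shift_l2 (H n *\<^sub>R e) u - u) /\<^sub>R H n - w)"
        using norm_mult_l2[OF am K] by simp
      show "(\<lambda>n. K * norm ((shift_l2 (H n *\<^sub>R e) u - u) /\<^sub>R H n - w)) \<longlonglongrightarrow> 0"
        using tendsto_norm_zero[OF LIM_zero[OF D]] tendsto_mult_right_zero by blast
    qed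
    moreover have "(\<lambda>n. mult_l2 (\<lambda>x. a (x + H n *\<^sub>R e)) w) \<longlonglongrightarrow> mult_l2 a w"
    proof (rule mult_l2_tendsto[OF am K a_m K])
      fix x
      have "(\<lambda>n. x + H n *\<^sub>R e) \<longlonglongrightarrow> x + 0 *\<^sub>R e" by (intro tendsto_intros H)
      then show "(\<lambda>n. a (x + H n *\<^sub>R e)) \<longlonglongrightarrow> a x"
        using cont by (simp add: continuous_on_tendsto_compose[of UNIV a])
    qed
    moreover have "(\<lambda>n. mult_l2 (q (H n)) u) \<longlonglongrightarrow> mult_l2 (partial_deriv i a) u"
      using H by (intro mult_l2_tendsto[OF qm qb pdm K'] qs) auto
    ultimately have "(\<lambda>n. mult_l2 (\<lambda>x. a (x + H n *\<^sub>R e)) ((shift_l2 (H n *\<^sub>R e) u - u) /\<^sub>R H n - w) +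
        mult_l2 (\<lambda>x. a (x + H n *\<^sub>R e)) w + mult_l2 (q (H n)) u) \<longlonglongrightarrow> 0 + mult_l2 a w + mult_l2 (partial_deriv i a) u"
      by (intro tendsto_add)
    then show "((\<lambda>h. mult_l2 (\<lambda>x. a (x + h *\<^sub>R e)) ((shift_l2 (h *\<^sub>R e) u - u) /\<^sub>R h) + mult_l2 (q h) u) \<circ> H)
        \<longlonglongrightarrow> mult_l2 a w + mult_l2 (partial_deriv i a) u"
      by (simp add: o_def linear_add[OF bounded_linear.linear[OF bounded_linear_mult_l2[OF am K]], symmetric])
  qed
qed

subsection \<open>Integral inequalities and continuation arguments\<close>

text \<open>
  With respect to the weight \<open>exp (2 K (t - s))\<close> the integral operator has norm at most
  \<open>1 / 2\<close>; this gives Gronwall's inequality with the non-optimal constant \<open>2\<close>.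
\<close>

lemma integral_exp_le:
  fixes K :: real
  assumes "K > 0" "s \<le> t"
  shows "integral {s..t} (\<lambda>r. K * exp (2 * K * (r - s))) \<le> exp (2 * K * (t - s)) / 2"
    and "(\<lambda>r. K * exp (2 * K * (r - s))) integrable_on {s..t}"
proof -
  have "((\<lambda>r. K * exp (2 * K * (r - s))) has_integral
      exp (2 * K * (t - s)) / 2 - exp (2 * K * (s - s)) / 2) {s..t}"
    using assms by (intro fundamental_theorem_of_calculus)
      (auto intro!: derivative_eq_intros simp flip: has_real_derivative_iff_has_vector_derivative)
  from integral_unique[OF this] this
  show "integral {s..t} (\<lambda>r. K * exp (2 * K * (r - s))) \<le> exp (2 * K * (t - s)) / 2"
    "(\<lambda>r. K * exp (2 * K * (r - s))) integrable_on {s..t}"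
    by (simp_all only:) (auto simp: integrable_on_def)
qed

lemma gronwall:
  fixes D :: "real \<Rightarrow> real"
  assumes K: "K > 0" and a: "a \<ge> 0" and cont: "continuous_on {s..T} D"
    and le: "\<And>t. t \<in> {s..T} \<Longrightarrow> D t \<le> a + K * integral {s..t} D"
    and t: "t \<in> {s..T}"
  shows "D t \<le> 2 * a * exp (2 * K * (t - s))"
proof -
  \<comment> \<open>At a maximum point c of the weighted function, if q c is positive, the integral
    term contributes at most half of q c and is absorbed; the bound at c then serves every
    t.\<close>
  define q where "q r = D r * exp (- (2 * K * (r - s)))" for r
  have "continuous_on {s..T} q" unfolding q_def using cont by (intro continuous_intros)
  moreover have "{s..T} \<noteq> {}" using t by auto
  ultimately obtain c where c: "c \<in> {s..T}" "\<And>r. r \<in> {s..T} \<Longrightarrow> q r \<le> q c"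
    using continuous_attains_sup[of "{s..T}" q] by auto
  have D: "D r = q r * exp (2 * K * (r - s))" for r
    by (simp add: q_def exp_minus)
  have "q c \<le> 2 * a"
  proof (cases "q c \<le> 0")
    case False
    then have qc: "q c > 0" by simp
    have "K * integral {s..c} D = integral {s..c} (\<lambda>r. K * D r)" by simp
    also have "\<dots> \<le> integral {s..c} (\<lambda>r. q c * (K * exp (2 * K * (r - s))))"
    proof (rule integral_le)
      show "(\<lambda>r. K * D r) integrable_on {s..c}"
        using c(1) by (intro integrable_continuous_real continuous_intros continuous_on_subset[OF cont]) auto
      show "(\<lambda>r. q c * (K * exp (2 * K * (r - s)))) integrable_on {s..c}"
        by (intro integrable_continuous_real continuous_intros)
      show "K * D r \<le> q c * (K * exp (2 * K * (r - s)))" if "r \<in> {s..c}" for r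
      proof -
        have "r \<in> {s..T}" using that c(1) by auto
        from mult_right_mono[OF c(2)[OF this], of "K * exp (2 * K * (r - s))"] K
        show ?thesis by (simp add: D mult_ac)
      qed
    qed
    also have "\<dots> = q c * integral {s..c} (\<lambda>r. K * exp (2 * K * (r - s)))" by simp
    also have "\<dots> \<le> q c * (exp (2 * K * (c - s)) / 2)"
      using integral_exp_le(1)[OF K, of s c] c(1) qc by (intro mult_left_mono) auto
    finally have "D c \<le> a + q c * exp (2 * K * (c - s)) / 2" using le[OF c(1)] by simp
    then have "q c * exp (2 * K * (c - s)) \<le> 2 * a" using D[of c] by simp
    moreover have "q c * 1 \<le> q c * exp (2 * K * (c - s))"
      using qc K c(1) by (intro mult_left_mono) auto
    ultimately show ?thesis by simp
  qed (use a in simp)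
  then have "q t \<le> 2 * a" using c(2)[OF t] by simp
  then show ?thesis unfolding D[of t] by (intro mult_right_mono) auto
qed

lemma gronwall_backward:
  fixes D :: "real \<Rightarrow> real"
  assumes K: "K > 0" and a: "a \<ge> 0" and cont: "continuous_on {s..t} D" and st: "s \<le> t"
    and le: "\<And>r. r \<in> {s..t} \<Longrightarrow> D r \<le> a + K * integral {r..t} D"
  shows "D s \<le> 2 * a * exp (2 * K * (t - s))"
proof -
  have "(\<lambda>x. D (- x)) (- s) \<le> 2 * a * exp (2 * K * (- s - (- t)))"
  proof (rule gronwall[OF K a, of "- t" "- s"])
    show "continuous_on {- t..- s} (\<lambda>x. D (- x))"
      by (rule continuous_on_compose2[OF cont]) (auto intro!: continuous_intros)
    show "D (- r) \<le> a + K * integral {- t..r} (\<lambda>x. D (- x))" if "r \<in> {- t..- s}" for r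
      using le[of "- r"] that Henstock_Kurzweil_Integration.integral_reflect_real[of t "- r" D] by simp
  qed (use st in auto)
  then show ?thesis by simp
qed

text \<open>
  Stands in for the uniqueness of primitives: \<open>p\<close> need not be differentiable anywhere.
\<close>

lemma constant_by_left_increments:
  fixes p M :: "real \<Rightarrow> real"
  assumes ab: "a \<le> b" and p: "continuous_on {a..b} p" and M: "continuous_on {a..b} M"
    and loc: "\<And>\<epsilon> t. \<epsilon> > 0 \<Longrightarrow> a < t \<Longrightarrow> t \<le> b \<Longrightarrow>
      \<exists>d>0. \<forall>s\<in>{a..t}. t - s < d \<longrightarrow> \<bar>p t - p s\<bar> \<le> \<epsilon> * (M t - M s)"
  shows "p a = p b"
proof -
  have main: "\<bar>p b - p a\<bar> \<le> \<epsilon> * (M b - M a)" if \<epsilon>: "\<epsilon> > 0" for \<epsilon>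
  proof -
    define S where "S = {s\<in>{a..b}. \<bar>p b - p s\<bar> \<le> \<epsilon> * (M b - M s)}"
    have "closed S"
      unfolding S_def
      by (rule continuous_on_closed_Collect_le) (intro continuous_intros p M closed_atLeastAtMost)+
    have bS: "b \<in> S" using ab by (simp add: S_def)
    have bdd: "bdd_below S" by (rule bdd_belowI[of _ a]) (auto simp: S_def)
    \<comment> \<open>Continuous induction from b downwards: S is closed, so it contains its infimum
      c, and the local hypothesis at c would push S below c if c > a.\<close>
    define c where "c = Inf S"
    have cS: "c \<in> S" unfolding c_def
      using closed_contains_Inf[OF _ bdd \<open>closed S\<close>] bS by blast
    have "c = a"
    proof (rule ccontr)
      assume "c \<noteq> a"
      then have c: "a < c" "c \<le> b" using cS by (auto simp: S_def)
      from loc[OF \<epsilon> this] obtain d where d: "d > 0"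
        "\<And>s. s \<in> {a..c} \<Longrightarrow> c - s < d \<Longrightarrow> \<bar>p c - p s\<bar> \<le> \<epsilon> * (M c - M s)" by blast
      define s where "s = max a (c - d / 2)"
      have s: "s \<in> {a..c}" "c - s < d" "s < c" using d(1) c by (auto simp: s_def)
      have "\<bar>p b - p s\<bar> \<le> \<epsilon> * (M b - M c) + \<epsilon> * (M c - M s)"
        using d(2)[OF s(1,2)] cS by (auto simp: S_def)
      also have "\<dots> = \<epsilon> * (M b - M s)" by (simp add: algebra_simps)
      finally have "s \<in> S" using s c by (auto simp: S_def)
      then have "c \<le> s" unfolding c_def using bdd by (rule cInf_lower)
      then show False using s(3) by simp
    qed
    then show ?thesis using cS by (simp add: S_def)
  qed
  \<comment> \<open>M is not assumed monotone; that its total increment is nonnegative is read off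
    from the bound with \<epsilon> = 1.\<close>
  have nn: "M b - M a \<ge> 0" using main[of 1] by (smt (verit) mult_1)
  have "\<bar>p b - p a\<bar> \<le> e" if "e > 0" for e
  proof -
    have "\<bar>p b - p a\<bar> \<le> e / (M b - M a + 1) * (M b - M a)" using that nn by (intro main) auto
    also have "\<dots> = e * ((M b - M a) / (M b - M a + 1))" by simp
    also have "\<dots> \<le> e * 1" using that nn by (intro mult_left_mono) auto
    finally show ?thesis by simp
  qed
  then have "\<bar>p b - p a\<bar> \<le> 0" by (rule field_le_epsilon) simp
  then show ?thesis by simp
qed

subsection \<open>Maps with a Lipschitz left inverse are nonsingular\<close>

lemma cube_subset_ball:
  fixes u v :: "'a::euclidean_space"
  assumes "\<And>i. i \<in> Basis \<Longrightarrow> v \<bullet> i - u \<bullet> i \<le> h" "x \<in> cbox u v" "y \<in> cbox u v"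
  shows "norm (x - y) \<le> real DIM('a) * h"
proof -
  have "norm (x - y) \<le> (\<Sum>i\<in>Basis. \<bar>(x - y) \<bullet> i\<bar>)" by (rule norm_le_l1)
  also have "\<dots> \<le> (\<Sum>i::'a\<in>Basis. h)"
  proof (rule sum_mono)
    fix i :: 'a assume i: "i \<in> Basis"
    then show "\<bar>(x - y) \<bullet> i\<bar> \<le> h"
      using assms(1)[OF i] assms(2,3) by (force simp: mem_box inner_diff_left)
  qed
  finally show ?thesis by simp
qed

lemma emeasure_UN_countable_le:
  assumes X: "\<And>i. i \<in> I \<Longrightarrow> X i \<in> sets M" and I: "countable I"
  shows "emeasure M (\<Union>i\<in>I. X i) \<le> (\<integral>\<^sup>+i. emeasure M (X i) \<partial>count_space I)"
proof -
  have "emeasure M (\<Union>i\<in>I. X i) = (\<integral>\<^sup>+x. indicator (\<Union>i\<in>I. X i) x \<partial>M)"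
    using X I by (subst nn_integral_indicator) (auto intro: sets.countable_UN')
  also have "\<dots> \<le> (\<integral>\<^sup>+x. \<integral>\<^sup>+i. indicator (X i) x \<partial>count_space I \<partial>M)"
  proof (rule nn_integral_mono)
    fix x
    show "indicator (\<Union>i\<in>I. X i) x \<le> (\<integral>\<^sup>+i. indicator (X i) x \<partial>count_space I)"
    proof (cases "x \<in> (\<Union>i\<in>I. X i)")
      case True
      then obtain j where j: "j \<in> I" "x \<in> X j" by blast
      have "1 = (\<integral>\<^sup>+i. indicator {j} i \<partial>count_space I)" using j by simp
      also have "\<dots> \<le> (\<integral>\<^sup>+i. indicator (X i) x \<partial>count_space I)"
        using j by (intro nn_integral_mono) (auto simp: indicator_def)
      finally show ?thesis using True by simp
    qed simp
  qed
  also have "\<dots> = (\<integral>\<^sup>+i. \<integral>\<^sup>+x. indicator (X i) x \<partial>M \<partial>count_space I)"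
    using X I by (intro nn_integral_count_space_nn_integral) auto
  also have "\<dots> = (\<integral>\<^sup>+i. emeasure M (X i) \<partial>count_space I)"
    using X by (intro nn_integral_cong) simp
  finally show ?thesis .
qed

text \<open>A cube with edge h has diameter at most DIM h, so its preimage has diameter at most
  \<rho> = L DIM h and fits into the cube of edge 2 \<rho> around any of its points. The ratio of
  the two volumes is the constant.\<close>

lemma emeasure_vimage_cube_le:
  fixes \<Psi> :: "'a::euclidean_space \<Rightarrow> 'a"
  assumes \<Psi>: "continuous_on UNIV \<Psi>" "\<And>x y. norm (x - y) \<le> L * norm (\<Psi> x - \<Psi> y)" and L: "L > 0"
    and cube: "\<And>i. i \<in> Basis \<Longrightarrow> v \<bullet> i - u \<bullet> i = h" and h: "h > 0"
  shows "emeasure lborel (\<Psi> -` cbox u v) \<le> ennreal ((2 * L * real DIM('a)) ^ DIM('a)) * emeasure lborel (cbox u v)"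
proof (cases "\<Psi> -` cbox u v = {}")
  case False
  then obtain x0 where x0: "\<Psi> x0 \<in> cbox u v" by auto
  define \<rho> where "\<rho> = L * (real DIM('a) * h)"
  have \<rho>: "\<rho> > 0" using L h by (simp add: \<rho>_def)
  define lo where "lo = x0 - \<rho> *\<^sub>R One"
  define hi where "hi = x0 + \<rho> *\<^sub>R One"
  have "\<Psi> -` cbox u v \<subseteq> cbox lo hi"
  proof
    fix x assume "x \<in> \<Psi> -` cbox u v"
    then have "norm (\<Psi> x - \<Psi> x0) \<le> real DIM('a) * h" using x0 cube by (intro cube_subset_ball) auto
    then have "norm (x - x0) \<le> \<rho>"
      using \<Psi>(2)[of x x0] L unfolding \<rho>_def by (meson mult_left_mono less_imp_le order_trans)
    then have "\<bar>(x - x0) \<bullet> i\<bar> \<le> \<rho>" if "i \<in> Basis" for i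
      using Basis_le_norm[OF that, of "x - x0"] by linarith
    then show "x \<in> cbox lo hi"
      by (fastforce simp: mem_box lo_def hi_def inner_diff_left inner_add_left abs_le_iff)
  qed
  then have "emeasure lborel (\<Psi> -` cbox u v) \<le> emeasure lborel (cbox lo hi)"
    by (intro emeasure_mono) auto
  also have "\<dots> = ennreal ((2 * \<rho>) ^ DIM('a))"
    using \<rho> by (subst emeasure_lborel_cbox) (auto simp: lo_def hi_def algebra_simps)
  also have "(2 * \<rho>) ^ DIM('a) = (2 * L * real DIM('a)) ^ DIM('a) * h ^ DIM('a)"
    by (simp add: \<rho>_def flip: power_mult_distrib mult.assoc)
  also have "ennreal \<dots> = ennreal ((2 * L * real DIM('a)) ^ DIM('a)) * ennreal (h ^ DIM('a))"
    using L h by (intro ennreal_mult) auto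
  also have "ennreal (h ^ DIM('a)) = emeasure lborel (cbox u v)"
  proof -
    have "(\<Prod>i\<in>Basis. (v - u) \<bullet> i) = (\<Prod>i::'a\<in>Basis. h)"
      by (rule prod.cong) (auto simp: inner_diff_left cube)
    moreover have "u \<bullet> i \<le> v \<bullet> i" if "i \<in> Basis" for i using cube[OF that] h by simp
    ultimately show ?thesis by (subst emeasure_lborel_cbox) auto
  qed
  finally show ?thesis .
qed auto

text \<open>The estimate for cubes passes to a bounded Borel set by covering it with non-overlapping
  cubes inside an open set of almost the same measure, and to all Borel sets by exhaustion with
  balls.\<close>

lemma nonsingular_lower_lipschitz:
  fixes \<Psi> :: "'a::euclidean_space \<Rightarrow> 'a"
  assumes \<Psi>: "continuous_on UNIV \<Psi>" "\<And>x y. norm (x - y) \<le> L * norm (\<Psi> x - \<Psi> y)" and L: "L > 0"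
  shows "nonsingular ((2 * L * real DIM('a)) ^ DIM('a)) \<Psi>"
proof -
  define C where "C = (2 * L * real DIM('a)) ^ DIM('a)"
  have C0: "C \<ge> 0" using L by (simp add: C_def)
  have \<Psi>m: "\<Psi> \<in> borel_measurable borel" using \<Psi>(1) by (rule borel_measurable_continuous_onI)
  have bounded_case: "emeasure lborel (\<Psi> -` A) \<le> ennreal C * emeasure lborel A"
    if A: "A \<in> sets borel" "A \<subseteq> ball 0 (real k)" for A and k :: nat
  proof -
    have fin: "emeasure lborel A < \<infinity>"
      using emeasure_mono[OF A(2), of lborel] emeasure_lborel_ball_finite[of "0::'a" "real k"] by (simp add: order_le_less_trans)
    have "emeasure lborel (\<Psi> -` A) \<le> ennreal C * (emeasure lborel A + ennreal e)" if e: "e > 0" for e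
    proof -
      have "A \<in> sets lebesgue" using A(1) by simp
      then obtain U where U: "open U" "A \<subseteq> U" "U - A \<in> lmeasurable" "emeasure lebesgue (U - A) < ennreal e"
        by (rule sets_lebesgue_outer_open[OF _ e])
      \<comment> \<open>The gauge forces every cube of the covering lemma into U, as each cube is
        tagged by a point of A. The value off U only makes it a gauge on the whole space.\<close>
      define g where "g x = (if x \<in> U then ball x (SOME r. r > 0 \<and> ball x r \<subseteq> U) else ball x 1)" for x
      have gU: "\<exists>r>0. g x = ball x r \<and> ball x r \<subseteq> U" if "x \<in> U" for x
      proof -
        have "\<exists>r. r > 0 \<and> ball x r \<subseteq> U" using U(1) that openE by blast
        from someI_ex[OF this] that show ?thesis by (auto simp: g_def)
      qed
      have gauge: "gauge g"
        unfolding gauge_def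
      proof (intro allI conjI)
        fix x
        obtain r where "r > 0" "g x = ball x r"
          proof (cases "x \<in> U")
          case True
          from gU[OF this] show ?thesis using that by blast
        qed (use that[of 1] in \<open>simp add: g_def\<close>)
        then show "x \<in> g x" "open (g x)" by simp_all
      qed
      \<comment> \<open>Adding 1 keeps the enclosing box nondegenerate for k = 0.\<close>
      define m where "m = real k + 1"
      have Abox: "A \<subseteq> cbox (- m *\<^sub>R One) (m *\<^sub>R One)"
      proof
        fix x assume "x \<in> A"
        then have "norm x \<le> m" using A(2) by (auto simp: m_def)
        then have "\<bar>x \<bullet> i\<bar> \<le> m" if "i \<in> Basis" for i
          using Basis_le_norm[OF that, of x] by linarith
        then show "x \<in> cbox (- m *\<^sub>R One) (m *\<^sub>R One)" by (fastforce simp: mem_box abs_le_iff)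
      qed
      have ne: "box (- m *\<^sub>R One :: 'a) (m *\<^sub>R One) \<noteq> {}" by (simp add: box_eq_empty m_def)
      obtain \<D> where D: "countable \<D>" "\<Union>\<D> \<subseteq> cbox (- m *\<^sub>R One) (m *\<^sub>R One)"
        "\<And>K. K \<in> \<D> \<Longrightarrow> interior K \<noteq> {} \<and> (\<exists>c d. K = cbox c d)"
        "pairwise (\<lambda>A B. interior A \<inter> interior B = {}) \<D>"
        "\<And>K. K \<in> \<D> \<Longrightarrow> \<exists>x \<in> A \<inter> K. K \<subseteq> g x"
        "\<And>u v. cbox u v \<in> \<D> \<Longrightarrow> \<exists>n. \<forall>i \<in> Basis. v \<bullet> i - u \<bullet> i = ((m *\<^sub>R One) \<bullet> i - (- m *\<^sub>R One) \<bullet> i) / 2^n"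
        "A \<subseteq> \<Union>\<D>"
        using covering_lemma[OF Abox ne gauge] by metis
      have KU: "K \<subseteq> U" if "K \<in> \<D>" for K
        using D(5)[OF that] gU U(2) by blast
      have Kle: "emeasure lborel (\<Psi> -` K) \<le> ennreal C * emeasure lborel K" and Kb: "K \<in> sets borel"
        and Kint: "emeasure lborel (interior K) = emeasure lborel K" if K: "K \<in> \<D>" for K
      proof -
        obtain u v where uv: "K = cbox u v" using D(3)[OF K] by blast
        then obtain n where n: "\<And>i. i \<in> Basis \<Longrightarrow> v \<bullet> i - u \<bullet> i = (m + m) / 2 ^ n"
          using D(6)[of u v] K by auto
        show "emeasure lborel (\<Psi> -` K) \<le> ennreal C * emeasure lborel K"
          unfolding uv C_def by (rule emeasure_vimage_cube_le[OF \<Psi> L n]) (auto simp: m_def)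
        show "K \<in> sets borel" by (simp add: uv)
        show "emeasure lborel (interior K) = emeasure lborel K"
          by (simp add: uv interior_cbox emeasure_lborel_box_eq emeasure_lborel_cbox_eq)
      qed
      have "emeasure lborel (\<Psi> -` A) \<le> emeasure lborel (\<Union>K\<in>\<D>. \<Psi> -` K)"
      proof (rule emeasure_mono)
        show "(\<Union>K\<in>\<D>. \<Psi> -` K) \<in> sets lborel"
          using D(1) Kb measurable_sets[OF \<Psi>m] by (intro sets.countable_UN') auto
      qed (use D(7) in auto)
      also have "\<dots> \<le> (\<integral>\<^sup>+K. emeasure lborel (\<Psi> -` K) \<partial>count_space \<D>)"
        using D(1) Kb measurable_sets[OF \<Psi>m] by (intro emeasure_UN_countable_le) auto
      \<comment> \<open>Cubes of the cover may share faces. Their interiors have the same measure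
        and are disjoint, so the volumes add up to at most that of U.\<close>
      also have "\<dots> \<le> (\<integral>\<^sup>+K. ennreal C * emeasure lborel (interior K) \<partial>count_space \<D>)"
        using Kle Kint by (intro nn_integral_mono) auto
      also have "\<dots> = ennreal C * (\<integral>\<^sup>+K. emeasure lborel (interior K) \<partial>count_space \<D>)"
        by (rule nn_integral_cmult) simp
      also have "(\<integral>\<^sup>+K. emeasure lborel (interior K) \<partial>count_space \<D>) = emeasure lborel (\<Union>K\<in>\<D>. interior K)"
        using D(1,4) by (intro emeasure_UN_countable[symmetric]) (auto simp: disjoint_family_on_def pairwise_def)
      also have "\<dots> \<le> emeasure lborel U"
        using KU interior_subset U(1) by (intro emeasure_mono) fastforce+
      also have "emeasure lborel U = emeasure lborel A + emeasure lborel (U - A)"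
        using A(1) U(1,2) by (subst plus_emeasure) (auto simp: Un_absorb1)
      also have "emeasure lborel (U - A) \<le> ennreal e"
        using U(1,4) A(1) by (simp add: less_imp_le)
      finally show ?thesis by (simp add: add_left_mono mult_left_mono)
    qed
    note approx = this
    show ?thesis
    proof (rule ennreal_le_epsilon)
      fix e :: real assume e: "e > 0"
      have "emeasure lborel (\<Psi> -` A) \<le> ennreal C * (emeasure lborel A + ennreal (e / (C + 1)))"
        using C0 e by (intro approx) auto
      also have "\<dots> = ennreal C * emeasure lborel A + ennreal (C * (e / (C + 1)))"
        using C0 e ennreal_mult[of C "e / (C + 1)"] by (simp only: distrib_left) simp
      also have "C * (e / (C + 1)) \<le> e" using C0 e by (simp add: field_simps)
      finally show "emeasure lborel (\<Psi> -` A) \<le> ennreal C * emeasure lborel A + ennreal e"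
        by (simp add: add_left_mono ennreal_leI)
    qed
  qed
  have "emeasure lborel (\<Psi> -` A) \<le> ennreal C * emeasure lborel A" if A: "A \<in> sets borel" for A
  proof -
    define B where "B k = A \<inter> ball 0 (real k)" for k
    have B: "B k \<in> sets borel" for k using A by (simp add: B_def)
    have "(\<Union>k. B k) = A"
    proof (intro subset_antisym subsetI)
      fix x assume "x \<in> A"
      obtain k :: nat where "norm x < real k" using reals_Archimedean2 by blast
      then show "x \<in> (\<Union>k. B k)" using \<open>x \<in> A\<close> by (auto simp: B_def)
    qed (auto simp: B_def)
    then have eq: "\<Psi> -` A = (\<Union>k. \<Psi> -` B k)" by blast
    have inc: "incseq (\<lambda>k. \<Psi> -` B k)" by (rule incseq_SucI) (auto simp: B_def)
    have "emeasure lborel (\<Psi> -` A) = (SUP k. emeasure lborel (\<Psi> -` B k))"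
      unfolding eq using inc B measurable_sets[OF \<Psi>m] by (intro SUP_emeasure_incseq[symmetric]) auto
    also have "\<dots> \<le> ennreal C * emeasure lborel A"
    proof (rule SUP_least)
      fix k
      have "emeasure lborel (\<Psi> -` B k) \<le> ennreal C * emeasure lborel (B k)"
        using B by (intro bounded_case[of _ k]) (auto simp: B_def)
      also have "\<dots> \<le> ennreal C * emeasure lborel A"
        using A by (intro mult_left_mono emeasure_mono) (auto simp: B_def)
      finally show "emeasure lborel (\<Psi> -` B k) \<le> ennreal C * emeasure lborel A" .
    qed
    finally show ?thesis .
  qed
  then show ?thesis using C0 \<Psi>m by (simp add: nonsingular_def C_def)
qed

subsection \<open>The flow of a bounded Lipschitz field\<close>

text \<open>One constant K serves as bound and as Lipschitz constant, and both hold at all real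
  times: the field to which this is applied vanishes for times outside [0,T].\<close>

locale lipschitz_field =
  fixes K :: real and f :: "real^'n::finite \<Rightarrow> real \<Rightarrow> real^'n"
  assumes K_pos: "K > 0"
    and f_meas: "(\<lambda>(x, t). f x t) \<in> borel_measurable borel"
    and f_bound: "norm (f x t) \<le> K"
    and f_lip: "norm (f x t - f y t) \<le> K * norm (x - y)"
begin

lemma along_measurable:
  assumes "y \<in> borel_measurable (lebesgue_on S)"
  shows "(\<lambda>r. f (y r) r) \<in> borel_measurable (lebesgue_on S)"
proof -
  have "(\<lambda>r. r) \<in> borel_measurable (lebesgue_on S)"
    by (intro measurable_restrict_space1 borel_measurable_continuous_lebesgue continuous_on_id)
  then have "(\<lambda>r. (y r, r)) \<in> borel_measurable (lebesgue_on S)"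
    using assms by (rule borel_measurable_Pair[rotated])
  from measurable_compose[OF this f_meas] show ?thesis by simp
qed

lemma along_integrable:
  assumes "y \<in> borel_measurable (lebesgue_on {s..t})"
  shows "integrable (lebesgue_on {s..t}) (\<lambda>r. f (y r) r)" (is ?A)
    and "(\<lambda>r. f (y r) r) integrable_on {s..t}"
    and "(LINT r|lebesgue_on {s..t}. f (y r) r) = integral {s..t} (\<lambda>r. f (y r) r)"
proof -
  interpret finite_measure "lebesgue_on {s..t}" by (rule finite_measure_lebesgue_on) simp
  show A: ?A
    by (rule integrable_const_bound[of _ K]) (auto simp: f_bound along_measurable assms)
  show "(\<lambda>r. f (y r) r) integrable_on {s..t}"
    using A by (rule integrable_on_lebesgue_on) simp
  show "(LINT r|lebesgue_on {s..t}. f (y r) r) = integral {s..t} (\<lambda>r. f (y r) r)"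
    using A by (rule lebesgue_integral_eq_integral) simp
qed

lemma continuous_measurable_on:
  "continuous_on {s..t} (y :: real \<Rightarrow> real^'n) \<Longrightarrow> y \<in> borel_measurable (lebesgue_on {s..t})"
  by (rule continuous_imp_measurable_on_sets_lebesgue) auto

text \<open>Along a measurable curve the field is bounded and measurable, so its Bochner integral
  over a bounded interval exists and equals the gauge integral, for which indefinite integrals are
  continuous.\<close>

lemma is_characteristic_iff:
  "is_characteristic T f x s y \<longleftrightarrow>
    continuous_on {s..T} y \<and> (\<forall>t\<in>{s..T}. y t = x + integral {s..t} (\<lambda>r. f (y r) r))"
proof (intro iffI conjI ballI)
  assume y: "is_characteristic T f x s y"
  show eq: "y t = x + integral {s..t} (\<lambda>r. f (y r) r)" if t: "t \<in> {s..T}" for t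
  proof -
    have "has_bochner_integral (lebesgue_on {s..t}) (\<lambda>r. f (y r) r) (y t - x)"
      using y t by (simp add: is_characteristic_def)
    then have "integrable (lebesgue_on {s..t}) (\<lambda>r. f (y r) r)"
      "(LINT r|lebesgue_on {s..t}. f (y r) r) = y t - x"
      by (auto simp: has_bochner_integral_iff)
    then show ?thesis using lebesgue_integral_eq_integral[of "{s..t}" "\<lambda>r. f (y r) r"] by simp
  qed
  show "continuous_on {s..T} y"
  proof (cases "s \<le> T")
    case True
    then have "has_bochner_integral (lebesgue_on {s..T}) (\<lambda>r. f (y r) r) (y T - x)"
      using y by (simp add: is_characteristic_def)
    then have "(\<lambda>r. f (y r) r) integrable_on {s..T}"
      by (intro integrable_on_lebesgue_on) (auto simp: has_bochner_integral_iff)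
    from indefinite_integral_continuous_1[OF this]
    have "continuous_on {s..T} (\<lambda>t. x + integral {s..t} (\<lambda>r. f (y r) r))" by (intro continuous_intros)
    then show ?thesis by (rule continuous_on_eq) (use eq in auto)
  qed simp
next
  assume y: "continuous_on {s..T} y \<and> (\<forall>t\<in>{s..T}. y t = x + integral {s..t} (\<lambda>r. f (y r) r))"
  show "is_characteristic T f x s y"
    unfolding is_characteristic_def
  proof
    fix t assume t: "t \<in> {s..T}"
    have "y \<in> borel_measurable (lebesgue_on {s..t})"
      using y t by (intro continuous_measurable_on) (auto elim: continuous_on_subset)
    from along_integrable[OF this] show "has_bochner_integral (lebesgue_on {s..t}) (\<lambda>r. f (y r) r) (y t - x)"
      using y t by (simp add: has_bochner_integral_iff)
  qed
qed

lemma integral_diff_le: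
  assumes "y \<in> borel_measurable (lebesgue_on {s..t})" "z \<in> borel_measurable (lebesgue_on {s..t})"
    and g: "g integrable_on {s..t}" "\<And>r. r \<in> {s..t} \<Longrightarrow> norm (y r - z r) \<le> g r"
  shows "norm (integral {s..t} (\<lambda>r. f (y r) r) - integral {s..t} (\<lambda>r. f (z r) r)) \<le> K * integral {s..t} g"
proof -
  note i = along_integrable(2)[OF assms(1)] along_integrable(2)[OF assms(2)]
  have "norm (integral {s..t} (\<lambda>r. f (y r) r - f (z r) r)) \<le> integral {s..t} (\<lambda>r. K * g r)"
  proof (rule integral_norm_bound_integral)
    show "(\<lambda>r. f (y r) r - f (z r) r) integrable_on {s..t}" by (intro Henstock_Kurzweil_Integration.integrable_diff i)
    show "(\<lambda>r. K * g r) integrable_on {s..t}" using integrable_cmul[OF g(1), of K] by simp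
    show "norm (f (y r) r - f (z r) r) \<le> K * g r" if "r \<in> {s..t}" for r
      using f_lip[of "y r" r "z r"] mult_left_mono[OF g(2)[OF that], of K] K_pos by linarith
  qed
  then show ?thesis by (simp add: Henstock_Kurzweil_Integration.integral_diff[OF i])
qed

section \<open>Existence and uniqueness of characteristics\<close>

primrec picard :: "real^'n \<Rightarrow> real \<Rightarrow> nat \<Rightarrow> real \<Rightarrow> real^'n" where
  "picard x s 0 = (\<lambda>t. x)"
| "picard x s (Suc k) = (\<lambda>t. x + integral {s..t} (\<lambda>r. f (picard x s k r) r))"

lemma continuous_picard: "continuous_on {s..t} (picard x s k)"
proof (induction k)
  case (Suc k)
  have "continuous_on {s..t} (\<lambda>t. integral {s..t} (\<lambda>r. f (picard x s k r) r))"
    by (intro indefinite_integral_continuous_1 along_integrable(2) continuous_measurable_on Suc)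
  then show ?case by (simp add: continuous_on_add)
qed simp

text \<open>In the weight exp (2 K (t - s)) each Picard step contracts by 1/2 on time intervals of
  any length; the first step is at most K (t - s), which the weight dominates.\<close>

lemma picard_diff:
  assumes "s \<le> t"
  shows "norm (picard x s (Suc k) t - picard x s k t) \<le> (1/2) ^ k * exp (2 * K * (t - s))"
  using assms
proof (induction k arbitrary: t)
  case 0
  have "norm (integral {s..t} (\<lambda>r. f x r)) \<le> integral {s..t} (\<lambda>r. K)"
    using along_integrable(2)[OF continuous_measurable_on[OF continuous_on_const[of _ x]]]
    by (intro integral_norm_bound_integral) (auto simp: f_bound)
  also have "\<dots> = K * (t - s)" using 0 by simp
  also have "\<dots> \<le> 2 * K * (t - s)" using 0 K_pos by simp
  also have "\<dots> \<le> exp (2 * K * (t - s))" using exp_ge_add_one_self[of "2 * K * (t - s)"] by linarith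
  finally show ?case by simp
next
  case (Suc k)
  have "norm (picard x s (Suc (Suc k)) t - picard x s (Suc k) t) =
      norm (integral {s..t} (\<lambda>r. f (picard x s (Suc k) r) r) - integral {s..t} (\<lambda>r. f (picard x s k r) r))"
    by (subst picard.simps(2), subst (3) picard.simps(2)) simp
  also have "\<dots> \<le> K * integral {s..t} (\<lambda>r. (1/2) ^ k * exp (2 * K * (r - s)))"
    by (intro integral_diff_le continuous_measurable_on continuous_picard Suc.IH)
      (auto intro!: integrable_continuous_real continuous_intros)
  also have "\<dots> = (1/2) ^ k * integral {s..t} (\<lambda>r. K * exp (2 * K * (r - s)))" by simp
  also have "\<dots> \<le> (1/2) ^ k * (exp (2 * K * (t - s)) / 2)"
    using integral_exp_le(1)[OF K_pos Suc.prems] by (intro mult_left_mono) auto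
  finally show ?case by simp
qed

lemma characteristic_exists: "\<exists>y. is_characteristic T f x s y"
proof -
  have conv: "convergent (\<lambda>k. picard x s k t)" if "s \<le> t" for t
  proof -
    have "summable (\<lambda>k. picard x s (Suc k) t - picard x s k t)"
    proof (rule summable_comparison_test)
      show "\<exists>N. \<forall>k\<ge>N. norm (picard x s (Suc k) t - picard x s k t) \<le> (1/2) ^ k * exp (2 * K * (t - s))"
        using picard_diff[OF that] by blast
      show "summable (\<lambda>k. (1/2) ^ k * exp (2 * K * (t - s)))"
        by (intro summable_mult2 summable_geometric) simp
    qed
    then have "convergent (\<lambda>n. \<Sum>k<n. picard x s (Suc k) t - picard x s k t)"
      by (simp add: summable_iff_convergent)
    moreover have "(\<Sum>k<n. picard x s (Suc k) t - picard x s k t) = picard x s n t - x" for n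
      by (induction n) (auto simp del: picard.simps(2))
    ultimately have "convergent (\<lambda>n. picard x s n t - x)" by simp
    then show ?thesis by (simp add: convergent_diff_const_right_iff)
  qed
  \<comment> \<open>A pointwise limit is enough: the integral equation passes to it by dominated
    convergence with the bound K. The same y serves every end time T.\<close>
  define y where "y t = lim (\<lambda>k. picard x s k t)" for t
  have lim: "(\<lambda>k. picard x s k t) \<longlonglongrightarrow> y t" if "s \<le> t" for t
    using conv[OF that] by (simp add: y_def convergent_LIMSEQ_iff)
  have int: "(\<lambda>r. f (y r) r) integrable_on {s..t} \<and> y t = x + integral {s..t} (\<lambda>r. f (y r) r)"
    if t: "s \<le> t" for t
  proof -
    have 1: "(\<lambda>r. f (picard x s k r) r) integrable_on {s..t}" for k
      by (intro along_integrable(2) continuous_measurable_on continuous_picard)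
    have 2: "(\<lambda>r. K) integrable_on {s..t}" by (intro integrable_continuous_real continuous_intros)
    have 4: "(\<lambda>k. f (picard x s k r) r) \<longlonglongrightarrow> f (y r) r" if r: "r \<in> {s..t}" for r
    proof -
      have "continuous_on UNIV (\<lambda>x. f x r)"
      proof (rule lipschitz_on_continuous_on[of K], rule lipschitz_onI)
        show "dist (f u r) (f v r) \<le> K * dist u v" for u v using f_lip by (simp add: dist_norm)
      qed (use K_pos in simp)
      then show ?thesis
        using lim[of r] r by (auto intro: continuous_on_tendsto_compose[of UNIV "\<lambda>x. f x r"])
    qed
    note dom = dominated_convergence[OF 1 2 f_bound 4]
    have "(\<lambda>k. picard x s (Suc k) t) \<longlonglongrightarrow> x + integral {s..t} (\<lambda>r. f (y r) r)"
      using tendsto_add[OF tendsto_const dom(2)] by simp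
    moreover have "(\<lambda>k. picard x s (Suc k) t) \<longlonglongrightarrow> y t" using lim[OF t] by (rule LIMSEQ_Suc)
    ultimately show ?thesis using dom(1) LIMSEQ_unique by blast
  qed
  have "continuous_on {s..T} y"
  proof (cases "s \<le> T")
    case True
    then have "continuous_on {s..T} (\<lambda>t. x + integral {s..t} (\<lambda>r. f (y r) r))"
      using int by (intro continuous_intros indefinite_integral_continuous_1) auto
    then show ?thesis by (rule continuous_on_eq) (use int in auto)
  qed simp
  then have "is_characteristic T f x s y" unfolding is_characteristic_iff using int by simp
  then show ?thesis by blast
qed

text \<open>Gronwall's inequality forward in time gives Lipschitz dependence and uniqueness.
  Backward from t it gives the lower bound that makes the flow nonsingular.\<close>

lemma characteristics_diff:
  assumes y: "is_characteristic T f x s y" and z: "is_characteristic T f x' s z" and t: "t \<in> {s..T}"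
  shows "norm (y t - z t) \<le> 2 * norm (x - x') * exp (2 * K * (t - s))"
    and "norm (x - x') \<le> 2 * norm (y t - z t) * exp (2 * K * (t - s))"
proof -
  note yc = y[unfolded is_characteristic_iff] and zc = z[unfolded is_characteristic_iff]
  have dc: "continuous_on {s..T} (\<lambda>t. norm (y t - z t))" using yc zc by (intro continuous_intros) auto
  have ym: "y \<in> borel_measurable (lebesgue_on {a..b})" "z \<in> borel_measurable (lebesgue_on {a..b})"
    and di: "(\<lambda>t. norm (y t - z t)) integrable_on {a..b}"
    if "s \<le> a" "b \<le> T" for a b
    using yc zc that
    by (auto intro!: continuous_measurable_on integrable_continuous_real continuous_on_subset[OF dc]
        elim: continuous_on_subset)
  have "norm (y r - z r) \<le> norm (x - x') + K * integral {s..r} (\<lambda>t. norm (y t - z t))" if r: "r \<in> {s..T}" for r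
  proof -
    have "y r - z r = (x - x') + (integral {s..r} (\<lambda>r. f (y r) r) - integral {s..r} (\<lambda>r. f (z r) r))"
      using yc zc r by simp
    also have "norm \<dots> \<le> norm (x - x') + norm (integral {s..r} (\<lambda>r. f (y r) r) - integral {s..r} (\<lambda>r. f (z r) r))"
      by (rule norm_triangle_ineq)
    also have "norm (integral {s..r} (\<lambda>r. f (y r) r) - integral {s..r} (\<lambda>r. f (z r) r)) \<le>
        K * integral {s..r} (\<lambda>t. norm (y t - z t))"
      using r by (intro integral_diff_le ym di) auto
    finally show ?thesis by simp
  qed
  from gronwall[OF K_pos _ dc this t] show "norm (y t - z t) \<le> 2 * norm (x - x') * exp (2 * K * (t - s))" by simp
  have "norm (y r - z r) \<le> norm (y t - z t) + K * integral {r..t} (\<lambda>t. norm (y t - z t))" if r: "r \<in> {s..t}" for r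
  proof -
    have comb: "integral {s..t} (\<lambda>r. f (y r) r) = integral {s..r} (\<lambda>r. f (y r) r) + integral {r..t} (\<lambda>r. f (y r) r)"
      "integral {s..t} (\<lambda>r. f (z r) r) = integral {s..r} (\<lambda>r. f (z r) r) + integral {r..t} (\<lambda>r. f (z r) r)"
      using r t by (auto intro!: Henstock_Kurzweil_Integration.integral_combine[symmetric] along_integrable(2) ym)
    have "y t = y r + integral {r..t} (\<lambda>r. f (y r) r)" "z t = z r + integral {r..t} (\<lambda>r. f (z r) r)"
      using yc zc r t comb by (auto simp: algebra_simps)
    then have "y r - z r = (y t - z t) + (integral {r..t} (\<lambda>r. f (z r) r) - integral {r..t} (\<lambda>r. f (y r) r))"
      by simp
    also have "norm \<dots> \<le> norm (y t - z t) + norm (integral {r..t} (\<lambda>r. f (z r) r) - integral {r..t} (\<lambda>r. f (y r) r))"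
      by (rule norm_triangle_ineq)
    also have "norm (integral {r..t} (\<lambda>r. f (z r) r) - integral {r..t} (\<lambda>r. f (y r) r)) \<le>
        K * integral {r..t} (\<lambda>t. norm (y t - z t))"
      using r t by (intro integral_diff_le ym di) (auto simp: norm_minus_commute)
    finally show ?thesis by simp
  qed
  moreover have "continuous_on {s..t} (\<lambda>t. norm (y t - z t))"
    using t by (intro continuous_on_subset[OF dc]) auto
  ultimately have "norm (y s - z s) \<le> 2 * norm (y t - z t) * exp (2 * K * (t - s))"
    using t by (intro gronwall_backward[where D = "\<lambda>t. norm (y t - z t)", OF K_pos]) auto
  moreover have "y s = x" "z s = x'" using yc zc t by auto
  ultimately show "norm (x - x') \<le> 2 * norm (y t - z t) * exp (2 * K * (t - s))" by simp
qed

lemma characteristic_eq: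
  assumes "is_characteristic T f x s y" "t \<in> {s..T}"
  shows "characteristic T f x s t = y t"
  unfolding characteristic_def
proof (rule the_equality)
  show "\<exists>y'. is_characteristic T f x s y' \<and> y' t = y t" using assms(1) by blast
  show "z = y t" if "\<exists>y'. is_characteristic T f x s y' \<and> y' t = z" for z
    using that characteristics_diff(1)[OF assms(1) _ assms(2)] by fastforce
qed

lemma is_characteristic_mono: "is_characteristic T f x s y \<Longrightarrow> T' \<le> T \<Longrightarrow> is_characteristic T' f x s y"
  by (auto simp: is_characteristic_def)

text \<open>Using the end time itself as horizon removes T, and \<open>max\<close> freezes the flow
  at the identity for t \<le> s, so that it is defined and jointly continuous for all real s and
  t.\<close>

definition flow :: "real^'n \<Rightarrow> real \<Rightarrow> real \<Rightarrow> real^'n" where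
  "flow x s t = characteristic (max s t) f x s (max s t)"

lemma characteristic_flow:
  assumes "s \<le> t" "t \<le> T" shows "characteristic T f x s t = flow x s t"
proof -
  obtain y where y: "is_characteristic T f x s y" using characteristic_exists by blast
  have "characteristic T f x s t = y t" using y assms by (intro characteristic_eq) auto
  moreover have "flow x s t = y t"
    using characteristic_eq[OF is_characteristic_mono[OF y, of t], of t] assms by (simp add: flow_def max_def)
  ultimately show ?thesis by simp
qed

lemma is_characteristic_flow: "is_characteristic T f x s (flow x s)"
proof -
  obtain y where y: "is_characteristic T f x s y" using characteristic_exists by blast
  have "flow x s t = y t" if "t \<in> {s..T}" for t
    using characteristic_eq[OF y that] characteristic_flow[of s t T x] that by simp
  then have eq: "\<And>t. t \<in> {s..T} \<Longrightarrow> y t = flow x s t" by simp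
  have "continuous_on {s..T} y" using y unfolding is_characteristic_iff by simp
  then have "continuous_on {s..T} (flow x s)" by (rule continuous_on_eq) (rule eq)
  moreover have "integral {s..t} (\<lambda>r. f (y r) r) = integral {s..t} (\<lambda>r. f (flow x s r) r)" if "t \<in> {s..T}" for t
    using that by (intro integral_cong) (simp add: eq)
  ultimately show ?thesis using y eq unfolding is_characteristic_iff by simp
qed

lemma continuous_flow_time: "continuous_on {s..t} (flow x s)"
  using is_characteristic_flow[of t x s] by (simp add: is_characteristic_iff)

lemma flow_eq: "s \<le> t \<Longrightarrow> flow x s t = x + integral {s..t} (\<lambda>r. f (flow x s r) r)"
  using is_characteristic_flow[of t x s] by (simp add: is_characteristic_iff)

lemma flow_self: "t \<le> s \<Longrightarrow> flow x s t = x"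
proof -
  have "flow x s s = x" using flow_eq[of s s x] by simp
  then show "t \<le> s \<Longrightarrow> flow x s t = x" by (simp add: flow_def max_def)
qed

lemma flow_along_integrable:
  assumes "s \<le> a" shows "(\<lambda>r. f (flow x s r) r) integrable_on {a..b}"
  using assms continuous_flow_time[of s b x]
  by (intro along_integrable(2) continuous_measurable_on) (auto elim: continuous_on_subset)

lemma flow_diff_time:
  assumes "s \<le> t" "t \<le> t'"
  shows "flow x s t' - flow x s t = integral {t..t'} (\<lambda>r. f (flow x s r) r)"
proof -
  have "integral {s..t'} (\<lambda>r. f (flow x s r) r) =
      integral {s..t} (\<lambda>r. f (flow x s r) r) + integral {t..t'} (\<lambda>r. f (flow x s r) r)"
    using assms
    by (intro Henstock_Kurzweil_Integration.integral_combine[symmetric] flow_along_integrable) auto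
  then show ?thesis using flow_eq[of s t x] flow_eq[of s t' x] assms by simp
qed

lemma flow_step:
  assumes "s \<le> r" "r \<le> t"
  shows "flow x s t = flow (flow x s r) r t"
proof -
  have "is_characteristic t f (flow x s r) r (flow x s)"
    unfolding is_characteristic_iff
  proof (intro conjI ballI)
    show "continuous_on {r..t} (flow x s)"
      using continuous_on_subset[OF continuous_flow_time[of s t x]] assms by auto
    show "flow x s t' = flow x s r + integral {r..t'} (\<lambda>r. f (flow x s r) r)" if "t' \<in> {r..t}" for t'
      using flow_diff_time[of s r t' x] that assms by (simp add: algebra_simps)
  qed
  from characteristic_eq[OF this, of t] show ?thesis
    using characteristic_flow[of r t t "flow x s r"] assms by simp
qed

lemma flow_lip_time:
  "norm (flow x s t - flow x s t') \<le> K * \<bar>t - t'\<bar>"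
proof -
  have *: "norm (flow x s t' - flow x s t) \<le> K * (t' - t)" if "s \<le> t" "t \<le> t'" for t t'
  proof -
    have "norm (integral {t..t'} (\<lambda>r. f (flow x s r) r)) \<le> integral {t..t'} (\<lambda>r. K)"
      using that by (intro integral_norm_bound_integral flow_along_integrable) (auto simp: f_bound)
    then show ?thesis using flow_diff_time[OF that] that by (simp add: mult.commute)
  qed
  have **: "norm (flow x s t' - flow x s t) \<le> K * (t' - t)" if "t \<le> t'" for t t'
  proof (cases "s \<le> t")
    case False
    show ?thesis
    proof (cases "s \<le> t'")
      case True
      then have "norm (flow x s t' - flow x s s) \<le> K * (t' - s)" by (intro *) auto
      also have "\<dots> \<le> K * (t' - t)" using False K_pos by (intro mult_left_mono) auto
      finally show ?thesis using False by (simp add: flow_self)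
    qed (use False that K_pos in \<open>simp add: flow_self\<close>)
  qed (use * that in simp)
  show ?thesis using **[of t t'] **[of t' t] by (cases "t \<le> t'") (auto simp: norm_minus_commute)
qed

lemma flow_displacement: "norm (flow x s t - x) \<le> K * \<bar>t - s\<bar>"
  using flow_lip_time[of x s t s] by (simp add: flow_self)

lemma
  shows flow_lip: "norm (flow x s t - flow y s t) \<le> 2 * exp (2 * K * \<bar>t - s\<bar>) * norm (x - y)"
    and flow_lower_lip: "norm (x - y) \<le> 2 * exp (2 * K * \<bar>t - s\<bar>) * norm (flow x s t - flow y s t)"
proof -
  show "norm (flow x s t - flow y s t) \<le> 2 * exp (2 * K * \<bar>t - s\<bar>) * norm (x - y)"
  proof (cases "s \<le> t")
    case True
    then show ?thesis
      using characteristics_diff(1)[OF is_characteristic_flow is_characteristic_flow, of t s t x y]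
      by (simp add: mult_ac)
  next
    case False
    have "1 * norm (x - y) \<le> 2 * exp (2 * K * \<bar>t - s\<bar>) * norm (x - y)"
      using K_pos one_le_exp_iff[of "2 * K * \<bar>t - s\<bar>"] by (intro mult_right_mono) (auto intro: order_trans[of _ 2])
    then show ?thesis using False by (simp add: flow_self)
  qed
  show "norm (x - y) \<le> 2 * exp (2 * K * \<bar>t - s\<bar>) * norm (flow x s t - flow y s t)"
  proof (cases "s \<le> t")
    case True
    then show ?thesis
      using characteristics_diff(2)[OF is_characteristic_flow is_characteristic_flow, of t s t x y]
      by (simp add: mult_ac)
  next
    case False
    have "1 * norm (x - y) \<le> 2 * exp (2 * K * \<bar>t - s\<bar>) * norm (x - y)"
      using K_pos one_le_exp_iff[of "2 * K * \<bar>t - s\<bar>"] by (intro mult_right_mono) (auto intro: order_trans[of _ 2])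
    then show ?thesis using False by (simp add: flow_self)
  qed
qed

text \<open>Starting earlier, at s, amounts to starting at s' from \<open>flow x s s'\<close>, which
  is within K (s' - s) of x.\<close>

lemma flow_diff_start:
  assumes "s \<le> s'"
  shows "norm (flow x s t - flow x s' t) \<le> 2 * exp (2 * K * \<bar>t - s'\<bar>) * (K * (s' - s))"
proof (cases "s' \<le> t")
  case True
  have "flow x s t = flow (flow x s s') s' t" using assms True by (rule flow_step)
  then have "norm (flow x s t - flow x s' t) \<le> 2 * exp (2 * K * \<bar>t - s'\<bar>) * norm (flow x s s' - x)"
    using flow_lip by simp
  also have "\<dots> \<le> 2 * exp (2 * K * \<bar>t - s'\<bar>) * (K * (s' - s))"
    using flow_displacement[of x s s'] assms by (intro mult_left_mono) auto
  finally show ?thesis .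
next
  case False
  then have "norm (flow x s t - flow x s' t) = norm (flow x s t - flow x s s)" by (simp add: flow_self)
  also have "\<dots> \<le> 1 * (K * (s' - s))"
  proof (cases "s \<le> t")
    case True
    have "norm (flow x s t - flow x s s) \<le> K * \<bar>t - s\<bar>" by (rule flow_lip_time)
    also have "\<dots> \<le> K * (s' - s)" using True False K_pos by (intro mult_left_mono) auto
    finally show ?thesis by simp
  qed (use assms K_pos in \<open>simp add: flow_self\<close>)
  also have "\<dots> \<le> 2 * exp (2 * K * \<bar>t - s'\<bar>) * (K * (s' - s))"
    using K_pos assms one_le_exp_iff[of "2 * K * \<bar>t - s'\<bar>"] by (intro mult_right_mono) (auto intro: order_trans[of _ 2])
  finally show ?thesis .
qed

lemma continuous_flow: "continuous_on UNIV (\<lambda>(x, s, t). flow x s t)"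
  unfolding continuous_on_sequentially
proof (intro ballI allI impI, elim conjE)
  fix X :: "nat \<Rightarrow> (real^'n) \<times> real \<times> real" and a assume X: "X \<longlonglongrightarrow> a"
  obtain x s t where a: "a = (x, s, t)" by (cases a)
  define x' s' t' where "x' n = fst (X n)" and "s' n = fst (snd (X n))" and "t' n = snd (snd (X n))" for n
  have lim: "x' \<longlonglongrightarrow> x" "s' \<longlonglongrightarrow> s" "t' \<longlonglongrightarrow> t"
    unfolding x'_def s'_def t'_def
    using tendsto_fst[OF X] tendsto_fst[OF tendsto_snd[OF X]] tendsto_snd[OF tendsto_snd[OF X]] by (simp_all add: a)
  \<comment> \<open>The extra 1 in the exponent makes E a common Lipschitz constant for all start
    times within distance 1 of s.\<close>
  define E where "E = 2 * exp (2 * K * (\<bar>t - s\<bar> + 1))"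
  have "\<forall>\<^sub>F n in sequentially. dist (s' n) s < 1" using tendstoD[OF lim(2), of 1] by simp
  then have ev: "\<forall>\<^sub>F n in sequentially. norm (flow (x' n) (s' n) (t' n) - flow x s t)
      \<le> E * norm (x' n - x) + E * K * \<bar>s' n - s\<bar> + K * \<bar>t' n - t\<bar>"
  proof eventually_elim
    case (elim n)
    have E: "2 * exp (2 * K * \<bar>t - r\<bar>) \<le> E" if "\<bar>r - s\<bar> \<le> 1" for r
      using that K_pos by (auto simp: E_def intro!: mult_left_mono)
    have 1: "norm (flow (x' n) s t - flow x s t) \<le> E * norm (x' n - x)"
      using flow_lip[of "x' n" s t x] mult_right_mono[OF E[of s], of "norm (x' n - x)"] by simp
    have 2: "norm (flow (x' n) (s' n) t - flow (x' n) s t) \<le> E * K * \<bar>s' n - s\<bar>"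
    proof (cases "s \<le> s' n")
      case True
      have "norm (flow (x' n) s t - flow (x' n) (s' n) t) \<le> 2 * exp (2 * K * \<bar>t - s' n\<bar>) * (K * (s' n - s))"
        using True by (rule flow_diff_start)
      also have "\<dots> \<le> E * (K * (s' n - s))"
        using elim True K_pos by (intro mult_right_mono E) (auto simp: dist_real_def)
      finally show ?thesis using True by (simp add: norm_minus_commute)
    next
      case False
      have "norm (flow (x' n) (s' n) t - flow (x' n) s t) \<le> 2 * exp (2 * K * \<bar>t - s\<bar>) * (K * (s - s' n))"
        using False by (intro flow_diff_start) simp
      also have "\<dots> \<le> E * (K * (s - s' n))"
        using False K_pos by (intro mult_right_mono E) auto
      finally show ?thesis using False by simp
    qed
    have 3: "norm (flow (x' n) (s' n) (t' n) - flow (x' n) (s' n) t) \<le> K * \<bar>t' n - t\<bar>"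
      by (rule flow_lip_time)
    have "norm (flow (x' n) (s' n) (t' n) - flow x s t) \<le>
        norm (flow (x' n) (s' n) (t' n) - flow (x' n) (s' n) t) + norm (flow (x' n) (s' n) t - flow (x' n) s t)
        + norm (flow (x' n) s t - flow x s t)"
      using norm_triangle_ineq[of "flow (x' n) (s' n) (t' n) - flow (x' n) (s' n) t" "flow (x' n) (s' n) t - flow x s t"]
        norm_triangle_ineq[of "flow (x' n) (s' n) t - flow (x' n) s t" "flow (x' n) s t - flow x s t"] by simp
    then show ?case using 1 2 3 by linarith
  qed
  have "(\<lambda>n. E * norm (x' n - x) + E * K * \<bar>s' n - s\<bar> + K * \<bar>t' n - t\<bar>) \<longlonglongrightarrow>
      E * norm (x - x) + E * K * \<bar>s - s\<bar> + K * \<bar>t - t\<bar>"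
    by (intro tendsto_intros lim)
  then have "(\<lambda>n. E * norm (x' n - x) + E * K * \<bar>s' n - s\<bar> + K * \<bar>t' n - t\<bar>) \<longlonglongrightarrow> 0" by simp
  with ev have "(\<lambda>n. flow (x' n) (s' n) (t' n) - flow x s t) \<longlonglongrightarrow> 0"
    by (rule Lim_null_comparison)
  then have "(\<lambda>n. flow (x' n) (s' n) (t' n)) \<longlonglongrightarrow> flow x s t" by (simp only: LIM_zero_iff)
  then show "((\<lambda>(x, s, t). flow x s t) \<circ> X) \<longlonglongrightarrow> (case a of (x, s, t) \<Rightarrow> flow x s t)"
    by (simp add: a o_def x'_def s'_def t'_def case_prod_beta)
qed

lemma flow_tendsto:
  "(x' \<longlongrightarrow> x) F \<Longrightarrow> (s' \<longlongrightarrow> s) F \<Longrightarrow> (t' \<longlongrightarrow> t) F \<Longrightarrow> ((\<lambda>n. flow (x' n) (s' n) (t' n)) \<longlongrightarrow> flow x s t) F"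
  using continuous_on_tendsto_compose[OF continuous_flow, of "\<lambda>n. (x' n, s' n, t' n)" "(x, s, t)" F]
  by (simp add: tendsto_Pair)

text \<open>The constant of \<open>nonsingular_lower_lipschitz\<close> for the lower Lipschitz
  constant \<open>2 * exp (2 * K * r)\<close> of the flow over a time r.\<close>

definition flow_const :: "real \<Rightarrow> real" where
  "flow_const r = (2 * (2 * exp (2 * K * r)) * real CARD('n)) ^ CARD('n)"

lemma flow_nonsingular:
  assumes "\<bar>t - s\<bar> \<le> r"
  shows "nonsingular (flow_const r) (\<lambda>x. flow x s t)"
proof -
  have "continuous_on UNIV (\<lambda>x. flow x s t)"
    using continuous_on_compose2[OF continuous_flow, of UNIV "\<lambda>x. (x, s, t)"]
    by (simp add: continuous_on_Pair continuous_on_id continuous_on_const)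
  moreover have "norm (x - y) \<le> (2 * exp (2 * K * r)) * norm (flow x s t - flow y s t)" for x y
  proof -
    have "norm (x - y) \<le> 2 * exp (2 * K * \<bar>t - s\<bar>) * norm (flow x s t - flow y s t)"
      by (rule flow_lower_lip)
    also have "\<dots> \<le> (2 * exp (2 * K * r)) * norm (flow x s t - flow y s t)"
      using assms K_pos by (intro mult_right_mono) auto
    finally show ?thesis .
  qed
  ultimately have "nonsingular ((2 * (2 * exp (2 * K * r)) * real DIM(real^'n)) ^ DIM(real^'n)) (\<lambda>x. flow x s t)"
    by (rule nonsingular_lower_lipschitz) simp
  then show ?thesis by (simp add: flow_const_def)
qed

end

subsection \<open>Smooth approximation of Sobolev functions\<close>

text \<open>As in calculus, partial derivatives that are continuous give a total differential. The
  required continuity is that of the translates of \<open>w j\<close>, and the increment a is built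
  up one coordinate at a time.\<close>

lemma shift_l2_differentiable:
  fixes u :: "(real^'n::finite) l2"
  assumes w: "\<And>i. l2_deriv i u (w i)" and e: "\<epsilon> > 0"
  obtains d where "d > 0"
    "\<And>a. norm a < d \<Longrightarrow> norm (shift_l2 a u - u - (\<Sum>i\<in>UNIV. a $ i *\<^sub>R w i)) \<le> \<epsilon> * norm a"
proof -
  define cut where "cut S a = (\<chi> i. if i \<in> S then a $ i else 0)" for S and a :: "real^'n"
  have norm_cut: "norm (cut S a) \<le> norm a" for S a
    by (rule norm_le_componentwise_cart) (auto simp: cut_def)
  have main: "\<forall>\<epsilon>>0. \<exists>d>0. \<forall>a. norm a < d \<longrightarrow>
      norm (shift_l2 (cut S a) u - u - (\<Sum>i\<in>S. a $ i *\<^sub>R w i)) \<le> \<epsilon> * norm a" if "finite S" for S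
    using that
  proof (induction S)
    case empty
    have "cut {} a = 0" for a by (simp add: cut_def vec_eq_iff)
    then show ?case by (auto intro: exI[of _ 1])
  next
    case (insert j S)
    show ?case
    proof (intro allI impI)
      fix \<epsilon> :: real assume \<epsilon>: "\<epsilon> > 0"
      then have \<epsilon>3: "\<epsilon> / 3 > 0" by simp
      from insert.IH \<epsilon>3 obtain d1 where d1: "d1 > 0"
        "\<And>a. norm a < d1 \<Longrightarrow> norm (shift_l2 (cut S a) u - u - (\<Sum>i\<in>S. a $ i *\<^sub>R w i)) \<le> \<epsilon> / 3 * norm a"
        by blast
      have "\<forall>e>0. \<exists>d>0. \<forall>y. \<bar>y\<bar> < d \<longrightarrow> norm (shift_l2 (y *\<^sub>R axis j 1) u - u - y *\<^sub>R w j) \<le> e * \<bar>y\<bar>"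
        using w[of j, unfolded l2_deriv_def has_vector_derivative_def has_derivative_at_alt] by simp
      with \<epsilon>3 obtain d2 where d2: "d2 > 0"
        "\<And>h. \<bar>h\<bar> < d2 \<Longrightarrow> norm (shift_l2 (h *\<^sub>R axis j 1) u - u - h *\<^sub>R w j) \<le> \<epsilon> / 3 * \<bar>h\<bar>"
        by meson
      have "((\<lambda>a. shift_l2 a (w j)) \<longlongrightarrow> shift_l2 0 (w j)) (at 0)"
        by (intro tendsto_shift_l2 tendsto_ident_at)
      then have "((\<lambda>a. shift_l2 a (w j)) \<longlongrightarrow> w j) (at 0)" by simp
      from LIM_D[OF this \<epsilon>3] obtain d3 where d3: "d3 > 0"
        "\<And>a. a \<noteq> 0 \<Longrightarrow> norm a < d3 \<Longrightarrow> norm (shift_l2 a (w j) - w j) < \<epsilon> / 3" by auto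
      have "norm (shift_l2 (cut (insert j S) a) u - u - (\<Sum>i\<in>insert j S. a $ i *\<^sub>R w i)) \<le> \<epsilon> * norm a"
        if a: "norm a < Min {d1, d2, d3}" for a
      proof -
        define b where "b = cut S a"
        define h where "h = a $ j"
        have ha: "\<bar>h\<bar> \<le> norm a" unfolding h_def by (rule component_le_norm_cart)
        have "cut (insert j S) a = b + h *\<^sub>R axis j 1"
          using insert.hyps by (auto simp: b_def h_def cut_def vec_eq_iff axis_def)
        \<comment> \<open>Three errors, each at most \<epsilon> / 3 times norm a: the remainder in
          direction j, translated isometrically; the change of \<open>w j\<close> under the
          translation by b; and the remainder for the coordinates in S.\<close>
        then have "shift_l2 (cut (insert j S) a) u - u - (\<Sum>i\<in>insert j S. a $ i *\<^sub>R w i) =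
            shift_l2 b (shift_l2 (h *\<^sub>R axis j 1) u - u - h *\<^sub>R w j) + h *\<^sub>R (shift_l2 b (w j) - w j)
            + (shift_l2 b u - u - (\<Sum>i\<in>S. a $ i *\<^sub>R w i))"
          using insert.hyps
          by (simp add: shift_l2_simps shift_shift_l2 scaleR_diff_right h_def algebra_simps)
        also have "norm \<dots> \<le> norm (shift_l2 b (shift_l2 (h *\<^sub>R axis j 1) u - u - h *\<^sub>R w j))
            + norm (h *\<^sub>R (shift_l2 b (w j) - w j)) + norm (shift_l2 b u - u - (\<Sum>i\<in>S. a $ i *\<^sub>R w i))"
          by (intro order_trans[OF norm_triangle_ineq] add_right_mono norm_triangle_ineq)
        also have "norm (shift_l2 b (shift_l2 (h *\<^sub>R axis j 1) u - u - h *\<^sub>R w j)) \<le> \<epsilon> / 3 * norm a"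
        proof -
          have "norm (shift_l2 (h *\<^sub>R axis j 1) u - u - h *\<^sub>R w j) \<le> \<epsilon> / 3 * \<bar>h\<bar>"
            using ha a by (intro d2(2)) simp
          also have "\<dots> \<le> \<epsilon> / 3 * norm a" using ha \<epsilon> by (intro mult_left_mono) auto
          finally show ?thesis by simp
        qed
        also have "norm (h *\<^sub>R (shift_l2 b (w j) - w j)) \<le> norm a * (\<epsilon> / 3)"
        proof -
          have "norm b < d3" using norm_cut[of S a] a by (simp add: b_def)
          then have "norm (shift_l2 b (w j) - w j) \<le> \<epsilon> / 3"
            using d3(2)[of b] \<epsilon> by (cases "b = 0") auto
          then show ?thesis using ha unfolding norm_scaleR real_norm_def by (intro mult_mono) auto
        qed
        also have "norm (shift_l2 b u - u - (\<Sum>i\<in>S. a $ i *\<^sub>R w i)) \<le> \<epsilon> / 3 * norm a"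
          using d1(2)[of a] a by (simp add: b_def)
        finally show ?thesis by (simp add: algebra_simps)
      qed
      then show "\<exists>d>0. \<forall>a. norm a < d \<longrightarrow>
          norm (shift_l2 (cut (insert j S) a) u - u - (\<Sum>i\<in>insert j S. a $ i *\<^sub>R w i)) \<le> \<epsilon> * norm a"
        using d1(1) d2(1) d3(1) by (intro exI[of _ "Min {d1, d2, d3}"]) auto
    qed
  qed
  have "cut UNIV a = a" for a by (simp add: cut_def vec_eq_iff)
  then show ?thesis using main[of UNIV] e that by auto
qed

text \<open>A C^1 function with gradient g whose first-order remainder is uniform in x. The
  uniformity allows integrating the expansion over space.\<close>

definition C1_l2 :: "(real^'n::finite \<Rightarrow> real) \<Rightarrow> (real^'n \<Rightarrow> real^'n) \<Rightarrow> bool" where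
  "C1_l2 G g \<longleftrightarrow> continuous_on UNIV G \<and> continuous_on UNIV g \<and> square_integrable G \<and>
    (\<forall>i. square_integrable (\<lambda>x. g x $ i)) \<and> (\<exists>B. \<forall>x. norm (g x) \<le> B) \<and>
    (\<forall>\<epsilon>>0. \<exists>d>0. \<forall>x a. norm a < d \<longrightarrow> \<bar>G (x + a) - G x - inner a (g x)\<bar> \<le> \<epsilon> * norm a)"

text \<open>G averages u over balls of radius d. Cauchy-Schwarz for the probability density \<eta>
  and Tonelli's theorem bound the squared error by the average of the squared norms of the
  translation differences. The kernel need not be smooth, since differentiability of G will come
  from that of u.\<close>

lemma mollify_l2:
  fixes u :: "(real^'n::finite) l2"
  assumes d: "d > 0" and shift: "\<And>z. norm z < d \<Longrightarrow> norm (shift_l2 z u - u) \<le> \<epsilon>" and \<epsilon>: "0 \<le> \<epsilon>"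
  defines "\<eta> \<equiv> (\<lambda>x::real^'n. (1 / measure lborel (ball (0::real^'n) d)) * indicator (ball 0 d) x)"
  defines "G \<equiv> (\<lambda>x. inner (shift_l2 x u) (abs_l2 \<eta>))"
  shows "square_integrable \<eta>" "square_integrable G" "norm (abs_l2 G - u) \<le> \<epsilon>"
proof -
  define m where "m = measure lborel (ball (0::real^'n) d)"
  have m: "m > 0" using d by (simp add: m_def content_ball_pos)
  show s\<eta>: "square_integrable \<eta>" unfolding \<eta>_def by (rule square_integrable_ball)
  have \<eta>0: "\<eta> z \<ge> 0" for z using m by (simp add: \<eta>_def m_def)
  have \<eta>m [measurable]: "\<eta> \<in> borel_measurable borel" unfolding \<eta>_def
    by (intro borel_measurable_times borel_measurable_const borel_measurable_indicator) simp
  have \<eta>1: "(\<integral>\<^sup>+z. ennreal (\<eta> z) \<partial>lborel) = 1"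
  proof -
    have "(\<integral>\<^sup>+z. ennreal (\<eta> z) \<partial>lborel) = (\<integral>\<^sup>+z. ennreal (1 / m) * indicator (ball (0::real^'n) d) z \<partial>lborel)"
      by (intro nn_integral_cong) (auto simp: \<eta>_def m_def indicator_def)
    also have "\<dots> = ennreal (1 / m) * emeasure lborel (ball (0::real^'n) d)"
      by (subst nn_integral_cmult_indicator) auto
    also have "emeasure lborel (ball (0::real^'n) d) = ennreal m"
      using emeasure_lborel_ball_finite[of "0::real^'n" d] by (simp add: m_def emeasure_eq_ennreal_measure)
    also have "ennreal (1 / m) * ennreal m = 1" using m by (simp flip: ennreal_mult)
    finally show ?thesis .
  qed
  have \<eta>i: "integrable lborel \<eta>" "(LINT z|lborel. \<eta> z) = 1"
    using \<eta>1 \<eta>0 by (auto intro!: integrableI_nonneg simp: integral_eq_nn_integral)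
  obtain g where g [measurable]: "g \<in> borel_measurable borel" and sg: "square_integrable g" and gu: "abs_l2 g = u"
    using l2_borel_rep by blast
  have contG: "continuous_on UNIV G"
    unfolding G_def by (intro continuous_intros continuous_shift_l2)
  have Gm [measurable]: "G \<in> borel_measurable borel" using contG by (rule borel_measurable_continuous_onI)
  have prod_int: "integrable lborel (\<lambda>z. \<eta> z * g (z + x))" and G_eq: "G x = (LINT z|lborel. \<eta> z * g (z + x))" for x
  proof -
    have sx: "square_integrable (\<lambda>z. g (z + x))" by (rule square_integrable_shift[OF sg])
    have mm: "(\<lambda>z. \<eta> z * g (z + x)) \<in> borel_measurable lborel" by measurable
    have "integrable lebesgue (\<lambda>z. \<eta> z * g (z + x))" by (rule square_integrable_mult[OF s\<eta> sx])
    then show "integrable lborel (\<lambda>z. \<eta> z * g (z + x))" using mm by (simp add: integrable_completion)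
    have "G x = (LINT z|lebesgue. g (z + x) * \<eta> z)"
      unfolding G_def gu[symmetric] shift_abs_l2[OF sg] by (rule inner_abs_l2[OF sx s\<eta>])
    also have "\<dots> = (LINT z|lborel. \<eta> z * g (z + x))"
      using mm by (subst integral_completion) (simp_all add: mult.commute)
    finally show "G x = (LINT z|lborel. \<eta> z * g (z + x))" .
  qed
  have point: "ennreal ((G x - g x)\<^sup>2) \<le> (\<integral>\<^sup>+z. ennreal (\<eta> z * (g (z + x) - g x)\<^sup>2) \<partial>lborel)" for x
  proof -
    have i: "integrable lborel (\<lambda>z. \<eta> z * (g (z + x) - g x))"
      using prod_int[of x] \<eta>i(1) by (simp add: right_diff_distrib)
    have "G x - g x = (LINT z|lborel. \<eta> z * g (z + x)) - (LINT z|lborel. \<eta> z * g x)"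
      using \<eta>i by (simp add: G_eq)
    also have "\<dots> = (LINT z|lborel. \<eta> z * (g (z + x) - g x))"
      using prod_int[of x] \<eta>i(1) by (simp add: right_diff_distrib)
    finally have "ennreal \<bar>G x - g x\<bar> \<le> (\<integral>\<^sup>+z. ennreal \<bar>\<eta> z * (g (z + x) - g x)\<bar> \<partial>lborel)"
      using integral_norm_bound_ennreal[OF i] by simp
    \<comment> \<open>The density is split into two square roots for Cauchy-Schwarz: the first
      factor integrates to 1, the second yields the average of squares.\<close>
    also have "\<dots> = (\<integral>\<^sup>+z. ennreal (sqrt (\<eta> z)) * ennreal (sqrt (\<eta> z) * \<bar>g (z + x) - g x\<bar>) \<partial>lborel)"
    proof (rule nn_integral_cong)
      fix z
      have "\<bar>\<eta> z * (g (z + x) - g x)\<bar> = sqrt (\<eta> z) * (sqrt (\<eta> z) * \<bar>g (z + x) - g x\<bar>)"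
        using \<eta>0[of z] by (simp add: abs_mult mult.assoc[symmetric])
      then show "ennreal \<bar>\<eta> z * (g (z + x) - g x)\<bar> =
          ennreal (sqrt (\<eta> z)) * ennreal (sqrt (\<eta> z) * \<bar>g (z + x) - g x\<bar>)"
        using \<eta>0[of z] by (simp add: ennreal_mult)
    qed
    finally have "(ennreal \<bar>G x - g x\<bar>)\<^sup>2 \<le>
        (\<integral>\<^sup>+z. ennreal (sqrt (\<eta> z)) * ennreal (sqrt (\<eta> z) * \<bar>g (z + x) - g x\<bar>) \<partial>lborel)\<^sup>2"
      by (rule power_mono) simp
    also have "\<dots> \<le> (\<integral>\<^sup>+z. (ennreal (sqrt (\<eta> z)))\<^sup>2 \<partial>lborel) *
        (\<integral>\<^sup>+z. (ennreal (sqrt (\<eta> z) * \<bar>g (z + x) - g x\<bar>))\<^sup>2 \<partial>lborel)"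
      by (rule Cauchy_Schwarz_nn_integral) measurable
    also have "(\<integral>\<^sup>+z. (ennreal (sqrt (\<eta> z)))\<^sup>2 \<partial>lborel) = 1"
      using \<eta>0 \<eta>1 by (simp add: ennreal_power)
    also have "(\<integral>\<^sup>+z. (ennreal (sqrt (\<eta> z) * \<bar>g (z + x) - g x\<bar>))\<^sup>2 \<partial>lborel) =
        (\<integral>\<^sup>+z. ennreal (\<eta> z * (g (z + x) - g x)\<^sup>2) \<partial>lborel)"
      using \<eta>0 by (intro nn_integral_cong) (simp add: ennreal_power power_mult_distrib)
    finally show ?thesis by (simp add: ennreal_power)
  qed
  have "(\<integral>\<^sup>+x. ennreal ((G x - g x)\<^sup>2) \<partial>lborel) \<le>
      (\<integral>\<^sup>+x. \<integral>\<^sup>+z. ennreal (\<eta> z * (g (z + x) - g x)\<^sup>2) \<partial>lborel \<partial>lborel)"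
    by (rule nn_integral_mono) (rule point)
  also have "\<dots> = (\<integral>\<^sup>+z. \<integral>\<^sup>+x. ennreal (\<eta> z * (g (z + x) - g x)\<^sup>2) \<partial>lborel \<partial>lborel)"
    by (rule lborel_pair.Fubini') measurable
  also have "\<dots> \<le> (\<integral>\<^sup>+z. ennreal (\<eta> z) * ennreal (\<epsilon>\<^sup>2) \<partial>lborel)"
  proof (rule nn_integral_mono)
    fix z
    show "(\<integral>\<^sup>+x. ennreal (\<eta> z * (g (z + x) - g x)\<^sup>2) \<partial>lborel) \<le> ennreal (\<eta> z) * ennreal (\<epsilon>\<^sup>2)"
    proof (cases "norm z < d")
      case True
      have sx: "square_integrable (\<lambda>x. g (x + z))" by (rule square_integrable_shift[OF sg])
      have "(\<integral>\<^sup>+x. ennreal ((g (z + x) - g x)\<^sup>2) \<partial>lborel) = ennreal ((norm (shift_l2 z u - u))\<^sup>2)"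
        using nn_integral_l2[OF square_integrable_diff[OF sx sg]]
        unfolding abs_l2_diff[OF sx sg] gu[symmetric] shift_abs_l2[OF sg, symmetric]
        by (simp add: nn_integral_completion add.commute)
      also have "\<dots> \<le> ennreal (\<epsilon>\<^sup>2)" using shift[OF True] by (intro ennreal_leI power_mono) auto
      finally have "ennreal (\<eta> z) * (\<integral>\<^sup>+x. ennreal ((g (z + x) - g x)\<^sup>2) \<partial>lborel) \<le> ennreal (\<eta> z) * ennreal (\<epsilon>\<^sup>2)"
        by (rule mult_left_mono) simp
      then show ?thesis
        using \<eta>0[of z] by (subst (asm) nn_integral_cmult[symmetric]) (auto simp: ennreal_mult)
    qed (simp add: \<eta>_def)
  qed
  also have "\<dots> = ennreal (\<epsilon>\<^sup>2)" by (subst nn_integral_multc) (auto simp: \<eta>1)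
  finally have le: "(\<integral>\<^sup>+x. ennreal ((G x - g x)\<^sup>2) \<partial>lebesgue) \<le> ennreal (\<epsilon>\<^sup>2)"
    by (simp add: nn_integral_completion)
  have dm: "(\<lambda>x. G x - g x) \<in> borel_measurable lebesgue"
    by (intro measurable_completion) measurable
  have sd: "square_integrable (\<lambda>x. G x - g x)"
    using le_less_trans[OF le] by (intro square_integrableI_nn[OF dm]) auto
  from square_integrable_add[OF this sg] show sG: "square_integrable G" by simp
  show "norm (abs_l2 G - u) \<le> \<epsilon>"
    using norm_l2_leI_nn[OF sd le \<epsilon>] by (simp add: abs_l2_diff sG sg gu)
qed

text \<open>Averaging commutes with translations, so averaging u and its derivatives with the same
  kernel gives a function together with its gradient. The remainder is uniform in x because
  translations are isometries.\<close>

lemma H1_approx: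
  fixes u :: "(real^'n::finite) l2"
  assumes w: "\<And>i. l2_deriv i u (w i)" and e: "e > 0"
  obtains G g where "C1_l2 G g" "norm (abs_l2 G - u) \<le> e" "\<And>i. norm (abs_l2 (\<lambda>x. g x $ i) - w i) \<le> e"
proof -
  have near: "\<exists>d>0. \<forall>z. norm z < d \<longrightarrow> norm (shift_l2 z v - v) \<le> e" for v :: "(real^'n) l2"
  proof -
    have "((\<lambda>a. shift_l2 a v) \<longlongrightarrow> shift_l2 0 v) (at 0)"
      by (intro tendsto_shift_l2 tendsto_ident_at)
    then have "((\<lambda>a. shift_l2 a v) \<longlongrightarrow> v) (at 0)" by simp
    from LIM_D[OF this e] obtain d where d: "d > 0"
      "\<And>a. a \<noteq> 0 \<Longrightarrow> norm a < d \<Longrightarrow> norm (shift_l2 a v - v) < e" by auto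
    have "norm (shift_l2 z v - v) \<le> e" if "norm z < d" for z
      using d(2)[of z] that e by (cases "z = 0") auto
    then show ?thesis using d(1) by blast
  qed
  obtain du where du: "du > 0" "\<And>z. norm z < du \<Longrightarrow> norm (shift_l2 z u - u) \<le> e" using near by blast
  have "\<forall>i. \<exists>d>0. \<forall>z. norm z < d \<longrightarrow> norm (shift_l2 z (w i) - w i) \<le> e" using near by blast
  then obtain dw where dw: "\<And>i. dw i > 0" "\<And>i z. norm z < dw i \<Longrightarrow> norm (shift_l2 z (w i) - w i) \<le> e" by metis
  define d where "d = Min (insert du (range dw))"
  have d: "d > 0" "d \<le> du" using du(1) dw(1) by (auto simp: d_def)
  have d': "d \<le> dw i" for i unfolding d_def by (rule Min_le) auto
  define \<eta> where "\<eta> = (\<lambda>x::real^'n. (1 / measure lborel (ball (0::real^'n) d)) * indicator (ball 0 d) x)"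
  define G where "G x = inner (shift_l2 x u) (abs_l2 \<eta>)" for x
  define g where "g x = (\<chi> i. inner (shift_l2 x (w i)) (abs_l2 \<eta>))" for x
  have mu: "square_integrable G" "norm (abs_l2 G - u) \<le> e"
    using mollify_l2(2,3)[of d u e] d du(2) e unfolding G_def[abs_def] \<eta>_def by auto
  have mw: "square_integrable (\<lambda>x. g x $ i)" "norm (abs_l2 (\<lambda>x. g x $ i) - w i) \<le> e" for i
    using mollify_l2(2,3)[of d "w i" e] d d' dw(2) e unfolding g_def \<eta>_def by (auto intro: less_le_trans)
  have rem: "\<exists>\<delta>>0. \<forall>x a. norm a < \<delta> \<longrightarrow> \<bar>G (x + a) - G x - inner a (g x)\<bar> \<le> \<epsilon> * norm a" if \<epsilon>: "\<epsilon> > 0" for \<epsilon>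
  proof -
    define N where "N = norm (abs_l2 \<eta>) + 1"
    have N: "N > 0" by (simp add: N_def add_nonneg_pos)
    then have "\<epsilon> / N > 0" using \<epsilon> by simp
    from shift_l2_differentiable[OF w this] obtain \<delta> where \<delta>: "\<delta> > 0"
      "\<And>a. norm a < \<delta> \<Longrightarrow> norm (shift_l2 a u - u - (\<Sum>i\<in>UNIV. a $ i *\<^sub>R w i)) \<le> \<epsilon> / N * norm a" by blast
    have "\<bar>G (x + a) - G x - inner a (g x)\<bar> \<le> \<epsilon> * norm a" if a: "norm a < \<delta>" for x a
    proof -
      have "G (x + a) - G x - inner a (g x) = inner (shift_l2 x (shift_l2 a u - u - (\<Sum>i\<in>UNIV. a $ i *\<^sub>R w i))) (abs_l2 \<eta>)"
        by (simp add: G_def g_def shift_l2_simps shift_shift_l2 inner_diff_left inner_vec_def inner_sum_left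
            linear_sum[OF bounded_linear.linear[OF bounded_linear_shift_l2]])
      also have "\<bar>\<dots>\<bar> \<le> norm (shift_l2 x (shift_l2 a u - u - (\<Sum>i\<in>UNIV. a $ i *\<^sub>R w i))) * norm (abs_l2 \<eta>)"
        by (rule Cauchy_Schwarz_ineq2)
      also have "\<dots> \<le> (\<epsilon> / N * norm a) * N"
        using \<delta>(2)[OF a] N \<epsilon> by (intro mult_mono) (auto simp: N_def)
      also have "\<dots> = \<epsilon> * norm a" using N by simp
      finally show ?thesis .
    qed
    then show ?thesis using \<delta>(1) by blast
  qed
  have "continuous_on UNIV G" unfolding G_def by (intro continuous_intros continuous_shift_l2)
  moreover have "continuous_on UNIV g"
    unfolding g_def by (intro continuous_intros continuous_shift_l2)
  moreover have "norm (g x) \<le> (\<Sum>i\<in>UNIV. norm (w i) * norm (abs_l2 \<eta>))" for x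
  proof -
    have "norm (g x) \<le> (\<Sum>i\<in>UNIV. \<bar>g x $ i\<bar>)" by (rule norm_le_l1_cart)
    also have "\<dots> \<le> (\<Sum>i\<in>UNIV. norm (w i) * norm (abs_l2 \<eta>))"
      unfolding g_def
      by (intro sum_mono) (use Cauchy_Schwarz_ineq2[of "shift_l2 x (w _)" "abs_l2 \<eta>"] in simp)
    finally show ?thesis .
  qed
  ultimately have "C1_l2 G g"
    unfolding C1_l2_def using mu(1) mw(1) rem by blast
  then show ?thesis using that mu(2) mw(2) by blast
qed

lemma norm_abs_l2_abs:
  assumes "square_integrable k"
  shows "square_integrable (\<lambda>x. \<bar>k x\<bar>)" "norm (abs_l2 (\<lambda>x. \<bar>k x\<bar>)) = norm (abs_l2 k)"
proof -
  show s: "square_integrable (\<lambda>x. \<bar>k x\<bar>)" using assms by (auto simp: square_integrable_def)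
  show "norm (abs_l2 (\<lambda>x. \<bar>k x\<bar>)) = norm (abs_l2 k)" by (simp add: norm_abs_l2 s assms)
qed

lemma integral_abs_mult_le:
  assumes "square_integrable k" "square_integrable l"
  shows "integrable lebesgue (\<lambda>x. \<bar>k x\<bar> * \<bar>l x\<bar>)"
    and "(LINT x|lebesgue. \<bar>k x\<bar> * \<bar>l x\<bar>) \<le> norm (abs_l2 k) * norm (abs_l2 l)"
proof -
  note k = norm_abs_l2_abs[OF assms(1)] and l = norm_abs_l2_abs[OF assms(2)]
  show "integrable lebesgue (\<lambda>x. \<bar>k x\<bar> * \<bar>l x\<bar>)" by (rule square_integrable_mult[OF k(1) l(1)])
  show "(LINT x|lebesgue. \<bar>k x\<bar> * \<bar>l x\<bar>) \<le> norm (abs_l2 k) * norm (abs_l2 l)"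
    using norm_cauchy_schwarz[of "abs_l2 (\<lambda>x. \<bar>k x\<bar>)" "abs_l2 (\<lambda>x. \<bar>l x\<bar>)"]
    by (simp add: inner_abs_l2 k l)
qed

lemma integrable_test: "test_function \<psi> \<Longrightarrow> integrable lebesgue (\<lambda>x. \<bar>\<psi> x\<bar>)"
proof -
  assume \<psi>: "test_function \<psi>"
  obtain r where r: "r > 0" "\<And>x. \<psi> x \<noteq> 0 \<Longrightarrow> norm x < r" using test_function_supp[OF \<psi>] by blast
  have "integrable lebesgue (\<lambda>x. \<bar>\<psi> x\<bar> * \<bar>1 * indicator (ball 0 r) x\<bar>)"
    by (rule integral_abs_mult_le(1)[OF square_integrable_test[OF \<psi>] square_integrable_ball])
  moreover have "(\<lambda>x. \<bar>\<psi> x\<bar> * \<bar>1 * indicator (ball 0 r) x\<bar>) = (\<lambda>x. \<bar>\<psi> x\<bar>)"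
    using r(2) by (auto simp: indicator_def fun_eq_iff)
  ultimately show ?thesis by (simp only:)
qed

text \<open>
  Only first-order expansions along \<open>\<Psi>\<close> enter, so \<open>\<Psi>\<close> need not be differentiable.
\<close>

lemma comp_C1_weak_bound:
  fixes \<Psi> :: "real^'n::finite \<Rightarrow> real^'n"
  assumes ns: "nonsingular C \<Psi>" and lip: "\<And>x y. norm (\<Psi> x - \<Psi> y) \<le> L * norm (x - y)"
    and G: "C1_l2 G g" and \<psi>: "test_function \<psi>"
  shows "\<bar>inner (comp_l2 \<Psi> (abs_l2 G)) (abs_l2 (partial_deriv i \<psi>))\<bar> \<le>
    L * sqrt C * (\<Sum>j\<in>UNIV. norm (abs_l2 (\<lambda>x. g x $ j))) * norm (abs_l2 \<psi>)"
proof -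
  define e :: "real^'n" where "e = axis i 1"
  have ne: "norm e = 1" by (simp add: e_def)
  have L: "L \<ge> 0" using lip[of e 0] ne by (smt (verit) norm_ge_zero diff_zero mult_cancel_left2)
  have sG: "square_integrable G" and sg: "\<And>j. square_integrable (\<lambda>x. g x $ j)" using G by (auto simp: C1_l2_def)
  note s\<psi> = square_integrable_test[OF \<psi>]
  have sv: "square_integrable (\<lambda>x. G (\<Psi> x))" and sgj: "square_integrable (\<lambda>x. g (\<Psi> x) $ j)" for j
    using nonsingular_square_integrable(1)[OF ns sG] nonsingular_square_integrable(1)[OF ns sg[of j]] by auto
  define v where "v = abs_l2 (\<lambda>x. G (\<Psi> x))"
  have vc: "comp_l2 \<Psi> (abs_l2 G) = v" by (simp add: v_def comp_abs_l2[OF ns sG])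
  define D where "D = (\<Sum>j\<in>UNIV. norm (abs_l2 (\<lambda>x. g (\<Psi> x) $ j)))"
  define N where "N = (LINT x|lebesgue. \<bar>\<psi> x\<bar>)"
  \<comment> \<open>The derivative of r at 0 is minus the pairing to be estimated, so it suffices to
    bound the difference quotients of r, in which only values of G along \<open>\<Psi>\<close>
    occur.\<close>
  define r where "r h = inner (shift_l2 (h *\<^sub>R e) v) (abs_l2 \<psi>)" for h
  have "((\<lambda>h. inner v (shift_l2 (h *\<^sub>R e) (abs_l2 \<psi>))) has_real_derivative inner v (abs_l2 (partial_deriv i \<psi>))) (at (- 0))"
    using bounded_linear.has_vector_derivative[OF bounded_linear_inner_right l2_deriv_test[OF \<psi>, of i, unfolded l2_deriv_def], of v]
    by (simp add: has_real_derivative_iff_has_vector_derivative e_def)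
  from DERIV_chain2[OF this DERIV_minus[OF DERIV_ident]]
  have rd: "(r has_real_derivative - inner v (abs_l2 (partial_deriv i \<psi>))) (at 0)"
    by (simp add: r_def[abs_def] inner_shift_l2)
  \<comment> \<open>The remainder of G brings in N, the integral of \<bar>\<psi>\<bar>, which the
    norm of \<psi> does not control; this term disappears as \<epsilon> tends to 0.\<close>
  have bound: "\<bar>inner v (abs_l2 (partial_deriv i \<psi>))\<bar> \<le> L * (D * norm (abs_l2 \<psi>)) + \<epsilon> * (L * N)" if \<epsilon>: "\<epsilon> > 0" for \<epsilon>
  proof -
    obtain d where d: "d > 0" "\<And>x a. norm a < d \<Longrightarrow> \<bar>G (x + a) - G x - inner a (g x)\<bar> \<le> \<epsilon> * norm a"
      using G \<epsilon> unfolding C1_l2_def by blast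
    have rh: "\<bar>r h - r 0\<bar> \<le> \<bar>h\<bar> * (L * (D * norm (abs_l2 \<psi>)) + \<epsilon> * (L * N))" if h: "\<bar>h\<bar> < d / (L + 1)" for h
    proof -
      have point: "\<bar>(G (\<Psi> (x + h *\<^sub>R e)) - G (\<Psi> x)) * \<psi> x\<bar> \<le>
          \<bar>h\<bar> * (L * (\<Sum>j\<in>UNIV. \<bar>g (\<Psi> x) $ j\<bar> * \<bar>\<psi> x\<bar>) + \<epsilon> * (L * \<bar>\<psi> x\<bar>))" for x
      proof -
        define a where "a = \<Psi> (x + h *\<^sub>R e) - \<Psi> x"
        have a: "norm a \<le> L * \<bar>h\<bar>" using lip[of "x + h *\<^sub>R e" x] by (simp add: a_def ne)
        also have "\<dots> \<le> (L + 1) * \<bar>h\<bar>" by (intro mult_right_mono) auto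
        also have "\<dots> < d" using h L by (simp add: field_simps)
        finally have "\<bar>G (\<Psi> x + a) - G (\<Psi> x) - inner a (g (\<Psi> x))\<bar> \<le> \<epsilon> * norm a" by (rule d(2))
        then have "\<bar>G (\<Psi> x + a) - G (\<Psi> x)\<bar> \<le> norm a * norm (g (\<Psi> x)) + \<epsilon> * norm a"
          using Cauchy_Schwarz_ineq2[of a "g (\<Psi> x)"] by linarith
        also have "\<dots> \<le> (L * \<bar>h\<bar>) * (\<Sum>j\<in>UNIV. \<bar>g (\<Psi> x) $ j\<bar>) + \<epsilon> * (L * \<bar>h\<bar>)"
          using a \<epsilon> L norm_le_l1_cart[of "g (\<Psi> x)"] by (intro add_mono mult_mono mult_left_mono) auto
        finally have "\<bar>G (\<Psi> x + a) - G (\<Psi> x)\<bar> * \<bar>\<psi> x\<bar> \<le>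
            ((L * \<bar>h\<bar>) * (\<Sum>j\<in>UNIV. \<bar>g (\<Psi> x) $ j\<bar>) + \<epsilon> * (L * \<bar>h\<bar>)) * \<bar>\<psi> x\<bar>"
          by (rule mult_right_mono) simp
        then show ?thesis
          unfolding abs_mult by (simp add: a_def algebra_simps sum_distrib_left sum_distrib_right)
      qed
      have ij: "integrable lebesgue (\<lambda>x. \<bar>g (\<Psi> x) $ j\<bar> * \<bar>\<psi> x\<bar>)" for j
        by (rule integral_abs_mult_le(1)[OF sgj s\<psi>])
      have sh: "square_integrable (\<lambda>x. G (\<Psi> (x + h *\<^sub>R e)))"
        using square_integrable_shift[OF sv] by simp
      have sdiff: "square_integrable (\<lambda>x. G (\<Psi> (x + h *\<^sub>R e)) - G (\<Psi> x))" by (rule square_integrable_diff[OF sh sv])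
      have "r h - r 0 = inner (abs_l2 (\<lambda>x. G (\<Psi> (x + h *\<^sub>R e)) - G (\<Psi> x))) (abs_l2 \<psi>)"
        by (simp add: r_def inner_diff_left v_def shift_abs_l2[OF sv] abs_l2_diff[OF sh sv])
      also have "\<dots> = (LINT x|lebesgue. (G (\<Psi> (x + h *\<^sub>R e)) - G (\<Psi> x)) * \<psi> x)"
        by (rule inner_abs_l2[OF sdiff s\<psi>])
      finally have "\<bar>r h - r 0\<bar> \<le> (LINT x|lebesgue. \<bar>(G (\<Psi> (x + h *\<^sub>R e)) - G (\<Psi> x)) * \<psi> x\<bar>)"
        using integral_norm_bound[of lebesgue "\<lambda>x. (G (\<Psi> (x + h *\<^sub>R e)) - G (\<Psi> x)) * \<psi> x"] by simp
      also have "\<dots> \<le> (LINT x|lebesgue. \<bar>h\<bar> * (L * (\<Sum>j\<in>UNIV. \<bar>g (\<Psi> x) $ j\<bar> * \<bar>\<psi> x\<bar>) + \<epsilon> * (L * \<bar>\<psi> x\<bar>)))"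
      proof (rule integral_mono)
        show "integrable lebesgue (\<lambda>x. \<bar>(G (\<Psi> (x + h *\<^sub>R e)) - G (\<Psi> x)) * \<psi> x\<bar>)"
          by (intro integrable_abs square_integrable_mult sdiff s\<psi>)
        show "integrable lebesgue (\<lambda>x. \<bar>h\<bar> * (L * (\<Sum>j\<in>UNIV. \<bar>g (\<Psi> x) $ j\<bar> * \<bar>\<psi> x\<bar>) + \<epsilon> * (L * \<bar>\<psi> x\<bar>)))"
          by (intro integrable_mult_right Bochner_Integration.integrable_add Bochner_Integration.integrable_sum ij integrable_test[OF \<psi>])
      qed (rule point)
      also have "\<dots> = \<bar>h\<bar> * (L * (\<Sum>j\<in>UNIV. (LINT x|lebesgue. \<bar>g (\<Psi> x) $ j\<bar> * \<bar>\<psi> x\<bar>)) + \<epsilon> * (L * N))"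
        using ij integrable_test[OF \<psi>] by (simp add: N_def Bochner_Integration.integral_add Bochner_Integration.integral_sum)
      also have "\<dots> \<le> \<bar>h\<bar> * (L * (\<Sum>j\<in>UNIV. norm (abs_l2 (\<lambda>x. g (\<Psi> x) $ j)) * norm (abs_l2 \<psi>)) + \<epsilon> * (L * N))"
        using L by (intro mult_left_mono add_right_mono sum_mono integral_abs_mult_le(2) sgj s\<psi>) auto
      finally show ?thesis by (simp add: D_def sum_distrib_right)
    qed
    have "((\<lambda>h. \<bar>(r h - r 0) / h\<bar>) \<longlongrightarrow> \<bar>- inner v (abs_l2 (partial_deriv i \<psi>))\<bar>) (at 0)"
      using rd by (intro tendsto_rabs) (simp add: DERIV_def)
    moreover have "\<forall>\<^sub>F h in at 0. \<bar>(r h - r 0) / h\<bar> \<le> L * (D * norm (abs_l2 \<psi>)) + \<epsilon> * (L * N)"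
      unfolding eventually_at
    proof (intro exI[of _ "d / (L + 1)"] conjI ballI impI)
      show "0 < d / (L + 1)" using d(1) L by simp
      fix h :: real assume "h \<noteq> 0 \<and> dist h 0 < d / (L + 1)"
      then show "\<bar>(r h - r 0) / h\<bar> \<le> L * (D * norm (abs_l2 \<psi>)) + \<epsilon> * (L * N)"
        using rh[of h] by (simp add: abs_divide pos_divide_le_eq mult.commute)
    qed
    ultimately have "\<bar>- inner v (abs_l2 (partial_deriv i \<psi>))\<bar> \<le> L * (D * norm (abs_l2 \<psi>)) + \<epsilon> * (L * N)"
      by (rule tendsto_upperbound) simp
    then show ?thesis by simp
  qed
  have LN: "L * N \<ge> 0" using L by (simp add: N_def)
  have "\<bar>inner v (abs_l2 (partial_deriv i \<psi>))\<bar> \<le> L * (D * norm (abs_l2 \<psi>))"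
  proof (rule field_le_epsilon)
    fix \<delta> :: real assume \<delta>: "\<delta> > 0"
    have "\<bar>inner v (abs_l2 (partial_deriv i \<psi>))\<bar> \<le> L * (D * norm (abs_l2 \<psi>)) + \<delta> / (L * N + 1) * (L * N)"
      using \<delta> LN by (intro bound) auto
    also have "\<delta> / (L * N + 1) * (L * N) \<le> \<delta>" using \<delta> LN by (simp add: field_simps)
    finally show "\<bar>inner v (abs_l2 (partial_deriv i \<psi>))\<bar> \<le> L * (D * norm (abs_l2 \<psi>)) + \<delta>" by simp
  qed
  also have "\<dots> \<le> L * ((\<Sum>j\<in>UNIV. sqrt C * norm (abs_l2 (\<lambda>x. g x $ j))) * norm (abs_l2 \<psi>))"
    unfolding D_def using L
    by (intro mult_left_mono mult_right_mono sum_mono nonsingular_square_integrable(2)[OF ns sg]) auto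
  finally show ?thesis by (simp add: vc sum_distrib_left mult_ac)
qed

text \<open>For a fixed \<psi> both sides depend continuously on u and its derivatives, so the bound
  passes from \<open>C1_l2\<close> functions to all of \<open>H1\<close> by
  \<open>H1_approx\<close>. With \<open>weak_deriv_exists\<close> this shows that composition
  preserves \<open>H1\<close>.\<close>

lemma comp_l2_weak_bound:
  fixes \<Psi> :: "real^'n::finite \<Rightarrow> real^'n"
  assumes ns: "nonsingular C \<Psi>" and lip: "\<And>x y. norm (\<Psi> x - \<Psi> y) \<le> L * norm (x - y)"
    and w: "\<And>i. l2_deriv i u (w i)" and \<psi>: "test_function \<psi>"
  shows "\<bar>inner (comp_l2 \<Psi> u) (abs_l2 (partial_deriv i \<psi>))\<bar> \<le>
    L * sqrt C * (\<Sum>j\<in>UNIV. norm (w j)) * norm (abs_l2 \<psi>)"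
proof -
  have L: "L \<ge> 0"
  proof -
    obtain i :: 'n where True by blast
    show ?thesis using lip[of "axis i 1" 0] by (smt (verit) norm_ge_zero diff_zero mult_cancel_left2 norm_axis_1)
  qed
  define P where "P = norm (abs_l2 \<psi>)"
  define Q where "Q = norm (abs_l2 (partial_deriv i \<psi>))"
  \<comment> \<open>R collects the coefficients of the approximation error e: the one from the
    pairing with the derivative of \<psi> and the one from the norms of the approximate
    gradient.\<close>
  define R where "R = sqrt C * Q + L * sqrt C * real CARD('n) * P"
  have C: "C \<ge> 0" using ns by (rule nonsingular_nonneg)
  have R: "R \<ge> 0" using L C by (simp add: R_def P_def Q_def)
  show ?thesis
  proof (rule field_le_epsilon)
    fix \<delta> :: real assume \<delta>: "\<delta> > 0"
    define e where "e = \<delta> / (R + 1)"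
    have e: "e > 0" using \<delta> R by (simp add: e_def)
    obtain G g where G: "C1_l2 G g" "norm (abs_l2 G - u) \<le> e" "\<And>i. norm (abs_l2 (\<lambda>x. g x $ i) - w i) \<le> e"
      using H1_approx[OF w e] by blast
    have "\<bar>inner (comp_l2 \<Psi> u) (abs_l2 (partial_deriv i \<psi>))\<bar> \<le>
        \<bar>inner (comp_l2 \<Psi> (abs_l2 G)) (abs_l2 (partial_deriv i \<psi>))\<bar> +
        \<bar>inner (comp_l2 \<Psi> (abs_l2 G - u)) (abs_l2 (partial_deriv i \<psi>))\<bar>"
      by (simp add: linear_diff[OF bounded_linear.linear[OF bounded_linear_comp_l2[OF ns]]] inner_diff_left)
    also have "\<bar>inner (comp_l2 \<Psi> (abs_l2 G)) (abs_l2 (partial_deriv i \<psi>))\<bar> \<le>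
        L * sqrt C * (\<Sum>j\<in>UNIV. norm (abs_l2 (\<lambda>x. g x $ j))) * P"
      unfolding P_def by (rule comp_C1_weak_bound[OF ns lip G(1) \<psi>])
    also have "\<dots> \<le> L * sqrt C * (\<Sum>j\<in>UNIV. norm (w j) + e) * P"
    proof (intro mult_right_mono mult_left_mono sum_mono)
      fix j show "norm (abs_l2 (\<lambda>x. g x $ j)) \<le> norm (w j) + e"
        using G(3)[of j] norm_triangle_sub[of "abs_l2 (\<lambda>x. g x $ j)" "w j"] by linarith
    qed (use L C in \<open>auto simp: P_def\<close>)
    also have "\<bar>inner (comp_l2 \<Psi> (abs_l2 G - u)) (abs_l2 (partial_deriv i \<psi>))\<bar> \<le> (sqrt C * e) * Q"
    proof -
      have "\<bar>inner (comp_l2 \<Psi> (abs_l2 G - u)) (abs_l2 (partial_deriv i \<psi>))\<bar> \<le> norm (comp_l2 \<Psi> (abs_l2 G - u)) * Q"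
        unfolding Q_def by (rule Cauchy_Schwarz_ineq2)
      also have "norm (comp_l2 \<Psi> (abs_l2 G - u)) \<le> sqrt C * norm (abs_l2 G - u)" by (rule norm_comp_l2_le[OF ns])
      also have "\<dots> \<le> sqrt C * e" using G(2) C by (intro mult_left_mono) auto
      finally show ?thesis by (simp add: mult_right_mono Q_def)
    qed
    finally have "\<bar>inner (comp_l2 \<Psi> u) (abs_l2 (partial_deriv i \<psi>))\<bar> \<le>
        L * sqrt C * (\<Sum>j\<in>UNIV. norm (w j)) * P + e * R"
      by (simp add: R_def sum.distrib algebra_simps)
    also have "e * R \<le> \<delta>" using \<delta> R by (simp add: e_def field_simps)
    finally show "\<bar>inner (comp_l2 \<Psi> u) (abs_l2 (partial_deriv i \<psi>))\<bar> \<le>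
        L * sqrt C * (\<Sum>j\<in>UNIV. norm (w j)) * norm (abs_l2 \<psi>) + \<delta>"
      by (simp add: P_def)
  qed
qed

subsection \<open>Measurability and integrals of \<open>l2\<close>-valued functions\<close>

text \<open>Pettis' theorem in the separable case: a closed ball is a countable intersection of
  half-spaces, and an open set is a countable union of closed balls with centres in a dense set and
  rational radii.\<close>

lemma l2_measurableI:
  fixes X :: "'b \<Rightarrow> 'a::euclidean_space l2"
  assumes weak: "\<And>v. (\<lambda>t. inner (X t) v) \<in> borel_measurable M"
  shows "X \<in> borel_measurable M"
proof -
  obtain D :: "'a l2 set" where D: "countable D" "\<And>U. open U \<Longrightarrow> U \<noteq> {} \<Longrightarrow> \<exists>d\<in>D. d \<in> U"
    using countable_dense_exists by blast
  have norm_le: "norm z \<le> r \<longleftrightarrow> (\<forall>d\<in>D. inner z d \<le> r * norm d)" if r: "r \<ge> 0" for z :: "'a l2" and r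
  proof
    assume "norm z \<le> r"
    then show "\<forall>d\<in>D. inner z d \<le> r * norm d"
      using norm_cauchy_schwarz[of z] mult_right_mono[of "norm z" r] by (meson norm_ge_zero order_trans)
  next
    assume le: "\<forall>d\<in>D. inner z d \<le> r * norm d"
    have cl: "closed {d. inner z d \<le> r * norm d}" by (intro closed_Collect_le continuous_intros)
    have "- {d. inner z d \<le> r * norm d} = {}"
    proof (rule ccontr)
      assume "- {d. inner z d \<le> r * norm d} \<noteq> {}"
      from D(2)[OF _ this] cl le show False by (auto simp: open_closed)
    qed
    then have "inner z z \<le> r * norm z" by blast
    then have "norm z * norm z \<le> r * norm z" by (simp add: power2_norm_eq_inner[symmetric] power2_eq_square)
    then show "norm z \<le> r" using r by (cases "z = 0") auto
  qed
  have ball: "{t\<in>space M. norm (X t - c) \<le> r} \<in> sets M" if r: "r \<ge> 0" for c r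
  proof -
    have "{t\<in>space M. norm (X t - c) \<le> r} = {t\<in>space M. \<forall>d\<in>D. inner (X t) d - inner c d \<le> r * norm d}"
      using norm_le[OF r] by (simp add: inner_diff_left)
    also have "\<dots> = {t\<in>space M. \<forall>n. inner (X t) (from_nat_into D n) - inner c (from_nat_into D n) \<le> r * norm (from_nat_into D n)}"
    proof -
      have "D \<noteq> {}" using D(2)[OF open_UNIV] by auto
      then have "range (from_nat_into D) = D" using D(1) by (rule range_from_nat_into)
      then have "(\<forall>d\<in>D. P d) \<longleftrightarrow> (\<forall>n. P (from_nat_into D n))" for P
        using ball_simps(9)[of "from_nat_into D" UNIV P] by auto
      then show ?thesis by simp
    qed
    also have "\<dots> \<in> sets M"
    proof (rule sets.sets_Collect_countable_All)
      fix n
      let ?d = "from_nat_into D n"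
      have "(\<lambda>t. inner (X t) ?d - inner c ?d) \<in> borel_measurable M" using weak by measurable
      then show "{t\<in>space M. inner (X t) ?d - inner c ?d \<le> r * norm ?d} \<in> sets M" by measurable
    qed
    finally show ?thesis .
  qed
  show ?thesis
  proof (rule borel_measurableI)
    fix U :: "'a l2 set" assume U: "open U"
    define I where "I = {(d, q). d \<in> D \<and> q \<in> \<rat> \<and> q \<ge> 0 \<and> cball d q \<subseteq> U}"
    have "I \<subseteq> D \<times> \<rat>" by (auto simp: I_def)
    then have cI: "countable I" using D(1) countable_rat by (meson countable_SIGMA countable_subset)
    have "X -` U \<inter> space M = (\<Union>p\<in>I. {t\<in>space M. norm (X t - fst p) \<le> snd p})"
    proof (intro subset_antisym subsetI)
      fix t assume t: "t \<in> X -` U \<inter> space M"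
      then obtain e where e: "e > 0" "ball (X t) e \<subseteq> U" using U openE by blast
      have "ball (X t) (e / 4) \<noteq> {}" using e(1) by simp
      from D(2)[OF open_ball this] obtain d where d: "d \<in> D" "dist (X t) d < e / 4" by auto
      obtain q where q: "q \<in> \<rat>" "e / 4 < q" "q < e / 2" using Rats_dense_in_real[of "e / 4" "e / 2"] e(1) by auto
      have "cball d q \<subseteq> U"
      proof
        fix z assume "z \<in> cball d q"
        then have "dist (X t) z < e" using dist_triangle[of "X t" z d] d(2) q(3) e(1) by simp
        then show "z \<in> U" using e(2) by auto
      qed
      then have "(d, q) \<in> I" using d(1) q e(1) by (auto simp: I_def)
      moreover have "norm (X t - d) \<le> q" using d(2) q(2) by (simp add: dist_norm)
      ultimately show "t \<in> (\<Union>p\<in>I. {t\<in>space M. norm (X t - fst p) \<le> snd p})" using t by force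
    next
      fix t assume "t \<in> (\<Union>p\<in>I. {t\<in>space M. norm (X t - fst p) \<le> snd p})"
      then obtain d q where "(d, q) \<in> I" "t \<in> space M" "norm (X t - d) \<le> q" by auto
      then have "X t \<in> cball d q" "cball d q \<subseteq> U" by (auto simp: I_def dist_norm norm_minus_commute)
      then show "t \<in> X -` U \<inter> space M" using \<open>t \<in> space M\<close> by blast
    qed
    also have "\<dots> \<in> sets M"
      using cI ball by (intro sets.countable_UN') (auto simp: I_def)
    finally show "X -` U \<inter> space M \<in> sets M" .
  qed
qed

lemma lborel_imp_lebesgue_on:
  fixes q :: "real \<Rightarrow> real"
  assumes "integrable lborel (\<lambda>r. indicator {s..t} r *\<^sub>R q r)"
  shows "integrable (lebesgue_on {s..t}) q"
    and "(LINT r|lebesgue_on {s..t}. q r) = (LINT r|lborel. indicator {s..t} r *\<^sub>R q r)"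
proof -
  have m: "(\<lambda>r. indicator {s..t} r *\<^sub>R q r) \<in> borel_measurable lborel" using assms by auto
  show "integrable (lebesgue_on {s..t}) q"
    using assms m by (subst integrable_restrict_space) (auto simp: integrable_completion)
  show "(LINT r|lebesgue_on {s..t}. q r) = (LINT r|lborel. indicator {s..t} r *\<^sub>R q r)"
    using integral_completion[OF m] by (subst integral_restrict_space) auto
qed

lemma integral_lebesgue_on_bound:
  fixes q :: "real \<Rightarrow> real"
  assumes st: "s \<le> t" and q: "integrable (lebesgue_on {s..t}) q" "\<And>r. r \<in> {s..t} \<Longrightarrow> \<bar>q r\<bar> \<le> B"
  shows "\<bar>LINT r|lebesgue_on {s..t}. q r\<bar> \<le> (t - s) * B"
proof -
  interpret finite_measure "lebesgue_on {s..t}" by (rule finite_measure_lebesgue_on) simp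
  have "\<bar>LINT r|lebesgue_on {s..t}. q r\<bar> \<le> (LINT r|lebesgue_on {s..t}. \<bar>q r\<bar>)"
    using integral_norm_bound[of "lebesgue_on {s..t}" q] by simp
  also have "\<dots> \<le> (LINT r|lebesgue_on {s..t}. B)"
    using q by (intro integral_mono) auto
  also have "\<dots> = (t - s) * B" using st by (simp add: measure_restrict_space)
  finally show ?thesis .
qed

subsection \<open>The evolution operators\<close>

context lipschitz_field
begin

definition evol :: "real \<Rightarrow> real \<Rightarrow> (real^'n) l2 \<Rightarrow> (real^'n) l2" where
  "evol s t = comp_l2 (\<lambda>x. flow x s t)"

definition evol_const :: "real \<Rightarrow> real" where
  "evol_const r = sqrt (flow_const r)"

lemma evol_const_nonneg: "evol_const r \<ge> 0"
  by (simp add: evol_const_def flow_const_def)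

lemma norm_evol: "\<bar>t - s\<bar> \<le> r \<Longrightarrow> norm (evol s t u) \<le> evol_const r * norm u"
  unfolding evol_def evol_const_def by (rule norm_comp_l2_le[OF flow_nonsingular])

lemma bounded_linear_evol: "bounded_linear (evol s t)"
  unfolding evol_def by (rule bounded_linear_comp_l2[OF flow_nonsingular[OF order_refl]])

lemmas evol_add = linear_add[OF bounded_linear.linear[OF bounded_linear_evol]]
lemmas evol_diff = linear_diff[OF bounded_linear.linear[OF bounded_linear_evol]]
lemmas evol_scaleR = linear_cmul[OF bounded_linear.linear[OF bounded_linear_evol]]
lemmas evol_sum = linear_sum[OF bounded_linear.linear[OF bounded_linear_evol]]

lemma evol_abs_l2: "square_integrable k \<Longrightarrow> evol s t (abs_l2 k) = abs_l2 (\<lambda>x. k (flow x s t))"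
  unfolding evol_def by (rule comp_abs_l2[OF flow_nonsingular[OF order_refl]])

lemma square_integrable_flow: "square_integrable k \<Longrightarrow> square_integrable (\<lambda>x. k (flow x s t))"
  by (rule nonsingular_square_integrable(1)[OF flow_nonsingular[OF order_refl]])

lemma evol_self: "t \<le> s \<Longrightarrow> evol s t u = u"
  by (simp add: evol_def flow_self comp_l2_id)

lemma evol_evol: "s \<le> r \<Longrightarrow> r \<le> t \<Longrightarrow> evol s r (evol r t u) = evol s t u"
  unfolding evol_def
  by (subst comp_l2_compose[OF flow_nonsingular[OF order_refl] flow_nonsingular[OF order_refl]])
    (simp add: flow_step[of s r t])

lemma evol_tendsto:
  fixes s' t' :: "nat \<Rightarrow> real" and u' :: "nat \<Rightarrow> (real^'n) l2"
  assumes s: "s' \<longlonglongrightarrow> s" and t: "t' \<longlonglongrightarrow> t" and u: "u' \<longlonglongrightarrow> u"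
  shows "(\<lambda>n. evol (s' n) (t' n) (u' n)) \<longlonglongrightarrow> evol s t u"
proof -
  have "convergent (\<lambda>n. t' n - s' n)" using tendsto_diff[OF t s] by (auto simp: convergent_def)
  from convergent_imp_Bseq[OF this] obtain r where r: "\<And>n. \<bar>t' n - s' n\<bar> \<le> r"
    unfolding Bseq_def real_norm_def by blast
  have "\<bar>t - s\<bar> \<le> r"
    using tendsto_rabs[OF tendsto_diff[OF t s]] r by (intro LIMSEQ_le_const2) auto
  then have "(\<lambda>n. evol (s' n) (t' n) u) \<longlonglongrightarrow> evol s t u"
    unfolding evol_def
  proof (intro comp_l2_tendsto[where C = "flow_const r" and R = "K * r"])
    show "norm (flow x (s' n) (t' n) - x) \<le> K * r" for n x
      using flow_displacement[of x "s' n" "t' n"] mult_left_mono[OF r[of n], of K] K_pos by linarith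
    show "(\<lambda>n. flow x (s' n) (t' n)) \<longlonglongrightarrow> flow x s t" for x
      by (intro flow_tendsto tendsto_const s t)
  qed (use r flow_nonsingular in auto)
  moreover have "(\<lambda>n. evol (s' n) (t' n) (u' n) - evol (s' n) (t' n) u) \<longlonglongrightarrow> 0"
  proof (rule Lim_null_comparison)
    show "\<forall>\<^sub>F n in sequentially. norm (evol (s' n) (t' n) (u' n) - evol (s' n) (t' n) u) \<le> evol_const r * norm (u' n - u)"
      using norm_evol[OF r] by (simp add: evol_diff[symmetric])
    show "(\<lambda>n. evol_const r * norm (u' n - u)) \<longlonglongrightarrow> 0"
      using tendsto_mult_right_zero[OF tendsto_norm_zero[OF LIM_zero[OF u]]] .
  qed
  ultimately have "(\<lambda>n. (evol (s' n) (t' n) (u' n) - evol (s' n) (t' n) u) + evol (s' n) (t' n) u) \<longlonglongrightarrow> 0 + evol s t u"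
    by (intro tendsto_add)
  then show ?thesis by simp
qed

lemma continuous_evol: "continuous_on UNIV (\<lambda>(s, t, u). evol s t u)"
  unfolding continuous_on_sequentially
proof (intro ballI allI impI, elim conjE)
  fix X :: "nat \<Rightarrow> real \<times> real \<times> (real^'n) l2" and a assume X: "X \<longlonglongrightarrow> a"
  have "(\<lambda>n. evol (fst (X n)) (fst (snd (X n))) (snd (snd (X n)))) \<longlonglongrightarrow> evol (fst a) (fst (snd a)) (snd (snd a))"
    by (intro evol_tendsto tendsto_fst tendsto_snd X)
  then show "((\<lambda>(s, t, u). evol s t u) \<circ> X) \<longlonglongrightarrow> (case a of (s, t, u) \<Rightarrow> evol s t u)"
    by (simp add: o_def case_prod_beta)
qed

section \<open>The transport term as an operator on families of derivatives\<close>

lemma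
  shows f_component_continuous: "continuous_on UNIV (\<lambda>x. f x t $ i)"
    and f_component_measurable: "(\<lambda>x. f x t $ i) \<in> borel_measurable lebesgue"
    and f_component_bound: "\<bar>f x t $ i\<bar> \<le> K"
proof -
  have "continuous_on UNIV (\<lambda>x. f x t)"
  proof (rule lipschitz_on_continuous_on[of K], rule lipschitz_onI)
    show "dist (f u t) (f v t) \<le> K * dist u v" for u v using f_lip by (simp add: dist_norm)
  qed (use K_pos in simp)
  then show "continuous_on UNIV (\<lambda>x. f x t $ i)" by (intro continuous_intros)
  then show "(\<lambda>x. f x t $ i) \<in> borel_measurable lebesgue" by (rule borel_measurable_continuous_lebesgue)
  show "\<bar>f x t $ i\<bar> \<le> K" using component_le_norm_cart[of "f x t" i] f_bound[of x t] by linarith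
qed

text \<open>The derivatives enter as a family w rather than through a function u, so that
  differences, approximants and derivatives frozen at another time can be inserted.\<close>

definition adv :: "real \<Rightarrow> ('n \<Rightarrow> (real^'n) l2) \<Rightarrow> (real^'n) l2" where
  "adv t w = (\<Sum>i\<in>UNIV. mult_l2 (\<lambda>x. f x t $ i) (w i))"

lemma transport_term_adv: "transport_term f t u = adv t (\<lambda>i. weak_deriv i u)"
  unfolding transport_term_def adv_def mult_l2_def
  by (rule abs_l2_sum)
    (auto intro: square_integrable_times[OF f_component_measurable f_component_bound] square_integrable_rep_l2)

lemma norm_adv: "norm (adv t w) \<le> K * (\<Sum>i\<in>UNIV. norm (w i))"
  unfolding adv_def sum_distrib_left
  by (intro order_trans[OF norm_sum] sum_mono norm_mult_l2[OF f_component_measurable f_component_bound])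

lemma adv_diff: "adv t w - adv t z = adv t (\<lambda>i. w i - z i)"
  unfolding adv_def
  by (simp add: sum_subtractf linear_diff[OF bounded_linear.linear[OF bounded_linear_mult_l2[OF f_component_measurable f_component_bound]]])

text \<open>For Borel representatives of u and v the pairing is an integral over x of a jointly
  Borel integrand, hence Borel in t; weak measurability suffices by
  \<open>l2_measurableI\<close>.\<close>

lemma mult_f_measurable: "(\<lambda>t. mult_l2 (\<lambda>x. f x t $ i) u) \<in> borel_measurable borel"
proof (rule l2_measurableI)
  fix v :: "(real^'n) l2"
  obtain g where g [measurable]: "g \<in> borel_measurable borel" and sg: "square_integrable g" "abs_l2 g = u"
    using l2_borel_rep by blast
  obtain h where h [measurable]: "h \<in> borel_measurable borel" and sh: "square_integrable h" "abs_l2 h = v"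
    using l2_borel_rep by blast
  have fm: "(\<lambda>p. f (fst p) (snd p) $ i) \<in> borel_measurable borel"
    using measurable_compose[OF f_meas, of "\<lambda>v. v $ i" borel]
    by (simp add: case_prod_beta borel_measurable_continuous_onI continuous_on_component)
  have "(\<lambda>p::real \<times> (real^'n). (snd p, fst p)) \<in> borel_measurable borel"
    by (intro borel_measurable_continuous_onI continuous_intros)
  from measurable_compose[OF this fm]
  have fm': "(\<lambda>p. f (snd p) (fst p) $ i) \<in> borel_measurable borel" by simp
  have eq: "inner (mult_l2 (\<lambda>x. f x t $ i) u) v = (LINT x|lborel. f x t $ i * g x * h x)" for t
  proof -
    have "inner (mult_l2 (\<lambda>x. f x t $ i) u) v = (LINT x|lebesgue. f x t $ i * g x * h x)"
      unfolding sg(2)[symmetric] sh(2)[symmetric] mult_abs_l2[OF f_component_measurable f_component_bound sg(1)]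
      by (rule inner_abs_l2[OF square_integrable_times[OF f_component_measurable f_component_bound sg(1)] sh(1)])
    also have "\<dots> = (LINT x|lborel. f x t $ i * g x * h x)"
    proof (rule integral_completion)
      have "(\<lambda>x. f x t $ i) \<in> borel_measurable borel"
        using f_component_continuous by (rule borel_measurable_continuous_onI)
      then show "(\<lambda>x. f x t $ i * g x * h x) \<in> borel_measurable lborel" by measurable
    qed
    finally show ?thesis .
  qed
  have "(\<lambda>(t, x). f x t $ i * g x * h x) \<in> borel_measurable (borel \<Otimes>\<^sub>M lborel)"
  proof -
    have "(\<lambda>(t, x). f x t $ i * g x * h x) \<in> borel_measurable (borel :: (real \<times> (real^'n)) measure)"
    proof -
      have "snd \<in> (borel :: (real \<times> (real^'n)) measure) \<rightarrow>\<^sub>M borel"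
        by (intro borel_measurable_continuous_onI continuous_intros)
      from measurable_compose[OF this g] measurable_compose[OF this h]
      show ?thesis unfolding case_prod_beta by (intro borel_measurable_times fm')
    qed
    moreover have "sets (borel \<Otimes>\<^sub>M lborel) = sets (borel :: (real \<times> (real^'n)) measure)"
      by (simp add: borel_prod[symmetric] cong: sets_pair_measure_cong)
    ultimately show ?thesis by (simp cong: measurable_cong_sets)
  qed
  from lborel.borel_measurable_lebesgue_integral[OF this]
  show "(\<lambda>t. inner (mult_l2 (\<lambda>x. f x t $ i) u) v) \<in> borel_measurable borel"
    by (simp add: eq)
qed

text \<open>Here the multiplier and the argument both depend on t. Multiplication is symmetric, so
  when tested against v the multiplier can be moved to the fixed element v, and what remains is an
  inner product of two measurable functions.\<close>

lemma adv_measurable: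
  assumes "\<And>i. (\<lambda>t. w t i) \<in> borel_measurable (lebesgue_on S)"
  shows "(\<lambda>t. adv t (w t)) \<in> borel_measurable (lebesgue_on S)"
  unfolding adv_def
proof (intro borel_measurable_sum l2_measurableI)
  fix i v
  have id: "(\<lambda>r. r) \<in> lebesgue_on S \<rightarrow>\<^sub>M (borel :: real measure)"
    by (intro measurable_restrict_space1 borel_measurable_continuous_lebesgue continuous_on_id)
  have "(\<lambda>t. inner (w t i) (mult_l2 (\<lambda>x. f x t $ i) v)) \<in> borel_measurable (lebesgue_on S)"
    by (intro borel_measurable_inner assms measurable_compose[OF id mult_f_measurable])
  then show "(\<lambda>t. inner (mult_l2 (\<lambda>x. f x t $ i) (w t i)) v) \<in> borel_measurable (lebesgue_on S)"
    by (simp add: inner_mult_l2[OF f_component_measurable f_component_bound])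
qed

text \<open>
  As \<open>f\<close> is only measurable in time, the chain rule along characteristics is available in
  integrated form only.
\<close>

lemma C1_along_flow:
  assumes G: "C1_l2 G g" and st: "s \<le> t"
  shows "(\<lambda>r. inner (f (flow x s r) r) (g (flow x s r))) integrable_on {s..t}" (is "?h integrable_on _")
    and "G (flow x s t) - G x = integral {s..t} (\<lambda>r. inner (f (flow x s r) r) (g (flow x s r)))"
proof -
  define y where "y = flow x s"
  define h where "h r = inner (f (y r) r) (g (y r))" for r
  have yc: "continuous_on {a..b} y" if "s \<le> a" for a b
    using continuous_on_subset[OF continuous_flow_time[of s b x]] that by (auto simp: y_def)
  have gc: "continuous_on UNIV g" and Gc: "continuous_on UNIV G" using G by (auto simp: C1_l2_def)
  obtain B where B: "\<And>x. norm (g x) \<le> B" using G by (auto simp: C1_l2_def)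
  have gy: "continuous_on {a..b} (\<lambda>r. g (y r))" if "s \<le> a" for a b
    using continuous_on_compose2[OF gc yc[OF that]] by simp
  have hm: "h \<in> borel_measurable (lebesgue_on {a..b})" if "s \<le> a" for a b
    unfolding h_def using that
    by (intro borel_measurable_inner along_measurable continuous_measurable_on yc gy)
  have hi: "h integrable_on {a..b}" if "s \<le> a" for a b
  proof (rule measurable_bounded_by_integrable_imp_integrable[OF hm[OF that]])
    show "(\<lambda>r. K * B) integrable_on {a..b}" by (intro integrable_continuous_real continuous_intros)
    show "norm (h r) \<le> K * B" for r
      using Cauchy_Schwarz_ineq2[of "f (y r) r" "g (y r)"] mult_mono[OF f_bound[of "y r" r] B[of "y r"]] K_pos
      by (simp add: h_def)
  qed simp
  show "(\<lambda>r. inner (f (flow x s r) r) (g (flow x s r))) integrable_on {s..t}"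
    using hi[of s t] by (simp add: h_def[abs_def] y_def)
  \<comment> \<open>The claim is that p is constant. Since \<open>f\<close> is bounded the
    increments are compared with those of time itself.\<close>
  define p where "p r = G (y r) - integral {s..r} h" for r
  have "p s = p t"
  proof (rule constant_by_left_increments[OF st])
    show "continuous_on {s..t} p" unfolding p_def
      by (intro continuous_intros continuous_on_compose2[OF Gc yc] indefinite_integral_continuous_1 hi) auto
    show "continuous_on {s..t} (\<lambda>r. r)" by (rule continuous_on_id)
    fix \<epsilon> \<tau> :: real assume \<epsilon>: "\<epsilon> > 0" and \<tau>: "s < \<tau>" "\<tau> \<le> t"
    \<comment> \<open>Each of two errors gets \<epsilon> / 2 per unit of time: the remainder of G,
      with a displacement of at most K (\<tau> - r), and the variation of g along the curve
      multiplied by the bound K of the field.\<close>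
    have "\<epsilon> / (2 * K) > 0" using \<epsilon> K_pos by simp
    then obtain d1 where d1: "d1 > 0"
      "\<And>x a. norm a < d1 \<Longrightarrow> \<bar>G (x + a) - G x - inner a (g x)\<bar> \<le> \<epsilon> / (2 * K) * norm a"
      using G unfolding C1_l2_def by blast
    have "\<epsilon> / (4 * K) > 0" using \<epsilon> K_pos by simp
    moreover have "\<tau> \<in> {s..t}" using \<tau> by simp
    ultimately obtain d2 where d2: "d2 > 0"
      "\<And>r. r \<in> {s..t} \<Longrightarrow> dist r \<tau> < d2 \<Longrightarrow> dist (g (y r)) (g (y \<tau>)) < \<epsilon> / (4 * K)"
      using gy[of s t] unfolding continuous_on_iff by blast
    have "\<bar>p \<tau> - p r\<bar> \<le> \<epsilon> * (\<tau> - r)" if r: "r \<in> {s..\<tau>}" "\<tau> - r < min (d1 / K) d2" for r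
    proof -
      define a where "a = y \<tau> - y r"
      have a_le: "norm a \<le> K * (\<tau> - r)"
        using flow_lip_time[of x s \<tau> r] r by (simp add: a_def y_def)
      also have "\<dots> < d1" using r(2) K_pos by (simp add: pos_less_divide_eq mult.commute)
      finally have rem: "\<bar>G (y \<tau>) - G (y r) - inner a (g (y r))\<bar> \<le> \<epsilon> / (2 * K) * norm a"
        using d1(2)[of a "y r"] by (simp add: a_def)
      have "\<epsilon> / (2 * K) * norm a \<le> \<epsilon> / (2 * K) * (K * (\<tau> - r))"
        using \<epsilon> K_pos a_le by (intro mult_left_mono) auto
      then have rem': "\<bar>G (y \<tau>) - G (y r) - inner a (g (y r))\<bar> \<le> \<epsilon> / 2 * (\<tau> - r)"
        using rem K_pos by simp
      have fi: "(\<lambda>r. f (y r) r) integrable_on {r..\<tau>}"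
        using r by (simp add: y_def flow_along_integrable)
      have "inner a (g (y r)) = inner (integral {r..\<tau>} (\<lambda>r. f (y r) r)) (g (y r))"
        using flow_diff_time[of s r \<tau> x] r by (simp add: a_def y_def)
      also have "\<dots> = integral {r..\<tau>} (\<lambda>\<rho>. inner (f (y \<rho>) \<rho>) (g (y r)))"
        using integral_linear[OF fi bounded_linear_inner_left[of "g (y r)"]] by (simp add: o_def)
      finally have aeq: "inner a (g (y r)) = integral {r..\<tau>} (\<lambda>\<rho>. inner (f (y \<rho>) \<rho>) (g (y r)))" .
      have ii: "(\<lambda>\<rho>. inner (f (y \<rho>) \<rho>) (g (y r))) integrable_on {r..\<tau>}"
        using integrable_linear[OF fi bounded_linear_inner_left[of "g (y r)"]] by (simp add: o_def)
      have hr: "h integrable_on {r..\<tau>}" using r by (intro hi) simp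
      have "integral {r..\<tau>} (\<lambda>\<rho>. inner (f (y \<rho>) \<rho>) (g (y r))) - integral {r..\<tau>} h =
          integral {r..\<tau>} (\<lambda>\<rho>. inner (f (y \<rho>) \<rho>) (g (y r)) - h \<rho>)"
        by (rule Henstock_Kurzweil_Integration.integral_diff[OF ii hr, symmetric])
      also have "\<bar>\<dots>\<bar> \<le> integral {r..\<tau>} (\<lambda>\<rho>. \<epsilon> / 2)"
        unfolding real_norm_def[symmetric]
      proof (rule integral_norm_bound_integral[OF Henstock_Kurzweil_Integration.integrable_diff[OF ii hr]])
        show "(\<lambda>\<rho>. \<epsilon> / 2) integrable_on {r..\<tau>}" by (intro integrable_continuous_real continuous_intros)
        fix \<rho> assume \<rho>: "\<rho> \<in> {r..\<tau>}"
        have "dist (g (y r)) (g (y \<tau>)) < \<epsilon> / (4 * K)" "dist (g (y \<rho>)) (g (y \<tau>)) < \<epsilon> / (4 * K)"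
          using r \<rho> \<tau> by (auto intro!: d2(2) simp: dist_real_def)
        then have gg: "norm (g (y r) - g (y \<rho>)) \<le> \<epsilon> / (2 * K)"
          using dist_triangle2[of "g (y r)" "g (y \<rho>)" "g (y \<tau>)"] by (simp add: dist_norm field_simps)
        have "norm (inner (f (y \<rho>) \<rho>) (g (y r)) - h \<rho>) = \<bar>inner (f (y \<rho>) \<rho>) (g (y r) - g (y \<rho>))\<bar>"
          by (simp add: h_def inner_diff_right)
        also have "\<dots> \<le> norm (f (y \<rho>) \<rho>) * norm (g (y r) - g (y \<rho>))" by (rule Cauchy_Schwarz_ineq2)
        also have "\<dots> \<le> K * (\<epsilon> / (2 * K))" using gg f_bound K_pos by (intro mult_mono) auto
        finally show "norm (inner (f (y \<rho>) \<rho>) (g (y r)) - h \<rho>) \<le> \<epsilon> / 2" using K_pos by simp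
      qed
      finally have diff: "\<bar>inner a (g (y r)) - integral {r..\<tau>} h\<bar> \<le> \<epsilon> / 2 * (\<tau> - r)"
        using r by (simp add: aeq mult.commute)
      have "integral {s..\<tau>} h = integral {s..r} h + integral {r..\<tau>} h"
        using r hi[of s \<tau>] by (intro Henstock_Kurzweil_Integration.integral_combine[symmetric]) auto
      then have "p \<tau> - p r = (G (y \<tau>) - G (y r) - inner a (g (y r))) + (inner a (g (y r)) - integral {r..\<tau>} h)"
        by (simp add: p_def)
      also have "\<bar>\<dots>\<bar> \<le> \<epsilon> / 2 * (\<tau> - r) + \<epsilon> / 2 * (\<tau> - r)" using rem' diff by linarith
      finally show ?thesis by simp
    qed
    then show "\<exists>d>0. \<forall>r\<in>{s..\<tau>}. \<tau> - r < d \<longrightarrow> \<bar>p \<tau> - p r\<bar> \<le> \<epsilon> * (\<tau> - r)"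
      using d1(1) d2(1) K_pos by (intro exI[of _ "min (d1 / K) d2"]) auto
  qed
  moreover have "p s = G x" by (simp add: p_def y_def flow_self)
  ultimately have "G (flow x s t) - G x = integral {s..t} h" by (simp add: p_def y_def)
  then show "G (flow x s t) - G x = integral {s..t} (\<lambda>r. inner (f (flow x s r) r) (g (flow x s r)))"
    by (simp add: h_def[abs_def] y_def)
qed

lemma adv_C1:
  assumes "C1_l2 G g"
  shows "square_integrable (\<lambda>x. inner (f x r) (g x))"
    and "adv r (\<lambda>i. abs_l2 (\<lambda>x. g x $ i)) = abs_l2 (\<lambda>x. inner (f x r) (g x))"
proof -
  have sg: "\<And>i. square_integrable (\<lambda>x. g x $ i)" using assms by (auto simp: C1_l2_def)
  note st = square_integrable_times[OF f_component_measurable f_component_bound sg]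
  show "square_integrable (\<lambda>x. inner (f x r) (g x))"
    unfolding inner_vec_def inner_real_def by (rule square_integrable_sum) (rule st)
  show "adv r (\<lambda>i. abs_l2 (\<lambda>x. g x $ i)) = abs_l2 (\<lambda>x. inner (f x r) (g x))"
    unfolding adv_def mult_abs_l2[OF f_component_measurable f_component_bound sg] inner_vec_def inner_real_def
    by (rule abs_l2_sum[symmetric]) (auto intro: st)
qed

text \<open>The chain rule along characteristics, multiplied by \<psi> and integrated over x. The
  bounded support of \<psi> makes the integrand integrable on space-time, so Fubini's theorem turns
  it into an integral over time of evolved transport terms.\<close>

lemma forward_C1:
  assumes G: "C1_l2 G g" and \<psi>: "test_function \<psi>" and st: "s \<le> t"
  defines "q \<equiv> \<lambda>r. inner (evol s r (adv r (\<lambda>i. abs_l2 (\<lambda>x. g x $ i)))) (abs_l2 \<psi>)"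
  shows "integrable (lebesgue_on {s..t}) q"
    and "inner (evol s t (abs_l2 G) - abs_l2 G) (abs_l2 \<psi>) = (LINT r|lebesgue_on {s..t}. q r)"
proof -
  have gc: "continuous_on UNIV g" and Gc: "continuous_on UNIV G" and sG: "square_integrable G"
    using G by (auto simp: C1_l2_def)
  obtain B where B: "\<And>x. norm (g x) \<le> B" using G by (auto simp: C1_l2_def)
  have B0: "B \<ge> 0" using B[of 0] norm_ge_zero order_trans by blast
  note \<psi>c = test_function_continuous[OF \<psi>] and s\<psi> = square_integrable_test[OF \<psi>]
  obtain M R where M: "M > 0" "\<And>x. \<bar>\<psi> x\<bar> \<le> M * indicator (ball 0 R) x"
    using continuous_bounded_supp[OF \<psi>c] \<psi> unfolding test_function_iff by metis
  define h where "h x r = inner (f (flow x s r) r) (g (flow x s r)) * \<psi> x" for x r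
  define H where "H x r = indicator {s..t} r *\<^sub>R h x r" for x r
  have hb: "\<bar>h x r\<bar> \<le> K * B * M * indicator (ball 0 R) x" for x r
  proof -
    have "\<bar>inner (f (flow x s r) r) (g (flow x s r))\<bar> \<le> K * B"
      using Cauchy_Schwarz_ineq2[of "f (flow x s r) r" "g (flow x s r)"]
        mult_mono[OF f_bound[of "flow x s r" r] B[of "flow x s r"]] K_pos by simp
    then have "\<bar>h x r\<bar> \<le> (K * B) * (M * indicator (ball 0 R) x)"
      unfolding h_def abs_mult using M(2)[of x] K_pos B0 by (intro mult_mono) auto
    then show ?thesis by (simp add: mult.assoc)
  qed
  have hm: "(\<lambda>p. h (fst p) (snd p)) \<in> borel_measurable borel"
  proof -
    have fc: "continuous_on UNIV (\<lambda>p::(real^'n) \<times> real. flow (fst p) s (snd p))"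
      using continuous_on_compose2[OF continuous_flow, of UNIV "\<lambda>p::(real^'n) \<times> real. (fst p, s, snd p)"]
      by (simp add: continuous_on_Pair continuous_on_fst continuous_on_snd continuous_on_id continuous_on_const)
    then have "(\<lambda>p::(real^'n) \<times> real. (flow (fst p) s (snd p), snd p)) \<in> borel_measurable borel"
      by (intro borel_measurable_continuous_onI continuous_intros)
    from measurable_compose[OF this f_meas]
    have 1: "(\<lambda>p::(real^'n) \<times> real. f (flow (fst p) s (snd p)) (snd p)) \<in> borel_measurable borel" by simp
    have 2: "(\<lambda>p::(real^'n) \<times> real. g (flow (fst p) s (snd p))) \<in> borel_measurable borel"
      by (intro borel_measurable_continuous_onI continuous_on_compose2[OF gc fc]) simp
    have 3: "(\<lambda>p::(real^'n) \<times> real. \<psi> (fst p)) \<in> borel_measurable borel"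
      by (intro borel_measurable_continuous_onI continuous_on_compose2[OF \<psi>c] continuous_intros) simp
    show ?thesis unfolding h_def by (intro borel_measurable_times borel_measurable_inner 1 2 3)
  qed
  have Hm: "(\<lambda>p. H (fst p) (snd p)) \<in> borel_measurable borel"
  proof -
    have "(\<lambda>p::(real^'n) \<times> real. indicator {s..t} (snd p) :: real) \<in> borel_measurable borel"
    proof (rule measurable_compose[of snd borel borel "indicator {s..t}"])
      show "snd \<in> borel \<rightarrow>\<^sub>M (borel :: real measure)"
        by (intro borel_measurable_continuous_onI continuous_intros)
    qed simp
    then show ?thesis unfolding H_def by (intro borel_measurable_scaleR hm)
  qed
  have Hi: "integrable (lborel \<Otimes>\<^sub>M lborel) (\<lambda>(x, r). H x r)"
    unfolding lborel_prod
  proof (rule Bochner_Integration.integrable_bound)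
    show "integrable lborel (\<lambda>p::(real^'n) \<times> real. K * B * M * indicator (ball 0 R \<times> {s..t}) p)"
    proof (intro integrable_mult_right integrable_real_indicator)
      have "bounded (ball (0::real^'n) R \<times> {s..t})" by (intro bounded_Times) auto
      then show "emeasure lborel (ball (0::real^'n) R \<times> {s..t}) < \<infinity>" by (rule emeasure_bounded_finite)
      have "ball (0::real^'n) R \<times> {s..t} \<in> sets (borel \<Otimes>\<^sub>M borel)" by (intro pair_measureI) auto
      then show "ball (0::real^'n) R \<times> {s..t} \<in> sets lborel" unfolding borel_prod by simp
    qed
    show "(\<lambda>(x, r). H x r) \<in> borel_measurable lborel" using Hm by (simp add: case_prod_beta)
    show "AE p in lborel. norm (case p of (x, r) \<Rightarrow> H x r) \<le> norm (K * B * M * indicator (ball 0 R \<times> {s..t}) p :: real)"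
    proof (rule AE_I2, clarify)
      fix x r
      show "norm (H x r) \<le> norm (K * B * M * indicator (ball 0 R \<times> {s..t}) (x, r) :: real)"
        using hb[of x r] K_pos B0 M(1) by (auto simp: H_def indicator_def)
    qed
  qed
  have hx: "(\<lambda>x. h x r) \<in> borel_measurable borel" for r
    using measurable_compose[OF _ hm, of "\<lambda>x. (x, r)" borel]
    by (simp add: borel_measurable_continuous_onI continuous_on_Pair continuous_on_id continuous_on_const)
  have q_eq: "q r = (LINT x|lborel. h x r)" for r
  proof -
    have sr: "square_integrable (\<lambda>x. inner (f (flow x s r) r) (g (flow x s r)))"
      by (rule square_integrable_flow[OF adv_C1(1)[OF G]])
    have "q r = (LINT x|lebesgue. inner (f (flow x s r) r) (g (flow x s r)) * \<psi> x)"
      unfolding q_def adv_C1(2)[OF G] evol_abs_l2[OF adv_C1(1)[OF G]] by (rule inner_abs_l2[OF sr s\<psi>])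
    also have "\<dots> = (LINT x|lborel. h x r)"
      using hx[of r] unfolding h_def by (intro integral_completion) simp
    finally show ?thesis .
  qed
  have Hx: "(LINT x|lborel. H x r) = indicator {s..t} r *\<^sub>R q r" for r
    by (simp add: H_def q_eq)
  have "integrable lborel (\<lambda>r. LINT x|lborel. H x r)"
    by (rule lborel_pair.integrable_snd[OF Hi])
  then have qi: "integrable lborel (\<lambda>r. indicator {s..t} r *\<^sub>R q r)" by (simp only: Hx)
  show "integrable (lebesgue_on {s..t}) q" by (rule lborel_imp_lebesgue_on(1)[OF qi])
  have Hr: "(LINT r|lborel. H x r) = (G (flow x s t) - G x) * \<psi> x" for x
  proof -
    have si: "set_integrable lborel {s..t} (h x)"
      unfolding set_integrable_def
    proof (rule Bochner_Integration.integrable_bound)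
      show "integrable lborel (\<lambda>r. K * B * M * indicator {s..t} r :: real)"
        by (intro integrable_mult_right integrable_real_indicator) (auto simp: emeasure_lborel_Icc_eq)
      have "h x \<in> borel_measurable borel"
        using measurable_compose[OF _ hm, of "\<lambda>r. (x, r)" borel]
        by (simp add: borel_measurable_continuous_onI continuous_on_Pair continuous_on_id continuous_on_const)
      then show "(\<lambda>r. indicator {s..t} r *\<^sub>R h x r) \<in> borel_measurable lborel" by measurable
      have "\<bar>h x r\<bar> \<le> K * B * M" for r
        using order_trans[OF hb[of x r] mult_left_le[of "indicator (ball 0 R) x" "K * B * M"]] K_pos B0 M(1)
        by (simp add: indicator_le_1)
      then show "AE r in lborel. norm (indicator {s..t} r *\<^sub>R h x r) \<le> norm (K * B * M * indicator {s..t} r :: real)"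
        using K_pos B0 M(1) by (intro AE_I2) (auto simp: indicator_def)
    qed
    have "(LINT r|lborel. H x r) = integral {s..t} (h x)"
      using set_borel_integral_eq_integral(2)[OF si] by (simp add: set_lebesgue_integral_def H_def)
    also have "\<dots> = integral {s..t} (\<lambda>r. inner (f (flow x s r) r) (g (flow x s r))) * \<psi> x"
      unfolding h_def by (rule integral_mult_left)
    finally show ?thesis by (simp add: C1_along_flow(2)[OF G st])
  qed
  have sd: "square_integrable (\<lambda>x. G (flow x s t) - G x)"
    by (rule square_integrable_diff[OF square_integrable_flow[OF sG] sG])
  have "inner (evol s t (abs_l2 G) - abs_l2 G) (abs_l2 \<psi>) = (LINT x|lebesgue. (G (flow x s t) - G x) * \<psi> x)"
    unfolding evol_abs_l2[OF sG] abs_l2_diff[OF square_integrable_flow[OF sG] sG, symmetric]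
    by (rule inner_abs_l2[OF sd s\<psi>])
  also have "\<dots> = (LINT x|lborel. (G (flow x s t) - G x) * \<psi> x)"
  proof (rule integral_completion)
    have "(\<lambda>x. LINT r|lborel. H x r) \<in> borel_measurable lborel"
      using lborel_pair.integrable_fst[OF Hi] by (rule borel_measurable_integrable)
    then show "(\<lambda>x. (G (flow x s t) - G x) * \<psi> x) \<in> borel_measurable lborel" by (simp only: Hr)
  qed
  also have "\<dots> = (LINT r|lborel. LINT x|lborel. H x r)"
    unfolding Hr[symmetric] by (rule lborel_pair.Fubini_integral[OF Hi, symmetric])
  also have "\<dots> = (LINT r|lebesgue_on {s..t}. q r)"
    by (simp only: Hx lborel_imp_lebesgue_on(2)[OF qi])
  finally show "inner (evol s t (abs_l2 G) - abs_l2 G) (abs_l2 \<psi>) = (LINT r|lebesgue_on {s..t}. q r)" .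
qed

end

subsection \<open>Estimates for the evolution operators\<close>

lemma H1_approx_sequence:
  fixes u :: "(real^'n::finite) l2"
  assumes w: "\<And>i. l2_deriv i u (w i)"
  obtains G g where "\<And>n::nat. C1_l2 (G n) (g n)" "(\<lambda>n. abs_l2 (G n)) \<longlonglongrightarrow> u"
    "\<And>i. (\<lambda>n. abs_l2 (\<lambda>x. g n x $ i)) \<longlonglongrightarrow> w i"
proof -
  have "\<exists>G g. C1_l2 G g \<and> norm (abs_l2 G - u) \<le> inverse (real (Suc n)) \<and>
      (\<forall>i. norm (abs_l2 (\<lambda>x. g x $ i) - w i) \<le> inverse (real (Suc n)))" for n
  proof -
    have "inverse (real (Suc n)) > 0" by simp
    from H1_approx[OF w this] show ?thesis by metis
  qed
  then obtain G g where G: "\<And>n. C1_l2 (G n) (g n)" "\<And>n. norm (abs_l2 (G n) - u) \<le> inverse (real (Suc n))"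
    "\<And>n i. norm (abs_l2 (\<lambda>x. g n x $ i) - w i) \<le> inverse (real (Suc n))" by metis
  have "(\<lambda>n. abs_l2 (G n) - u) \<longlonglongrightarrow> 0"
    by (rule Lim_null_comparison[OF always_eventually LIMSEQ_inverse_real_of_nat]) (intro allI G(2))
  moreover have "(\<lambda>n. abs_l2 (\<lambda>x. g n x $ i) - w i) \<longlonglongrightarrow> 0" for i
    by (rule Lim_null_comparison[OF always_eventually LIMSEQ_inverse_real_of_nat]) (intro allI G(3))
  ultimately show ?thesis using that[OF G(1)] by (simp add: LIM_zero_iff)
qed

lemma integrable_lebesgue_on_bounded:
  fixes h :: "real \<Rightarrow> 'b::{banach, second_countable_topology}"
  assumes "h \<in> borel_measurable (lebesgue_on {s..t})" "\<And>r. r \<in> {s..t} \<Longrightarrow> norm (h r) \<le> B"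
  shows "integrable (lebesgue_on {s..t}) h"
proof -
  interpret finite_measure "lebesgue_on {s..t}" by (rule finite_measure_lebesgue_on) simp
  show ?thesis using assms by (intro integrable_const_bound[of _ B]) auto
qed

lemma comp_mult_l2:
  assumes ns: "nonsingular C \<Psi>" and a: "a \<in> borel_measurable lebesgue" "\<And>x. \<bar>a x\<bar> \<le> K"
  shows "comp_l2 \<Psi> (mult_l2 a u) = mult_l2 (\<lambda>x. a (\<Psi> x)) (comp_l2 \<Psi> u)"
proof -
  have a': "(\<lambda>x. a (\<Psi> x)) \<in> borel_measurable lebesgue"
    using measurable_compose[OF nonsingular_lebesgue[OF ns] a(1)] .
  have "comp_l2 \<Psi> (mult_l2 a u) = abs_l2 (\<lambda>x. a (\<Psi> x) * rep_l2 u (\<Psi> x))"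
    unfolding mult_l2_def by (rule comp_abs_l2[OF ns square_integrable_times[OF a square_integrable_rep_l2]])
  also have "\<dots> = mult_l2 (\<lambda>x. a (\<Psi> x)) (comp_l2 \<Psi> u)"
    unfolding comp_l2_def using a(2)
    by (intro mult_abs_l2[OF a', symmetric] nonsingular_square_integrable(1)[OF ns square_integrable_rep_l2])
  finally show ?thesis .
qed

lemma mult_l2_diff_multiplier:
  assumes a: "a \<in> borel_measurable lebesgue" "\<And>x. \<bar>a x\<bar> \<le> K"
    and b: "b \<in> borel_measurable lebesgue" "\<And>x. \<bar>b x\<bar> \<le> K"
  shows "mult_l2 a u - mult_l2 b u = mult_l2 (\<lambda>x. a x - b x) u"
  unfolding mult_l2_def
  by (subst abs_l2_diff[symmetric])
    (auto simp: left_diff_distrib intro!: square_integrable_times[OF a square_integrable_rep_l2]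
      square_integrable_times[OF b square_integrable_rep_l2])

context lipschitz_field
begin

definition sobolev_const :: "real \<Rightarrow> real" where
  "sobolev_const r = 2 * exp (2 * K * r) * evol_const r"

lemma sobolev_const_nonneg: "sobolev_const r \<ge> 0"
  by (simp add: sobolev_const_def evol_const_nonneg)

lemma evol_weak_bound:
  assumes "\<bar>t - s\<bar> \<le> r" "\<And>i. l2_deriv i u (w i)" "test_function \<psi>"
  shows "\<bar>inner (evol s t u) (abs_l2 (partial_deriv i \<psi>))\<bar> \<le>
    sobolev_const r * (\<Sum>j\<in>UNIV. norm (w j)) * norm (abs_l2 \<psi>)"
proof -
  have "norm (flow x s t - flow y s t) \<le> 2 * exp (2 * K * r) * norm (x - y)" for x y
  proof -
    have "norm (flow x s t - flow y s t) \<le> 2 * exp (2 * K * \<bar>t - s\<bar>) * norm (x - y)" by (rule flow_lip)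
    also have "\<dots> \<le> 2 * exp (2 * K * r) * norm (x - y)"
      using assms(1) K_pos by (intro mult_right_mono) auto
    finally show ?thesis .
  qed
  from comp_l2_weak_bound[OF flow_nonsingular[OF assms(1)] this assms(2,3)]
  show ?thesis by (simp add: evol_def sobolev_const_def evol_const_def)
qed

text \<open>The integrand in \<open>forward_C1\<close> is bounded by the stated factor, and both
  sides pass to the limit along smooth approximations. The bound is linear in the elapsed time and
  in the first derivatives, which suits data that are only integrable in time.\<close>

lemma evol_diff_bound:
  assumes st: "s \<le> t" "t - s \<le> r" and w: "\<And>i. l2_deriv i u (w i)"
  shows "norm (evol s t u - u) \<le> (t - s) * (evol_const r * (K * (\<Sum>i\<in>UNIV. norm (w i))))"
proof (rule norm_l2_le_test)
  have nn: "evol_const r * (K * (\<Sum>i\<in>UNIV. norm (z i))) \<ge> 0" for z :: "'n \<Rightarrow> (real^'n) l2"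
    using K_pos by (intro mult_nonneg_nonneg evol_const_nonneg sum_nonneg) auto
  then show "0 \<le> (t - s) * (evol_const r * (K * (\<Sum>i\<in>UNIV. norm (w i))))" using st(1) by simp
  fix \<psi> :: "real^'n \<Rightarrow> real" assume \<psi>: "test_function \<psi>"
  obtain G g where G: "\<And>n::nat. C1_l2 (G n) (g n)" "(\<lambda>n. abs_l2 (G n)) \<longlonglongrightarrow> u"
    "\<And>i. (\<lambda>n. abs_l2 (\<lambda>x. g n x $ i)) \<longlonglongrightarrow> w i"
    using H1_approx_sequence[OF w] by blast
  have bound: "\<bar>inner (evol s t (abs_l2 (G n)) - abs_l2 (G n)) (abs_l2 \<psi>)\<bar> \<le>
      (t - s) * (evol_const r * (K * (\<Sum>i\<in>UNIV. norm (abs_l2 (\<lambda>x. g n x $ i)))) * norm (abs_l2 \<psi>))" for n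
    unfolding forward_C1(2)[OF G(1) \<psi> st(1)]
  proof (rule integral_lebesgue_on_bound[OF st(1) forward_C1(1)[OF G(1) \<psi> st(1)]])
    fix \<rho> assume \<rho>: "\<rho> \<in> {s..t}"
    let ?a = "adv \<rho> (\<lambda>i. abs_l2 (\<lambda>x. g n x $ i))"
    have "\<bar>inner (evol s \<rho> ?a) (abs_l2 \<psi>)\<bar> \<le> norm (evol s \<rho> ?a) * norm (abs_l2 \<psi>)" by (rule Cauchy_Schwarz_ineq2)
    also have "norm (evol s \<rho> ?a) \<le> evol_const r * norm ?a" using \<rho> st by (intro norm_evol) auto
    also have "norm ?a \<le> K * (\<Sum>i\<in>UNIV. norm (abs_l2 (\<lambda>x. g n x $ i)))" by (rule norm_adv)
    finally show "\<bar>inner (evol s \<rho> ?a) (abs_l2 \<psi>)\<bar> \<le>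
        evol_const r * (K * (\<Sum>i\<in>UNIV. norm (abs_l2 (\<lambda>x. g n x $ i)))) * norm (abs_l2 \<psi>)"
      using evol_const_nonneg by (simp add: mult_left_mono mult_right_mono)
  qed
  have "\<bar>inner (evol s t u - u) (abs_l2 \<psi>)\<bar> \<le>
      (t - s) * (evol_const r * (K * (\<Sum>i\<in>UNIV. norm (w i))) * norm (abs_l2 \<psi>))"
  proof (rule LIMSEQ_le)
    show "(\<lambda>n. \<bar>inner (evol s t (abs_l2 (G n)) - abs_l2 (G n)) (abs_l2 \<psi>)\<bar>) \<longlonglongrightarrow> \<bar>inner (evol s t u - u) (abs_l2 \<psi>)\<bar>"
      by (intro tendsto_intros G bounded_linear.tendsto[OF bounded_linear_evol])
    show "(\<lambda>n. (t - s) * (evol_const r * (K * (\<Sum>i\<in>UNIV. norm (abs_l2 (\<lambda>x. g n x $ i)))) * norm (abs_l2 \<psi>)))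
        \<longlonglongrightarrow> (t - s) * (evol_const r * (K * (\<Sum>i\<in>UNIV. norm (w i))) * norm (abs_l2 \<psi>))"
      by (intro tendsto_intros G)
  qed (use bound in blast)
  then show "\<bar>inner (evol s t u - u) (abs_l2 \<psi>)\<bar> \<le>
      (t - s) * (evol_const r * (K * (\<Sum>i\<in>UNIV. norm (w i)))) * norm (abs_l2 \<psi>)"
    by (simp add: mult.assoc)
qed

text \<open>Composition acts on both factors of \<open>f\<close> times w. The change in w is kept as
  it is; the change in \<open>f\<close> is at most K times the displacement, which is at most K
  (\<rho> - s).\<close>

lemma evol_adv_diff:
  assumes "s \<le> \<rho>"
  shows "norm (evol s \<rho> (adv \<rho> w) - adv \<rho> w) \<le>
    (\<Sum>i\<in>UNIV. K * (norm (evol s \<rho> (w i) - w i) + K * (\<rho> - s) * norm (w i)))"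
proof -
  have le: "norm (evol s \<rho> (mult_l2 (\<lambda>x. f x \<rho> $ i) u) - mult_l2 (\<lambda>x. f x \<rho> $ i) u) \<le>
      K * (norm (evol s \<rho> u - u) + K * (\<rho> - s) * norm u)" for i u
  proof -
    note ns = flow_nonsingular[of \<rho> s, OF order_refl]
    have m: "(\<lambda>x. f (flow x s \<rho>) \<rho> $ i) \<in> borel_measurable lebesgue"
      using measurable_compose[OF nonsingular_lebesgue[OF ns] f_component_measurable] .
    have mb: "\<bar>f (flow x s \<rho>) \<rho> $ i\<bar> \<le> K" for x by (rule f_component_bound)
    have fm: "(\<lambda>x. f x \<rho> $ i) \<in> borel_measurable lebesgue" by (rule f_component_measurable)
    have fb: "\<bar>f x \<rho> $ i\<bar> \<le> K" for x by (rule f_component_bound)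
    let ?A = "mult_l2 (\<lambda>x. f (flow x s \<rho>) \<rho> $ i) (evol s \<rho> u - u)"
    let ?B = "mult_l2 (\<lambda>x. f (flow x s \<rho>) \<rho> $ i) u - mult_l2 (\<lambda>x. f x \<rho> $ i) u"
    have "evol s \<rho> (mult_l2 (\<lambda>x. f x \<rho> $ i) u) = mult_l2 (\<lambda>x. f (flow x s \<rho>) \<rho> $ i) (evol s \<rho> u)"
      unfolding evol_def by (rule comp_mult_l2[OF ns fm fb])
    then have eq: "evol s \<rho> (mult_l2 (\<lambda>x. f x \<rho> $ i) u) - mult_l2 (\<lambda>x. f x \<rho> $ i) u = ?A + ?B"
      using linear_diff[OF bounded_linear.linear[OF bounded_linear_mult_l2[OF m mb]], of "evol s \<rho> u" u] by simp
    have A: "norm ?A \<le> K * norm (evol s \<rho> u - u)"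
      by (rule norm_mult_l2[OF m mb])
    have B: "norm ?B \<le> (K * (K * (\<rho> - s))) * norm u"
      unfolding mult_l2_diff_multiplier[OF m mb fm fb]
    proof (rule norm_mult_l2)
      show "(\<lambda>x. f (flow x s \<rho>) \<rho> $ i - f x \<rho> $ i) \<in> borel_measurable lebesgue"
        by (rule borel_measurable_diff[OF m fm])
      fix x
      have "\<bar>f (flow x s \<rho>) \<rho> $ i - f x \<rho> $ i\<bar> \<le> norm (f (flow x s \<rho>) \<rho> - f x \<rho>)"
        using component_le_norm_cart[of "f (flow x s \<rho>) \<rho> - f x \<rho>" i] by simp
      also have "\<dots> \<le> K * norm (flow x s \<rho> - x)" by (rule f_lip)
      also have "\<dots> \<le> K * (K * (\<rho> - s))"
        using flow_displacement[of x s \<rho>] assms K_pos by (intro mult_left_mono) auto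
      finally show "\<bar>f (flow x s \<rho>) \<rho> $ i - f x \<rho> $ i\<bar> \<le> K * (K * (\<rho> - s))" .
    qed
    show ?thesis
      unfolding eq using norm_triangle_ineq[of ?A ?B] A B by (simp add: distrib_left mult.assoc)
  qed
  have "evol s \<rho> (adv \<rho> w) - adv \<rho> w =
      (\<Sum>i\<in>UNIV. evol s \<rho> (mult_l2 (\<lambda>x. f x \<rho> $ i) (w i)) - mult_l2 (\<lambda>x. f x \<rho> $ i) (w i))"
    by (simp add: adv_def evol_sum sum_subtractf)
  also have "norm \<dots> \<le> (\<Sum>i\<in>UNIV. K * (norm (evol s \<rho> (w i) - w i) + K * (\<rho> - s) * norm (w i)))"
    by (intro order_trans[OF norm_sum] sum_mono le)
  finally show ?thesis .
qed

lemma inner_adv_integrable: "integrable (lebesgue_on {s..t}) (\<lambda>\<rho>. inner (adv \<rho> w) v)"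
proof (rule integrable_lebesgue_on_bounded)
  show "(\<lambda>\<rho>. inner (adv \<rho> w) v) \<in> borel_measurable (lebesgue_on {s..t})"
    by (intro borel_measurable_inner adv_measurable) auto
  show "norm (inner (adv \<rho> w) v) \<le> K * (\<Sum>i\<in>UNIV. norm (w i)) * norm v" for \<rho>
    using Cauchy_Schwarz_ineq2[of "adv \<rho> w" v] mult_right_mono[OF norm_adv[of \<rho> w], of "norm v"] by simp
qed

text \<open>The first-order term is an integral of \<open>adv\<close> over time, since
  \<open>f\<close> cannot be evaluated at a single time. What is frozen is w:
  \<open>evol_adv_diff\<close> bounds the error by \<beta>, the oscillation of w under the flow,
  plus a multiple of the elapsed time.\<close>

lemma evol_expansion:
  assumes st: "s \<le> t" and w: "\<And>i. l2_deriv i u (w i)" and \<psi>: "test_function \<psi>"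
    and \<beta>: "\<And>\<rho> i. \<rho> \<in> {s..t} \<Longrightarrow> norm (evol s \<rho> (w i) - w i) \<le> \<beta>"
  shows "\<bar>inner (evol s t u - u) (abs_l2 \<psi>) - (LINT \<rho>|lebesgue_on {s..t}. inner (adv \<rho> w) (abs_l2 \<psi>))\<bar> \<le>
    (t - s) * ((\<Sum>i\<in>UNIV. K * (\<beta> + K * (t - s) * norm (w i))) * norm (abs_l2 \<psi>))"
proof -
  define c where "c = evol_const (t - s)"
  have c: "c \<ge> 0" by (simp add: c_def evol_const_nonneg)
  obtain G g where G: "\<And>n::nat. C1_l2 (G n) (g n)" "(\<lambda>n. abs_l2 (G n)) \<longlonglongrightarrow> u"
    "\<And>i. (\<lambda>n. abs_l2 (\<lambda>x. g n x $ i)) \<longlonglongrightarrow> w i"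
    using H1_approx_sequence[OF w] by blast
  define z where "z n i = abs_l2 (\<lambda>x. g n x $ i)" for n i
  have zw: "(\<lambda>n. z n i) \<longlonglongrightarrow> w i" for i using G(3)[of i] by (simp add: z_def)
  define P where "P = norm (abs_l2 \<psi>)"
  \<comment> \<open>\<beta> controls only the limit w; passing to the approximants costs (c + 1)
    times their distance to w, which vanishes in the limit.\<close>
  define B where "B n = (\<Sum>i\<in>UNIV. K * ((\<beta> + (c + 1) * norm (z n i - w i)) + K * (t - s) * norm (z n i)))" for n
  have bound: "\<bar>inner (evol s t (abs_l2 (G n)) - abs_l2 (G n)) (abs_l2 \<psi>) - (LINT \<rho>|lebesgue_on {s..t}. inner (adv \<rho> (z n)) (abs_l2 \<psi>))\<bar>
      \<le> (t - s) * (B n * P)" for n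
  proof -
    note fwd = forward_C1[OF G(1)[of n] \<psi> st, folded z_def]
    have "inner (evol s t (abs_l2 (G n)) - abs_l2 (G n)) (abs_l2 \<psi>) - (LINT \<rho>|lebesgue_on {s..t}. inner (adv \<rho> (z n)) (abs_l2 \<psi>))
        = (LINT \<rho>|lebesgue_on {s..t}. inner (evol s \<rho> (adv \<rho> (z n))) (abs_l2 \<psi>) - inner (adv \<rho> (z n)) (abs_l2 \<psi>))"
      unfolding fwd(2) using Bochner_Integration.integral_diff[OF fwd(1) inner_adv_integrable] by simp
    also have "\<bar>\<dots>\<bar> \<le> (t - s) * (B n * P)"
    proof (rule integral_lebesgue_on_bound[OF st Bochner_Integration.integrable_diff[OF fwd(1) inner_adv_integrable]])
      fix \<rho> assume \<rho>: "\<rho> \<in> {s..t}"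
      have "\<bar>inner (evol s \<rho> (adv \<rho> (z n))) (abs_l2 \<psi>) - inner (adv \<rho> (z n)) (abs_l2 \<psi>)\<bar> \<le>
          norm (evol s \<rho> (adv \<rho> (z n)) - adv \<rho> (z n)) * P"
        unfolding P_def inner_diff_left[symmetric] by (rule Cauchy_Schwarz_ineq2)
      also have "norm (evol s \<rho> (adv \<rho> (z n)) - adv \<rho> (z n)) \<le>
          (\<Sum>i\<in>UNIV. K * (norm (evol s \<rho> (z n i) - z n i) + K * (\<rho> - s) * norm (z n i)))"
        using \<rho> by (intro evol_adv_diff) simp
      also have "\<dots> \<le> B n"
        unfolding B_def
      proof (intro sum_mono mult_left_mono add_mono mult_right_mono)
        fix i
        have "evol s \<rho> (z n i) - z n i = (evol s \<rho> (w i) - w i) + evol s \<rho> (z n i - w i) - (z n i - w i)"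
          by (simp add: evol_diff)
        also have "norm \<dots> \<le> norm (evol s \<rho> (w i) - w i) + norm (evol s \<rho> (z n i - w i)) + norm (z n i - w i)"
          by (intro order_trans[OF norm_triangle_ineq4] add_right_mono norm_triangle_ineq)
        also have "norm (evol s \<rho> (z n i - w i)) \<le> c * norm (z n i - w i)"
          unfolding c_def using \<rho> by (intro norm_evol) auto
        finally show "norm (evol s \<rho> (z n i) - z n i) \<le> \<beta> + (c + 1) * norm (z n i - w i)"
          using \<beta>[OF \<rho>, of i] by (simp add: algebra_simps)
      qed (use \<rho> K_pos in auto)
      finally show "\<bar>inner (evol s \<rho> (adv \<rho> (z n))) (abs_l2 \<psi>) - inner (adv \<rho> (z n)) (abs_l2 \<psi>)\<bar> \<le> B n * P"
        by (simp add: mult_right_mono P_def)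
    qed
    finally show ?thesis .
  qed
  have int_lim: "(\<lambda>n. LINT \<rho>|lebesgue_on {s..t}. inner (adv \<rho> (z n)) (abs_l2 \<psi>)) \<longlonglongrightarrow>
      (LINT \<rho>|lebesgue_on {s..t}. inner (adv \<rho> w) (abs_l2 \<psi>))"
  proof (rule LIM_zero_cancel, rule Lim_null_comparison[OF always_eventually])
    show "\<forall>n. norm ((LINT \<rho>|lebesgue_on {s..t}. inner (adv \<rho> (z n)) (abs_l2 \<psi>)) - (LINT \<rho>|lebesgue_on {s..t}. inner (adv \<rho> w) (abs_l2 \<psi>)))
        \<le> (t - s) * (K * (\<Sum>i\<in>UNIV. norm (z n i - w i)) * P)"
    proof
      fix n
      have "\<bar>LINT \<rho>|lebesgue_on {s..t}. inner (adv \<rho> (z n)) (abs_l2 \<psi>) - inner (adv \<rho> w) (abs_l2 \<psi>)\<bar>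
          \<le> (t - s) * (K * (\<Sum>i\<in>UNIV. norm (z n i - w i)) * P)"
      proof (rule integral_lebesgue_on_bound[OF st Bochner_Integration.integrable_diff[OF inner_adv_integrable inner_adv_integrable]])
        fix \<rho>
        have "\<bar>inner (adv \<rho> (z n)) (abs_l2 \<psi>) - inner (adv \<rho> w) (abs_l2 \<psi>)\<bar> \<le> norm (adv \<rho> (\<lambda>i. z n i - w i)) * P"
          unfolding P_def inner_diff_left[symmetric] adv_diff by (rule Cauchy_Schwarz_ineq2)
        also have "\<dots> \<le> K * (\<Sum>i\<in>UNIV. norm (z n i - w i)) * P"
          by (intro mult_right_mono norm_adv) (simp add: P_def)
        finally show "\<bar>inner (adv \<rho> (z n)) (abs_l2 \<psi>) - inner (adv \<rho> w) (abs_l2 \<psi>)\<bar> \<le> K * (\<Sum>i\<in>UNIV. norm (z n i - w i)) * P" .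
      qed
      then show "norm ((LINT \<rho>|lebesgue_on {s..t}. inner (adv \<rho> (z n)) (abs_l2 \<psi>)) - (LINT \<rho>|lebesgue_on {s..t}. inner (adv \<rho> w) (abs_l2 \<psi>)))
          \<le> (t - s) * (K * (\<Sum>i\<in>UNIV. norm (z n i - w i)) * P)"
        by (simp add: Bochner_Integration.integral_diff[OF inner_adv_integrable inner_adv_integrable])
    qed
    have "(\<lambda>n. (t - s) * (K * (\<Sum>i\<in>UNIV. norm (z n i - w i)) * P)) \<longlonglongrightarrow> (t - s) * (K * (\<Sum>i\<in>UNIV. norm (w i - w i)) * P)"
      by (intro tendsto_intros zw)
    then show "(\<lambda>n. (t - s) * (K * (\<Sum>i\<in>UNIV. norm (z n i - w i)) * P)) \<longlonglongrightarrow> 0" by simp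
  qed
  have "\<bar>inner (evol s t u - u) (abs_l2 \<psi>) - (LINT \<rho>|lebesgue_on {s..t}. inner (adv \<rho> w) (abs_l2 \<psi>))\<bar> \<le>
      (t - s) * ((\<Sum>i\<in>UNIV. K * ((\<beta> + (c + 1) * norm (w i - w i)) + K * (t - s) * norm (w i))) * P)"
  proof (rule LIMSEQ_le)
    show "(\<lambda>n. \<bar>inner (evol s t (abs_l2 (G n)) - abs_l2 (G n)) (abs_l2 \<psi>) - (LINT \<rho>|lebesgue_on {s..t}. inner (adv \<rho> (z n)) (abs_l2 \<psi>))\<bar>)
        \<longlonglongrightarrow> \<bar>inner (evol s t u - u) (abs_l2 \<psi>) - (LINT \<rho>|lebesgue_on {s..t}. inner (adv \<rho> w) (abs_l2 \<psi>))\<bar>"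
      by (intro tendsto_rabs tendsto_diff tendsto_inner tendsto_const G(2) int_lim bounded_linear.tendsto[OF bounded_linear_evol])
    show "(\<lambda>n. (t - s) * (B n * P)) \<longlonglongrightarrow>
        (t - s) * ((\<Sum>i\<in>UNIV. K * ((\<beta> + (c + 1) * norm (w i - w i)) + K * (t - s) * norm (w i))) * P)"
      unfolding B_def by (intro tendsto_intros zw)
  qed (use bound in blast)
  then show ?thesis by (simp add: P_def)
qed

end

locale transport_field = lipschitz_field K f
  for K :: real and f :: "real^'n::finite \<Rightarrow> real \<Rightarrow> real^'n" +
  assumes f_partial: "has_partial_deriv i (\<lambda>x. f x t) x"
begin

lemma f_component_partial:
  shows "has_partial_deriv i (\<lambda>x. f x t $ j) x" and "\<bar>partial_deriv i (\<lambda>x. f x t $ j) x\<bar> \<le> K"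
proof -
  have d: "((\<lambda>h. f (x + h *\<^sub>R axis i 1) t $ j) has_vector_derivative partial_deriv i (\<lambda>x. f x t) x $ j) (at 0)"
    using bounded_linear.has_vector_derivative[OF bounded_linear_vec_nth partial_derivD[OF f_partial]] .
  then show "has_partial_deriv i (\<lambda>x. f x t $ j) x" by (rule partial_derivI(1))
  have "\<bar>partial_deriv i (\<lambda>x. f x t $ j) x\<bar> \<le> K"
  proof -
    have lim: "((\<lambda>h. (f (x + h *\<^sub>R axis i 1) t $ j - f x t $ j) /\<^sub>R h) \<longlongrightarrow> partial_deriv i (\<lambda>x. f x t $ j) x) (at 0)"
      using d partial_derivI(2)[OF d] by (simp add: has_vector_derivative_at_0_iff)
    have "norm (partial_deriv i (\<lambda>x. f x t $ j) x) \<le> K"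
    proof (rule tendsto_upperbound[OF tendsto_norm[OF lim]])
      show "\<forall>\<^sub>F h in at 0. norm ((f (x + h *\<^sub>R axis i 1) t $ j - f x t $ j) /\<^sub>R h) \<le> K"
      proof (rule eventually_at_filter[THEN iffD2], rule always_eventually, intro allI impI)
        fix h :: real assume h: "h \<noteq> 0"
        have "\<bar>f (x + h *\<^sub>R axis i 1) t $ j - f x t $ j\<bar> \<le> norm (f (x + h *\<^sub>R axis i 1) t - f x t)"
          using component_le_norm_cart[of "f (x + h *\<^sub>R axis i 1) t - f x t" j] by simp
        also have "\<dots> \<le> K * \<bar>h\<bar>" using f_lip[of "x + h *\<^sub>R axis i 1" t x] by simp
        finally show "norm ((f (x + h *\<^sub>R axis i 1) t $ j - f x t $ j) /\<^sub>R h) \<le> K"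
          using h by (simp add: abs_mult divide_inverse[symmetric] mult.commute[of "inverse _"] pos_divide_le_eq)
      qed
    qed simp
    then show ?thesis by simp
  qed
  then show "\<bar>partial_deriv i (\<lambda>x. f x t $ j) x\<bar> \<le> K" .
qed

lemma l2_deriv_mult_f:
  assumes "l2_deriv i u w"
  shows "partial_deriv i (\<lambda>x. f x t $ j) \<in> borel_measurable lebesgue"
    and "l2_deriv i (mult_l2 (\<lambda>x. f x t $ j) u) (mult_l2 (\<lambda>x. f x t $ j) w + mult_l2 (partial_deriv i (\<lambda>x. f x t $ j)) u)"
  by (rule l2_deriv_mult[OF f_component_continuous f_component_bound f_component_partial assms])+

lemma partial_f_measurable: "partial_deriv i (\<lambda>x. f x t $ j) \<in> borel_measurable lebesgue"
  by (rule l2_deriv_mult_f(1)[OF l2_deriv_test[OF test_function_0]])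

text \<open>Integration by parts moves the derivative to \<psi> and \<open>f\<close>, leaving a
  bound by the norm of u alone. The transport term is thus controlled by continuity in
  \<open>l2\<close>, though the derivatives themselves need not be continuous in time.\<close>

lemma adv_weak_bound:
  assumes w: "\<And>i. l2_deriv i u (w i)" and \<psi>: "test_function \<psi>"
  shows "\<bar>inner (adv t w) (abs_l2 \<psi>)\<bar> \<le>
    (K * (\<Sum>i\<in>UNIV. norm (abs_l2 (partial_deriv i \<psi>)) + norm (abs_l2 \<psi>))) * norm u"
proof -
  have le: "\<bar>inner (mult_l2 (\<lambda>x. f x t $ i) (w i)) (abs_l2 \<psi>)\<bar> \<le>
      norm u * (K * (norm (abs_l2 (partial_deriv i \<psi>)) + norm (abs_l2 \<psi>)))" for i
  proof -
    let ?d = "mult_l2 (\<lambda>x. f x t $ i) (abs_l2 (partial_deriv i \<psi>)) + mult_l2 (partial_deriv i (\<lambda>x. f x t $ i)) (abs_l2 \<psi>)"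
    have "inner (mult_l2 (\<lambda>x. f x t $ i) (w i)) (abs_l2 \<psi>) = inner (w i) (mult_l2 (\<lambda>x. f x t $ i) (abs_l2 \<psi>))"
      by (rule inner_mult_l2[OF f_component_measurable f_component_bound])
    also have "\<dots> = - inner u ?d"
      by (rule l2_deriv_by_parts[OF w l2_deriv_mult_f(2)[OF l2_deriv_test[OF \<psi>]]])
    also have "\<bar>\<dots>\<bar> \<le> norm u * norm ?d" using Cauchy_Schwarz_ineq2[of u ?d] by simp
    also have "norm ?d \<le> norm (mult_l2 (\<lambda>x. f x t $ i) (abs_l2 (partial_deriv i \<psi>))) +
        norm (mult_l2 (partial_deriv i (\<lambda>x. f x t $ i)) (abs_l2 \<psi>))" by (rule norm_triangle_ineq)
    also have "\<dots> \<le> K * norm (abs_l2 (partial_deriv i \<psi>)) + K * norm (abs_l2 \<psi>)"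
      by (intro add_mono norm_mult_l2 f_component_measurable f_component_bound partial_f_measurable f_component_partial)
    finally show ?thesis by (simp add: mult_left_mono distrib_left)
  qed
  have "\<bar>inner (adv t w) (abs_l2 \<psi>)\<bar> \<le>
      (\<Sum>i\<in>UNIV. norm u * (K * (norm (abs_l2 (partial_deriv i \<psi>)) + norm (abs_l2 \<psi>))))"
    unfolding adv_def inner_sum_left by (rule order_trans[OF sum_abs], rule sum_mono, rule le)
  also have "\<dots> = (K * (\<Sum>i\<in>UNIV. norm (abs_l2 (partial_deriv i \<psi>)) + norm (abs_l2 \<psi>))) * norm u"
    by (simp add: sum_distrib_left mult_ac)
  finally show ?thesis .
qed

text \<open>Antisymmetry of the transport term up to the divergence of \<open>f\<close>.\<close>

lemma inner_adv_self:
  assumes w: "\<And>i. l2_deriv i u (w i)"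
  shows "\<bar>2 * inner (adv t w) u\<bar> \<le> real CARD('n) * K * (norm u)\<^sup>2"
proof -
  have le: "\<bar>2 * inner (mult_l2 (\<lambda>x. f x t $ i) (w i)) u\<bar> \<le> K * (norm u)\<^sup>2" for i
  proof -
    have "inner (w i) (mult_l2 (\<lambda>x. f x t $ i) u) =
        - inner u (mult_l2 (\<lambda>x. f x t $ i) (w i) + mult_l2 (partial_deriv i (\<lambda>x. f x t $ i)) u)"
      by (rule l2_deriv_by_parts[OF w l2_deriv_mult_f(2)[OF w]])
    moreover have "inner (mult_l2 (\<lambda>x. f x t $ i) (w i)) u = inner (w i) (mult_l2 (\<lambda>x. f x t $ i) u)"
      by (rule inner_mult_l2[OF f_component_measurable f_component_bound])
    ultimately have "2 * inner (mult_l2 (\<lambda>x. f x t $ i) (w i)) u = - inner u (mult_l2 (partial_deriv i (\<lambda>x. f x t $ i)) u)"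
      by (simp add: inner_add_right inner_commute)
    also have "\<bar>\<dots>\<bar> \<le> norm u * norm (mult_l2 (partial_deriv i (\<lambda>x. f x t $ i)) u)"
      using Cauchy_Schwarz_ineq2[of u] by simp
    also have "\<dots> \<le> norm u * (K * norm u)"
      by (intro mult_left_mono norm_mult_l2 partial_f_measurable f_component_partial) auto
    finally show ?thesis by (simp add: power2_eq_square mult_ac)
  qed
  have "\<bar>2 * inner (adv t w) u\<bar> \<le> (\<Sum>i::'n\<in>UNIV. K * (norm u)\<^sup>2)"
    unfolding adv_def inner_sum_left sum_distrib_left by (rule order_trans[OF sum_abs], rule sum_mono, rule le)
  then show ?thesis by simp
qed

end

subsection \<open>Integrals over subintervals\<close>

lemma integrable_lebesgue_on_iff:
  fixes h :: "real \<Rightarrow> 'b::{banach, second_countable_topology}"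
  shows "integrable (lebesgue_on {a..b}) h \<longleftrightarrow> integrable lebesgue (\<lambda>t. indicator {a..b} t *\<^sub>R h t)"
  by (rule integrable_restrict_space) simp

lemma integral_lebesgue_on_eq:
  fixes h :: "real \<Rightarrow> 'b::{banach, second_countable_topology}"
  shows "(LINT t|lebesgue_on {a..b}. h t) = (LINT t|lebesgue. indicator {a..b} t *\<^sub>R h t)"
  by (rule integral_restrict_space) simp

lemma indicator_subinterval:
  fixes h :: "real \<Rightarrow> 'b::real_vector"
  assumes "{c..d} \<subseteq> {a..b}"
  shows "(\<lambda>t. indicator {a..b} t *\<^sub>R (indicator {c..d} t *\<^sub>R h t)) = (\<lambda>t. indicator {c..d} t *\<^sub>R h t)"
proof
  fix t show "indicator {a..b} t *\<^sub>R (indicator {c..d} t *\<^sub>R h t) = indicator {c..d} t *\<^sub>R h t"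
    using assms by (cases "t \<in> {c..d}") (auto simp: subset_eq)
qed

lemma integrable_subinterval:
  fixes h :: "real \<Rightarrow> 'b::{banach, second_countable_topology}"
  assumes "integrable (lebesgue_on {a..b}) h" "{c..d} \<subseteq> {a..b}"
  shows "integrable (lebesgue_on {c..d}) h"
proof -
  have "integrable lebesgue (\<lambda>t. indicator {c..d} t *\<^sub>R (indicator {a..b} t *\<^sub>R h t))"
    using assms(1) unfolding integrable_lebesgue_on_iff by (rule integrable_mult_indicator[rotated]) simp
  moreover have "(\<lambda>t. indicator {c..d} t *\<^sub>R (indicator {a..b} t *\<^sub>R h t)) = (\<lambda>t. indicator {c..d} t *\<^sub>R h t)"
    using indicator_subinterval[OF assms(2), of h] by (simp add: mult.commute)
  ultimately show ?thesis by (simp add: integrable_lebesgue_on_iff)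
qed

lemma integral_subinterval_eq:
  fixes h :: "real \<Rightarrow> 'b::{banach, second_countable_topology}"
  assumes "{c..d} \<subseteq> {a..b}"
  shows "(LINT t|lebesgue_on {c..d}. h t) = (LINT t|lebesgue_on {a..b}. indicator {c..d} t *\<^sub>R h t)"
  unfolding integral_lebesgue_on_eq indicator_subinterval[OF assms] ..

lemma Icc_in_sets_lebesgue_on: "{c..d} \<subseteq> {a..b} \<Longrightarrow> {c..d} \<in> sets (lebesgue_on {a..b :: real})"
  by (subst sets_restrict_space_iff) auto

lemma AE_lebesgue_on_neq: "AE t in lebesgue_on {a..b}. t \<noteq> (c::real)"
proof -
  have "AE t in lebesgue. t \<noteq> c" by (rule AE_completion[OF AE_lborel_singleton])
  then show ?thesis by (subst AE_restrict_space_iff) auto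
qed

lemma AE_subinterval:
  assumes "AE t in lebesgue_on {a..b}. P (t::real)" "{c..d} \<subseteq> {a..b}"
  shows "AE t in lebesgue_on {c..d}. P t"
proof -
  have "AE t in lebesgue. t \<in> {a..b} \<longrightarrow> P t" using assms(1) by (subst (asm) AE_restrict_space_iff) auto
  then have "AE t in lebesgue. t \<in> {c..d} \<longrightarrow> P t" by eventually_elim (use assms(2) in blast)
  then show ?thesis by (subst AE_restrict_space_iff) auto
qed

lemma integral_lebesgue_on_combine:
  fixes h :: "real \<Rightarrow> 'b::{banach, second_countable_topology}"
  assumes h: "integrable (lebesgue_on {a..c}) h" and b: "a \<le> b" "b \<le> c"
  shows "(LINT t|lebesgue_on {a..c}. h t) = (LINT t|lebesgue_on {a..b}. h t) + (LINT t|lebesgue_on {b..c}. h t)"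
proof -
  have i: "integrable lebesgue (\<lambda>t. indicator {a..b} t *\<^sub>R h t)" "integrable lebesgue (\<lambda>t. indicator {b..c} t *\<^sub>R h t)"
    "integrable lebesgue (\<lambda>t. indicator {a..c} t *\<^sub>R h t)"
    using integrable_subinterval[OF h] h b unfolding integrable_lebesgue_on_iff by auto
  have "AE t in lebesgue. t \<noteq> b" by (rule AE_completion[OF AE_lborel_singleton])
  then have "(LINT t|lebesgue. indicator {a..c} t *\<^sub>R h t) =
      (LINT t|lebesgue. indicator {a..b} t *\<^sub>R h t + indicator {b..c} t *\<^sub>R h t)"
  proof (intro integral_cong_AE)
    show "AE t in lebesgue. indicator {a..c} t *\<^sub>R h t = indicator {a..b} t *\<^sub>R h t + indicator {b..c} t *\<^sub>R h t"
      using \<open>AE t in lebesgue. t \<noteq> b\<close> by eventually_elim (use b in \<open>auto simp: indicator_def\<close>)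
  qed (use i in \<open>auto intro: borel_measurable_integrable\<close>)
  then show ?thesis unfolding integral_lebesgue_on_eq by (simp add: Bochner_Integration.integral_add i)
qed

lemma continuous_primitive:
  fixes m :: "real \<Rightarrow> real"
  assumes "integrable (lebesgue_on {a..b}) m"
  shows "continuous_on {a..b} (\<lambda>s. LINT t|lebesgue_on {a..s}. m t)"
proof -
  have "continuous_on {a..b} (\<lambda>s. integral {a..s} m)"
    using assms by (intro indefinite_integral_continuous_1 integrable_on_lebesgue_on) auto
  then show ?thesis
  proof (rule continuous_on_eq)
    fix s assume "s \<in> {a..b}"
    then have "integrable (lebesgue_on {a..s}) m" by (intro integrable_subinterval[OF assms]) auto
    then show "integral {a..s} m = (LINT t|lebesgue_on {a..s}. m t)"
      by (rule lebesgue_integral_eq_integral[symmetric]) simp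
  qed
qed

lemma integral_lebesgue_on_mono_AE:
  fixes p q :: "real \<Rightarrow> real"
  assumes "integrable (lebesgue_on {a..b}) p" "integrable (lebesgue_on {a..b}) q"
    "AE t in lebesgue_on {a..b}. \<bar>p t\<bar> \<le> q t"
  shows "\<bar>LINT t|lebesgue_on {a..b}. p t\<bar> \<le> (LINT t|lebesgue_on {a..b}. q t)"
proof -
  have "\<bar>LINT t|lebesgue_on {a..b}. p t\<bar> \<le> (LINT t|lebesgue_on {a..b}. \<bar>p t\<bar>)"
    using integral_norm_bound[of "lebesgue_on {a..b}" p] by simp
  also have "\<dots> \<le> (LINT t|lebesgue_on {a..b}. q t)"
    using assms by (intro integral_mono_AE) auto
  finally show ?thesis .
qed

lemma norm_weak_deriv_le_H1: "norm (weak_deriv i u) \<le> norm_H1 u"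
proof -
  have "(norm (weak_deriv i u))\<^sup>2 \<le> (\<Sum>i\<in>UNIV. (norm (weak_deriv i u))\<^sup>2)" by (rule member_le_sum) auto
  then show ?thesis unfolding norm_H1_def by (intro real_le_rsqrt) (smt (verit) zero_le_power2)
qed

lemma norm_le_H1: "norm u \<le> norm_H1 u"
  unfolding norm_H1_def by (intro real_le_rsqrt) (simp add: sum_nonneg)

text \<open>Used to pass from square integrability to integrability over the time interval, which
  has finite measure.\<close>

lemma le_one_plus_square: "(x::real) \<le> 1 + x\<^sup>2"
  using zero_le_power2[of "x - 1"] by (simp add: power2_diff) (smt (verit) zero_le_power2)

lemma X1_weak_deriv_integrable:
  assumes "v \<in> X1 T"
  shows "integrable (lebesgue_on {0..T}) (\<lambda>t. norm (weak_deriv i (v t)))"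
proof (rule Bochner_Integration.integrable_bound)
  interpret finite_measure "lebesgue_on {0..T}" by (rule finite_measure_lebesgue_on) simp
  show "integrable (lebesgue_on {0..T}) (\<lambda>t. 1 + (norm_H1 (v t))\<^sup>2)"
    using assms by (intro Bochner_Integration.integrable_add) (auto simp: X1_def)
  show "(\<lambda>t. norm (weak_deriv i (v t))) \<in> borel_measurable (lebesgue_on {0..T})"
  proof -
    have "(\<lambda>t. weak_deriv i (v t)) \<in> borel_measurable (lebesgue_on {0..T})" using assms by (simp add: X1_def)
    then show ?thesis by measurable
  qed
  show "AE t in lebesgue_on {0..T}. norm (norm (weak_deriv i (v t))) \<le> norm (1 + (norm_H1 (v t))\<^sup>2)"
  proof (rule AE_I2)
    fix t
    have "norm (weak_deriv i (v t)) \<le> 1 + (norm_H1 (v t))\<^sup>2"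
      using norm_weak_deriv_le_H1[of i "v t"] le_one_plus_square[of "norm_H1 (v t)"] by linarith
    then show "norm (norm (weak_deriv i (v t))) \<le> norm (1 + (norm_H1 (v t))\<^sup>2)" by simp
  qed
qed

lemma X1_subset_X10: "X1 T \<subseteq> X10 T"
proof
  fix v :: "real \<Rightarrow> (real^'a) l2" assume v: "v \<in> X1 T"
  interpret finite_measure "lebesgue_on {0..T}" by (rule finite_measure_lebesgue_on) simp
  have "integrable (lebesgue_on {0..T}) v"
  proof (rule Bochner_Integration.integrable_bound)
    show "integrable (lebesgue_on {0..T}) (\<lambda>t. 1 + (norm_H1 (v t))\<^sup>2)"
      using v by (intro Bochner_Integration.integrable_add) (auto simp: X1_def)
    show "v \<in> borel_measurable (lebesgue_on {0..T})" using v by (auto simp: X1_def)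
    show "AE t in lebesgue_on {0..T}. norm (v t) \<le> norm (1 + (norm_H1 (v t))\<^sup>2)"
    proof (rule AE_I2)
      fix t
      have "norm (v t) \<le> 1 + (norm_H1 (v t))\<^sup>2"
        using norm_le_H1[of "v t"] le_one_plus_square[of "norm_H1 (v t)"] by linarith
      then show "norm (v t) \<le> norm (1 + (norm_H1 (v t))\<^sup>2)" by simp
    qed
  qed
  then show "v \<in> X10 T" by (simp add: X10_def)
qed

subsection \<open>Existence for the Cauchy problem\<close>

locale transport_problem = transport_field K f
  for K :: real and f :: "real^'n::finite \<Rightarrow> real \<Rightarrow> real^'n" +
  fixes T :: real
  assumes T_pos: "T > 0"
begin

text \<open>Duhamel's formula for the backward problem with zero data at time T.\<close>

definition sol :: "(real \<Rightarrow> (real^'n) l2) \<Rightarrow> real \<Rightarrow> (real^'n) l2" where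
  "sol \<phi> s = (LINT t|lebesgue_on {s..T}. evol s t (\<phi> t))"

lemma evol_le: "s \<in> {0..T} \<Longrightarrow> t \<in> {0..T} \<Longrightarrow> norm (evol s t u) \<le> evol_const T * norm u"
  by (rule norm_evol) auto

lemma evol_measurable:
  assumes "\<phi> \<in> borel_measurable (lebesgue_on S)"
  shows "(\<lambda>t. evol s t (\<phi> t)) \<in> borel_measurable (lebesgue_on S)"
proof -
  have "(\<lambda>t. t) \<in> lebesgue_on S \<rightarrow>\<^sub>M (borel :: real measure)"
    by (intro measurable_restrict_space1 borel_measurable_continuous_lebesgue continuous_on_id)
  then have "(\<lambda>t. (s, t, \<phi> t)) \<in> borel_measurable (lebesgue_on S)"
    using assms by (intro borel_measurable_Pair) auto
  from measurable_compose[OF this borel_measurable_continuous_onI[OF continuous_evol]] show ?thesis by simp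
qed

lemma evol_integrable:
  assumes \<phi>: "integrable (lebesgue_on {0..T}) \<phi>" and s: "s \<in> {0..T}"
  shows "integrable (lebesgue_on {0..T}) (\<lambda>t. evol s t (\<phi> t))"
proof (rule Bochner_Integration.integrable_bound)
  show "integrable (lebesgue_on {0..T}) (\<lambda>t. evol_const T * norm (\<phi> t))"
    using \<phi> by (intro integrable_mult_right integrable_norm)
  show "(\<lambda>t. evol s t (\<phi> t)) \<in> borel_measurable (lebesgue_on {0..T})"
    using \<phi> by (intro evol_measurable) auto
  show "AE t in lebesgue_on {0..T}. norm (evol s t (\<phi> t)) \<le> norm (evol_const T * norm (\<phi> t))"
    using evol_le[OF s] by (intro AE_I2) (simp add: evol_const_nonneg)
qed

lemma evol_integrable_sub:
  assumes "integrable (lebesgue_on {0..T}) \<phi>" "s \<in> {0..T}" "{a..b} \<subseteq> {0..T}"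
  shows "integrable (lebesgue_on {a..b}) (\<lambda>t. evol s t (\<phi> t))"
  by (rule integrable_subinterval[OF evol_integrable[OF assms(1,2)] assms(3)])

lemma sol_bound:
  assumes \<phi>: "integrable (lebesgue_on {0..T}) \<phi>" and s: "s \<in> {0..T}"
  shows "norm (sol \<phi> s) \<le> evol_const T * (LINT t|lebesgue_on {0..T}. norm (\<phi> t))"
proof -
  have "sol \<phi> s = (LINT t|lebesgue_on {0..T}. indicator {s..T} t *\<^sub>R evol s t (\<phi> t))"
    unfolding sol_def using s by (intro integral_subinterval_eq) auto
  then have "norm (sol \<phi> s) \<le> (LINT t|lebesgue_on {0..T}. norm (indicator {s..T} t *\<^sub>R evol s t (\<phi> t)))"
    by (simp only: integral_norm_bound)
  also have "\<dots> \<le> (LINT t|lebesgue_on {0..T}. evol_const T * norm (\<phi> t))"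
  proof (rule integral_mono)
    show "integrable (lebesgue_on {0..T}) (\<lambda>t. norm (indicator {s..T} t *\<^sub>R evol s t (\<phi> t)))"
      using evol_integrable[OF \<phi> s] s
      by (intro integrable_norm integrable_mult_indicator Icc_in_sets_lebesgue_on) auto
    show "integrable (lebesgue_on {0..T}) (\<lambda>t. evol_const T * norm (\<phi> t))"
      using \<phi> by (intro integrable_mult_right integrable_norm)
    show "norm (indicator {s..T} t *\<^sub>R evol s t (\<phi> t)) \<le> evol_const T * norm (\<phi> t)"
      if "t \<in> space (lebesgue_on {0..T})" for t
      using evol_le[OF s, of t "\<phi> t"] that evol_const_nonneg[of T] by (auto simp: indicator_def)
  qed
  finally show ?thesis by simp
qed

lemma sol_add:
  assumes "integrable (lebesgue_on {0..T}) \<phi>" "integrable (lebesgue_on {0..T}) \<psi>" "s \<in> {0..T}"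
  shows "sol (\<lambda>t. \<phi> t + \<psi> t) s = sol \<phi> s + sol \<psi> s"
  unfolding sol_def evol_add
  using assms by (intro Bochner_Integration.integral_add evol_integrable_sub) auto

lemma sol_scaleR: "sol (\<lambda>t. c *\<^sub>R \<phi> t) s = c *\<^sub>R sol \<phi> s"
  by (simp add: sol_def evol_scaleR)

text \<open>The evolution property pulls \<open>evol s s'\<close> out of the part of the integral
  beyond s'. What remains is an integral over the short interval from s to s', so the increment of
  \<open>sol\<close> can be expanded at s'.\<close>

lemma sol_step:
  assumes \<phi>: "integrable (lebesgue_on {0..T}) \<phi>" and s: "0 \<le> s" "s \<le> s'" "s' \<le> T"
  shows "sol \<phi> s = evol s s' (sol \<phi> s') + (LINT t|lebesgue_on {s..s'}. evol s t (\<phi> t))"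
proof -
  have "evol s s' (sol \<phi> s') = (LINT t|lebesgue_on {s'..T}. evol s s' (evol s' t (\<phi> t)))"
    unfolding sol_def using s
    by (intro integral_bounded_linear[OF bounded_linear_evol, symmetric] evol_integrable_sub[OF \<phi>]) auto
  also have "\<dots> = (LINT t|lebesgue_on {s'..T}. evol s t (\<phi> t))"
    using s by (intro Bochner_Integration.integral_cong) (auto simp: evol_evol)
  finally show ?thesis
    unfolding sol_def
    using integral_lebesgue_on_combine[OF evol_integrable_sub[OF \<phi>, of s s T] s(2,3)] s by simp
qed

lemma sol_continuous:
  assumes \<phi>: "integrable (lebesgue_on {0..T}) \<phi>"
  shows "continuous_on {0..T} (sol \<phi>)"
  unfolding continuous_on_sequentially
proof (intro ballI allI impI, elim conjE)
  fix X :: "nat \<Rightarrow> real" and s assume s: "s \<in> {0..T}" and X: "\<forall>n. X n \<in> {0..T}" "X \<longlonglongrightarrow> s"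
  have eq: "sol \<phi> r = (LINT t|lebesgue_on {0..T}. indicator {r..T} t *\<^sub>R evol r t (\<phi> t))" if "r \<in> {0..T}" for r
    unfolding sol_def using that by (intro integral_subinterval_eq) auto
  have m: "(\<lambda>t. indicator {r..T} t *\<^sub>R evol r t (\<phi> t)) \<in> borel_measurable (lebesgue_on {0..T})" if "r \<in> {0..T}" for r
    using that by (intro borel_measurable_integrable integrable_mult_indicator Icc_in_sets_lebesgue_on
      evol_integrable[OF \<phi>]) auto
  have "(\<lambda>n. LINT t|lebesgue_on {0..T}. indicator {X n..T} t *\<^sub>R evol (X n) t (\<phi> t)) \<longlonglongrightarrow>
      (LINT t|lebesgue_on {0..T}. indicator {s..T} t *\<^sub>R evol s t (\<phi> t))"
  proof (rule integral_dominated_convergence[where w = "\<lambda>t. evol_const T * norm (\<phi> t)"])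
    show "integrable (lebesgue_on {0..T}) (\<lambda>t. evol_const T * norm (\<phi> t))"
      using \<phi> by (intro integrable_mult_right integrable_norm)
    show "AE t in lebesgue_on {0..T}. norm (indicator {X n..T} t *\<^sub>R evol (X n) t (\<phi> t)) \<le> evol_const T * norm (\<phi> t)" for n
    proof (rule AE_I2)
      fix t assume "t \<in> space (lebesgue_on {0..T})"
      then show "norm (indicator {X n..T} t *\<^sub>R evol (X n) t (\<phi> t)) \<le> evol_const T * norm (\<phi> t)"
        using evol_le[of "X n" t "\<phi> t"] X(1) evol_const_nonneg[of T] by (auto simp: indicator_def)
    qed
    \<comment> \<open>At t = s the indicators may fail to converge; this single time is discarded as
      a null set.\<close>
    show "AE t in lebesgue_on {0..T}. (\<lambda>n. indicator {X n..T} t *\<^sub>R evol (X n) t (\<phi> t)) \<longlonglongrightarrow> indicator {s..T} t *\<^sub>R evol s t (\<phi> t)"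
      using AE_lebesgue_on_neq[where a = 0 and b = T and c = s] AE_space
    proof eventually_elim
      case (elim t)
      have E: "(\<lambda>n. evol (X n) t (\<phi> t)) \<longlonglongrightarrow> evol s t (\<phi> t)" by (intro evol_tendsto X tendsto_const)
      have "(\<lambda>n. indicator {X n..T} t :: real) \<longlonglongrightarrow> indicator {s..T} t"
      proof (cases "t < s")
        case True
        have "\<forall>\<^sub>F n in sequentially. t < X n" by (rule order_tendstoD(1)[OF X(2) True])
        then have "\<forall>\<^sub>F n in sequentially. indicator {s..T} t = (indicator {X n..T} t :: real)"
          by eventually_elim (use True in \<open>auto simp: indicator_def\<close>)
        then show ?thesis by (rule Lim_transform_eventually[OF tendsto_const])
      next
        case False
        then have ts: "s < t" using elim(1) by simp
        have "\<forall>\<^sub>F n in sequentially. X n < t" by (rule order_tendstoD(2)[OF X(2) ts])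
        then have "\<forall>\<^sub>F n in sequentially. indicator {s..T} t = (indicator {X n..T} t :: real)"
          by eventually_elim (use ts in \<open>auto simp: indicator_def\<close>)
        then show ?thesis by (rule Lim_transform_eventually[OF tendsto_const])
      qed
      then show ?case by (intro tendsto_scaleR E)
    qed
  qed (use m X s in auto)
  then show "(sol \<phi> \<circ> X) \<longlonglongrightarrow> sol \<phi> s" using X(1) s by (simp add: o_def eq)
qed

lemma inner_sol:
  assumes \<phi>: "integrable (lebesgue_on {0..T}) \<phi>" and s: "s \<in> {0..T}"
  shows "inner (sol \<phi> s) v = (LINT t|lebesgue_on {s..T}. inner (evol s t (\<phi> t)) v)"
  unfolding sol_def using s
  by (intro integral_bounded_linear[OF bounded_linear_inner_left, symmetric] evol_integrable_sub[OF \<phi>]) auto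

text \<open>The derivative is not taken under the integral. The dual bound for \<open>evol\<close>
  is integrated over t, and \<open>weak_deriv_exists\<close> then supplies a derivative, with a
  bound B that is uniform in s.\<close>

lemma sol_weak_deriv:
  assumes \<phi>: "\<phi> \<in> X1 T"
  obtains B w where "B \<ge> 0" "\<And>s i. s \<in> {0..T} \<Longrightarrow> l2_deriv i (sol \<phi> s) (w s i)"
    "\<And>s i. s \<in> {0..T} \<Longrightarrow> norm (w s i) \<le> B"
proof -
  have \<phi>i: "integrable (lebesgue_on {0..T}) \<phi>" using \<phi> X1_subset_X10 by (auto simp: X10_def)
  define m where "m t = (\<Sum>i\<in>UNIV. norm (weak_deriv i (\<phi> t)))" for t
  have m: "integrable (lebesgue_on {0..T}) m"
    unfolding m_def by (intro Bochner_Integration.integrable_sum X1_weak_deriv_integrable \<phi>)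
  have m0: "m t \<ge> 0" for t by (simp add: m_def sum_nonneg)
  define B where "B = sobolev_const T * (LINT t|lebesgue_on {0..T}. m t)"
  have B: "B \<ge> 0" by (simp add: B_def sobolev_const_nonneg integral_nonneg_AE m0)
  have "\<exists>w. l2_deriv i (sol \<phi> s) w \<and> norm w \<le> B" if s: "s \<in> {0..T}" for s i
  proof -
    have "\<bar>inner (sol \<phi> s) (abs_l2 (partial_deriv i \<psi>))\<bar> \<le> B * norm (abs_l2 \<psi>)" if \<psi>: "test_function \<psi>" for \<psi>
    proof -
      define c where "c = sobolev_const T * norm (abs_l2 \<psi>)"
      have c: "c \<ge> 0" by (simp add: c_def sobolev_const_nonneg)
      have sub: "{s..T} \<subseteq> {0..T}" using s by auto
      have "\<bar>inner (sol \<phi> s) (abs_l2 (partial_deriv i \<psi>))\<bar> \<le> (LINT t|lebesgue_on {s..T}. c * m t)"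
        unfolding inner_sol[OF \<phi>i s]
      proof (rule integral_lebesgue_on_mono_AE)
        show "integrable (lebesgue_on {s..T}) (\<lambda>t. inner (evol s t (\<phi> t)) (abs_l2 (partial_deriv i \<psi>)))"
          by (intro integrable_inner_left evol_integrable_sub[OF \<phi>i s sub])
        show "integrable (lebesgue_on {s..T}) (\<lambda>t. c * m t)"
          by (intro integrable_mult_right integrable_subinterval[OF m sub])
        have "AE t in lebesgue_on {s..T}. \<phi> t \<in> H1"
          using \<phi> by (intro AE_subinterval[OF _ sub]) (auto simp: X1_def)
        then show "AE t in lebesgue_on {s..T}. \<bar>inner (evol s t (\<phi> t)) (abs_l2 (partial_deriv i \<psi>))\<bar> \<le> c * m t"
          using AE_space
        proof eventually_elim
          case (elim t)
          have "\<bar>t - s\<bar> \<le> T" using elim(2) s by auto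
          from evol_weak_bound[OF this H1_l2_deriv[OF elim(1)] \<psi>, of i]
          show ?case by (simp add: c_def m_def mult_ac)
        qed
      qed
      also have "\<dots> = c * (LINT t|lebesgue_on {s..T}. m t)" by simp
      also have "\<dots> \<le> c * (LINT t|lebesgue_on {0..T}. m t)"
      proof (intro mult_left_mono c)
        have "(LINT t|lebesgue_on {0..T}. m t) = (LINT t|lebesgue_on {0..s}. m t) + (LINT t|lebesgue_on {s..T}. m t)"
          using s by (intro integral_lebesgue_on_combine m) auto
        then show "(LINT t|lebesgue_on {s..T}. m t) \<le> (LINT t|lebesgue_on {0..T}. m t)"
          using m0 by simp
      qed
      finally show ?thesis by (simp add: B_def c_def mult_ac)
    qed
    from weak_deriv_exists[OF this B] show ?thesis by blast
  qed
  then obtain w where "\<And>s i. s \<in> {0..T} \<Longrightarrow> l2_deriv i (sol \<phi> s) (w s i) \<and> norm (w s i) \<le> B" by metis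
  then show ?thesis using that B by blast
qed

text \<open>
  The weak derivatives depend measurably on time because they are limits of difference quotients,
  which are continuous in time.
\<close>

lemma weak_deriv_measurable:
  assumes v: "continuous_on {0..T} v" and w: "\<And>s. s \<in> {0..T} \<Longrightarrow> l2_deriv i (v s) (w s)"
  shows "w \<in> borel_measurable (lebesgue_on {0..T})"
proof (rule borel_measurable_LIMSEQ_metric)
  define h where "h n = inverse (real (Suc n))" for n
  fix n
  have "continuous_on {0..T} (\<lambda>s. (shift_l2 (h n *\<^sub>R axis i 1) (v s) - v s) /\<^sub>R h n)"
    by (intro continuous_intros v bounded_linear.continuous_on[OF bounded_linear_shift_l2])
  then show "(\<lambda>s. (shift_l2 (inverse (real (Suc n)) *\<^sub>R axis i 1) (v s) - v s) /\<^sub>R inverse (real (Suc n))) \<in> borel_measurable (lebesgue_on {0..T})"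
    unfolding h_def by (rule continuous_imp_measurable_on_sets_lebesgue) simp
next
  fix s assume "s \<in> space (lebesgue_on {0..T})"
  then have "l2_deriv i (v s) (w s)" using w by simp
  then have lim: "((\<lambda>h. (shift_l2 (h *\<^sub>R axis i 1) (v s) - v s) /\<^sub>R h) \<longlongrightarrow> w s) (at 0)"
    by (simp add: l2_deriv_iff)
  have "filterlim (\<lambda>n. inverse (real (Suc n))) (at 0) sequentially"
    using LIMSEQ_inverse_real_of_nat by (intro filterlim_atI) auto
  from filterlim_compose[OF lim this]
  show "(\<lambda>n. (shift_l2 (inverse (real (Suc n)) *\<^sub>R axis i 1) (v s) - v s) /\<^sub>R inverse (real (Suc n))) \<longlonglongrightarrow> w s" .
qed

lemma continuous_H1_in_X1:
  fixes v :: "real \<Rightarrow> (real^'n) l2"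
  assumes v: "continuous_on {0..T} v" and w: "\<And>s i. s \<in> {0..T} \<Longrightarrow> l2_deriv i (v s) (w s i)"
    and B: "\<And>s i. s \<in> {0..T} \<Longrightarrow> norm (w s i) \<le> B"
  shows "v \<in> X1 T"
proof -
  interpret finite_measure "lebesgue_on {0..T}" by (rule finite_measure_lebesgue_on) simp
  have wd: "weak_deriv i (v s) = w s i" if "s \<in> {0..T}" for s i by (rule weak_deriv_eqI[OF w[OF that]])
  have "\<forall>s\<in>{0..T}. v s \<in> H1" unfolding H1_iff using w by blast
  then have 1: "AE t in lebesgue_on {0..T}. v t \<in> H1" by (intro AE_I2) simp
  have 2: "v \<in> borel_measurable (lebesgue_on {0..T})"
    using v by (rule continuous_imp_measurable_on_sets_lebesgue) simp
  have 3: "(\<lambda>t. weak_deriv i (v t)) \<in> borel_measurable (lebesgue_on {0..T})" for i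
  proof -
    have "(\<lambda>s. w s i) \<in> borel_measurable (lebesgue_on {0..T})"
      by (rule weak_deriv_measurable[OF v w])
    moreover have "(\<lambda>t. weak_deriv i (v t)) \<in> borel_measurable (lebesgue_on {0..T}) \<longleftrightarrow>
        (\<lambda>s. w s i) \<in> borel_measurable (lebesgue_on {0..T})"
      by (rule measurable_cong) (simp add: wd)
    ultimately show ?thesis by simp
  qed
  have "bounded (v ` {0..T})" by (intro compact_imp_bounded compact_continuous_image v) simp
  then obtain A where A: "\<And>s. s \<in> {0..T} \<Longrightarrow> norm (v s) \<le> A"
    unfolding bounded_iff by blast
  have eq: "(norm_H1 (v t))\<^sup>2 = (norm (v t))\<^sup>2 + (\<Sum>i\<in>UNIV. (norm (weak_deriv i (v t)))\<^sup>2)" for t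
    unfolding norm_H1_def by (simp add: sum_nonneg)
  have "integrable (lebesgue_on {0..T}) (\<lambda>t. (norm_H1 (v t))\<^sup>2)"
  proof (rule integrable_const_bound[of _ "A\<^sup>2 + (\<Sum>i::'n\<in>UNIV. B\<^sup>2)"])
    show "(\<lambda>t. (norm_H1 (v t))\<^sup>2) \<in> borel_measurable (lebesgue_on {0..T})"
      unfolding eq using 2 3 by measurable
    show "AE t in lebesgue_on {0..T}. norm ((norm_H1 (v t))\<^sup>2) \<le> A\<^sup>2 + (\<Sum>i::'n\<in>UNIV. B\<^sup>2)"
    proof (rule AE_I2)
      fix t assume "t \<in> space (lebesgue_on {0..T})"
      then have t: "t \<in> {0..T}" by simp
      have "(norm (v t))\<^sup>2 + (\<Sum>i\<in>UNIV. (norm (weak_deriv i (v t)))\<^sup>2) \<le> A\<^sup>2 + (\<Sum>i::'n\<in>UNIV. B\<^sup>2)"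
      proof (rule add_mono)
        show "(norm (v t))\<^sup>2 \<le> A\<^sup>2" using A[OF t] by (rule power_mono) simp
        show "(\<Sum>i\<in>UNIV. (norm (weak_deriv i (v t)))\<^sup>2) \<le> (\<Sum>i::'n\<in>UNIV. B\<^sup>2)"
        proof (rule sum_mono)
          show "(norm (weak_deriv i (v t)))\<^sup>2 \<le> B\<^sup>2" for i :: 'n
            unfolding wd[OF t] using B[OF t] by (rule power_mono) simp
        qed
      qed
      then show "norm ((norm_H1 (v t))\<^sup>2) \<le> A\<^sup>2 + (\<Sum>i::'n\<in>UNIV. B\<^sup>2)" unfolding eq by (simp add: sum_nonneg)
    qed
  qed
  then show ?thesis using 1 2 3 by (simp add: X1_def)
qed

end

context transport_problem
begin

lemma adv_integrable:
  assumes w: "\<And>i. (\<lambda>t. w t i) \<in> borel_measurable (lebesgue_on {0..T})"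
    and m: "integrable (lebesgue_on {0..T}) (\<lambda>t. \<Sum>i\<in>UNIV. norm (w t i))"
  shows "integrable (lebesgue_on {0..T}) (\<lambda>t. adv t (w t))"
proof (rule Bochner_Integration.integrable_bound)
  show "integrable (lebesgue_on {0..T}) (\<lambda>t. K * (\<Sum>i\<in>UNIV. norm (w t i)))"
    using m by (rule integrable_mult_right)
  show "(\<lambda>t. adv t (w t)) \<in> borel_measurable (lebesgue_on {0..T})"
    by (rule adv_measurable[OF w])
  show "AE t in lebesgue_on {0..T}. norm (adv t (w t)) \<le> norm (K * (\<Sum>i\<in>UNIV. norm (w t i)))"
    using norm_adv K_pos by (intro AE_I2) (simp add: sum_nonneg abs_mult)
qed

text \<open>Tested against \<psi>, the equation says that inner (V r) \<psi> plus the integral of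
  inner (a t) \<psi> from 0 to r does not depend on r. The left increments at \<tau> are expanded
  with V and its derivatives frozen at \<tau>, where V is known to lie in \<open>H1\<close>.\<close>

lemma sol_cauchy_solution:
  assumes \<phi>: "\<phi> \<in> X1 T"
  shows "cauchy_solution T f \<phi> (sol \<phi>)"
proof -
  have \<phi>i: "integrable (lebesgue_on {0..T}) \<phi>" using \<phi> X1_subset_X10 by (auto simp: X10_def)
  obtain B w where B: "B \<ge> 0" and w: "\<And>s i. s \<in> {0..T} \<Longrightarrow> l2_deriv i (sol \<phi> s) (w s i)"
    and wB: "\<And>s i. s \<in> {0..T} \<Longrightarrow> norm (w s i) \<le> B"
    using sol_weak_deriv[OF \<phi>] by blast
  define V where "V = sol \<phi>"
  have Vc: "continuous_on {0..T} V" unfolding V_def by (rule sol_continuous[OF \<phi>i])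
  have VX1: "V \<in> X1 T" by (rule continuous_H1_in_X1[OF Vc w[folded V_def] wB])
  have wm: "(\<lambda>s. w s i) \<in> borel_measurable (lebesgue_on {0..T})" for i
    by (rule weak_deriv_measurable[OF Vc w[folded V_def]])
  have wi: "integrable (lebesgue_on {0..T}) (\<lambda>t. \<Sum>i\<in>UNIV. norm (w t i))"
  proof (rule integrable_lebesgue_on_bounded)
    show "(\<lambda>t. \<Sum>i\<in>UNIV. norm (w t i)) \<in> borel_measurable (lebesgue_on {0..T})"
      using wm by measurable
    show "norm (\<Sum>i\<in>UNIV. norm (w t i)) \<le> (\<Sum>i::'n\<in>UNIV. B)" if "t \<in> {0..T}" for t
      using wB[OF that] by (simp only: real_norm_def abs_of_nonneg sum_nonneg norm_ge_zero) (intro sum_mono)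
  qed
  define a where "a t = \<phi> t + adv t (w t)" for t
  have ai: "integrable (lebesgue_on {0..T}) a"
    unfolding a_def by (intro Bochner_Integration.integrable_add \<phi>i adv_integrable wm wi)
  define m where "m t = (\<Sum>i\<in>UNIV. norm (weak_deriv i (\<phi> t)))" for t
  have mi: "integrable (lebesgue_on {0..T}) m"
    unfolding m_def by (intro Bochner_Integration.integrable_sum X1_weak_deriv_integrable \<phi>)
  have m0: "m t \<ge> 0" for t by (simp add: m_def sum_nonneg)
  \<comment> \<open>The summand s absorbs the errors of expanding the evolution of V; the integral
    of m absorbs those of \<open>\<phi>\<close>, whose derivatives are only integrable in
    time.\<close>
  define M where "M s = s + (LINT t|lebesgue_on {0..s}. m t)" for s
  have weak: "inner (V s) (abs_l2 \<psi>) = (LINT t|lebesgue_on {s..T}. inner (a t) (abs_l2 \<psi>))"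
    if s: "s \<in> {0..T}" and \<psi>: "test_function \<psi>" for s \<psi>
  proof -
    let ?\<psi> = "abs_l2 \<psi>"
    define P where "P = norm ?\<psi>"
    have P: "P \<ge> 0" by (simp add: P_def)
    have qi: "integrable (lebesgue_on {0..T}) (\<lambda>t. inner (a t) ?\<psi>)" by (rule integrable_inner_left[OF ai])
    define I where "I r = (LINT t|lebesgue_on {0..r}. inner (a t) ?\<psi>)" for r
    define p where "p r = inner (V r) ?\<psi> + I r" for r
    have I_diff: "I \<tau> - I r = (LINT t|lebesgue_on {r..\<tau>}. inner (a t) ?\<psi>)" if "0 \<le> r" "r \<le> \<tau>" "\<tau> \<le> T" for r \<tau>
      unfolding I_def
      using integral_lebesgue_on_combine[OF integrable_subinterval[OF qi], of 0 \<tau> r] that by simp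
    have M_diff: "M \<tau> - M r = (\<tau> - r) + (LINT t|lebesgue_on {r..\<tau>}. m t)" if "0 \<le> r" "r \<le> \<tau>" "\<tau> \<le> T" for r \<tau>
      unfolding M_def
      using integral_lebesgue_on_combine[OF integrable_subinterval[OF mi], of 0 \<tau> r] that by simp
    have sT: "s \<le> T" "0 \<le> s" using s by auto
    have "p s = p T"
    proof (rule constant_by_left_increments[OF sT(1), of p M])
      have "continuous_on {0..T} p" unfolding p_def I_def
        by (intro continuous_intros Vc continuous_primitive[OF qi])
      then show "continuous_on {s..T} p" by (rule continuous_on_subset) (use s in auto)
      have "continuous_on {0..T} M" unfolding M_def
        by (intro continuous_intros continuous_primitive[OF mi])
      then show "continuous_on {s..T} M" by (rule continuous_on_subset) (use s in auto)
    next
      fix \<epsilon> \<tau> :: real assume \<epsilon>: "\<epsilon> > 0" and \<tau>: "s < \<tau>" "\<tau> \<le> T"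
      have \<tau>0: "\<tau> \<in> {0..T}" using \<tau> s by auto
      \<comment> \<open>C1, C2 and N are the factors in the three error bounds below. Adding 1 to
        them in the denominators allows them to vanish.\<close>
      define C1 where "C1 = (K * (\<Sum>i\<in>UNIV. norm (abs_l2 (partial_deriv i \<psi>)) + P))"
      have C1: "C1 \<ge> 0" unfolding C1_def using K_pos P by (intro mult_nonneg_nonneg sum_nonneg add_nonneg_nonneg) auto
      define C2 where "C2 = evol_const T * K * P"
      have C2: "C2 \<ge> 0" unfolding C2_def using K_pos P by (intro mult_nonneg_nonneg evol_const_nonneg) auto
      define N where "N = real CARD('n) * K * P"
      have N: "N \<ge> 0" unfolding N_def using K_pos P by simp
      define \<beta> where "\<beta> = \<epsilon> / (6 * (N + 1))"
      have \<beta>: "\<beta> > 0" "N * \<beta> \<le> \<epsilon> / 6"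
      proof -
        show "\<beta> > 0" using \<epsilon> N by (simp add: \<beta>_def)
        have "N * \<beta> = \<epsilon> / 6 * (N / (N + 1))" by (simp add: \<beta>_def)
        also have "\<dots> \<le> \<epsilon> / 6 * 1" using \<epsilon> N by (intro mult_left_mono) auto
        finally show "N * \<beta> \<le> \<epsilon> / 6" by simp
      qed
      have "\<exists>d>0. \<forall>r \<rho>. \<bar>r - \<tau>\<bar> < d \<longrightarrow> \<bar>\<rho> - \<tau>\<bar> < d \<longrightarrow> (\<forall>i. norm (evol r \<rho> (w \<tau> i) - w \<tau> i) \<le> \<beta>)"
      proof -
        have "\<exists>d>0. \<forall>r \<rho>. \<bar>r - \<tau>\<bar> < d \<longrightarrow> \<bar>\<rho> - \<tau>\<bar> < d \<longrightarrow> norm (evol r \<rho> (w \<tau> i) - w \<tau> i) \<le> \<beta>" for i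
        proof -
          have "continuous_on UNIV (\<lambda>p. evol (fst p) (snd p) (w \<tau> i))"
            using continuous_on_compose2[OF continuous_evol, of UNIV "\<lambda>p. (fst p, snd p, w \<tau> i)"]
            by (simp add: continuous_on_Pair continuous_on_fst continuous_on_snd continuous_on_id continuous_on_const)
          then obtain d where d: "d > 0" "\<And>p. dist p (\<tau>, \<tau>) < d \<Longrightarrow>
              dist (evol (fst p) (snd p) (w \<tau> i)) (evol \<tau> \<tau> (w \<tau> i)) < \<beta>"
            using \<beta>(1) unfolding continuous_on_iff by (metis UNIV_I fst_conv snd_conv)
          have "norm (evol r \<rho> (w \<tau> i) - w \<tau> i) \<le> \<beta>" if "\<bar>r - \<tau>\<bar> < d / 2" "\<bar>\<rho> - \<tau>\<bar> < d / 2" for r \<rho>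
          proof -
            have "dist (r, \<rho>) (\<tau>, \<tau>) \<le> \<bar>r - \<tau>\<bar> + \<bar>\<rho> - \<tau>\<bar>"
              unfolding dist_Pair_Pair dist_real_def by (rule sqrt_sum_squares_le_sum) auto
            also have "\<dots> < d" using that by linarith
            finally show ?thesis using d(2)[of "(r, \<rho>)"] by (simp add: dist_norm evol_self)
          qed
          then show ?thesis using d(1) by (intro exI[of _ "d / 2"]) auto
        qed
        then obtain d where d: "\<And>i. d i > 0"
          "\<And>i r \<rho>. \<bar>r - \<tau>\<bar> < d i \<Longrightarrow> \<bar>\<rho> - \<tau>\<bar> < d i \<Longrightarrow> norm (evol r \<rho> (w \<tau> i) - w \<tau> i) \<le> \<beta>" by metis
        have "Min (range d) > 0" using d(1) by simp
        moreover have "Min (range d) \<le> d i" for i by simp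
        ultimately show ?thesis using d(2) by (intro exI[of _ "Min (range d)"]) (auto intro: less_le_trans)
      qed
      then obtain d1 where d1: "d1 > 0"
        "\<And>r \<rho> i. \<bar>r - \<tau>\<bar> < d1 \<Longrightarrow> \<bar>\<rho> - \<tau>\<bar> < d1 \<Longrightarrow> norm (evol r \<rho> (w \<tau> i) - w \<tau> i) \<le> \<beta>" by blast
      have "\<epsilon> / (3 * (C1 + 1)) > 0" using \<epsilon> C1 by simp
      then obtain d2 where d2: "d2 > 0"
        "\<And>t. t \<in> {0..T} \<Longrightarrow> \<bar>t - \<tau>\<bar> < d2 \<Longrightarrow> norm (V t - V \<tau>) < \<epsilon> / (3 * (C1 + 1))"
        using Vc \<tau>0 unfolding continuous_on_iff dist_norm real_norm_def by blast
      \<comment> \<open>The expansion error has a part N \<beta> and a part proportional to \<tau> -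
        r; \<beta> and d3 allot \<epsilon> / 6 to each.\<close>
      define d3 where "d3 = \<epsilon> / (6 * (real CARD('n) * K * K * B * P + 1))"
      have Z: "real CARD('n) * K * K * B * P \<ge> 0" using K_pos B P by simp
      have d3: "d3 > 0" using \<epsilon> Z by (simp add: d3_def)
      define d4 where "d4 = \<epsilon> / (3 * (C2 + 1))"
      have d4: "d4 > 0" using \<epsilon> C2 by (simp add: d4_def)
      have "\<bar>p \<tau> - p r\<bar> \<le> \<epsilon> * (M \<tau> - M r)" if r: "r \<in> {s..\<tau>}" and close: "\<tau> - r < Min {d1, d2, d3, d4}" for r
      proof -
        have rr: "0 \<le> r" "r \<le> \<tau>" "\<tau> \<le> T" "r \<in> {0..T}" using r s \<tau> by auto
        have cl: "\<tau> - r < d1" "\<tau> - r < d2" "\<tau> - r < d3" "\<tau> - r < d4" using close by auto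
        have sub: "{r..\<tau>} \<subseteq> {0..T}" using rr by auto
        let ?L = "lebesgue_on {r..\<tau>}"
        have i1: "integrable ?L (\<lambda>t. inner (adv t (w \<tau>)) ?\<psi>)" by (rule inner_adv_integrable)
        have i2: "integrable ?L (\<lambda>t. inner (adv t (w t)) ?\<psi>)"
          by (intro integrable_inner_left integrable_subinterval[OF adv_integrable[OF wm wi] sub])
        have i3: "integrable ?L (\<lambda>t. inner (evol r t (\<phi> t)) ?\<psi>)"
          by (intro integrable_inner_left evol_integrable_sub[OF \<phi>i rr(4) sub])
        have i4: "integrable ?L (\<lambda>t. inner (\<phi> t) ?\<psi>)"
          by (intro integrable_inner_left integrable_subinterval[OF \<phi>i sub])
        have i5: "integrable ?L m" by (rule integrable_subinterval[OF mi sub])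
        have "inner (V r) ?\<psi> = inner (evol r \<tau> (V \<tau>)) ?\<psi> + (LINT t|?L. inner (evol r t (\<phi> t)) ?\<psi>)"
          unfolding V_def sol_step[OF \<phi>i rr(1-3)] inner_add_left
          using integral_bounded_linear[OF bounded_linear_inner_left evol_integrable_sub[OF \<phi>i rr(4) sub], of ?\<psi>] by simp
        moreover have "I \<tau> - I r = (LINT t|?L. inner (\<phi> t) ?\<psi>) + (LINT t|?L. inner (adv t (w t)) ?\<psi>)"
          unfolding I_diff[OF rr(1-3)] a_def inner_add_left by (rule Bochner_Integration.integral_add[OF i4 i2])
        ultimately have split: "p r - p \<tau> =
            (inner (evol r \<tau> (V \<tau>) - V \<tau>) ?\<psi> - (LINT t|?L. inner (adv t (w \<tau>)) ?\<psi>)) +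
            (LINT t|?L. inner (adv t (w \<tau>)) ?\<psi> - inner (adv t (w t)) ?\<psi>) +
            (LINT t|?L. inner (evol r t (\<phi> t)) ?\<psi> - inner (\<phi> t) ?\<psi>)"
          by (simp add: p_def inner_diff_left Bochner_Integration.integral_diff[OF i1 i2] Bochner_Integration.integral_diff[OF i3 i4])
        have e1: "\<bar>inner (evol r \<tau> (V \<tau>) - V \<tau>) ?\<psi> - (LINT t|?L. inner (adv t (w \<tau>)) ?\<psi>)\<bar> \<le> \<epsilon> / 3 * (\<tau> - r)"
        proof -
          have "\<bar>inner (evol r \<tau> (V \<tau>) - V \<tau>) ?\<psi> - (LINT t|?L. inner (adv t (w \<tau>)) ?\<psi>)\<bar> \<le>
              (\<tau> - r) * ((\<Sum>i\<in>UNIV. K * (\<beta> + K * (\<tau> - r) * norm (w \<tau> i))) * norm ?\<psi>)"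
            using cl(1) rr by (intro evol_expansion w[folded V_def] \<tau>0 \<psi> d1(2)) auto
          also have "\<dots> \<le> (\<tau> - r) * (\<epsilon> / 3)"
          proof (rule mult_left_mono)
            have "(\<Sum>i\<in>UNIV. K * (\<beta> + K * (\<tau> - r) * norm (w \<tau> i))) * P \<le> (\<Sum>i::'n\<in>UNIV. K * (\<beta> + K * d3 * B)) * P"
              using K_pos rr cl(3) wB[OF \<tau>0] P B d3
              by (intro mult_right_mono sum_mono mult_left_mono add_left_mono mult_mono) auto
            also have "\<dots> = N * \<beta> + (real CARD('n) * K * K * B * P) * d3" by (simp add: N_def algebra_simps)
            also have "(real CARD('n) * K * K * B * P) * d3 =
                \<epsilon> / 6 * ((real CARD('n) * K * K * B * P) / (real CARD('n) * K * K * B * P + 1))" by (simp add: d3_def)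
            also have "\<dots> \<le> \<epsilon> / 6 * 1" using \<epsilon> Z by (intro mult_left_mono) auto
            finally show "(\<Sum>i\<in>UNIV. K * (\<beta> + K * (\<tau> - r) * norm (w \<tau> i))) * norm ?\<psi> \<le> \<epsilon> / 3"
              using \<beta>(2) by (simp add: P_def)
          qed (use rr in simp)
          finally show ?thesis by (simp add: mult.commute)
        qed
        \<comment> \<open>The derivatives w t are only measurable in t. After integration by parts
          their difference is paid for by V \<tau> - V t, and V is continuous in
          \<open>l2\<close>.\<close>
        have e2: "\<bar>LINT t|?L. inner (adv t (w \<tau>)) ?\<psi> - inner (adv t (w t)) ?\<psi>\<bar> \<le> \<epsilon> / 3 * (\<tau> - r)"
        proof -
          have "\<bar>LINT t|?L. inner (adv t (w \<tau>)) ?\<psi> - inner (adv t (w t)) ?\<psi>\<bar> \<le> (\<tau> - r) * (\<epsilon> / 3)"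
          proof (rule integral_lebesgue_on_bound[OF rr(2) Bochner_Integration.integrable_diff[OF i1 i2]])
            fix t assume t: "t \<in> {r..\<tau>}"
            then have t0: "t \<in> {0..T}" "\<bar>t - \<tau>\<bar> < d2" using sub cl(2) by auto
            have "\<bar>inner (adv t (w \<tau>)) ?\<psi> - inner (adv t (w t)) ?\<psi>\<bar> = \<bar>inner (adv t (\<lambda>i. w \<tau> i - w t i)) ?\<psi>\<bar>"
              by (simp add: adv_diff[symmetric] inner_diff_left)
            also have "\<dots> \<le> C1 * norm (V \<tau> - V t)"
              unfolding C1_def P_def
              by (intro adv_weak_bound l2_deriv_diff w[folded V_def] \<tau>0 t0 \<psi>)
            also have "\<dots> \<le> C1 * (\<epsilon> / (3 * (C1 + 1)))"
              using d2(2)[OF t0] C1 by (intro mult_left_mono) (auto simp: norm_minus_commute)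
            also have "\<dots> = \<epsilon> / 3 * (C1 / (C1 + 1))" by simp
            also have "\<dots> \<le> \<epsilon> / 3 * 1" using \<epsilon> C1 by (intro mult_left_mono) auto
            finally show "\<bar>inner (adv t (w \<tau>)) ?\<psi> - inner (adv t (w t)) ?\<psi>\<bar> \<le> \<epsilon> / 3" by simp
          qed
          then show ?thesis by (simp add: mult.commute)
        qed
        \<comment> \<open>Almost every \<open>\<phi>\<close> t lies in \<open>H1\<close> and moves
          by at most a multiple of (t - r) m t, so this error is measured by m and not by
          time.\<close>
        have e3: "\<bar>LINT t|?L. inner (evol r t (\<phi> t)) ?\<psi> - inner (\<phi> t) ?\<psi>\<bar> \<le> \<epsilon> / 3 * (LINT t|?L. m t)"
        proof -
          have "\<bar>LINT t|?L. inner (evol r t (\<phi> t)) ?\<psi> - inner (\<phi> t) ?\<psi>\<bar> \<le> (LINT t|?L. \<epsilon> / 3 * m t)"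
          proof (rule integral_lebesgue_on_mono_AE[OF Bochner_Integration.integrable_diff[OF i3 i4] integrable_mult_right[OF i5]])
            have "AE t in ?L. \<phi> t \<in> H1"
              using \<phi> by (intro AE_subinterval[OF _ sub]) (auto simp: X1_def)
            then show "AE t in ?L. \<bar>inner (evol r t (\<phi> t)) ?\<psi> - inner (\<phi> t) ?\<psi>\<bar> \<le> \<epsilon> / 3 * m t"
              using AE_space
            proof eventually_elim
              case (elim t)
              then have t: "r \<le> t" "t \<le> \<tau>" by auto
              have "\<bar>inner (evol r t (\<phi> t)) ?\<psi> - inner (\<phi> t) ?\<psi>\<bar> \<le> norm (evol r t (\<phi> t) - \<phi> t) * P"
                unfolding P_def inner_diff_left[symmetric] by (rule Cauchy_Schwarz_ineq2)
              also have "\<dots> \<le> ((t - r) * (evol_const T * (K * m t))) * P"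
                unfolding m_def using t rr
                by (intro mult_right_mono evol_diff_bound H1_l2_deriv[OF elim(1)] P) auto
              also have "\<dots> = (t - r) * (C2 * m t)" by (simp add: C2_def mult_ac)
              also have "\<dots> \<le> d4 * (C2 * m t)"
                using t cl(4) C2 m0 by (intro mult_right_mono) auto
              also have "\<dots> = \<epsilon> / 3 * m t * (C2 / (C2 + 1))" by (simp add: d4_def)
              also have "\<dots> \<le> \<epsilon> / 3 * m t * 1" using \<epsilon> C2 m0 by (intro mult_left_mono) auto
              finally show ?case by simp
            qed
          qed
          then show ?thesis by simp
        qed
        have nonneg: "0 \<le> \<epsilon> * (\<tau> - r)" "0 \<le> \<epsilon> * (LINT t|?L. m t)"
          using m0 \<epsilon> rr(2) by simp_all
        have "\<bar>p \<tau> - p r\<bar> \<le> \<epsilon> / 3 * (\<tau> - r) + \<epsilon> / 3 * (\<tau> - r) + \<epsilon> / 3 * (LINT t|?L. m t)"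
          using e1 e2 e3 split by linarith
        also have "\<dots> \<le> \<epsilon> * (M \<tau> - M r)"
          unfolding M_diff[OF rr(1-3)] distrib_left
          using nonneg by (simp add: field_simps)
        finally show ?thesis .
      qed
      then show "\<exists>d>0. \<forall>r\<in>{s..\<tau>}. \<tau> - r < d \<longrightarrow> \<bar>p \<tau> - p r\<bar> \<le> \<epsilon> * (M \<tau> - M r)"
        using d1(1) d2(1) d3 d4 by (intro exI[of _ "Min {d1, d2, d3, d4}"]) auto
    qed
    moreover have "V T = 0"
      unfolding V_def sol_def integral_lebesgue_on_eq
    proof (rule integral_eq_zero_AE)
      have "AE t in lebesgue. t \<noteq> T" by (rule AE_completion[OF AE_lborel_singleton])
      then show "AE t in lebesgue. indicator {T..T} t *\<^sub>R evol T t (\<phi> t) = 0"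
        by eventually_elim (auto simp: indicator_def)
    qed
    ultimately show ?thesis using I_diff[of s T] sT by (simp add: p_def)
  qed
  have eq: "V s = (LINT t|lebesgue_on {s..T}. a t)" if s: "s \<in> {0..T}" for s
  proof (rule l2_eqI_test)
    fix \<psi> :: "real^'n \<Rightarrow> real" assume \<psi>: "test_function \<psi>"
    have "integrable (lebesgue_on {s..T}) a" using s by (intro integrable_subinterval[OF ai]) auto
    from integral_bounded_linear[OF bounded_linear_inner_left this, of "abs_l2 \<psi>"]
    show "inner (V s) (abs_l2 \<psi>) = inner (LINT t|lebesgue_on {s..T}. a t) (abs_l2 \<psi>)"
      by (simp add: weak[OF s \<psi>])
  qed
  have "has_bochner_integral (lebesgue_on {s..T}) (\<lambda>t. \<phi> t + transport_term f t (V t)) (V s)"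
    if s: "s \<in> {0..T}" for s
  proof -
    have "integrable (lebesgue_on {s..T}) a" using s by (intro integrable_subinterval[OF ai]) auto
    then have "has_bochner_integral (lebesgue_on {s..T}) a (V s)"
      using eq[OF s] by (simp add: has_bochner_integral_iff)
    moreover have "a t = \<phi> t + transport_term f t (V t)" if "t \<in> {s..T}" for t
    proof -
      have "weak_deriv i (V t) = w t i" for i
        using that s w[of t i] by (intro weak_deriv_eqI) (auto simp: V_def)
      then show ?thesis by (simp add: a_def transport_term_adv)
    qed
    ultimately show ?thesis
      using has_bochner_integral_cong[of "lebesgue_on {s..T}" "lebesgue_on {s..T}" a "\<lambda>t. \<phi> t + transport_term f t (V t)" "V s" "V s"] by simp
  qed
  then show ?thesis using VX1 Vc by (simp add: cauchy_solution_def C0_def V_def)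
qed

subsection \<open>Uniqueness for the Cauchy problem\<close>

text \<open>Energy method: formally the squared norm n of the difference d has time derivative -2
  inner (D t) (d t), which \<open>inner_adv_self\<close> bounds by a multiple of n; n vanishes at T,
  and Gronwall's inequality backward in time gives n = 0.\<close>

lemma cauchy_solution_unique:
  assumes v1: "cauchy_solution T f \<phi> v1" and v2: "cauchy_solution T f \<phi> v2" and s: "s \<in> {0..T}"
  shows "v1 s = v2 s"
proof -
  define d where "d t = v1 t - v2 t" for t
  define D where "D t = transport_term f t (v1 t) - transport_term f t (v2 t)" for t
  have dc: "continuous_on {0..T} d"
    unfolding d_def using v1 v2 by (intro continuous_intros) (auto simp: cauchy_solution_def C0_def)
  have hb: "has_bochner_integral (lebesgue_on {r..T}) D (d r)" if "r \<in> {0..T}" for r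
  proof -
    have "has_bochner_integral (lebesgue_on {r..T})
        (\<lambda>t. (\<phi> t + transport_term f t (v1 t)) - (\<phi> t + transport_term f t (v2 t))) (v1 r - v2 r)"
      using v1 v2 that by (intro has_bochner_integral_diff) (auto simp: cauchy_solution_def)
    then show ?thesis by (simp add: D_def[abs_def] d_def)
  qed
  have Di: "integrable (lebesgue_on {0..T}) D" using hb[of 0] T_pos by (simp add: has_bochner_integral_iff)
  have d_eq: "d r = (LINT t|lebesgue_on {r..T}. D t)" if "r \<in> {0..T}" for r
    using hb[OF that] by (simp add: has_bochner_integral_iff)
  have d_diff: "d r - d \<tau> = (LINT t|lebesgue_on {r..\<tau>}. D t)" if "0 \<le> r" "r \<le> \<tau>" "\<tau> \<le> T" for r \<tau>
    using integral_lebesgue_on_combine[OF integrable_subinterval[OF Di], of r T \<tau>] that d_eq[of r] d_eq[of \<tau>] by simp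
  have energy: "AE t in lebesgue_on {0..T}. \<bar>2 * inner (D t) (d t)\<bar> \<le> real CARD('n) * K * (norm (d t))\<^sup>2"
  proof -
    have "AE t in lebesgue_on {0..T}. v1 t \<in> H1" "AE t in lebesgue_on {0..T}. v2 t \<in> H1"
      using v1 v2 by (auto simp: cauchy_solution_def X1_def)
    then show ?thesis
    proof eventually_elim
      case (elim t)
      have "D t = adv t (\<lambda>i. weak_deriv i (v1 t) - weak_deriv i (v2 t))"
        by (simp add: D_def transport_term_adv adv_diff)
      then show ?case
        using inner_adv_self[OF l2_deriv_diff[OF H1_l2_deriv[OF elim(1)] H1_l2_deriv[OF elim(2)]], of t]
        by (simp add: d_def)
    qed
  qed
  have dm: "d \<in> borel_measurable (lebesgue_on {0..T})"
    using dc by (rule continuous_imp_measurable_on_sets_lebesgue) simp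
  have "bounded (d ` {0..T})" by (intro compact_imp_bounded compact_continuous_image dc) simp
  then obtain A where A: "\<And>t. t \<in> {0..T} \<Longrightarrow> norm (d t) \<le> A" unfolding bounded_iff by blast
  define q where "q t = 2 * inner (D t) (d t)" for t
  define n where "n t = (norm (d t))\<^sup>2" for t
  have nc: "continuous_on {0..T} n" unfolding n_def by (intro continuous_intros dc)
  have ni: "integrable (lebesgue_on {0..T}) n"
  proof (rule integrable_lebesgue_on_bounded)
    show "n \<in> borel_measurable (lebesgue_on {0..T})"
      using nc by (rule continuous_imp_measurable_on_sets_lebesgue) simp
    show "norm (n t) \<le> A\<^sup>2" if "t \<in> {0..T}" for t
      using A[OF that] by (simp add: n_def power_mono)
  qed
  have qi: "integrable (lebesgue_on {0..T}) q"
  proof (rule Bochner_Integration.integrable_bound)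
    show "integrable (lebesgue_on {0..T}) (\<lambda>t. real CARD('n) * K * n t)" by (rule integrable_mult_right[OF ni])
    have "D \<in> borel_measurable (lebesgue_on {0..T})" using Di by (rule borel_measurable_integrable)
    then show "q \<in> borel_measurable (lebesgue_on {0..T})"
      unfolding q_def using dm by (intro borel_measurable_times borel_measurable_inner) auto
    show "AE t in lebesgue_on {0..T}. norm (q t) \<le> norm (real CARD('n) * K * n t)"
      using energy by eventually_elim (use K_pos in \<open>simp add: q_def n_def\<close>)
  qed
  have Dn: "integrable (lebesgue_on {0..T}) (\<lambda>t. norm (D t))" by (rule integrable_norm[OF Di])
  define I where "I r = (LINT t|lebesgue_on {0..r}. q t)" for r
  have I_diff: "I \<tau> - I r = (LINT t|lebesgue_on {r..\<tau>}. q t)" if "0 \<le> r" "r \<le> \<tau>" "\<tau> \<le> T" for r \<tau>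
    unfolding I_def
    using integral_lebesgue_on_combine[OF integrable_subinterval[OF qi], of 0 \<tau> r] that by simp
  \<comment> \<open>D is only integrable in time, so the increments of p are compared with the
    integral of its norm.\<close>
  define M where "M r = (LINT t|lebesgue_on {0..r}. norm (D t))" for r
  have M_diff: "M \<tau> - M r = (LINT t|lebesgue_on {r..\<tau>}. norm (D t))" if "0 \<le> r" "r \<le> \<tau>" "\<tau> \<le> T" for r \<tau>
    unfolding M_def
    using integral_lebesgue_on_combine[OF integrable_subinterval[OF Dn], of 0 \<tau> r] that by simp
  define p where "p r = n r + I r" for r
  have identity: "n r = (LINT t|lebesgue_on {r..T}. q t)" if r: "r \<in> {0..T}" for r
  proof -
    have rT: "0 \<le> r" "r \<le> T" using r by auto
    have "p r = p T"
    proof (rule constant_by_left_increments[OF rT(2), of p M])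
      have "continuous_on {0..T} p" unfolding p_def I_def by (intro continuous_intros nc continuous_primitive[OF qi])
      then show "continuous_on {r..T} p" by (rule continuous_on_subset) (use r in auto)
      have "continuous_on {0..T} M" unfolding M_def by (rule continuous_primitive[OF Dn])
      then show "continuous_on {r..T} M" by (rule continuous_on_subset) (use r in auto)
    next
      fix \<epsilon> \<tau> :: real assume \<epsilon>: "\<epsilon> > 0" and \<tau>: "r < \<tau>" "\<tau> \<le> T"
      have "\<epsilon> / 4 > 0" "\<tau> \<in> {0..T}" using \<epsilon> \<tau> r by auto
      then obtain \<delta> where \<delta>: "\<delta> > 0" "\<And>t. t \<in> {0..T} \<Longrightarrow> dist t \<tau> < \<delta> \<Longrightarrow> dist (d t) (d \<tau>) < \<epsilon> / 4"
        using dc unfolding continuous_on_iff by blast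
      have "\<bar>p \<tau> - p x\<bar> \<le> \<epsilon> * (M \<tau> - M x)" if x: "x \<in> {r..\<tau>}" "\<tau> - x < \<delta>" for x
      proof -
        have xx: "0 \<le> x" "x \<le> \<tau>" "\<tau> \<le> T" using x r \<tau> by auto
        have sub: "{x..\<tau>} \<subseteq> {0..T}" using xx by auto
        let ?L = "lebesgue_on {x..\<tau>}"
        have Ds: "integrable ?L D" by (rule integrable_subinterval[OF Di sub])
        have qs: "integrable ?L q" by (rule integrable_subinterval[OF qi sub])
        \<comment> \<open>The difference of squares gives the exact increment with d x + d \<tau> in
          place of 2 d t. By continuity of d the two are within \<epsilon> of each other, and the
          resulting error is \<epsilon> times the integral of norm (D t).\<close>
        have "n x - n \<tau> = inner (d x - d \<tau>) (d x + d \<tau>)"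
          by (simp add: n_def power2_norm_eq_inner inner_diff_left inner_add_right inner_commute[of "d \<tau>" "d x"])
        also have "\<dots> = (LINT t|?L. inner (D t) (d x + d \<tau>))"
          unfolding d_diff[OF xx] by (rule integral_bounded_linear[OF bounded_linear_inner_left Ds, symmetric])
        finally have "p x - p \<tau> = (LINT t|?L. inner (D t) (d x + d \<tau>)) - (LINT t|?L. q t)"
          using I_diff[OF xx] by (simp add: p_def)
        also have "\<dots> = (LINT t|?L. inner (D t) (d x + d \<tau>) - q t)"
          by (rule Bochner_Integration.integral_diff[OF integrable_inner_left[OF Ds] qs, symmetric])
        also have "\<bar>\<dots>\<bar> \<le> (LINT t|?L. \<epsilon> * norm (D t))"
        proof (rule integral_lebesgue_on_mono_AE)
          show "integrable ?L (\<lambda>t. inner (D t) (d x + d \<tau>) - q t)"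
            by (intro Bochner_Integration.integrable_diff integrable_inner_left Ds qs)
          show "integrable ?L (\<lambda>t. \<epsilon> * norm (D t))" by (intro integrable_mult_right integrable_norm Ds)
          show "AE t in ?L. \<bar>inner (D t) (d x + d \<tau>) - q t\<bar> \<le> \<epsilon> * norm (D t)"
          proof (rule AE_I2)
            fix t assume "t \<in> space ?L"
            then have t: "t \<in> {0..T}" "dist t \<tau> < \<delta>" using sub x(2) by (auto simp: dist_real_def)
            have x': "x \<in> {0..T}" "dist x \<tau> < \<delta>" using xx x by (auto simp: dist_real_def)
            have small: "norm (d x - d \<tau>) < \<epsilon> / 4" "norm (d t - d \<tau>) < \<epsilon> / 4"
              using \<delta>(2)[OF t] \<delta>(2)[OF x'] by (auto simp: dist_norm)
            have sum_eq: "d x + d \<tau> - 2 *\<^sub>R d t = (d x - d \<tau>) - 2 *\<^sub>R (d t - d \<tau>)"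
              by (simp add: scaleR_2 algebra_simps)
            have "norm (d x + d \<tau> - 2 *\<^sub>R d t) \<le> \<epsilon>"
              unfolding sum_eq
              using small norm_triangle_ineq4[of "d x - d \<tau>" "2 *\<^sub>R (d t - d \<tau>)"] norm_ge_zero[of "d x - d \<tau>"]
              by (simp only: norm_scaleR)
            moreover have "inner (D t) (d x + d \<tau>) - q t = inner (D t) (d x + d \<tau> - 2 *\<^sub>R d t)"
              by (simp add: q_def inner_diff_right)
            ultimately show "\<bar>inner (D t) (d x + d \<tau>) - q t\<bar> \<le> \<epsilon> * norm (D t)"
              using Cauchy_Schwarz_ineq2[of "D t" "d x + d \<tau> - 2 *\<^sub>R d t"]
                mult_left_mono[of "norm (d x + d \<tau> - 2 *\<^sub>R d t)" \<epsilon> "norm (D t)"] by (simp add: mult.commute)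
          qed
        qed
        finally have "\<bar>p x - p \<tau>\<bar> \<le> \<epsilon> * (M \<tau> - M x)" unfolding M_diff[OF xx] by simp
        then show ?thesis by (simp add: abs_minus_commute)
      qed
      then show "\<exists>\<delta>>0. \<forall>x\<in>{r..\<tau>}. \<tau> - x < \<delta> \<longrightarrow> \<bar>p \<tau> - p x\<bar> \<le> \<epsilon> * (M \<tau> - M x)"
        using \<delta>(1) by blast
    qed
    moreover have "n T = 0"
    proof -
      have "d T - d T = (LINT t|lebesgue_on {T..T}. D t)" using T_pos by (intro d_diff) auto
      then have "d T = 0" using d_eq[of T] T_pos by simp
      then show ?thesis by (simp add: n_def)
    qed
    ultimately show ?thesis using I_diff[OF rT order_refl] by (simp add: p_def)
  qed
  define c where "c = real CARD('n) * K"
  have c: "c > 0" using K_pos by (simp add: c_def)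
  \<comment> \<open>Gronwall's inequality with initial value a = 0.\<close>
  have "n s \<le> 2 * 0 * exp (2 * c * (T - s))"
  proof (rule gronwall_backward[OF c])
    show "continuous_on {s..T} n" by (rule continuous_on_subset[OF nc]) (use s in auto)
    fix r assume "r \<in> {s..T}"
    then have r: "r \<in> {0..T}" and sub: "{r..T} \<subseteq> {0..T}" using s by auto
    have nr: "integrable (lebesgue_on {r..T}) n" by (rule integrable_subinterval[OF ni sub])
    have "n r \<le> (LINT t|lebesgue_on {r..T}. c * n t)"
      using identity[OF r] integral_lebesgue_on_mono_AE[of r T q "\<lambda>t. c * n t"]
        integrable_subinterval[OF qi sub] integrable_mult_right[OF nr] AE_subinterval[OF energy sub]
      by (simp add: c_def q_def n_def)
    also have "\<dots> = c * integral {r..T} n"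
      using lebesgue_integral_eq_integral[OF nr] by simp
    finally show "n r \<le> 0 + c * integral {r..T} n" by simp
  qed (use s in auto)
  then have "d s = 0" by (simp add: n_def)
  then show ?thesis by (simp add: d_def)
qed

subsection \<open>The solution operator\<close>

lemma is_solution_operator_sol: "is_solution_operator T f sol"
  unfolding is_solution_operator_def
proof (intro conjI ballI allI)
  show "sol ` X10 T \<subseteq> C0 T" using sol_continuous by (auto simp: X10_def C0_def)
  show "sol (\<lambda>t. \<phi> t + \<psi> t) s = sol \<phi> s + sol \<psi> s" if "\<phi> \<in> X10 T" "\<psi> \<in> X10 T" "s \<in> {0..T}" for \<phi> \<psi> s
    using that by (intro sol_add) (auto simp: X10_def)
  show "\<exists>K. \<forall>\<phi>\<in>X10 T. \<forall>s\<in>{0..T}. norm (sol \<phi> s) \<le> K * (LINT t|lebesgue_on {0..T}. norm (\<phi> t))"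
  proof (intro exI ballI)
    show "norm (sol \<phi> s) \<le> evol_const T * (LINT t|lebesgue_on {0..T}. norm (\<phi> t))"
      if "\<phi> \<in> X10 T" "s \<in> {0..T}" for \<phi> s
      using that sol_bound by (simp add: X10_def)
  qed
qed (auto simp: sol_scaleR intro: sol_cauchy_solution)

text \<open>
  Two solution operators agree on simple functions with values in \<open>test_l2\<close>, hence, both being
  bounded, on all of \<open>X10\<close>.
\<close>

lemma solution_operator_unique:
  assumes L: "is_solution_operator T f L" "is_solution_operator T f L'"
    and \<phi>: "\<phi> \<in> X10 T" and s: "s \<in> {0..T}"
  shows "L \<phi> s = L' \<phi> s"
proof -
  let ?M = "lebesgue_on {0..T}"
  obtain C where C: "\<And>\<phi>. \<phi> \<in> X10 T \<Longrightarrow> norm (L \<phi> s) \<le> C * (LINT t|?M. norm (\<phi> t))"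
    using L(1) s unfolding is_solution_operator_def by blast
  obtain C' where C': "\<And>\<phi>. \<phi> \<in> X10 T \<Longrightarrow> norm (L' \<phi> s) \<le> C' * (LINT t|?M. norm (\<phi> t))"
    using L(2) s unfolding is_solution_operator_def by blast
  note op = L[unfolded is_solution_operator_def, THEN conjunct2]
  note add_ball = op[THEN conjunct1] and scale_ball = op[THEN conjunct2, THEN conjunct1]
  note sol_ball = op(1)[THEN conjunct2, THEN conjunct2, THEN conjunct2]
  note sol_ball' = op(2)[THEN conjunct2, THEN conjunct2, THEN conjunct2]
  have add: "L (\<lambda>t. \<phi> t + \<psi> t) s = L \<phi> s + L \<psi> s" "L' (\<lambda>t. \<phi> t + \<psi> t) s = L' \<phi> s + L' \<psi> s"
    if "\<phi> \<in> X10 T" "\<psi> \<in> X10 T" for \<phi> \<psi>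
    using add_ball that s by simp_all
  have scale: "L (\<lambda>t. c *\<^sub>R \<phi> t) s = c *\<^sub>R L \<phi> s" "L' (\<lambda>t. c *\<^sub>R \<phi> t) s = c *\<^sub>R L' \<phi> s"
    if "\<phi> \<in> X10 T" for \<phi> c
    using scale_ball that s by simp_all
  have diff: "L (\<lambda>t. \<phi> t - \<psi> t) s = L \<phi> s - L \<psi> s" "L' (\<lambda>t. \<phi> t - \<psi> t) s = L' \<phi> s - L' \<psi> s"
    if "\<phi> \<in> X10 T" "\<psi> \<in> X10 T" for \<phi> \<psi>
  proof -
    have "(\<lambda>t. (-1) *\<^sub>R \<psi> t) \<in> X10 T" using that(2) by (simp add: X10_def)
    from add[OF that(1) this] scale[OF that(2), of "-1"]
    show "L (\<lambda>t. \<phi> t - \<psi> t) s = L \<phi> s - L \<psi> s" "L' (\<lambda>t. \<phi> t - \<psi> t) s = L' \<phi> s - L' \<psi> s" by simp_all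
  qed
  have lim: "L \<phi> s = L' \<phi> s"
    if \<phi>: "\<phi> \<in> X10 T" and X: "\<And>n. X n \<in> X10 T" "\<And>n. L (X n) s = L' (X n) s"
      and conv: "(\<lambda>n. LINT t|?M. norm (X n t - \<phi> t)) \<longlonglongrightarrow> 0" for X \<phi>
  proof -
    have d: "(\<lambda>t. X n t - \<phi> t) \<in> X10 T" for n using X(1)[of n] \<phi> by (simp add: X10_def)
    have "(\<lambda>n. L (X n) s - L \<phi> s) \<longlonglongrightarrow> 0"
    proof (rule Lim_null_comparison[OF always_eventually])
      show "\<forall>n. norm (L (X n) s - L \<phi> s) \<le> C * (LINT t|?M. norm (X n t - \<phi> t))"
        using C[OF d] diff(1)[OF X(1) \<phi>] by simp
      show "(\<lambda>n. C * (LINT t|?M. norm (X n t - \<phi> t))) \<longlonglongrightarrow> 0" by (rule tendsto_mult_right_zero[OF conv])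
    qed
    then have 1: "(\<lambda>n. L (X n) s) \<longlonglongrightarrow> L \<phi> s" by (simp add: LIM_zero_iff)
    have "(\<lambda>n. L' (X n) s - L' \<phi> s) \<longlonglongrightarrow> 0"
    proof (rule Lim_null_comparison[OF always_eventually])
      show "\<forall>n. norm (L' (X n) s - L' \<phi> s) \<le> C' * (LINT t|?M. norm (X n t - \<phi> t))"
        using C'[OF d] diff(2)[OF X(1) \<phi>] by simp
      show "(\<lambda>n. C' * (LINT t|?M. norm (X n t - \<phi> t))) \<longlonglongrightarrow> 0" by (rule tendsto_mult_right_zero[OF conv])
    qed
    then have "(\<lambda>n. L (X n) s) \<longlonglongrightarrow> L' \<phi> s" by (simp add: LIM_zero_iff X(2))
    with 1 show ?thesis by (rule LIMSEQ_unique)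
  qed
  interpret finite_measure ?M by (rule finite_measure_lebesgue_on) simp
  have "integrable ?M \<phi>" using \<phi> by (simp add: X10_def)
  then show ?thesis
  proof (induction rule: integrable_induct)
    case (base A c)
    have "c \<in> closure test_l2" using closure_test_l2 by auto
    then obtain u where u: "\<And>n. u n \<in> test_l2" "u \<longlonglongrightarrow> c" unfolding closure_sequential by blast
    have X10: "(\<lambda>t. indicator A t *\<^sub>R v) \<in> X10 T" for v :: "(real^'n) l2"
    proof -
      have "integrable ?M (indicator A :: real \<Rightarrow> real)"
        using base.hyps by (intro integrable_real_indicator) (auto simp: less_top)
      then show ?thesis by (simp add: X10_def)
    qed
    show ?case
    proof (rule lim[OF X10])
      show "(\<lambda>t. indicator A t *\<^sub>R u n) \<in> X10 T" for n by (rule X10)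
      show "L (\<lambda>t. indicator A t *\<^sub>R u n) s = L' (\<lambda>t. indicator A t *\<^sub>R u n) s" for n
      proof -
        obtain \<psi> where \<psi>: "test_function \<psi>" "u n = abs_l2 \<psi>" using u(1)[of n] by (auto simp: test_l2_def)
        have D: "l2_deriv i (indicator A t *\<^sub>R u n) (indicator A t *\<^sub>R weak_deriv i (u n))" for i t
          using H1_l2_deriv[OF test_in_H1[OF \<psi>(1)]] unfolding \<psi>(2) by (rule l2_deriv_scaleR)
        have wd: "weak_deriv i (indicator A t *\<^sub>R u n) = indicator A t *\<^sub>R weak_deriv i (u n)" for i t
          by (rule weak_deriv_eqI[OF D])
        have im: "(indicator A :: real \<Rightarrow> real) \<in> borel_measurable ?M" using base.hyps(1) by simp
        have "(norm_H1 (indicator A t *\<^sub>R u n))\<^sup>2 \<le> (norm_H1 (u n))\<^sup>2" for t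
          unfolding norm_H1_def wd by (simp add: indicator_def sum_nonneg)
        moreover have "(\<lambda>t. (norm_H1 (indicator A t *\<^sub>R u n))\<^sup>2) \<in> borel_measurable ?M"
          unfolding norm_H1_def wd using im by measurable
        ultimately have "integrable ?M (\<lambda>t. (norm_H1 (indicator A t *\<^sub>R u n))\<^sup>2)"
          by (intro integrable_const_bound[of _ "(norm_H1 (u n))\<^sup>2"]) auto
        then have "(\<lambda>t. indicator A t *\<^sub>R u n) \<in> X1 T"
          unfolding X1_def mem_Collect_eq wd using D im by (auto simp: H1_iff intro!: borel_measurable_scaleR)
        then show ?thesis
          using cauchy_solution_unique[OF sol_ball[THEN bspec] sol_ball'[THEN bspec] s] by blast
      qed
      have "(LINT t|?M. norm (indicator A t *\<^sub>R u n - indicator A t *\<^sub>R c)) = measure ?M A * norm (u n - c)" for n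
        using base.hyps(1) sets.sets_into_space[OF base.hyps(1)]
        by (simp add: scaleR_diff_right[symmetric] Int_absorb2)
      moreover have "(\<lambda>n. measure ?M A * norm (u n - c)) \<longlonglongrightarrow> 0"
        by (rule tendsto_mult_right_zero[OF tendsto_norm_zero[OF LIM_zero[OF u(2)]]])
      ultimately show "(\<lambda>n. LINT t|?M. norm (indicator A t *\<^sub>R u n - indicator A t *\<^sub>R c)) \<longlonglongrightarrow> 0" by simp
    qed
  next
    case (add \<phi> \<psi>)
    have "\<phi> \<in> X10 T" "\<psi> \<in> X10 T" using add.hyps by (simp_all add: X10_def)
    from \<open>\<And>\<phi> \<psi>. \<phi> \<in> X10 T \<Longrightarrow> \<psi> \<in> X10 T \<Longrightarrow> L (\<lambda>t. \<phi> t + \<psi> t) s = L \<phi> s + L \<psi> s\<close>[OF this]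
      \<open>\<And>\<phi> \<psi>. \<phi> \<in> X10 T \<Longrightarrow> \<psi> \<in> X10 T \<Longrightarrow> L' (\<lambda>t. \<phi> t + \<psi> t) s = L' \<phi> s + L' \<psi> s\<close>[OF this]
    show ?case using add.IH by simp
  next
    case (lim \<phi> X)
    show ?case
    proof (rule \<open>\<And>\<phi> X. \<phi> \<in> X10 T \<Longrightarrow> (\<And>n. X n \<in> X10 T) \<Longrightarrow> (\<And>n. L (X n) s = L' (X n) s) \<Longrightarrow>
        (\<lambda>n. LINT t|?M. norm (X n t - \<phi> t)) \<longlonglongrightarrow> 0 \<Longrightarrow> L \<phi> s = L' \<phi> s\<close>)
      show "\<phi> \<in> X10 T" "X n \<in> X10 T" for n using lim.hyps by (simp_all add: X10_def)
      show "L (X n) s = L' (X n) s" for n by (rule lim.IH)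
      have "(\<lambda>n. LINT t|?M. norm (X n t - \<phi> t)) \<longlonglongrightarrow> (LINT t|?M. 0)"
      proof (rule integral_dominated_convergence[where w = "\<lambda>t. 3 * norm (\<phi> t)"])
        have mm: "\<phi> \<in> borel_measurable ?M" "X n \<in> borel_measurable ?M" for n
          using lim.hyps by (auto intro: borel_measurable_integrable)
        then show "(\<lambda>t. norm (X n t - \<phi> t)) \<in> borel_measurable ?M" for n by measurable
        show "integrable ?M (\<lambda>t. 3 * norm (\<phi> t))" using lim.hyps by simp
        show "AE t in ?M. (\<lambda>n. norm (X n t - \<phi> t)) \<longlonglongrightarrow> 0"
          using lim.hyps(2) by (intro AE_I2 tendsto_norm_zero LIM_zero) auto
        show "AE t in ?M. norm (norm (X n t - \<phi> t)) \<le> 3 * norm (\<phi> t)" for n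
        proof (rule AE_I2)
          fix t assume "t \<in> space ?M"
          then show "norm (norm (X n t - \<phi> t)) \<le> 3 * norm (\<phi> t)"
            using lim.hyps(3)[of t n] norm_triangle_ineq4[of "X n t" "\<phi> t"] by simp
        qed
      qed simp
      then show "(\<lambda>n. LINT t|?M. norm (X n t - \<phi> t)) \<longlonglongrightarrow> 0" by simp
    qed
  qed
qed

lemma solution_operator_eq:
  assumes "\<phi> \<in> X10 T" "s \<in> {0..T}"
  shows "solution_operator T f \<phi> s = sol \<phi> s"
proof -
  have "is_solution_operator T f (solution_operator T f)"
    unfolding solution_operator_def by (rule someI[of "is_solution_operator T f", OF is_solution_operator_sol])
  from solution_operator_unique[OF this is_solution_operator_sol assms] show ?thesis .
qed

end

subsection \<open>Modification on null sets\<close>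

text \<open>By completeness of Lebesgue measure every subset of the null set where the functions
  differ is measurable.\<close>

lemma measurable_lebesgue_on_cong_AE:
  fixes f g :: "'a::euclidean_space \<Rightarrow> 'b::topological_space"
  assumes S: "S \<in> sets lebesgue" and AE: "AE t in lebesgue_on S. f t = g t"
  shows "f \<in> borel_measurable (lebesgue_on S) \<longleftrightarrow> g \<in> borel_measurable (lebesgue_on S)"
proof -
  have *: "h \<in> borel_measurable (lebesgue_on S)"
    if k: "k \<in> borel_measurable (lebesgue_on S)" and AE: "AE t in lebesgue_on S. h t = k t" for h k :: "'a \<Rightarrow> 'b"
  proof (rule measurableI)
    have "AE t in lebesgue. t \<in> S \<longrightarrow> h t = k t" using AE S by (subst (asm) AE_restrict_space_iff) auto
    then have N: "{t. \<not> (t \<in> S \<longrightarrow> h t = k t)} \<in> null_sets lebesgue" (is "?N \<in> _")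
      by (simp add: completion.AE_iff_null_sets)
    fix A :: "'b set" assume A: "A \<in> sets borel"
    have 1: "h -` A \<inter> S \<inter> ?N \<in> sets lebesgue" by (rule completion.complete[OF _ N]) auto
    have 2: "k -` A \<inter> S \<in> sets lebesgue"
      using measurable_sets[OF k A] S by (simp add: sets_restrict_space_iff)
    have eq: "h -` A \<inter> S = (k -` A \<inter> S - ?N) \<union> (h -` A \<inter> S \<inter> ?N)" by auto
    have "h -` A \<inter> S \<in> sets lebesgue"
      by (subst eq) (intro sets.Un sets.Diff 1 2 null_setsD2[OF N])
    then show "h -` A \<inter> space (lebesgue_on S) \<in> sets (lebesgue_on S)"
      using S by (simp add: sets_restrict_space_iff)
  qed simp
  from AE have "AE t in lebesgue_on S. g t = f t" by eventually_elim simp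
  then show ?thesis using *[of g f] *[of f g] AE by blast
qed

text \<open>No measurability is assumed: by completeness either both functions are measurable or
  neither is, and in the second case neither has an integral.\<close>

lemma has_bochner_integral_lebesgue_on_cong_AE:
  assumes S: "S \<in> sets lebesgue" and AE: "AE t in lebesgue_on S. f t = g t"
  shows "has_bochner_integral (lebesgue_on S) f x \<longleftrightarrow> has_bochner_integral (lebesgue_on S) g x"
proof (cases "g \<in> borel_measurable (lebesgue_on S)")
  case True
  then show ?thesis
    using measurable_lebesgue_on_cong_AE[OF S AE] AE by (intro has_bochner_integral_cong_AE) auto
next
  case False
  then have "f \<notin> borel_measurable (lebesgue_on S)" using measurable_lebesgue_on_cong_AE[OF S AE] by simp
  with False show ?thesis by (auto dest: borel_measurable_has_bochner_integral)
qed

lemma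
  assumes S: "S \<in> sets lebesgue" and AE: "AE t in lebesgue_on S. f t = g t"
  shows integrable_lebesgue_on_cong_AE: "integrable (lebesgue_on S) f \<longleftrightarrow> integrable (lebesgue_on S) g"
    and integral_lebesgue_on_cong_AE: "integral\<^sup>L (lebesgue_on S) f = integral\<^sup>L (lebesgue_on S) g"
proof -
  note eq = has_bochner_integral_lebesgue_on_cong_AE[OF S AE]
  show i: "integrable (lebesgue_on S) f \<longleftrightarrow> integrable (lebesgue_on S) g"
    by (simp add: integrable.simps eq)
  show "integral\<^sup>L (lebesgue_on S) f = integral\<^sup>L (lebesgue_on S) g"
    unfolding lebesgue_integral_def eq ..
qed

lemma completion_ex_borel_measurable_euclidean:
  fixes g :: "'a \<Rightarrow> 'b::euclidean_space"
  assumes "g \<in> borel_measurable (completion M)"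
  shows "\<exists>g'\<in>borel_measurable M. AE x in M. g x = g' x"
proof -
  have "\<exists>h\<in>borel_measurable M. AE x in M. g x \<bullet> b = h x" for b
    using assms by (intro completion_ex_borel_measurable_real) auto
  then obtain h where h: "\<And>b. h b \<in> borel_measurable M" "\<And>b. AE x in M. g x \<bullet> b = h b x"
    by metis
  show ?thesis
  proof
    show "(\<lambda>x. \<Sum>b\<in>Basis. h b x *\<^sub>R b) \<in> borel_measurable M" using h(1) by measurable
    have "AE x in M. \<forall>b\<in>Basis. g x \<bullet> b = h b x" by (rule AE_finite_allI) (auto intro: h(2))
    then show "AE x in M. g x = (\<Sum>b\<in>Basis. h b x *\<^sub>R b)"
    proof eventually_elim
      case (elim x)
      have "g x = (\<Sum>b\<in>Basis. (g x \<bullet> b) *\<^sub>R b)" by (rule euclidean_representation[symmetric])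
      also have "\<dots> = (\<Sum>b\<in>Basis. h b x *\<^sub>R b)" using elim by (intro sum.cong) auto
      finally show ?case .
    qed
  qed
qed

lemma strip_borel_rep:
  fixes g :: "'a::euclidean_space \<Rightarrow> real \<Rightarrow> 'b::euclidean_space"
  assumes "(\<lambda>(x, t). g x t) \<in> borel_measurable (lebesgue_on (UNIV \<times> {0..T}))"
  obtains g' N where "g' \<in> borel_measurable borel" "N \<in> sets borel" "emeasure lborel N = 0"
    "\<And>x t. t \<in> {0..T} \<Longrightarrow> (x, t) \<notin> N \<Longrightarrow> g x t = g' (x, t)"
proof -
  let ?S = "UNIV \<times> {0..T} :: ('a \<times> real) set"
  have S: "?S \<in> sets borel" by (intro borel_closed closed_Times) auto
  have "(\<lambda>p. indicator ?S p *\<^sub>R (case p of (x, t) \<Rightarrow> g x t)) \<in> borel_measurable (completion lborel)"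
    using assms S by (subst (asm) borel_measurable_restrict_space_iff) auto
  from completion_ex_borel_measurable_euclidean[OF this]
  obtain g' where g': "g' \<in> borel_measurable lborel"
    and AE: "AE p in lborel. indicator ?S p *\<^sub>R (case p of (x, t) \<Rightarrow> g x t) = g' p" by blast
  from AE obtain N where N: "{p. indicator ?S p *\<^sub>R (case p of (x, t) \<Rightarrow> g x t) \<noteq> g' p} \<subseteq> N"
    "N \<in> sets borel" "emeasure lborel N = 0"
    by (auto elim!: AE_E)
  show ?thesis
  proof (rule that[OF _ N(2,3)])
    show "g' \<in> borel_measurable borel" using g' by simp
    show "g x t = g' (x, t)" if "t \<in> {0..T}" "(x, t) \<notin> N" for x t
    proof -
      have "(x, t) \<notin> {p. indicator ?S p *\<^sub>R (case p of (x, t) \<Rightarrow> g x t) \<noteq> g' p}"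
        using that(2) N(1) by blast
      then show ?thesis using that(1) by simp
    qed
  qed
qed

lemma sets_vimage_Pair:
  fixes N :: "('a::euclidean_space \<times> 'b::euclidean_space) set"
  assumes "N \<in> sets borel"
  shows "Pair x -` N \<in> sets borel" "(\<lambda>x. (x, t)) -` N \<in> sets borel"
proof -
  have "Pair x \<in> borel_measurable borel" by (intro borel_measurable_continuous_onI continuous_intros)
  from measurable_sets[OF this assms] show "Pair x -` N \<in> sets borel" by simp
  have "(\<lambda>x. (x, t)) \<in> borel_measurable borel" by (intro borel_measurable_continuous_onI continuous_intros)
  from measurable_sets[OF this assms] show "(\<lambda>x. (x, t)) -` N \<in> sets borel" by simp
qed

lemma sets_borel_pair_lborel:
  "sets (borel \<Otimes>\<^sub>M lborel) = sets (borel :: ('a::euclidean_space \<times> 'b::euclidean_space) measure)"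
proof -
  have "sets (borel \<Otimes>\<^sub>M lborel) = sets (borel \<Otimes>\<^sub>M borel :: ('a \<times> 'b) measure)"
    by (rule sets_pair_measure_cong) auto
  then show ?thesis by (simp only: borel_prod)
qed

lemma borel_measurable_indicator_snd:
  assumes "A \<in> sets borel"
  shows "(\<lambda>p. indicator A (snd p) :: real) \<in> borel_measurable (borel :: ('a::euclidean_space \<times> 'b::euclidean_space) measure)"
  by (rule measurable_compose[OF _ borel_measurable_indicator[OF assms]])
    (intro borel_measurable_continuous_onI continuous_intros)

lemma emeasure_eq_0_sections:
  fixes N :: "('a::euclidean_space \<times> 'b::euclidean_space) set"
  assumes N: "N \<in> sets borel"
  shows "emeasure lborel N = 0 \<longleftrightarrow> (AE t in lborel. emeasure lborel ((\<lambda>x. (x, t)) -` N) = 0)"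
    and "emeasure lborel N = 0 \<longleftrightarrow> (AE x in lborel. emeasure lborel (Pair x -` N) = 0)"
    and "(\<lambda>t. emeasure lborel ((\<lambda>x. (x, t)) -` N)) \<in> borel_measurable borel"
    and "(\<lambda>x. emeasure lborel (Pair x -` N)) \<in> borel_measurable borel"
proof -
  have N': "N \<in> sets (lborel \<Otimes>\<^sub>M lborel)" unfolding lborel_prod using N by simp
  show m1: "(\<lambda>t. emeasure lborel ((\<lambda>x. (x, t)) -` N)) \<in> borel_measurable borel"
    using lborel_pair.measurable_emeasure_Pair2[OF N'] by simp
  show m2: "(\<lambda>x. emeasure lborel (Pair x -` N)) \<in> borel_measurable borel"
    using lborel.measurable_emeasure_Pair[OF N'] by simp
  have "emeasure lborel N = (\<integral>\<^sup>+t. emeasure lborel ((\<lambda>x. (x, t)) -` N) \<partial>lborel)"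
    using lborel_pair.emeasure_pair_measure_alt2[OF N'] by (simp add: lborel_prod)
  then show "emeasure lborel N = 0 \<longleftrightarrow> (AE t in lborel. emeasure lborel ((\<lambda>x. (x, t)) -` N) = 0)"
    using m1 by (simp add: nn_integral_0_iff_AE)
  have "emeasure lborel N = (\<integral>\<^sup>+x. emeasure lborel (Pair x -` N) \<partial>lborel)"
    using lborel.emeasure_pair_measure_alt[OF N'] by (simp add: lborel_prod)
  then show "emeasure lborel N = 0 \<longleftrightarrow> (AE x in lborel. emeasure lborel (Pair x -` N) = 0)"
    using m2 by (simp add: nn_integral_0_iff_AE)
qed

lemma AE_notin_null:
  "N \<in> sets borel \<Longrightarrow> emeasure lborel N = 0 \<Longrightarrow> AE x in lborel. x \<notin> N"
  by (rule AE_not_in) (auto intro: null_setsI)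

subsection \<open>Borel modification of the velocity field\<close>

lemma vec_eq_sum_axis:
  fixes x :: "real^'n::finite"
  shows "x = (\<Sum>i\<in>UNIV. (x $ i) *\<^sub>R axis i 1)"
  by (simp add: vec_eq_iff axis_def if_distrib[of "\<lambda>y. x $ _ * y"] cong: if_cong)

text \<open>The path from y to x changes one coordinate at a time, and each leg is bounded by the
  one-variable mean value inequality.\<close>

lemma partial_bounds_lipschitz:
  fixes g :: "real^'n::finite \<Rightarrow> 'b::real_normed_vector"
  assumes "\<And>i x. has_partial_deriv i g x" "\<And>i x. norm (partial_deriv i g x) \<le> L"
  shows "norm (g x - g y) \<le> real CARD('n) * L * norm (x - y)"
proof -
  have "norm (g (y + (\<Sum>i\<in>I. h i *\<^sub>R axis i 1)) - g y) \<le> (\<Sum>i\<in>I. L * \<bar>h i\<bar>)" if "finite I" for I :: "'n set" and h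
    using that
  proof (induction I rule: finite_induct)
    case (insert j I)
    have "norm (g (y + (\<Sum>i\<in>insert j I. h i *\<^sub>R axis i 1)) - g (y + (\<Sum>i\<in>I. h i *\<^sub>R axis i 1))) \<le> L * \<bar>h j\<bar>"
      using partial_lipschitz[OF assms(1) assms(2)[of j], where x = "y + (\<Sum>i\<in>I. h i *\<^sub>R axis i 1)" and h = "h j"] insert.hyps
      by (simp add: ac_simps)
    then show ?case
      using insert norm_triangle_ineq[of "g (y + (\<Sum>i\<in>insert j I. h i *\<^sub>R axis i 1)) - g (y + (\<Sum>i\<in>I. h i *\<^sub>R axis i 1))"
        "g (y + (\<Sum>i\<in>I. h i *\<^sub>R axis i 1)) - g y"] by simp
  qed simp
  from this[OF finite[of UNIV], of "\<lambda>i. (x - y) $ i"]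
  have "norm (g x - g y) \<le> (\<Sum>i\<in>UNIV. L * \<bar>(x - y) $ i\<bar>)"
    unfolding vec_eq_sum_axis[symmetric] by simp
  also have "\<dots> \<le> (\<Sum>i::'n\<in>UNIV. L * norm (x - y))"
  proof (rule sum_mono)
    fix i :: 'n
    have "0 \<le> L" using assms(2)[of i y] norm_ge_zero order_trans by blast
    then show "L * \<bar>(x - y) $ i\<bar> \<le> L * norm (x - y)" by (intro mult_left_mono component_le_norm_cart)
  qed
  also have "\<dots> = real CARD('n) * L * norm (x - y)" by simp
  finally show ?thesis .
qed

text \<open>
  Averages over small balls only see \<open>f(\<cdot>, t)\<close> up to null sets, so they can be computed from a
  Borel representative; they converge to \<open>f\<close> because \<open>f\<close> is Lipschitz in \<open>x\<close>.
\<close>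

lemma borel_modification:
  fixes f :: "'a::euclidean_space \<Rightarrow> real \<Rightarrow> 'b::euclidean_space"
  assumes f: "(\<lambda>(x, t). f x t) \<in> borel_measurable (lebesgue_on (UNIV \<times> {0..T}))"
    and lip: "\<And>x y t. t \<in> {0..T} \<Longrightarrow> norm (f x t - f y t) \<le> L * norm (x - y)" and L: "L \<ge> 0"
  obtains Z where "Z \<in> sets borel" "Z \<subseteq> {0..T}" "emeasure lborel ({0..T} - Z) = 0"
    "(\<lambda>(x, t). indicator Z t *\<^sub>R f x t) \<in> borel_measurable borel"
proof -
  obtain g N where g: "g \<in> borel_measurable borel" and N: "N \<in> sets borel" "emeasure lborel N = 0"
    and eq: "\<And>x t. t \<in> {0..T} \<Longrightarrow> (x, t) \<notin> N \<Longrightarrow> f x t = g (x, t)"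
    using strip_borel_rep[OF f] by blast
  \<comment> \<open>The good times: those at which the Borel representative agrees with
    \<open>f\<close> for almost every x. By Tonelli's theorem almost every time is good.\<close>
  define Z where "Z = {t\<in>{0..T}. emeasure lborel ((\<lambda>x. (x, t)) -` N) = 0}"
  have Z: "Z \<in> sets borel"
    unfolding Z_def using emeasure_eq_0_sections(3)[OF N(1)] by measurable
  have "AE t in lborel. t \<notin> {0..T} - Z"
    using emeasure_eq_0_sections(1)[OF N(1)] N(2) by (auto simp: Z_def)
  then have Z0: "emeasure lborel ({0..T} - Z) = 0"
    using Z by (subst (asm) AE_iff_null_sets[symmetric]) auto
  define r where "r k = 1 / real (Suc k)" for k
  define c where "c k = measure lborel (ball 0 (r k) :: 'a set)" for k
  \<comment> \<open>Written with the Borel function g, the ball average is jointly Borel in (x, t)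
    as an integral with parameters.\<close>
  define m where "m k x t = (LINT y|lborel. indicator (ball 0 (r k)) y *\<^sub>R g (x + y, t)) /\<^sub>R c k" for k x t
  have c: "c k > 0" for k
    unfolding c_def r_def by (intro content_ball_pos) simp
  have m: "(\<lambda>p. indicator Z (snd p) *\<^sub>R m k (fst p) (snd p)) \<in> borel_measurable borel" for k
  proof -
    have "(\<lambda>q :: ('a \<times> real) \<times> 'a. (fst (fst q) + snd q, snd (fst q))) \<in> borel_measurable borel"
      by (intro borel_measurable_continuous_onI continuous_intros)
    from measurable_compose[OF this g]
    have "(\<lambda>(p, y). indicator (ball 0 (r k)) y *\<^sub>R g (fst p + y, snd p)) \<in> borel_measurable (borel \<Otimes>\<^sub>M (lborel :: 'a measure))"
      unfolding measurable_cong_sets[OF sets_borel_pair_lborel refl] case_prod_beta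
      by (intro borel_measurable_scaleR borel_measurable_indicator_snd) auto
    from lborel.borel_measurable_lebesgue_integral[OF this]
    have 1: "(\<lambda>p. LINT y|lborel. indicator (ball 0 (r k)) y *\<^sub>R g (fst p + y, snd p)) \<in> borel_measurable borel"
      by simp
    then show ?thesis unfolding m_def by (intro borel_measurable_scaleR borel_measurable_indicator_snd Z) auto
  qed
  have lim: "(\<lambda>k. indicator Z t *\<^sub>R m k x t) \<longlonglongrightarrow> indicator Z t *\<^sub>R f x t" for x t
  proof (cases "t \<in> Z")
    case True
    then have t: "t \<in> {0..T}" and null: "emeasure lborel ((\<lambda>x. (x, t)) -` N) = 0" by (auto simp: Z_def)
    have cf: "continuous_on UNIV (\<lambda>x. f x t)"
      by (rule lipschitz_on_continuous_on[of L]) (auto simp: lipschitz_on_def dist_norm lip[OF t] L)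
    have ae: "AE y in lborel. f (x + y) t = g (x + y, t)"
    proof -
      define Nt where "Nt = (\<lambda>x. (x, t)) -` N"
      have Nt [measurable]: "Nt \<in> sets borel" unfolding Nt_def by (rule sets_vimage_Pair(2)[OF N(1)])
      have "AE z in lborel. z \<notin> Nt" using Nt null by (intro AE_notin_null) (auto simp: Nt_def)
      then have "AE z in distr lborel borel ((+) x). z \<notin> Nt" unfolding lborel_distr_plus .
      then have "AE y in lborel. x + y \<notin> Nt" by (subst (asm) AE_distr_iff) measurable
      then have "AE y in lborel. (x + y, t) \<notin> N" by (simp add: Nt_def)
      then show ?thesis by eventually_elim (use eq t in auto)
    qed
    have bound: "norm (m k x t - f x t) \<le> L * r k" for k
    proof -
      let ?B = "ball 0 (r k) :: 'a set"
      have fin: "emeasure lborel ?B < \<infinity>" by (rule emeasure_lborel_ball_finite)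
      have fm: "(\<lambda>y. f (x + y) t) \<in> borel_measurable borel"
        by (intro borel_measurable_continuous_onI continuous_on_compose2[OF cf]) (auto intro!: continuous_intros)
      have gm: "(\<lambda>y. g (x + y, t)) \<in> borel_measurable borel"
        by (rule measurable_compose[OF _ g]) (intro borel_measurable_continuous_onI continuous_intros)
      have ib: "integrable lborel (\<lambda>y. indicator ?B y *\<^sub>R (f (x + y) t - f x t))"
      proof (rule integrableI_bounded_set_indicator[of _ _ _ "L * r k"])
        show "AE y in lborel. y \<in> ?B \<longrightarrow> norm (f (x + y) t - f x t) \<le> L * r k"
        proof (intro AE_I2 impI)
          fix y assume "y \<in> ?B"
          then show "norm (f (x + y) t - f x t) \<le> L * r k"
            using lip[OF t, of "x + y" x] mult_left_mono[OF _ L, of "norm y" "r k"] by simp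
        qed
      qed (use fm fin in auto)
      have ic: "integrable lborel (\<lambda>y. indicator ?B y *\<^sub>R f x t)" using fin by simp
      have "(LINT y|lborel. indicator ?B y *\<^sub>R g (x + y, t))
          = (LINT y|lborel. indicator ?B y *\<^sub>R (f (x + y) t - f x t) + indicator ?B y *\<^sub>R f x t)"
      proof (rule integral_cong_AE)
        show "AE y in lborel. indicator ?B y *\<^sub>R g (x + y, t)
            = indicator ?B y *\<^sub>R (f (x + y) t - f x t) + indicator ?B y *\<^sub>R f x t"
          using ae by eventually_elim (simp add: scaleR_diff_right)
      qed (auto intro!: borel_measurable_scaleR borel_measurable_add borel_measurable_diff borel_measurable_indicator simp: fm gm)
      also have "\<dots> = (LINT y|lborel. indicator ?B y *\<^sub>R (f (x + y) t - f x t)) + c k *\<^sub>R f x t"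
        using ib ic fin by (simp add: c_def)
      finally have "m k x t - f x t = (LINT y|lborel. indicator ?B y *\<^sub>R (f (x + y) t - f x t)) /\<^sub>R c k"
        using c[of k] by (simp add: m_def scaleR_add_right)
      moreover have "norm (LINT y|lborel. indicator ?B y *\<^sub>R (f (x + y) t - f x t)) \<le> L * r k * c k"
      proof -
        have "norm (LINT y|lborel. indicator ?B y *\<^sub>R (f (x + y) t - f x t)) \<le> (LINT y|lborel. indicator ?B y *\<^sub>R (L * r k))"
        proof (rule Bochner_Integration.integral_norm_bound_integral[OF ib])
          show "integrable lborel (\<lambda>y. indicator ?B y *\<^sub>R (L * r k))" using fin by simp
          fix y :: 'a
          show "norm (indicator ?B y *\<^sub>R (f (x + y) t - f x t)) \<le> indicator ?B y *\<^sub>R (L * r k)"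
          proof (cases "y \<in> ?B")
            case True
            then show ?thesis
              using lip[OF t, of "x + y" x] mult_left_mono[OF _ L, of "norm y" "r k"] by simp
          qed simp
        qed
        then show ?thesis using fin by (simp add: c_def mult.commute)
      qed
      ultimately show ?thesis using c[of k] by (simp add: divide_inverse_commute[symmetric] pos_divide_le_eq)
    qed
    have "(\<lambda>k. L * r k) \<longlonglongrightarrow> 0"
      unfolding r_def by (intro tendsto_mult_right_zero LIMSEQ_Suc[OF lim_1_over_n])
    then have "(\<lambda>k. m k x t - f x t) \<longlonglongrightarrow> 0"
      by (rule Lim_null_comparison[OF always_eventually[OF allI[OF bound]]])
    then show ?thesis using True by (simp add: LIM_zero_iff)
  qed simp
  show ?thesis
  proof (rule that[OF Z _ Z0])
    show "Z \<subseteq> {0..T}" by (auto simp: Z_def)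
    show "(\<lambda>(x, t). indicator Z t *\<^sub>R f x t) \<in> borel_measurable borel"
      unfolding case_prod_beta by (rule borel_measurable_LIMSEQ_metric[OF m lim])
  qed
qed

text \<open>\<open>h\<close> equals \<open>f\<close> for all x at the good times and is 0 at the
  others. Hence every curve meets the altered part only in a null set of times, and the Caratheodory
  equation keeps its solutions.\<close>

lemma modified_velocity_field:
  fixes f :: "real^'n::finite \<Rightarrow> real \<Rightarrow> real^'n"
  assumes T: "T > 0" and f: "velocity_field T f"
  obtains K h where "transport_problem K h T" "AE t in lebesgue_on {0..T}. \<forall>x. f x t = h x t"
proof -
  have bm: "bounded_measurable T f"
    and pd: "\<And>i x t. t \<in> {0..T} \<Longrightarrow> has_partial_deriv i (\<lambda>x. f x t) x"
    and bp: "\<And>i. bounded_measurable T (\<lambda>x t. partial_deriv i (\<lambda>x. f x t) x)"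
    using f by (auto simp: velocity_field_def)
  obtain A where A: "\<And>x t. t \<in> {0..T} \<Longrightarrow> norm (f x t) \<le> A"
    using bm unfolding bounded_measurable_def by blast
  have "\<forall>i. \<exists>B. \<forall>x. \<forall>t\<in>{0..T}. norm (partial_deriv i (\<lambda>x. f x t) x) \<le> B"
    using bp unfolding bounded_measurable_def by blast
  then obtain B where B: "\<And>i x t. t \<in> {0..T} \<Longrightarrow> norm (partial_deriv i (\<lambda>x. f x t) x) \<le> B i" by metis
  define M where "M = (\<Sum>i\<in>UNIV. \<bar>B i\<bar>)"
  have M: "norm (partial_deriv i (\<lambda>x. f x t) x) \<le> M" if "t \<in> {0..T}" for i x t
  proof -
    have "B i \<le> \<bar>B i\<bar>" by simp
    also have "\<dots> \<le> M" unfolding M_def by (rule member_le_sum) auto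
    finally show ?thesis using B[OF that, of i x] by linarith
  qed
  define L where "L = real CARD('n) * M"
  have L0: "L \<ge> 0" unfolding L_def M_def by (intro mult_nonneg_nonneg sum_nonneg) auto
  have lip: "norm (f x t - f y t) \<le> L * norm (x - y)" if "t \<in> {0..T}" for x y t
    unfolding L_def using partial_bounds_lipschitz[OF pd[OF that] M[OF that]] .
  \<comment> \<open>The 1 guarantees K > 0 also for the zero field.\<close>
  define K where "K = max 1 (max A L)"
  have K: "K > 0" "A \<le> K" "L \<le> K" by (auto simp: K_def)
  have m: "(\<lambda>(x, t). f x t) \<in> borel_measurable (lebesgue_on (UNIV \<times> {0..T}))"
    using bm by (simp add: bounded_measurable_def)
  obtain Z where Z: "Z \<in> sets borel" "Z \<subseteq> {0..T}" "emeasure lborel ({0..T} - Z) = 0"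
    "(\<lambda>(x, t). indicator Z t *\<^sub>R f x t) \<in> borel_measurable borel"
    using borel_modification[OF m lip L0] by blast
  define h where "h x t = indicator Z t *\<^sub>R f x t" for x t
  have "transport_problem K h T"
  proof
    show "K > 0" "T > 0" by (fact K(1) T)+
    show "(\<lambda>(x, t). h x t) \<in> borel_measurable borel" using Z(4) by (simp add: h_def)
    show "norm (h x t) \<le> K" for x t
      using A[of t x] K Z(2) by (cases "t \<in> Z") (auto simp: h_def)
    show "norm (h x t - h y t) \<le> K * norm (x - y)" for x y t
    proof (cases "t \<in> Z")
      case True
      then show ?thesis
        using lip[of t x y] mult_right_mono[OF K(3), of "norm (x - y)"] Z(2) by (auto simp: h_def)
    qed (use K(1) in \<open>simp add: h_def\<close>)
    show "has_partial_deriv i (\<lambda>x. h x t) x" for i x t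
      using pd[of t i x] Z(2) by (cases "t \<in> Z") (auto simp: h_def has_partial_deriv_def)
  qed
  moreover have "AE t in lebesgue_on {0..T}. \<forall>x. f x t = h x t"
  proof -
    have "AE t in lborel. t \<notin> {0..T} - Z" using Z(1,3) by (intro AE_notin_null) auto
    then have "AE t in lebesgue. t \<notin> {0..T} - Z" by (rule AE_completion)
    then have "AE t in lebesgue. t \<in> {0..T} \<longrightarrow> (\<forall>x. f x t = h x t)"
      by eventually_elim (auto simp: h_def)
    then show ?thesis by (subst AE_restrict_space_iff) auto
  qed
  ultimately show ?thesis by (rule that)
qed

context
  fixes T :: real and f h :: "real^'n::finite \<Rightarrow> real \<Rightarrow> real^'n"
  assumes eq: "AE t in lebesgue_on {0..T}. \<forall>x. f x t = h x t"
begin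

lemma characteristic_cong_AE:
  assumes "0 \<le> s"
  shows "characteristic T f x s = characteristic T h x s"
proof -
  have "is_characteristic T f x s y \<longleftrightarrow> is_characteristic T h x s y" for y
    unfolding is_characteristic_def
  proof (rule ball_cong[OF refl], rule has_bochner_integral_lebesgue_on_cong_AE)
    fix t assume "t \<in> {s..T}"
    then have "{s..t} \<subseteq> {0..T}" using assms by auto
    from AE_subinterval[OF eq this] show "AE r in lebesgue_on {s..t}. f (y r) r = h (y r) r"
      by eventually_elim simp
  qed auto
  then show ?thesis by (intro ext) (simp add: characteristic_def)
qed

lemma char_integral_cong_AE: "0 \<le> s \<Longrightarrow> char_integral T f \<phi> x s = char_integral T h \<phi> x s"
  by (simp add: char_integral_def characteristic_cong_AE)

lemma cauchy_solution_cong_AE: "cauchy_solution T f \<phi> v \<longleftrightarrow> cauchy_solution T h \<phi> v"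
proof -
  have "has_bochner_integral (lebesgue_on {s..T}) (\<lambda>t. \<phi> t + transport_term f t (v t)) (v s) \<longleftrightarrow>
      has_bochner_integral (lebesgue_on {s..T}) (\<lambda>t. \<phi> t + transport_term h t (v t)) (v s)"
    if "s \<in> {0..T}" for s
  proof (rule has_bochner_integral_lebesgue_on_cong_AE)
    have "{s..T} \<subseteq> {0..T}" using that by auto
    from AE_subinterval[OF eq this]
    show "AE t in lebesgue_on {s..T}. \<phi> t + transport_term f t (v t) = \<phi> t + transport_term h t (v t)"
      by eventually_elim (simp add: transport_term_def)
  qed simp
  then show ?thesis by (simp add: cauchy_solution_def)
qed

text \<open>The two choices agree as functions, also where the specification leaves them free,
  because they choose from the same predicate.\<close>

lemma solution_operator_cong_AE: "solution_operator T f = solution_operator T h"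
  by (simp add: solution_operator_def is_solution_operator_def cauchy_solution_cong_AE)

end

subsection \<open>Minkowski's inequality for integrals\<close>

lemma ennreal_power2_le_imp_le:
  fixes x y :: ennreal
  assumes "x\<^sup>2 \<le> y\<^sup>2" shows "x \<le> y"
proof (cases x y rule: ennreal2_cases)
  case (real_real a b)
  then have "a\<^sup>2 \<le> b\<^sup>2" using assms by (simp add: ennreal_power)
  then show ?thesis using real_real by (auto intro: power2_le_imp_le ennreal_leI)
qed (use assms in \<open>auto simp: ennreal_power power2_eq_square ennreal_top_mult ennreal_mult_eq_top_iff top_unique\<close>)

text \<open>The square of the inner integral is a double integral over t and r. After exchanging
  integrals, Cauchy-Schwarz in x bounds the integrand by A t * A r, and the double integral
  factorizes again.\<close>

lemma minkowski_nn_integral: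
  fixes a :: "'a::euclidean_space \<Rightarrow> 'b::euclidean_space \<Rightarrow> ennreal"
  assumes a: "(\<lambda>(x, t). a x t) \<in> borel_measurable borel" and A: "A \<in> borel_measurable borel"
    and le: "AE t in lborel. (\<integral>\<^sup>+x. (a x t)\<^sup>2 \<partial>lborel) \<le> (A t)\<^sup>2"
  shows "(\<integral>\<^sup>+x. (\<integral>\<^sup>+t. a x t \<partial>lborel)\<^sup>2 \<partial>lborel) \<le> (\<integral>\<^sup>+t. A t \<partial>lborel)\<^sup>2"
proof -
  have a' [measurable]: "(\<lambda>(x, t). a x t) \<in> borel_measurable (lborel \<Otimes>\<^sub>M lborel)"
    using a by (simp add: lborel_prod)
  have [measurable]: "A \<in> borel_measurable lborel" using A by simp
  have am: "(\<lambda>x. a x t) \<in> borel_measurable lborel" "(\<lambda>t. a x t) \<in> borel_measurable lborel" for x t by measurable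
  have "(\<integral>\<^sup>+x. (\<integral>\<^sup>+t. a x t \<partial>lborel)\<^sup>2 \<partial>lborel) = (\<integral>\<^sup>+x. (\<integral>\<^sup>+t. (\<integral>\<^sup>+r. a x t * a x r \<partial>lborel) \<partial>lborel) \<partial>lborel)"
    by (simp add: power2_eq_square nn_integral_cmult nn_integral_multc am)
  also have "\<dots> = (\<integral>\<^sup>+t. (\<integral>\<^sup>+x. (\<integral>\<^sup>+r. a x t * a x r \<partial>lborel) \<partial>lborel) \<partial>lborel)"
    by (intro lborel_pair.Fubini'[symmetric]) measurable
  also have "\<dots> = (\<integral>\<^sup>+t. (\<integral>\<^sup>+r. (\<integral>\<^sup>+x. a x t * a x r \<partial>lborel) \<partial>lborel) \<partial>lborel)"
    by (intro nn_integral_cong lborel_pair.Fubini'[symmetric]) measurable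
  also have "\<dots> \<le> (\<integral>\<^sup>+t. (\<integral>\<^sup>+r. A t * A r \<partial>lborel) \<partial>lborel)"
  proof (rule nn_integral_mono_AE)
    show "AE t in lborel. (\<integral>\<^sup>+r. (\<integral>\<^sup>+x. a x t * a x r \<partial>lborel) \<partial>lborel) \<le> (\<integral>\<^sup>+r. A t * A r \<partial>lborel)"
      using le
    proof eventually_elim
      case (elim t)
      show ?case
      proof (rule nn_integral_mono_AE)
        show "AE r in lborel. (\<integral>\<^sup>+x. a x t * a x r \<partial>lborel) \<le> A t * A r"
          using le
        proof eventually_elim
          case (elim r)
          have "(\<integral>\<^sup>+x. a x t * a x r \<partial>lborel)\<^sup>2 \<le> (\<integral>\<^sup>+x. (a x t)\<^sup>2 \<partial>lborel) * (\<integral>\<^sup>+x. (a x r)\<^sup>2 \<partial>lborel)"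
            by (rule Cauchy_Schwarz_nn_integral[OF am(1) am(1)])
          also have "\<dots> \<le> (A t)\<^sup>2 * (A r)\<^sup>2"
            using \<open>(\<integral>\<^sup>+x. (a x t)\<^sup>2 \<partial>lborel) \<le> (A t)\<^sup>2\<close> elim by (intro mult_mono) auto
          finally show ?case
            unfolding power_mult_distrib[symmetric] by (rule ennreal_power2_le_imp_le)
        qed
      qed
    qed
  qed
  also have "\<dots> = (\<integral>\<^sup>+t. A t \<partial>lborel)\<^sup>2"
    by (simp add: power2_eq_square nn_integral_cmult nn_integral_multc)
  finally show ?thesis .
qed

subsection \<open>Integrals along characteristics\<close>

context transport_problem
begin

definition pullback :: "((real^'n) \<times> real \<Rightarrow> real) \<Rightarrow> real \<Rightarrow> real^'n \<Rightarrow> real \<Rightarrow> real" where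
  "pullback g s x t = indicator {s..T} t * g (flow x s t, t)"

lemma flow_pair_measurable:
  "(\<lambda>q :: ((real^'n) \<times> real) \<times> real. (flow (fst (fst q)) (snd (fst q)) (snd q), snd q)) \<in> borel_measurable borel"
proof (rule borel_measurable_continuous_onI)
  have "continuous_on UNIV (\<lambda>q :: ((real^'n) \<times> real) \<times> real. flow (fst (fst q)) (snd (fst q)) (snd q))"
    using continuous_on_compose2[OF continuous_flow, of UNIV "\<lambda>q. (fst (fst q), snd (fst q), snd q)"]
    by (simp add: continuous_intros)
  then show "continuous_on UNIV (\<lambda>q :: ((real^'n) \<times> real) \<times> real. (flow (fst (fst q)) (snd (fst q)) (snd q), snd q))"
    by (intro continuous_on_Pair continuous_intros)
qed

lemma strip_borel: "{q :: ((real^'n) \<times> real) \<times> real. snd (fst q) \<le> snd q \<and> snd q \<le> T} \<in> sets borel"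
  by (intro borel_closed closed_Collect_conj closed_Collect_le continuous_intros)

lemma pullback_measurable:
  assumes g: "g \<in> borel_measurable borel"
  shows "(\<lambda>((x, s), t). pullback g s x t) \<in> borel_measurable borel"
    and "(\<lambda>(x, t). pullback g s x t) \<in> borel_measurable borel"
    and "pullback g s x \<in> borel_measurable borel"
proof -
  let ?S = "{q :: ((real^'n) \<times> real) \<times> real. snd (fst q) \<le> snd q \<and> snd q \<le> T}"
  have "(\<lambda>q. indicator ?S q * g (flow (fst (fst q)) (snd (fst q)) (snd q), snd q)) \<in> borel_measurable borel"
    by (intro borel_measurable_times borel_measurable_indicator strip_borel
      measurable_compose[OF flow_pair_measurable g])
  moreover have "(\<lambda>q. indicator ?S q * g (flow (fst (fst q)) (snd (fst q)) (snd q), snd q))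
      = (\<lambda>((x, s), t). pullback g s x t)"
    by (auto simp: fun_eq_iff pullback_def indicator_def)
  ultimately show m: "(\<lambda>((x, s), t). pullback g s x t) \<in> borel_measurable borel" by simp
  have "(\<lambda>q :: (real^'n) \<times> real. ((fst q, s), snd q)) \<in> borel_measurable borel"
    by (intro borel_measurable_continuous_onI continuous_intros)
  from measurable_compose[OF this m]
  show "(\<lambda>(x, t). pullback g s x t) \<in> borel_measurable borel" by (simp add: case_prod_beta)
  have "(\<lambda>t :: real. ((x, s), t)) \<in> borel_measurable borel"
    by (intro borel_measurable_continuous_onI continuous_intros)
  from measurable_compose[OF this m]
  show "pullback g s x \<in> borel_measurable borel" by simp
qed

lemma pullback_integral_measurable:
  assumes g: "g \<in> borel_measurable borel"
  shows "(\<lambda>(x, s). LINT t|lborel. pullback g s x t) \<in> borel_measurable borel"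
    and "(\<lambda>x. LINT t|lborel. pullback g s x t) \<in> borel_measurable borel"
proof -
  have "(\<lambda>(p, t). pullback g (snd p) (fst p) t) \<in> borel_measurable (borel \<Otimes>\<^sub>M lborel)"
    unfolding measurable_cong_sets[OF sets_borel_pair_lborel refl]
    using pullback_measurable(1)[OF g] by (simp add: case_prod_unfold)
  from lborel.borel_measurable_lebesgue_integral[OF this]
  show "(\<lambda>(x, s). LINT t|lborel. pullback g s x t) \<in> borel_measurable borel" by (simp add: case_prod_beta)
  have "(\<lambda>(x, t). pullback g s x t) \<in> borel_measurable (borel \<Otimes>\<^sub>M lborel)"
    unfolding measurable_cong_sets[OF sets_borel_pair_lborel refl] by (rule pullback_measurable(2)[OF g])
  from lborel.borel_measurable_lebesgue_integral[OF this]
  show "(\<lambda>x. LINT t|lborel. pullback g s x t) \<in> borel_measurable borel" .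
qed

text \<open>For fixed s and almost every t the slice of N at time t is null, hence so is its
  preimage under the flow; Tonelli's theorem turns this around: for almost every x the
  characteristic meets N in a null set of times. E collects the exceptional starting points; each
  slice is null for every s, not just for almost every s, as the integral has to be determined at
  each time.\<close>

lemma null_set_along_flow:
  assumes N: "N \<in> sets borel" "emeasure lborel N = 0"
  obtains E where "E \<in> sets borel" "emeasure lborel E = 0" "\<And>s. AE x in lborel. (x, s) \<notin> E"
    "\<And>x s. s \<in> {0..T} \<Longrightarrow> (x, s) \<notin> E \<Longrightarrow> AE t in lborel. t \<in> {s..T} \<longrightarrow> (flow x s t, t) \<notin> N"
proof -
  let ?\<Psi> = "\<lambda>q :: ((real^'n) \<times> real) \<times> real. (flow (fst (fst q)) (snd (fst q)) (snd q), snd q)"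
  let ?S = "{q :: ((real^'n) \<times> real) \<times> real. snd (fst q) \<le> snd q \<and> snd q \<le> T}"
  let ?C = "{q :: ((real^'n) \<times> real) \<times> real. 0 \<le> snd (fst q)}"
  \<comment> \<open>The constraints 0 \<le> s \<le> t \<le> T bound the elapsed time by T, so one
    constant \<open>flow_const T\<close> serves all slices.\<close>
  define D where "D = ?\<Psi> -` N \<inter> ?S \<inter> ?C"
  have "?C \<in> sets borel" by (intro borel_closed closed_Collect_le continuous_intros)
  moreover have "?\<Psi> -` N \<in> sets borel" using measurable_sets[OF flow_pair_measurable N(1)] by simp
  ultimately have D: "D \<in> sets borel" unfolding D_def by (intro sets.Int strip_borel)
  define E where "E = {p. emeasure lborel (Pair p -` D) \<noteq> 0}"
  have E: "E \<in> sets borel"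
    unfolding E_def using emeasure_eq_0_sections(4)[OF D] by measurable
  have AE: "AE x in lborel. (x, s) \<notin> E" for s
  proof -
    define Ds where "Ds = (\<lambda>q :: (real^'n) \<times> real. ((fst q, s), snd q)) -` D"
    have "(\<lambda>q :: (real^'n) \<times> real. ((fst q, s), snd q)) \<in> borel_measurable borel"
      by (intro borel_measurable_continuous_onI continuous_intros)
    from measurable_sets[OF this D] have Ds: "Ds \<in> sets borel" by (simp add: Ds_def)
    have "AE t in lborel. emeasure lborel ((\<lambda>x. (x, t)) -` N) = 0"
      using emeasure_eq_0_sections(1)[OF N(1)] N(2) by simp
    then have "AE t in lborel. emeasure lborel ((\<lambda>x. (x, t)) -` Ds) = 0"
    proof eventually_elim
      case (elim t)
      show ?case
      proof (cases "0 \<le> s \<and> s \<le> t \<and> t \<le> T")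
        case True
        then have "(\<lambda>x. (x, t)) -` Ds = (\<lambda>x. flow x s t) -` ((\<lambda>x. (x, t)) -` N)"
          by (auto simp: Ds_def D_def)
        moreover have "emeasure lborel ((\<lambda>x. flow x s t) -` ((\<lambda>x. (x, t)) -` N))
            \<le> ennreal (flow_const T) * emeasure lborel ((\<lambda>x. (x, t)) -` N)"
          using flow_nonsingular[of t s T] sets_vimage_Pair(2)[OF N(1)] True
          unfolding nonsingular_def by auto
        ultimately show ?thesis using elim by simp
      next
        case False
        then have "(\<lambda>x. (x, t)) -` Ds = {}" by (auto simp: Ds_def D_def)
        then show ?thesis by simp
      qed
    qed
    then have "AE x in lborel. emeasure lborel (Pair x -` Ds) = 0"
      using emeasure_eq_0_sections(1,2)[OF Ds] by simp
    moreover have "Pair x -` Ds = Pair (x, s) -` D" for x by (auto simp: Ds_def)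
    ultimately show ?thesis by (simp add: E_def)
  qed
  have E0: "emeasure lborel E = 0"
    unfolding emeasure_eq_0_sections(1)[OF E]
  proof (rule AE_I2)
    fix s :: real
    have "AE x in lborel. x \<notin> (\<lambda>x. (x, s)) -` E" using AE[of s] by simp
    then show "emeasure lborel ((\<lambda>x. (x, s)) -` E) = 0"
      using sets_vimage_Pair(2)[OF E] by (subst (asm) AE_iff_null_sets[symmetric]) auto
  qed
  show ?thesis
  proof (rule that[OF E E0 AE])
    fix x s assume s: "s \<in> {0..T}" and x: "(x, s) \<notin> E"
    have "AE t in lborel. t \<notin> Pair (x, s) -` D"
      using x sets_vimage_Pair(1)[OF D] by (intro AE_notin_null) (auto simp: E_def)
    then show "AE t in lborel. t \<in> {s..T} \<longrightarrow> (flow x s t, t) \<notin> N"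
      by eventually_elim (use s in \<open>auto simp: D_def\<close>)
  qed
qed

lemma lebesgue_on_pullback:
  assumes g: "g \<in> borel_measurable borel"
  shows "integrable (lebesgue_on {s..T}) (\<lambda>t. g (flow x s t, t)) \<longleftrightarrow> integrable lborel (pullback g s x)"
    and "(LINT t|lebesgue_on {s..T}. g (flow x s t, t)) = (LINT t|lborel. pullback g s x t)"
proof -
  have eq: "(\<lambda>t. indicator {s..T} t *\<^sub>R g (flow x s t, t)) = pullback g s x"
    by (simp add: fun_eq_iff pullback_def)
  have m: "pullback g s x \<in> borel_measurable lborel" using pullback_measurable(3)[OF g] by simp
  show "integrable (lebesgue_on {s..T}) (\<lambda>t. g (flow x s t, t)) \<longleftrightarrow> integrable lborel (pullback g s x)"
    unfolding integrable_lebesgue_on_iff eq by (rule integrable_completion[OF m])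
  show "(LINT t|lebesgue_on {s..T}. g (flow x s t, t)) = (LINT t|lborel. pullback g s x t)"
    unfolding integral_lebesgue_on_eq using eq integral_completion[OF m] by (simp add: fun_eq_iff)
qed

text \<open>Outside E a change of the integrand on a null set of space-time affects a characteristic
  only at a null set of times. It is applied to \<open>\<phi>\<close> and to a second
  representative, with the same Borel function g.\<close>

lemma char_integral_pullback:
  assumes g: "g \<in> borel_measurable borel" and N: "N \<in> sets borel" "emeasure lborel N = 0"
    and eq: "\<And>x t. t \<in> {0..T} \<Longrightarrow> (x, t) \<notin> N \<Longrightarrow> \<psi> x t = g (x, t)"
  obtains E where "E \<in> sets borel" "emeasure lborel E = 0" "\<And>s. AE x in lborel. (x, s) \<notin> E"
    "\<And>x s. s \<in> {0..T} \<Longrightarrow> (x, s) \<notin> E \<Longrightarrow>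
      integrable (lebesgue_on {s..T}) (\<lambda>t. \<psi> (characteristic T f x s t) t) \<longleftrightarrow> integrable lborel (pullback g s x)"
    "\<And>x s. s \<in> {0..T} \<Longrightarrow> (x, s) \<notin> E \<Longrightarrow> char_integral T f \<psi> x s = (LINT t|lborel. pullback g s x t)"
proof -
  obtain E where E: "E \<in> sets borel" "emeasure lborel E = 0" "\<And>s. AE x in lborel. (x, s) \<notin> E"
    "\<And>x s. s \<in> {0..T} \<Longrightarrow> (x, s) \<notin> E \<Longrightarrow> AE t in lborel. t \<in> {s..T} \<longrightarrow> (flow x s t, t) \<notin> N"
    using null_set_along_flow[OF N] by blast
  have AE: "AE t in lebesgue_on {s..T}. \<psi> (characteristic T f x s t) t = g (flow x s t, t)"
    if s: "s \<in> {0..T}" and x: "(x, s) \<notin> E" for x s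
  proof -
    have "AE t in lebesgue. t \<in> {s..T} \<longrightarrow> (flow x s t, t) \<notin> N" by (rule AE_completion[OF E(4)[OF s x]])
    then have "AE t in lebesgue. t \<in> {s..T} \<longrightarrow> \<psi> (characteristic T f x s t) t = g (flow x s t, t)"
      by eventually_elim (use s eq in \<open>auto simp: characteristic_flow\<close>)
    then show ?thesis by (subst AE_restrict_space_iff) auto
  qed
  show ?thesis
  proof (rule that[OF E(1-3)])
    fix x s assume *: "s \<in> {0..T}" "(x, s) \<notin> E"
    have S: "{s..T} \<in> sets lebesgue" by simp
    show "integrable (lebesgue_on {s..T}) (\<lambda>t. \<psi> (characteristic T f x s t) t) \<longleftrightarrow> integrable lborel (pullback g s x)"
      unfolding integrable_lebesgue_on_cong_AE[OF S AE[OF *]] by (rule lebesgue_on_pullback(1)[OF g])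
    show "char_integral T f \<psi> x s = (LINT t|lborel. pullback g s x t)"
      unfolding char_integral_def integral_lebesgue_on_cong_AE[OF S AE[OF *]] by (rule lebesgue_on_pullback(2)[OF g])
  qed
qed

context
  fixes g :: "(real^'n) \<times> real \<Rightarrow> real" and u :: "real \<Rightarrow> (real^'n) l2" and s :: real
  assumes g: "g \<in> borel_measurable borel"
    and sq: "AE t in lebesgue_on {0..T}. square_integrable (\<lambda>x. g (x, t)) \<and> u t = abs_l2 (\<lambda>x. g (x, t))"
    and u: "integrable (lebesgue_on {0..T}) u"
    and s: "s \<in> {0..T}"
begin

lemma pullback_sections:
  "AE t in lebesgue. t \<in> {s..T} \<longrightarrow> square_integrable (\<lambda>x. g (flow x s t, t)) \<and>
    evol s t (u t) = abs_l2 (\<lambda>x. g (flow x s t, t))"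
proof -
  have "AE t in lebesgue. t \<in> {0..T} \<longrightarrow> square_integrable (\<lambda>x. g (x, t)) \<and> u t = abs_l2 (\<lambda>x. g (x, t))"
    using sq by (subst (asm) AE_restrict_space_iff) auto
  then show ?thesis
  proof eventually_elim
    case (elim t)
    show ?case
    proof
      assume "t \<in> {s..T}"
      then have *: "square_integrable (\<lambda>x. g (x, t))" "u t = abs_l2 (\<lambda>x. g (x, t))" using elim s by auto
      show "square_integrable (\<lambda>x. g (flow x s t, t)) \<and> evol s t (u t) = abs_l2 (\<lambda>x. g (flow x s t, t))"
        unfolding *(2) using square_integrable_flow[OF *(1)] evol_abs_l2[OF *(1)] by blast
    qed
  qed
qed

text \<open>By Minkowski's inequality the bound is the square of the integral of norm (evol s t (u
  t)). Finiteness yields integrability along almost every characteristic, square integrability of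
  the integral, and the Fubini exchange below.\<close>

lemma pullback_nn_integral_finite:
  "(\<integral>\<^sup>+x. (\<integral>\<^sup>+t. ennreal \<bar>pullback g s x t\<bar> \<partial>lborel)\<^sup>2 \<partial>lborel) < \<infinity>"
proof -
  let ?n = "\<lambda>t. indicator {s..T} t *\<^sub>R norm (evol s t (u t))"
  define Q where "Q t = (\<integral>\<^sup>+x. (ennreal \<bar>pullback g s x t\<bar>)\<^sup>2 \<partial>lborel)" for t
  \<comment> \<open>The norm of evol s t (u t) is only known to be Lebesgue measurable in t; A is a
    Borel function that agrees with it almost everywhere on [s,T] and vanishes elsewhere.\<close>
  define A where "A t = ennreal (sqrt (enn2real (Q t)))" for t
  have pm: "(\<lambda>(x, t). ennreal \<bar>pullback g s x t\<bar>) \<in> borel_measurable borel"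
    using pullback_measurable(2)[OF g, of s] by (simp add: case_prod_unfold)
  have "(\<lambda>(t, x). (ennreal \<bar>pullback g s x t\<bar>)\<^sup>2) \<in> borel_measurable (borel \<Otimes>\<^sub>M lborel)"
  proof -
    have "(\<lambda>q :: real \<times> (real^'n). (snd q, fst q)) \<in> borel_measurable borel"
      by (intro borel_measurable_continuous_onI continuous_intros)
    from measurable_compose[OF this pm] show ?thesis
      unfolding measurable_cong_sets[OF sets_borel_pair_lborel refl]
      by (simp add: case_prod_beta borel_measurable_power)
  qed
  from lborel.borel_measurable_nn_integral[OF this]
  have Q: "Q \<in> borel_measurable borel" unfolding Q_def by simp
  then have A: "A \<in> borel_measurable borel" unfolding A_def by measurable
  have "AE t in lebesgue. Q t = ennreal ((?n t)\<^sup>2)"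
    using pullback_sections
  proof eventually_elim
    case (elim t)
    show ?case
    proof (cases "t \<in> {s..T}")
      case True
      with elim have *: "square_integrable (\<lambda>x. g (flow x s t, t))" "evol s t (u t) = abs_l2 (\<lambda>x. g (flow x s t, t))"
        by blast+
      have "Q t = (\<integral>\<^sup>+x. ennreal ((g (flow x s t, t))\<^sup>2) \<partial>lborel)"
        unfolding Q_def using True by (intro nn_integral_cong) (simp add: pullback_def ennreal_power)
      also have "\<dots> = (\<integral>\<^sup>+x. ennreal ((g (flow x s t, t))\<^sup>2) \<partial>lebesgue)"
        by (rule nn_integral_completion[symmetric])
      finally show ?thesis using True by (simp add: nn_integral_l2[OF *(1)] *(2))
    qed (simp add: Q_def pullback_def)
  qed
  then have Qn: "AE t in lborel. Q t = ennreal ((?n t)\<^sup>2)" by (simp add: AE_completion_iff)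
  then have An: "AE t in lborel. A t = ennreal (?n t)"
    by eventually_elim (simp add: A_def)
  from Qn An have "AE t in lborel. Q t \<le> (A t)\<^sup>2"
    by eventually_elim (simp add: ennreal_power)
  then have "(\<integral>\<^sup>+x. (\<integral>\<^sup>+t. ennreal \<bar>pullback g s x t\<bar> \<partial>lborel)\<^sup>2 \<partial>lborel) \<le> (\<integral>\<^sup>+t. A t \<partial>lborel)\<^sup>2"
    unfolding Q_def by (rule minkowski_nn_integral[OF pm A])
  also have "(\<integral>\<^sup>+t. A t \<partial>lborel) = (\<integral>\<^sup>+t. ennreal (?n t) \<partial>lebesgue)"
    unfolding nn_integral_completion using An by (rule nn_integral_cong_AE)
  also have "\<dots>\<^sup>2 < \<infinity>"
  proof -
    have "integrable lebesgue ?n"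
      unfolding integrable_lebesgue_on_iff[symmetric] using s
      by (intro integrable_norm evol_integrable_sub[OF u]) auto
    then have "(\<integral>\<^sup>+t. ennreal (?n t) \<partial>lebesgue) = ennreal (LINT t|lebesgue. ?n t)"
      by (rule nn_integral_eq_integral) simp
    then show ?thesis by (simp add: power_less_top_ennreal)
  qed
  finally show ?thesis .
qed

lemma nn_integral_pullback_measurable:
  "(\<lambda>x. \<integral>\<^sup>+t. ennreal \<bar>pullback g s x t\<bar> \<partial>lborel) \<in> borel_measurable borel"
proof -
  have "(\<lambda>(x, t). ennreal \<bar>pullback g s x t\<bar>) \<in> borel_measurable (borel \<Otimes>\<^sub>M lborel)"
    unfolding measurable_cong_sets[OF sets_borel_pair_lborel refl]
    using pullback_measurable(2)[OF g, of s] by (simp add: case_prod_unfold)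
  from lborel.borel_measurable_nn_integral[OF this] show ?thesis .
qed

lemma pullback_integrable: "AE x in lborel. integrable lborel (pullback g s x)"
proof -
  have "AE x in lborel. (\<integral>\<^sup>+t. ennreal \<bar>pullback g s x t\<bar> \<partial>lborel)\<^sup>2 \<noteq> \<infinity>"
    using pullback_nn_integral_finite nn_integral_pullback_measurable
    by (intro nn_integral_PInf_AE) auto
  then show ?thesis
  proof eventually_elim
    case (elim x)
    then have "(\<integral>\<^sup>+t. ennreal \<bar>pullback g s x t\<bar> \<partial>lborel) < \<infinity>"
      by (simp add: less_top power_less_top_ennreal)
    then show ?case
      using pullback_measurable(3)[OF g] by (intro integrableI_bounded) auto
  qed
qed

lemma square_integrable_pullback_integral: "square_integrable (\<lambda>x. LINT t|lborel. pullback g s x t)"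
proof (rule square_integrableI_nn)
  show "(\<lambda>x. LINT t|lborel. pullback g s x t) \<in> borel_measurable lebesgue"
    by (rule measurable_completion) (use pullback_integral_measurable(2)[OF g] in simp)
  have "(\<integral>\<^sup>+x. ennreal ((LINT t|lborel. pullback g s x t)\<^sup>2) \<partial>lebesgue)
      \<le> (\<integral>\<^sup>+x. (\<integral>\<^sup>+t. ennreal \<bar>pullback g s x t\<bar> \<partial>lborel)\<^sup>2 \<partial>lborel)"
    unfolding nn_integral_completion
  proof (rule nn_integral_mono_AE)
    show "AE x in lborel. ennreal ((LINT t|lborel. pullback g s x t)\<^sup>2)
        \<le> (\<integral>\<^sup>+t. ennreal \<bar>pullback g s x t\<bar> \<partial>lborel)\<^sup>2"
      using pullback_integrable
    proof eventually_elim
      case (elim x)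
      have "(ennreal \<bar>LINT t|lborel. pullback g s x t\<bar>)\<^sup>2 \<le> (\<integral>\<^sup>+t. ennreal \<bar>pullback g s x t\<bar> \<partial>lborel)\<^sup>2"
        using integral_norm_bound_ennreal[OF elim] by (intro power_mono) auto
      then show ?case by (simp add: ennreal_power)
    qed
  qed
  then show "(\<integral>\<^sup>+x. ennreal ((LINT t|lborel. pullback g s x t)\<^sup>2) \<partial>lebesgue) < \<infinity>"
    using pullback_nn_integral_finite by (rule le_less_trans)
qed

text \<open>A pointwise integral and a Bochner integral are compared through their pairings with
  test functions: Fubini's theorem exchanges x and t, and for almost every t the section is a
  representative of evol s t (u t).\<close>

lemma abs_l2_pullback_integral: "abs_l2 (\<lambda>x. LINT t|lborel. pullback g s x t) = sol u s"
proof (rule l2_eqI_test)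
  fix \<psi> :: "real^'n \<Rightarrow> real" assume "test_function \<psi>"
  then have \<psi>: "square_integrable \<psi>" "\<psi> \<in> borel_measurable borel"
    by (auto intro: square_integrable_test borel_measurable_continuous_onI test_function_continuous)
  have qm: "(\<lambda>(x, t). pullback g s x t * \<psi> x) \<in> borel_measurable borel"
  proof -
    have "(\<lambda>q :: (real^'n) \<times> real. \<psi> (fst q)) \<in> borel_measurable borel"
      by (rule measurable_compose[OF _ \<psi>(2)]) (intro borel_measurable_continuous_onI continuous_intros)
    then show ?thesis
      using pullback_measurable(2)[OF g] unfolding case_prod_beta by (rule borel_measurable_times[rotated])
  qed
  \<comment> \<open>Integrability on the product follows from Cauchy-Schwarz in x, with the finite
    quantity of \<open>pullback_nn_integral_finite\<close> as one factor and the norm of \<psi> as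
    the other.\<close>
  have qi: "integrable (lborel \<Otimes>\<^sub>M lborel) (\<lambda>(x, t). pullback g s x t * \<psi> x)"
  proof (rule integrableI_bounded)
    show "(\<lambda>(x, t). pullback g s x t * \<psi> x) \<in> borel_measurable (lborel \<Otimes>\<^sub>M lborel)"
      unfolding lborel_prod using qm by simp
    then have nm: "(\<lambda>q. ennreal (norm (case q of (x, t) \<Rightarrow> pullback g s x t * \<psi> x))) \<in> borel_measurable (lborel \<Otimes>\<^sub>M lborel)"
      by measurable
    have "(\<integral>\<^sup>+q. ennreal (norm (case q of (x, t) \<Rightarrow> pullback g s x t * \<psi> x)) \<partial>(lborel \<Otimes>\<^sub>M lborel))
        = (\<integral>\<^sup>+x. (\<integral>\<^sup>+t. ennreal \<bar>pullback g s x t\<bar> * ennreal \<bar>\<psi> x\<bar> \<partial>lborel) \<partial>lborel)"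
      unfolding lborel.nn_integral_fst[OF nm, symmetric] by (simp add: abs_mult ennreal_mult)
    also have "\<dots> = (\<integral>\<^sup>+x. (\<integral>\<^sup>+t. ennreal \<bar>pullback g s x t\<bar> \<partial>lborel) * ennreal \<bar>\<psi> x\<bar> \<partial>lborel)"
      using pullback_measurable(3)[OF g] by (simp add: nn_integral_multc)
    also have "\<dots> < \<infinity>"
    proof -
      have "(\<integral>\<^sup>+x. (\<integral>\<^sup>+t. ennreal \<bar>pullback g s x t\<bar> \<partial>lborel) * ennreal \<bar>\<psi> x\<bar> \<partial>lborel)\<^sup>2
          \<le> (\<integral>\<^sup>+x. (\<integral>\<^sup>+t. ennreal \<bar>pullback g s x t\<bar> \<partial>lborel)\<^sup>2 \<partial>lborel) * (\<integral>\<^sup>+x. (ennreal \<bar>\<psi> x\<bar>)\<^sup>2 \<partial>lborel)"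
        using nn_integral_pullback_measurable \<psi>(2) by (intro Cauchy_Schwarz_nn_integral) auto
      also have "(\<integral>\<^sup>+x. (ennreal \<bar>\<psi> x\<bar>)\<^sup>2 \<partial>lborel) = ennreal ((norm (abs_l2 \<psi>))\<^sup>2)"
        using nn_integral_l2[OF \<psi>(1)] by (simp add: nn_integral_completion ennreal_power)
      also have "(\<integral>\<^sup>+x. (\<integral>\<^sup>+t. ennreal \<bar>pullback g s x t\<bar> \<partial>lborel)\<^sup>2 \<partial>lborel) * \<dots> < \<infinity>"
        using pullback_nn_integral_finite by (simp add: ennreal_mult_less_top)
      finally show ?thesis by (simp add: power_less_top_ennreal)
    qed
    finally show "(\<integral>\<^sup>+q. ennreal (norm (case q of (x, t) \<Rightarrow> pullback g s x t * \<psi> x)) \<partial>(lborel \<Otimes>\<^sub>M lborel)) < \<infinity>" .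
  qed
  define F where "F t = (LINT x|lborel. pullback g s x t * \<psi> x)" for t
  have Fi: "integrable lborel F" unfolding F_def by (rule lborel_pair.integrable_snd[OF qi])
  have Vm: "(\<lambda>x. LINT t|lborel. pullback g s x t) \<in> borel_measurable borel"
    by (rule pullback_integral_measurable(2)[OF g])
  have "inner (abs_l2 (\<lambda>x. LINT t|lborel. pullback g s x t)) (abs_l2 \<psi>)
      = (LINT x|lebesgue. (LINT t|lborel. pullback g s x t) * \<psi> x)"
    by (rule inner_abs_l2[OF square_integrable_pullback_integral \<psi>(1)])
  also have "\<dots> = (LINT x|lborel. (LINT t|lborel. pullback g s x t) * \<psi> x)"
    by (rule integral_completion) (use Vm \<psi>(2) in simp)
  also have "\<dots> = (LINT x|lborel. LINT t|lborel. pullback g s x t * \<psi> x)" by simp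
  also have "\<dots> = (LINT t|lborel. F t)"
    unfolding F_def by (rule lborel_pair.Fubini_integral[OF qi, symmetric])
  also have "\<dots> = (LINT t|lebesgue. F t)"
    by (rule integral_completion[symmetric]) (use Fi in auto)
  also have "\<dots> = (LINT t|lebesgue. indicator {s..T} t *\<^sub>R F t)"
    by (rule arg_cong[of _ _ "integral\<^sup>L lebesgue"]) (auto simp: fun_eq_iff F_def pullback_def indicator_def)
  also have "\<dots> = (LINT t|lebesgue_on {s..T}. F t)" by (rule integral_lebesgue_on_eq[symmetric])
  also have "\<dots> = (LINT t|lebesgue_on {s..T}. inner (evol s t (u t)) (abs_l2 \<psi>))"
  proof (rule integral_lebesgue_on_cong_AE)
    have "AE t in lebesgue. t \<in> {s..T} \<longrightarrow> F t = inner (evol s t (u t)) (abs_l2 \<psi>)"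
      using pullback_sections
    proof eventually_elim
      case (elim t)
      show ?case
      proof
        assume t: "t \<in> {s..T}"
        with elim have *: "square_integrable (\<lambda>x. g (flow x s t, t))" "evol s t (u t) = abs_l2 (\<lambda>x. g (flow x s t, t))"
          by blast+
        have "(\<lambda>x :: real^'n. (x, t)) \<in> borel_measurable borel"
          by (intro borel_measurable_continuous_onI continuous_intros)
        from measurable_compose[OF this qm] have m: "(\<lambda>x. pullback g s x t * \<psi> x) \<in> borel_measurable lborel" by simp
        have "F t = (LINT x|lebesgue. pullback g s x t * \<psi> x)"
          unfolding F_def by (rule integral_completion[OF m, symmetric])
        also have "\<dots> = (LINT x|lebesgue. g (flow x s t, t) * \<psi> x)" using t by (simp add: pullback_def)
        finally show "F t = inner (evol s t (u t)) (abs_l2 \<psi>)"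
          by (simp add: *(2) inner_abs_l2[OF *(1) \<psi>(1)])
      qed
    qed
    then show "AE t in lebesgue_on {s..T}. F t = inner (evol s t (u t)) (abs_l2 \<psi>)"
      by (subst AE_restrict_space_iff) auto
  qed simp
  also have "\<dots> = inner (sol u s) (abs_l2 \<psi>)" by (rule inner_sol[OF u s, symmetric])
  finally show "inner (abs_l2 (\<lambda>x. LINT t|lborel. pullback g s x t)) (abs_l2 \<psi>) = inner (sol u s) (abs_l2 \<psi>)" .
qed

end

end

subsection \<open>The integral along characteristics solves the Cauchy problem\<close>

lemma square_integrable_cong_AE:
  assumes "square_integrable k" "k' \<in> borel_measurable lebesgue" "AE x in lebesgue. k x = k' x"
  shows "square_integrable k'"
proof -
  have "integrable lebesgue (\<lambda>x. (k x)\<^sup>2) \<longleftrightarrow> integrable lebesgue (\<lambda>x. (k' x)\<^sup>2)"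
    using assms by (intro integrable_cong_AE) (auto simp: square_integrable_def)
  then show ?thesis using assms by (simp add: square_integrable_def)
qed

context transport_problem
begin

text \<open>\<open>\<phi>\<close> is replaced by a Borel representative g on space-time. The
  integrals of g along the flow have all the properties, and \<open>char_integral_pullback\<close>
  transfers them back at every s for almost every x.\<close>

lemma char_integral_eq_sol:
  fixes \<phi> :: "real^'n \<Rightarrow> real \<Rightarrow> real"
  assumes \<phi>: "(\<lambda>(x, t). \<phi> x t) \<in> borel_measurable (lebesgue_on (UNIV \<times> {0..T}))"
    and sq: "AE t in lebesgue_on {0..T}. square_integrable (\<lambda>x. \<phi> x t)"
    and X: "(\<lambda>t. abs_l2 (\<lambda>x. \<phi> x t)) \<in> X10 T"
  shows "(\<lambda>(x, s). char_integral T f \<phi> x s) \<in> borel_measurable (lebesgue_on (UNIV \<times> {0..T}))"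
    and "s \<in> {0..T} \<Longrightarrow>
      AE x in lebesgue. integrable (lebesgue_on {s..T}) (\<lambda>t. \<phi> (characteristic T f x s t) t)"
    and "s \<in> {0..T} \<Longrightarrow> square_integrable (\<lambda>x. char_integral T f \<phi> x s)"
    and "s \<in> {0..T} \<Longrightarrow> (\<lambda>(x, t). \<psi> x t) \<in> borel_measurable (lebesgue_on (UNIV \<times> {0..T})) \<Longrightarrow>
      AE t in lebesgue_on {0..T}. AE x in lebesgue. \<psi> x t = \<phi> x t \<Longrightarrow>
      AE x in lebesgue. char_integral T f \<psi> x s = char_integral T f \<phi> x s"
    and "s \<in> {0..T} \<Longrightarrow>
      abs_l2 (\<lambda>x. char_integral T f \<phi> x s) = sol (\<lambda>t. abs_l2 (\<lambda>x. \<phi> x t)) s"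
proof -
  define u where "u t = abs_l2 (\<lambda>x. \<phi> x t)" for t
  have u: "integrable (lebesgue_on {0..T}) u" using X by (simp add: X10_def u_def[abs_def])
  obtain g N where g: "g \<in> borel_measurable borel" and N: "N \<in> sets borel" "emeasure lborel N = 0"
    and eq: "\<And>x t. t \<in> {0..T} \<Longrightarrow> (x, t) \<notin> N \<Longrightarrow> \<phi> x t = g (x, t)"
    using strip_borel_rep[OF \<phi>] by blast
  have AE_sections: "AE t in lebesgue. AE x in lebesgue. (x, t) \<notin> M"
    if M: "M \<in> sets borel" "emeasure lborel M = 0" for M :: "((real^'n) \<times> real) set"
  proof -
    have "AE t in lborel. emeasure lborel ((\<lambda>x. (x, t)) -` M) = 0"
      using emeasure_eq_0_sections(1)[OF M(1)] M(2) by simp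
    then have "AE t in lborel. AE x in lebesgue. (x, t) \<notin> M"
    proof eventually_elim
      case (elim t)
      then have "AE x in lborel. x \<notin> (\<lambda>x. (x, t)) -` M"
        using sets_vimage_Pair(2)[OF M(1)] by (intro AE_notin_null)
      then have "AE x in lborel. (x, t) \<notin> M" by simp
      then show ?case by (rule AE_completion)
    qed
    then show ?thesis by (rule AE_completion)
  qed
  have gt: "(\<lambda>x. g (x, t)) \<in> borel_measurable lebesgue" for t
  proof -
    have "(\<lambda>x. g (x, t)) \<in> borel_measurable borel"
      by (rule measurable_compose[OF _ g]) (intro borel_measurable_continuous_onI continuous_intros)
    then have "(\<lambda>x. g (x, t)) \<in> borel_measurable lborel" by simp
    then show ?thesis by (rule measurable_completion)
  qed
  have sqg: "AE t in lebesgue_on {0..T}. square_integrable (\<lambda>x. g (x, t)) \<and> u t = abs_l2 (\<lambda>x. g (x, t))"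
  proof -
    have "AE t in lebesgue. t \<in> {0..T} \<longrightarrow> square_integrable (\<lambda>x. \<phi> x t)"
      using sq by (subst (asm) AE_restrict_space_iff) auto
    with AE_sections[OF N]
    have "AE t in lebesgue. t \<in> {0..T} \<longrightarrow> square_integrable (\<lambda>x. g (x, t)) \<and> u t = abs_l2 (\<lambda>x. g (x, t))"
    proof eventually_elim
      case (elim t)
      show ?case
      proof
        assume t: "t \<in> {0..T}"
        then have k: "square_integrable (\<lambda>x. \<phi> x t)" using elim by blast
        have ae: "AE x in lebesgue. \<phi> x t = g (x, t)"
          using elim(1) by eventually_elim (rule eq[OF t])
        have "square_integrable (\<lambda>x. g (x, t))" by (rule square_integrable_cong_AE[OF k gt ae])
        then show "square_integrable (\<lambda>x. g (x, t)) \<and> u t = abs_l2 (\<lambda>x. g (x, t))"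
          using abs_l2_eq_iff[OF k] ae by (simp add: u_def)
      qed
    qed
    then show ?thesis by (subst AE_restrict_space_iff) auto
  qed
  obtain E where E: "E \<in> sets borel" "emeasure lborel E = 0" "\<And>s. AE x in lborel. (x, s) \<notin> E"
    "\<And>x s. s \<in> {0..T} \<Longrightarrow> (x, s) \<notin> E \<Longrightarrow>
      integrable (lebesgue_on {s..T}) (\<lambda>t. \<phi> (characteristic T f x s t) t) \<longleftrightarrow> integrable lborel (pullback g s x)"
    "\<And>x s. s \<in> {0..T} \<Longrightarrow> (x, s) \<notin> E \<Longrightarrow> char_integral T f \<phi> x s = (LINT t|lborel. pullback g s x t)"
  proof -
    show thesis by (rule char_integral_pullback[OF g N]) (fact eq, fact that)
  qed
  have AE: "AE x in lebesgue. (LINT t|lborel. pullback g s x t) = char_integral T f \<phi> x s"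
    if s: "s \<in> {0..T}" for s
    using AE_completion[OF E(3)[of s]] by eventually_elim (simp add: E(5)[OF s])
  let ?S = "UNIV \<times> {0..T} :: ((real^'n) \<times> real) set"
  have "?S \<in> sets borel" by (intro borel_closed closed_Times) auto
  then have S: "?S \<in> sets lebesgue" by simp
  show "(\<lambda>(x, s). char_integral T f \<phi> x s) \<in> borel_measurable (lebesgue_on ?S)"
  proof (subst measurable_lebesgue_on_cong_AE[OF S])
    have "AE p in lebesgue. p \<notin> E" by (rule AE_completion[OF AE_notin_null[OF E(1,2)]])
    then have "AE p in lebesgue. p \<in> ?S \<longrightarrow> (case p of (x, s) \<Rightarrow> char_integral T f \<phi> x s)
        = (case p of (x, s) \<Rightarrow> LINT t|lborel. pullback g s x t)"
      by eventually_elim (auto simp: E(5))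
    then show "AE p in lebesgue_on ?S. (case p of (x, s) \<Rightarrow> char_integral T f \<phi> x s)
        = (case p of (x, s) \<Rightarrow> LINT t|lborel. pullback g s x t)"
      using S by (subst AE_restrict_space_iff) auto
    have "(\<lambda>(x, s). LINT t|lborel. pullback g s x t) \<in> borel_measurable lborel"
      using pullback_integral_measurable(1)[OF g] by simp
    then show "(\<lambda>(x, s). LINT t|lborel. pullback g s x t) \<in> borel_measurable (lebesgue_on ?S)"
      by (intro measurable_restrict_space1 measurable_completion)
  qed
  {
    assume s: "s \<in> {0..T}"
    note sqV = square_integrable_pullback_integral[OF g sqg u s]
    have "AE x in lebesgue. integrable lborel (pullback g s x)"
      by (rule AE_completion[OF pullback_integrable[OF g sqg u s]])
    with AE_completion[OF E(3)[of s]]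
    show "AE x in lebesgue. integrable (lebesgue_on {s..T}) (\<lambda>t. \<phi> (characteristic T f x s t) t)"
      by eventually_elim (simp add: E(4)[OF s])
    have m: "(\<lambda>x. char_integral T f \<phi> x s) \<in> borel_measurable lebesgue"
      by (rule borel_measurable_AE[OF square_integrable_meas[OF sqV] AE[OF s]])
    show sqC: "square_integrable (\<lambda>x. char_integral T f \<phi> x s)"
      by (rule square_integrable_cong_AE[OF sqV m AE[OF s]])
    have "abs_l2 (\<lambda>x. char_integral T f \<phi> x s) = abs_l2 (\<lambda>x. LINT t|lborel. pullback g s x t)"
      using abs_l2_eq_iff[OF sqV sqC] AE[OF s] by simp
    also have "\<dots> = sol u s" by (rule abs_l2_pullback_integral[OF g sqg u s])
    finally show "abs_l2 (\<lambda>x. char_integral T f \<phi> x s) = sol (\<lambda>t. abs_l2 (\<lambda>x. \<phi> x t)) s"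
      by (simp add: u_def[abs_def])
    assume \<psi>: "(\<lambda>(x, t). \<psi> x t) \<in> borel_measurable (lebesgue_on ?S)"
      and \<psi>\<phi>: "AE t in lebesgue_on {0..T}. AE x in lebesgue. \<psi> x t = \<phi> x t"
    obtain g' N' where g': "g' \<in> borel_measurable borel" and N': "N' \<in> sets borel" "emeasure lborel N' = 0"
      and eq': "\<And>x t. t \<in> {0..T} \<Longrightarrow> (x, t) \<notin> N' \<Longrightarrow> \<psi> x t = g' (x, t)"
      using strip_borel_rep[OF \<psi>] by blast
    \<comment> \<open>The Borel representatives of \<psi> and \<open>\<phi>\<close> agree outside D,
      which is null because almost all its time slices are. Hence \<psi> too is represented by g,
      outside N' \<union> D, and both integrals equal that of g.\<close>
    define D where "D = {p \<in> ?S. g' p \<noteq> g p}"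
    have D: "D \<in> sets borel"
    proof -
      have "{p \<in> space borel. g' p \<noteq> g p} \<in> sets borel" using g g' by measurable
      then show ?thesis using \<open>?S \<in> sets borel\<close> unfolding D_def by (simp add: Collect_conj_eq sets.Int)
    qed
    have D0: "emeasure lborel D = 0"
      unfolding emeasure_eq_0_sections(1)[OF D]
    proof -
      have "AE t in lebesgue. t \<in> {0..T} \<longrightarrow> (AE x in lebesgue. \<psi> x t = \<phi> x t)"
        using \<psi>\<phi> by (subst (asm) AE_restrict_space_iff) auto
      with AE_sections[OF N] AE_sections[OF N']
      have "AE t in lebesgue. emeasure lborel ((\<lambda>x. (x, t)) -` D) = 0"
      proof eventually_elim
        case (elim t)
        have "AE x in lebesgue. x \<notin> (\<lambda>x. (x, t)) -` D"
        proof (cases "t \<in> {0..T}")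
          case True
          then have "AE x in lebesgue. \<psi> x t = \<phi> x t" using elim(3) by blast
          with elim(1,2) show ?thesis
            by eventually_elim (use eq[OF True] eq'[OF True] in \<open>auto simp: D_def\<close>)
        next
          case False
          then have "(\<lambda>x. (x, t)) -` D = {}" by (auto simp: D_def)
          then show ?thesis by simp
        qed
        then have "AE x in lborel. x \<notin> (\<lambda>x. (x, t)) -` D" by (simp add: AE_completion_iff)
        then show ?case
          using sets_vimage_Pair(2)[OF D] by (subst (asm) AE_iff_null_sets[symmetric]) auto
      qed
      then show "AE t in lborel. emeasure lborel ((\<lambda>x. (x, t)) -` D) = 0" by (simp add: AE_completion_iff)
    qed
    have M: "N' \<union> D \<in> sets borel" "emeasure lborel (N' \<union> D) = 0"
      using N' D D0 emeasure_Un_null_set[of N' lborel D] by (auto simp: null_setsI)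
    have eq'': "\<psi> x t = g (x, t)" if "t \<in> {0..T}" "(x, t) \<notin> N' \<union> D" for x t
      using that eq'[OF that(1)] by (auto simp: D_def)
    obtain E' where "E' \<in> sets borel" "emeasure lborel E' = 0" and E': "\<And>s. AE x in lborel. (x, s) \<notin> E'"
      "\<And>x s. s \<in> {0..T} \<Longrightarrow> (x, s) \<notin> E' \<Longrightarrow>
        integrable (lebesgue_on {s..T}) (\<lambda>t. \<psi> (characteristic T f x s t) t) \<longleftrightarrow> integrable lborel (pullback g s x)"
      "\<And>x s. s \<in> {0..T} \<Longrightarrow> (x, s) \<notin> E' \<Longrightarrow> char_integral T f \<psi> x s = (LINT t|lborel. pullback g s x t)"
    proof -
      show thesis by (rule char_integral_pullback[OF g M]) (fact eq'', fact that)
    qed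
    from AE_completion[OF E'(1)[of s]] AE[OF s]
    show "AE x in lebesgue. char_integral T f \<psi> x s = char_integral T f \<phi> x s"
      by eventually_elim (simp add: E'(3)[OF s])
  }
qed

end

theorem theorem1p1:
  fixes T :: real
    and f :: "real^'n::finite \<Rightarrow> real \<Rightarrow> real^'n"
    and \<phi> :: "real^'n \<Rightarrow> real \<Rightarrow> real"
  assumes "T > 0"
    and "velocity_field T f"
    and "(\<lambda>(x, t). \<phi> x t) \<in> borel_measurable (lebesgue_on (UNIV \<times> {0..T}))"
    and "AE t in lebesgue_on {0..T}. square_integrable (\<lambda>x. \<phi> x t)"
    and "(\<lambda>t. abs_l2 (\<lambda>x. \<phi> x t)) \<in> X10 T"
  shows "(\<lambda>(x, s). char_integral T f \<phi> x s) \<in> borel_measurable (lebesgue_on (UNIV \<times> {0..T})) \<and>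
    (\<forall>s\<in>{0..T}.
      (AE x in lebesgue. integrable (lebesgue_on {s..T}) (\<lambda>t. \<phi> (characteristic T f x s t) t)) \<and>
      square_integrable (\<lambda>x. char_integral T f \<phi> x s) \<and>
      (\<forall>\<psi>. (\<lambda>(x, t). \<psi> x t) \<in> borel_measurable (lebesgue_on (UNIV \<times> {0..T})) \<longrightarrow>
        (AE t in lebesgue_on {0..T}. AE x in lebesgue. \<psi> x t = \<phi> x t) \<longrightarrow>
        (AE x in lebesgue. char_integral T f \<psi> x s = char_integral T f \<phi> x s))) \<and>
    (\<lambda>s. abs_l2 (\<lambda>x. char_integral T f \<phi> x s)) \<in> C0 T \<and>
    (\<forall>s\<in>{0..T}. abs_l2 (\<lambda>x. char_integral T f \<phi> x s) =
      solution_operator T f (\<lambda>t. abs_l2 (\<lambda>x. \<phi> x t)) s)"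
proof -
  \<comment> \<open>All the work is done for \<open>h\<close>. Characteristics, the integrals along
    them and the solution operator are the same for \<open>f\<close> and \<open>h\<close>, because
    these differ only on a null set of times.\<close>
  obtain K h where h: "transport_problem K h T" and fh: "AE t in lebesgue_on {0..T}. \<forall>x. f x t = h x t"
    using modified_velocity_field[OF assms(1,2)] by blast
  interpret transport_problem K h T by (rule h)
  note rep = char_integral_eq_sol[OF assms(3-5)]
  have V: "char_integral T f \<psi> x s = char_integral T h \<psi> x s" if "s \<in> {0..T}" for \<psi> x s
    using char_integral_cong_AE[OF fh] that by simp
  have eq_sol: "abs_l2 (\<lambda>x. char_integral T f \<phi> x s) = sol (\<lambda>t. abs_l2 (\<lambda>x. \<phi> x t)) s" if "s \<in> {0..T}" for s
    unfolding V[OF that] by (rule rep(5)[OF that])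
  have "(\<lambda>(x, s). char_integral T f \<phi> x s) \<in> borel_measurable (lebesgue_on (UNIV \<times> {0..T}))"
  proof -
    have "(\<lambda>(x, s). char_integral T f \<phi> x s) \<in> borel_measurable (lebesgue_on (UNIV \<times> {0..T})) \<longleftrightarrow>
        (\<lambda>(x, s). char_integral T h \<phi> x s) \<in> borel_measurable (lebesgue_on (UNIV \<times> {0..T}))"
      by (rule measurable_cong) (auto simp: V)
    with rep(1) show ?thesis by simp
  qed
  moreover have "(AE x in lebesgue. integrable (lebesgue_on {s..T}) (\<lambda>t. \<phi> (characteristic T f x s t) t)) \<and>
      square_integrable (\<lambda>x. char_integral T f \<phi> x s) \<and>
      (\<forall>\<psi>. (\<lambda>(x, t). \<psi> x t) \<in> borel_measurable (lebesgue_on (UNIV \<times> {0..T})) \<longrightarrow>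
        (AE t in lebesgue_on {0..T}. AE x in lebesgue. \<psi> x t = \<phi> x t) \<longrightarrow>
        (AE x in lebesgue. char_integral T f \<psi> x s = char_integral T f \<phi> x s))" if s: "s \<in> {0..T}" for s
  proof -
    have "characteristic T f x s = characteristic T h x s" for x
      using characteristic_cong_AE[OF fh] s by simp
    then show ?thesis unfolding V[OF s] using rep(2-4)[OF s] by simp
  qed
  moreover have "(\<lambda>s. abs_l2 (\<lambda>x. char_integral T f \<phi> x s)) \<in> C0 T"
  proof -
    have "continuous_on {0..T} (sol (\<lambda>t. abs_l2 (\<lambda>x. \<phi> x t)))"
      using assms(5) by (intro sol_continuous) (simp add: X10_def)
    moreover have "continuous_on {0..T} (\<lambda>s. abs_l2 (\<lambda>x. char_integral T f \<phi> x s)) \<longleftrightarrow>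
        continuous_on {0..T} (sol (\<lambda>t. abs_l2 (\<lambda>x. \<phi> x t)))"
      by (intro continuous_on_cong refl eq_sol)
    ultimately show ?thesis by (simp add: C0_def)
  qed
  moreover have "abs_l2 (\<lambda>x. char_integral T f \<phi> x s) =
      solution_operator T f (\<lambda>t. abs_l2 (\<lambda>x. \<phi> x t)) s" if "s \<in> {0..T}" for s
    unfolding solution_operator_cong_AE[OF fh] solution_operator_eq[OF assms(5) that] by (rule eq_sol[OF that])
  ultimately show ?thesis by blast
qed

end
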